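(* Let $G$, $a>0$, $\rho_a$ and $A$ be as in the context, and suppose $\mathfrak g$ is not abelian (equivalently, $G$ is not the abelian group $\mathbb C^n$). Then $A$ is not holomorphic, i.e. it is not the case that $A(\mathcal D(A)\cap\mathcal H)\subset\mathcal H$.
   Context: Let $\mathfrak g$ be a finite-dimensional complex Lie algebra which is stratified of step $m$: $\mathfrak g=V_1\oplus\cdots\oplus V_m$ (complex subspaces) with $[V_1,V_j]=V_{j+1}$ for $1\le j<m$, $[V_1,V_m]=0$, $V_m\neq 0$. Let $G$ be the connected, simply connected complex Lie group with Lie algebra $\mathfrak g$, identified with $\mathfrak g$ as a set (exponential map = identity, identity $e=0$), with Haar measure $m$ = a Lebesgue measure on $\mathfrak g$. For $\xi\in\mathfrak g$, $\tilde\xi$ is the left-invariant vector field with $\tilde\xi(e)=\xi$. Let $J$ be the complex structure of $\mathfrak g$ and $h$ a symmetric positive semidefinite real bilinear form on the real dual $\mathfrak g^*$ with $h(J^*\alpha,J^*\beta)=h(\alpha,\beta)$ whose horizontal space $\{v:\alpha(v)=0\text{ whenever }h(\alpha,\alpha)=0\}$ equals $V_1$; it induces a positive definite $J$-Hermitian inner product $g$ on $V_1$. Choose $x_1,\dots,x_k\in V_1$ with $x_1,Jx_1,\dots,x_k,Jx_k$ a $g$-orthonormal real basis of $V_1$; $X_j=\widetilde{x_j}$, $Y_j=\widetilde{Jx_j}$; $\Delta=\sum_j(X_j^2+Y_j^2)$; heat kernel $\rho_s$: smooth positive probability density with $e^{s\Delta/4}f(x)=\int_G f(xy^{-1})\rho_s(y)\,dm(y)$.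 Fix $a>0$; $L^2(\rho_a)=L^2(G,\rho_a\,dm)$. $Q$ is the closure (a Dirichlet form) in $L^2(\rho_a)$ of $Q_0(f_1,f_2)=\int_G\sum_j(X_jf_1\,X_j\bar f_2+Y_jf_1\,Y_j\bar f_2)\rho_a\,dm$ on $C_c^\infty(G)$, with domain $\mathcal D(Q)$; $A$ is its generator: the unique self-adjoint operator with $\mathcal D(A)\subset\mathcal D(Q)$ and $\int_G(Af_1)\bar f_2\,\rho_a\,dm=Q(f_1,f_2)$ for $f_1\in\mathcal D(A)$, $f_2\in\mathcal D(Q)$. $\mathcal H$ = holomorphic functions on $G$. *)

theory Defs
  imports "HOL-Analysis.Analysis"
begin

text \<open>The Lie algebra g is modelled as the complex vector space complex^'n
 (a real Euclidean space, with Lebesgue measure lborel); complex scalar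
 multiplication is (*s), and the complex structure is J x = i *s x.\<close>

definition cJ :: "complex^'n \<Rightarrow> complex^'n" where
  "cJ x = \<i> *s x"

definition csubspace :: "(complex^'n) set \<Rightarrow> bool" where
  "csubspace V \<longleftrightarrow> 0 \<in> V \<and> (\<forall>x\<in>V. \<forall>y\<in>V. x + y \<in> V) \<and> (\<forall>c. \<forall>x\<in>V. c *s x \<in> V)"

definition is_lie_bracket :: "(complex^'n \<Rightarrow> complex^'n \<Rightarrow> complex^'n) \<Rightarrow> bool" where
  "is_lie_bracket br \<longleftrightarrow>
     (\<forall>c x y z. br (c *s x + y) z = c *s br x z + br y z) \<and>
     (\<forall>x y. br y x = - br x y) \<and>
     (\<forall>x y z. br x (br y z) + br y (br z x) + br z (br x y) = 0)"

definition stratified ::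
  "(complex^'n \<Rightarrow> complex^'n \<Rightarrow> complex^'n) \<Rightarrow> nat \<Rightarrow> (nat \<Rightarrow> (complex^'n) set) \<Rightarrow> bool" where
  "stratified br m V \<longleftrightarrow> 1 \<le> m \<and>
     (\<forall>i\<in>{1..m}. csubspace (V i)) \<and>
     (\<forall>x. \<exists>!xs. (\<forall>i\<in>{1..m}. xs i \<in> V i) \<and> (\<forall>i. i \<notin> {1..m} \<longrightarrow> xs i = 0)
              \<and> x = (\<Sum>i=1..m. xs i)) \<and>
     (\<forall>j\<in>{1..<m}. V (Suc j) = span {br x y | x y. x \<in> V 1 \<and> y \<in> V j}) \<and>
     (\<forall>x\<in>V 1. \<forall>y\<in>V m. br x y = 0) \<and>
     V m \<noteq> {0}"

fun nbr :: "('v::zero \<Rightarrow> 'v \<Rightarrow> 'v) \<Rightarrow> 'v list \<Rightarrow> 'v" where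
  "nbr br [] = 0"
| "nbr br [a] = a"
| "nbr br (a # b # w) = br a (nbr br (b # w))"

definition dynkin_word :: "'v \<Rightarrow> 'v \<Rightarrow> (nat \<times> nat) list \<Rightarrow> 'v list" where
  "dynkin_word X Y rs = concat (map (\<lambda>(r, s). replicate r X @ replicate s Y) rs)"

definition dynkin_idx :: "nat \<Rightarrow> nat \<Rightarrow> (nat \<times> nat) list set" where
  "dynkin_idx N n = {rs. length rs = n \<and> (\<forall>p\<in>set rs. 1 \<le> fst p + snd p)
                        \<and> (\<Sum>p\<leftarrow>rs. fst p + snd p) \<le> N}"

text \<open>Baker-Campbell-Hausdorff product (Dynkin's formula), keeping all terms whose
 bracket length is at most N. For a Lie algebra nilpotent of step m, all nested
 brackets of length > m vanish, so bch br m is the exact group law of the connected,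
 simply connected Lie group with exponential map = identity.\<close>
definition bch ::
  "(complex^'n \<Rightarrow> complex^'n \<Rightarrow> complex^'n) \<Rightarrow> nat \<Rightarrow> complex^'n \<Rightarrow> complex^'n \<Rightarrow> complex^'n" where
  "bch br N X Y = (\<Sum>n\<in>{1..N}. \<Sum>rs\<in>dynkin_idx N n.
      ((-1) ^ (n - 1) / (real n * real (\<Sum>p\<leftarrow>rs. fst p + snd p)
         * (\<Prod>p\<leftarrow>rs. fact (fst p) * fact (snd p)))) *\<^sub>R nbr br (dynkin_word X Y rs))"

definition lvf ::
  "(complex^'n \<Rightarrow> complex^'n \<Rightarrow> complex^'n) \<Rightarrow> complex^'n \<Rightarrow> (complex^'n \<Rightarrow> 'b::real_normed_vector)
     \<Rightarrow> complex^'n \<Rightarrow> 'b" where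
  "lvf mul xi f x = vector_derivative (\<lambda>t::real. f (mul x (t *\<^sub>R xi))) (at 0)"

definition dderiv :: "'a::real_normed_vector \<Rightarrow> ('a \<Rightarrow> 'b::real_normed_vector) \<Rightarrow> 'a \<Rightarrow> 'b" where
  "dderiv v f x = vector_derivative (\<lambda>t::real. f (x + t *\<^sub>R v)) (at 0)"

fun iter_dderiv :: "'a::real_normed_vector list \<Rightarrow> ('a \<Rightarrow> 'b::real_normed_vector) \<Rightarrow> 'a \<Rightarrow> 'b" where
  "iter_dderiv [] f = f"
| "iter_dderiv (v # vs) f = dderiv v (iter_dderiv vs f)"

definition smooth_fn :: "('a::real_normed_vector \<Rightarrow> 'b::real_normed_vector) \<Rightarrow> bool" where
  "smooth_fn f \<longleftrightarrow> (\<forall>vs. continuous_on UNIV (iter_dderiv vs f) \<and>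
      (\<forall>v x. (\<lambda>t::real. iter_dderiv vs f (x + t *\<^sub>R v)) differentiable (at 0)))"

definition test_fn :: "(complex^'n \<Rightarrow> complex) \<Rightarrow> bool" where
  "test_fn f \<longleftrightarrow> smooth_fn f \<and> compact (closure {x. f x \<noteq> 0})"

definition holo :: "(complex^'n \<Rightarrow> complex) \<Rightarrow> bool" where
  "holo f \<longleftrightarrow> (\<forall>x. \<exists>L. (f has_derivative L) (at x) \<and> (\<forall>c v. L (c *s v) = c * L v))"

definition sublap ::
  "(complex^'n \<Rightarrow> complex^'n \<Rightarrow> complex^'n) \<Rightarrow> nat \<Rightarrow> (nat \<Rightarrow> complex^'n)
     \<Rightarrow> (complex^'n \<Rightarrow> complex) \<Rightarrow> complex^'n \<Rightarrow> complex" where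
  "sublap mul k xs f x = (\<Sum>j\<in>{1..k}. lvf mul (xs j) (lvf mul (xs j) f) x
                                     + lvf mul (cJ (xs j)) (lvf mul (cJ (xs j)) f) x)"

text \<open>Right convolution with rho_s: x |-> integral f(x y^-1) rho_s(y) dm(y); y^-1 = -y.\<close>
definition heat_conv ::
  "(complex^'n \<Rightarrow> complex^'n \<Rightarrow> complex^'n) \<Rightarrow> (complex^'n \<Rightarrow> real)
     \<Rightarrow> (complex^'n \<Rightarrow> complex) \<Rightarrow> complex^'n \<Rightarrow> complex" where
  "heat_conv mul r f x = integral\<^sup>L lborel (\<lambda>y. f (mul x (- y)) * complex_of_real (r y))"

text \<open>rho is the heat kernel: each rho s (s > 0) is a smooth positive probability density,
 and P_s f = heat_conv (rho s) f is e^{s Delta/4} f, characterised (for f in C_c^infinity)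
 by d/ds P_s f = P_s (Delta f / 4) and P_s f -> f as s -> 0+.\<close>
definition heat_kernel ::
  "(complex^'n \<Rightarrow> complex^'n \<Rightarrow> complex^'n) \<Rightarrow> ((complex^'n \<Rightarrow> complex) \<Rightarrow> complex^'n \<Rightarrow> complex)
     \<Rightarrow> (real \<Rightarrow> complex^'n \<Rightarrow> real) \<Rightarrow> bool" where
  "heat_kernel mul Lap rho \<longleftrightarrow>
     (\<forall>s>0. smooth_fn (rho s) \<and> (\<forall>y. 0 < rho s y) \<and> integrable lborel (rho s)
            \<and> integral\<^sup>L lborel (rho s) = 1) \<and>
     (\<forall>f x. test_fn f \<longrightarrow>
        (\<forall>s>0. ((\<lambda>s. heat_conv mul (rho s) f x) has_vector_derivative
                 ((1/4) *\<^sub>R heat_conv mul (rho s) (Lap f) x)) (at s)) \<and>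
        ((\<lambda>s. heat_conv mul (rho s) f x) \<longlongrightarrow> f x) (at_right 0))"

text \<open>Sub-Riemannian data: h is a symmetric positive semidefinite real bilinear form on
 the real dual g^* (real-linear functionals), J^*-invariant, with horizontal space V1,
 and gg is the inner product it induces on V1: gg (H a) (H b) = h a b where H a is the
 vector representing the functional h a.\<close>
definition subriem ::
  "((complex^'n \<Rightarrow> real) \<Rightarrow> (complex^'n \<Rightarrow> real) \<Rightarrow> real) \<Rightarrow> (complex^'n) set
     \<Rightarrow> (complex^'n \<Rightarrow> complex^'n \<Rightarrow> real) \<Rightarrow> bool" where
  "subriem h V1 gg \<longleftrightarrow>
     (\<forall>a b. linear a \<and> linear b \<longrightarrow> h a b = h b a) \<and>
     (\<forall>a b c (t::real). linear a \<and> linear b \<and> linear c \<longrightarrow>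
         h (\<lambda>v. a v + t * b v) c = h a c + t * h b c) \<and>
     (\<forall>a. linear a \<longrightarrow> 0 \<le> h a a) \<and>
     (\<forall>a b. linear a \<and> linear b \<longrightarrow> h (a \<circ> cJ) (b \<circ> cJ) = h a b) \<and>
     {v. \<forall>a. linear a \<and> h a a = 0 \<longrightarrow> a v = 0} = V1 \<and>
     (\<forall>a b u w. linear a \<and> linear b \<and> (\<forall>c. linear c \<longrightarrow> c u = h a c)
          \<and> (\<forall>c. linear c \<longrightarrow> c w = h b c) \<longrightarrow> gg u w = h a b)"

definition horiz_onb ::
  "(complex^'n \<Rightarrow> complex^'n \<Rightarrow> real) \<Rightarrow> (complex^'n) set \<Rightarrow> nat \<Rightarrow> (nat \<Rightarrow> complex^'n) \<Rightarrow> bool" where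
  "horiz_onb gg V1 k xs \<longleftrightarrow>
     span (xs ` {1..k} \<union> (cJ \<circ> xs) ` {1..k}) = V1 \<and>
     (\<forall>i\<in>{1..k}. \<forall>j\<in>{1..k}.
        gg (xs i) (xs j) = (if i = j then 1 else 0) \<and>
        gg (cJ (xs i)) (cJ (xs j)) = (if i = j then 1 else 0) \<and>
        gg (xs i) (cJ (xs j)) = 0)"

definition L2 :: "'a measure \<Rightarrow> ('a \<Rightarrow> complex) set" where
  "L2 M = {f. f \<in> borel_measurable M \<and> integrable M (\<lambda>x. (cmod (f x))\<^sup>2)}"

definition form_approx ::
  "(complex^'n) measure \<Rightarrow> ((complex^'n \<Rightarrow> complex) \<Rightarrow> (complex^'n \<Rightarrow> complex) \<Rightarrow> complex)
     \<Rightarrow> (complex^'n \<Rightarrow> complex) \<Rightarrow> (nat \<Rightarrow> complex^'n \<Rightarrow> complex) \<Rightarrow> bool" where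
  "form_approx M Q0 f phi \<longleftrightarrow>
     (\<forall>n. test_fn (phi n)) \<and>
     ((\<lambda>n. integral\<^sup>L M (\<lambda>x. (cmod (phi n x - f x))\<^sup>2)) \<longlonglongrightarrow> 0) \<and>
     (\<forall>e>0. \<exists>N. \<forall>n\<ge>N. \<forall>l\<ge>N.
        cmod (Q0 (\<lambda>x. phi n x - phi l x) (\<lambda>x. phi n x - phi l x)) < e)"

definition form_dom :: "(complex^'n) measure \<Rightarrow> ((complex^'n \<Rightarrow> complex) \<Rightarrow> (complex^'n \<Rightarrow> complex) \<Rightarrow> complex) \<Rightarrow> (complex^'n \<Rightarrow> complex) set" where
  "form_dom M Q0 = {f \<in> L2 M. \<exists>phi. form_approx M Q0 f phi}"

definition form_val :: "(complex^'n) measure \<Rightarrow> ((complex^'n \<Rightarrow> complex) \<Rightarrow> (complex^'n \<Rightarrow> complex) \<Rightarrow> complex) \<Rightarrow> (complex^'n \<Rightarrow> complex) \<Rightarrow> (complex^'n \<Rightarrow> complex) \<Rightarrow> complex" where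
  "form_val M Q0 f g =
  (THE q. \<forall>phi psi. form_approx M Q0 f phi \<longrightarrow> form_approx M Q0 g psi \<longrightarrow>
             (\<lambda>n. Q0 (phi n) (psi n)) \<longlonglongrightarrow> q)"

definition form_gen :: "(complex^'n) measure \<Rightarrow> ((complex^'n \<Rightarrow> complex) \<Rightarrow> (complex^'n \<Rightarrow> complex) \<Rightarrow> complex) \<Rightarrow> (complex^'n \<Rightarrow> complex) \<Rightarrow> (complex^'n \<Rightarrow> complex) \<Rightarrow> bool" where
  "form_gen M Q0 f h \<longleftrightarrow>
  f \<in> form_dom M Q0 \<and> h \<in> L2 M \<and>
  (\<forall>f2\<in>form_dom M Q0. integral\<^sup>L M (\<lambda>x. h x * cnj (f2 x)) = form_val M Q0 f f2)"


definition Q0form ::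
  "(complex^'n \<Rightarrow> complex^'n \<Rightarrow> complex^'n) \<Rightarrow> nat \<Rightarrow> (nat \<Rightarrow> complex^'n) \<Rightarrow> (complex^'n \<Rightarrow> real)
     \<Rightarrow> (complex^'n \<Rightarrow> complex) \<Rightarrow> (complex^'n \<Rightarrow> complex) \<Rightarrow> complex" where
  "Q0form mul k xs r f1 f2 = integral\<^sup>L lborel (\<lambda>x.
      (\<Sum>j\<in>{1..k}. lvf mul (xs j) f1 x * cnj (lvf mul (xs j) f2 x)
          + lvf mul (cJ (xs j)) f1 x * cnj (lvf mul (cJ (xs j)) f2 x)) * complex_of_real (r x))"

end

theory Submission
  imports Defs "HOL-Computational_Algebra.Formal_Power_Series"
begin

text \<open>
  Let \<open>\<rho>\<close> be the heat kernel at time \<open>a\<close>. A complex linear functional \<open>f\<close> that depends only on the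
  \<open>V 1\<close>-component is additive on the group, so its horizontal derivatives are constants and
  integration by parts gives \<open>A f = - (\<Sum>\<zeta>. f \<zeta> * D\<^sub>\<zeta> \<rho>) / \<rho>\<close>. That this function is square integrable is
  the finiteness of the Fisher information of \<open>\<rho>\<close>; it follows from an energy estimate for
  \<open>sqrt \<rho>\<close> along the heat semigroup, which in turn needs the semigroup property, the symmetry and all
  polynomial moments of the kernel.

  If \<open>A f\<close> is holomorphic for every such \<open>f\<close>, then \<open>Z\<^sub>v \<rho> = - g\<^sub>v * \<rho>\<close> with \<open>g\<^sub>v\<close> holomorphic for
  all \<open>v \<in> V 1\<close>, where \<open>Z\<^sub>v = D\<^sub>v + \<i> * D\<^sub>J\<^sub>v\<close> annihilates holomorphic functions. Since
  \<open>[Z\<^sub>u, Z\<^sub>v] = 2 * Z\<close> at \<open>[u, v]\<close>, the field \<open>Z\<^sub>w\<close> annihilates \<open>\<rho>\<close> for every \<open>w\<close> in the layers \<open>V j\<close>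
  with \<open>j \<ge> 2\<close>. In particular \<open>\<rho>\<close> is invariant under translation by the central layer \<open>V m\<close>, which
  is impossible for an integrable positive function with a first moment.

  The group axioms for Dynkin's formula are obtained from the faithful nilpotent representation
  \<open>(v, c) \<mapsto> ([x, v] - c * deg x, 0)\<close>, in which the product becomes a product of exponentials.
\<close>

section \<open>Stratified Lie algebras\<close>

text \<open>The kernel is given only through its action on test functions, so no Gaussian or
  gradient bounds are at hand. Decay comes from testing with dilated cutoffs, whose sublaplacian is
  R^-2 times a function living where a smaller cutoff vanishes; iteration beats every power of R.
  The Fisher information comes from S(s), the integral of sqrt rho_s. Let B_t(s) be the squared L2
  norm of P_t sqrt rho_s and M a bound for the kernel. Then 1 - B_t(s) <= 2 sqrt M (S(s+t) - S(s)),
  and B_t is nondecreasing in s. Summing n steps of length t = a/(2n) from a/2 to a telescopes to 1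
  - B_t(a) = O(1/n), and n (1 - B_t(a)) controls the horizontal energy of sqrt rho_a as n grows. A
  generator value is determined only almost everywhere, so the holomorphic representative granted by
  the assumption has to be matched with the explicit one; both are continuous. The value of Q is a
  limit along arbitrary approximating sequences, hence the need for closability. The kernel of the
  adjoint representation is the centre; adjoining the grading derivation, injective because all
  weights are positive, makes it faithful.\<close>

lemma scaleR_eq_vector_smult: "r *\<^sub>R (x::complex^'n) = complex_of_real r *s x"
  by (simp add: vec_eq_iff scaleR_conv_of_real[where 'a=complex])

lemma csubspace_imp_subspace: "csubspace S \<Longrightarrow> subspace S"
  by (simp add: csubspace_def subspace_def scaleR_eq_vector_smult)

locale stratified_lie =
  fixes br :: "complex^'n \<Rightarrow> complex^'n \<Rightarrow> complex^'n" and m :: nat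
    and V :: "nat \<Rightarrow> (complex^'n) set"
  assumes lie: "is_lie_bracket br" and strat: "stratified br m V"
begin

section \<open>Bilinearity, antisymmetry and the Jacobi identity\<close>

lemma br_anti: "br y x = - br x y"
  using lie unfolding is_lie_bracket_def by blast

lemma br_left_clinear: "br (c *s x + y) z = c *s br x z + br y z"
  using lie unfolding is_lie_bracket_def by blast

lemma br_add_left: "br (x + y) z = br x z + br y z"
  using br_left_clinear[of 1 x y z] by simp

lemma br_zero_left [simp]: "br 0 z = 0"
  using br_add_left[of 0 0 z] by simp

lemma br_cscale_left: "br (c *s x) z = c *s br x z"
  using br_left_clinear[of c x 0 z] by simp

lemma br_add_right: "br z (x + y) = br z x + br z y"
  using br_add_left[of x y z] br_anti[of z x] br_anti[of z y] br_anti[of z "x + y"] by simp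

lemma br_cscale_right: "br z (c *s x) = c *s br z x"
proof -
  have "br z (c *s x) = - br (c *s x) z" by (rule br_anti)
  also have "\<dots> = c *s (- br x z)" by (simp add: br_cscale_left)
  also have "- br x z = br z x" by (rule br_anti[symmetric])
  finally show ?thesis .
qed

lemma br_scale_left: "br (r *\<^sub>R x) z = r *\<^sub>R br x z"
  and br_scale_right: "br z (r *\<^sub>R x) = r *\<^sub>R br z x"
  by (simp_all add: scaleR_eq_vector_smult br_cscale_left br_cscale_right)

lemma bilinear_br: "bilinear br"
  unfolding bilinear_def
  by (auto intro!: linearI simp: br_add_left br_add_right br_scale_left br_scale_right)

lemma bounded_bilinear_br: "bounded_bilinear br"
  using bilinear_br by (simp add: bilinear_conv_bounded_bilinear)

lemma br_zero_right [simp]: "br z 0 = 0"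
  using br_add_right[of z 0 0] by simp

lemma br_minus_left: "br (- x) z = - br x z"
  and br_minus_right: "br z (- x) = - br z x"
  and br_diff_left: "br (x - y) z = br x z - br y z"
  and br_diff_right: "br z (x - y) = br z x - br z y"
  using bilinear_br by (simp_all add: bilinear_lneg bilinear_rneg bilinear_lsub bilinear_rsub)

lemma br_self [simp]: "br x x = 0"
proof -
  have "br x x = - br x x" by (rule br_anti)
  then have "2 *\<^sub>R br x x = 0" by (metis add.right_inverse scaleR_2)
  then show ?thesis by simp
qed

lemma br_sum_left: "br (\<Sum>i\<in>I. f i) z = (\<Sum>i\<in>I. br (f i) z)"
  and br_sum_right: "br z (\<Sum>i\<in>I. f i) = (\<Sum>i\<in>I. br z (f i))"
  by (simp_all add: bounded_bilinear.sum_left[OF bounded_bilinear_br]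
      bounded_bilinear.sum_right[OF bounded_bilinear_br])

lemma jacobi: "br x (br y z) = br (br x y) z + br y (br x z)"
proof -
  have "br x (br y z) + br y (br z x) + br z (br x y) = 0"
    using lie unfolding is_lie_bracket_def by blast
  moreover have "br y (br z x) = - br y (br x z)"
    using br_anti[of z x] br_minus_right by metis
  moreover have "br z (br x y) = - br (br x y) z" by (rule br_anti)
  ultimately show ?thesis by (simp add: algebra_simps)
qed

section \<open>Layers and the projections onto them\<close>

lemma m_pos: "1 \<le> m" using strat by (simp add: stratified_def)

text \<open>The family \<open>V\<close> is constrained only at the indices 1 to m. Setting all other
  layers to zero makes the bracket and projection rules hold at every index without range
  conditions.\<close>

definition layer :: "nat \<Rightarrow> (complex^'n) set" where
  "layer i = (if i \<in> {1..m} then V i else {0})"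

lemma csubspace_layer: "csubspace (layer i)"
  using strat by (auto simp: layer_def stratified_def csubspace_def)

lemma subspace_layer: "subspace (layer i)"
  by (rule csubspace_imp_subspace[OF csubspace_layer])

definition proj :: "nat \<Rightarrow> complex^'n \<Rightarrow> complex^'n" where
  "proj i x = (THE xs. (\<forall>i\<in>{1..m}. xs i \<in> V i) \<and> (\<forall>i. i \<notin> {1..m} \<longrightarrow> xs i = 0)
              \<and> x = (\<Sum>i=1..m. xs i)) i"

lemma proj_unique:
  assumes "\<And>i. f i \<in> layer i" and "x = (\<Sum>i=1..m. f i)"
  shows "proj i x = f i"
proof -
  let ?Q = "\<lambda>xs. (\<forall>i\<in>{1..m}. xs i \<in> V i) \<and> (\<forall>i. i \<notin> {1..m} \<longrightarrow> xs i = 0) \<and> x = (\<Sum>i=1..m. xs i)"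
  have ex1: "\<exists>!xs. ?Q xs" using strat by (simp add: stratified_def)
  have "?Q f"
  proof (intro conjI ballI allI impI)
    fix i show "i \<in> {1..m} \<Longrightarrow> f i \<in> V i" using assms(1)[of i] by (simp add: layer_def)
    show "i \<notin> {1..m} \<Longrightarrow> f i = 0" using assms(1)[of i] by (auto simp: layer_def split: if_splits)
  qed (use assms in auto)
  then show ?thesis using the1_equality[OF ex1, of f] unfolding proj_def by simp
qed

lemma proj_in_layer [intro, simp]: "proj i x \<in> layer i" (is ?A)
  and sum_proj: "(\<Sum>i=1..m. proj i x) = x" (is ?B)
proof -
  let ?Q = "\<lambda>xs. (\<forall>i\<in>{1..m}. xs i \<in> V i) \<and> (\<forall>i. i \<notin> {1..m} \<longrightarrow> xs i = 0) \<and> x = (\<Sum>i=1..m. xs i)"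
  have ex1: "\<exists>!xs. ?Q xs" using strat by (simp add: stratified_def)
  have "?Q (\<lambda>i. proj i x)" unfolding proj_def using theI'[OF ex1] .
  then show ?A ?B by (auto simp: layer_def)
qed

lemmas sum_proj' = sum_proj[unfolded One_nat_def]

lemma proj_out: "i \<notin> {1..m} \<Longrightarrow> proj i x = 0"
  using proj_in_layer[of i x] by (auto simp: layer_def split: if_splits)

lemma proj_clinear: "proj i (c *s x + y) = c *s proj i x + proj i y"
proof (rule proj_unique)
  show "c *s proj j x + proj j y \<in> layer j" for j
    using csubspace_layer[of j] proj_in_layer unfolding csubspace_def by blast
  show "c *s x + y = (\<Sum>i = 1..m. c *s proj i x + proj i y)"
    by (simp add: sum.distrib sum_proj' flip: vec.scale_sum_right)
qed

lemma proj_add: "proj i (x + y) = proj i x + proj i y"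
  using proj_clinear[of i 1 x y] by simp

lemma proj_zero [simp]: "proj i 0 = 0"
  using proj_add[of i 0 0] by simp

lemma proj_cscale: "proj i (c *s x) = c *s proj i x"
  using proj_clinear[of i c x 0] by simp

lemma linear_proj: "linear (proj i)"
  by (rule linearI) (simp_all add: proj_add proj_cscale scaleR_eq_vector_smult)

lemma proj_layer: "x \<in> layer j \<Longrightarrow> proj i x = (if i = j then x else 0)"
proof (rule proj_unique)
  assume x: "x \<in> layer j"
  show "(if l = j then x else 0) \<in> layer l" for l
    using x csubspace_layer[of l] by (auto simp: csubspace_def)
  show "x = (\<Sum>i = 1..m. if i = j then x else 0)"
    using x by (auto simp: layer_def sum.delta split: if_splits)
qed

lemma proj_proj: "proj i (proj j x) = (if i = j then proj i x else 0)"
  by (simp add: proj_layer[OF proj_in_layer])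

lemma proj_eqI: "(\<And>i. i \<in> {1..m} \<Longrightarrow> proj i x = proj i y) \<Longrightarrow> x = y"
  using sum_proj[of x] sum_proj[of y] sum.cong[of "{1..m}" "{1..m}" "\<lambda>i. proj i x" "\<lambda>i. proj i y"] by simp

lemma br_layer_one: "x \<in> layer 1 \<Longrightarrow> y \<in> layer j \<Longrightarrow> br x y \<in> layer (Suc j)"
proof -
  assume x: "x \<in> layer 1" and y: "y \<in> layer j"
  have xV: "x \<in> V 1" using x m_pos by (simp add: layer_def)
  consider "j \<in> {1..<m}" | "j = m" | "j \<notin> {1..m}" by force
  then show ?thesis
  proof cases
    case 1
    then have "V (Suc j) = span {br x y | x y. x \<in> V 1 \<and> y \<in> V j}"
      using strat by (simp add: stratified_def)
    moreover have "y \<in> V j" using y 1 by (simp add: layer_def)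
    ultimately have "br x y \<in> V (Suc j)" using xV by (auto intro!: span_base)
    then show ?thesis using 1 by (simp add: layer_def)
  next
    case 2
    then have "br x y = 0" using strat xV y m_pos by (simp add: stratified_def layer_def)
    then show ?thesis using csubspace_layer[of "Suc j"] by (simp add: csubspace_def)
  next
    case 3
    then have "y = 0" using y by (auto simp: layer_def split: if_splits)
    then show ?thesis using csubspace_layer[of "Suc j"] by (simp add: csubspace_def)
  qed
qed

lemma layer_Suc: "1 \<le> i \<Longrightarrow> x \<in> layer (Suc i) \<Longrightarrow> x \<in> span {br a b | a b. a \<in> layer 1 \<and> b \<in> layer i}"
proof -
  assume i: "1 \<le> i" and x: "x \<in> layer (Suc i)"
  show ?thesis
  proof (cases "i < m")
    case True
    then have "V (Suc i) = span {br a b | a b. a \<in> V 1 \<and> b \<in> V i}"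
      using strat i by (simp add: stratified_def)
    moreover have "layer 1 = V 1" "layer i = V i" "layer (Suc i) = V (Suc i)"
      using True i m_pos by (auto simp: layer_def)
    ultimately show ?thesis using x by simp
  next
    case False
    then have "x = 0" using x by (auto simp: layer_def split: if_splits)
    then show ?thesis by (simp add: span_zero)
  qed
qed

text \<open>The stratification controls only brackets with \<open>V 1\<close>. Elements of layer i +
  1 are sums of brackets [a, b] with a in layer 1 and b in layer i, and Jacobi rewrites [[a, b], y]
  through brackets covered by the induction hypothesis and by the case of layer 1.\<close>

lemma br_layer: "x \<in> layer i \<Longrightarrow> y \<in> layer j \<Longrightarrow> br x y \<in> layer (i + j)"
proof (induction i arbitrary: x y j)
  case 0
  then have "x = 0" by (simp add: layer_def)
  then show ?case using csubspace_layer[of "0+j"] by (simp add: csubspace_def)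
next
  case (Suc i)
  show ?case
  proof (cases "i = 0")
    case True then show ?thesis using Suc.prems br_layer_one by simp
  next
    case False
    have "x \<in> span {br a b | a b. a \<in> layer 1 \<and> b \<in> layer i}"
      using layer_Suc Suc.prems False by simp
    then show ?thesis
    proof (induction rule: span_induct)
      case base
      show ?case
        using subspace_layer[of "Suc i + j"]
        by (auto simp: subspace_def br_add_left br_scale_left)
    next
      case (step x)
      then obtain a b where x: "x = br a b" and a: "a \<in> layer 1" and b: "b \<in> layer i" by blast
      have "br a (br b y) \<in> layer (Suc i + j)"
        using br_layer_one[OF a Suc.IH[OF b Suc.prems(2)]] by simp
      moreover have "br b (br a y) \<in> layer (Suc i + j)"
        using Suc.IH[OF b br_layer_one[OF a Suc.prems(2)]] by simp
      moreover have "br x y = br a (br b y) - br b (br a y)"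
        using jacobi[of a b y] x by simp
      ultimately show ?case using subspace_diff[OF subspace_layer] by metis
    qed
  qed
qed

lemma br_expand: "br x y = (\<Sum>p=1..m. \<Sum>q=1..m. br (proj p x) (proj q y))"
proof -
  have "br x y = br (\<Sum>p=1..m. proj p x) (\<Sum>q=1..m. proj q y)" by (simp add: sum_proj')
  then show ?thesis by (subst (asm) br_sum_left) (simp only: br_sum_right)
qed

text \<open>The sum of the layers of index at least j. Unlike a single layer it is stable under
  brackets with arbitrary elements, so it measures nilpotency and triangularity for inhomogeneous
  vectors.\<close>

definition filt :: "nat \<Rightarrow> (complex^'n) set" where
  "filt j = {v. \<forall>i<j. proj i v = 0}"

lemma subspace_filt: "subspace (filt j)"
  by (simp add: filt_def subspace_def proj_add linear_scale[OF linear_proj])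

lemma filt_antimono: "i \<le> j \<Longrightarrow> filt j \<subseteq> filt i" by (auto simp: filt_def)

lemma filt_one: "filt (Suc 0) = UNIV" by (auto simp: filt_def proj_out)

lemma filt_top: "m < j \<Longrightarrow> filt j = {0}"
proof -
  assume j: "m < j"
  have "v = 0" if "v \<in> filt j" for v
    by (rule proj_eqI) (use that j in \<open>auto simp: filt_def\<close>)
  then show ?thesis using subspace_0[OF subspace_filt, of j] by blast
qed

lemma layer_subset_filt: "layer j \<subseteq> filt j"
  by (auto simp: filt_def proj_layer)

lemma br_filt: assumes "v \<in> filt j" shows "br x v \<in> filt (Suc j)"
proof -
  have "proj i (br x v) = 0" if "i < Suc j" for i
  proof -
    have "proj i (br x v) = (\<Sum>p=1..m. \<Sum>q=1..m. proj i (br (proj p x) (proj q v)))"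
      by (subst br_expand) (simp only: linear_sum[OF linear_proj])
    also have "\<dots> = 0"
    proof (intro sum.neutral ballI)
      fix p q assume "p \<in> {1..m}" "q \<in> {1..m}"
      show "proj i (br (proj p x) (proj q v)) = 0"
      proof (cases "q < j")
        case True then show ?thesis using assms by (simp add: filt_def)
      next
        case False
        then show ?thesis using \<open>p \<in> _\<close> that by (subst proj_layer[OF br_layer[OF proj_in_layer proj_in_layer]]) auto
      qed
    qed
    finally show ?thesis .
  qed
  then show ?thesis by (simp add: filt_def)
qed

lemma br_filt_left: "v \<in> filt j \<Longrightarrow> br v x \<in> filt (Suc j)"
  using br_filt[of v j x] br_anti[of v x] subspace_neg[OF subspace_filt] by metis

text \<open>The infinitesimal generator of the dilations. Its eigenvalues lie among 1 to m and are
  never 0, so it also detects central elements, which the adjoint action misses.\<close>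

definition degop :: "complex^'n \<Rightarrow> complex^'n" where
  "degop x = (\<Sum>i=1..m. real i *\<^sub>R proj i x)"

lemma linear_degop: "linear degop"
  unfolding degop_def
  by (intro linear_compose_sum ballI linear_compose_scale_right linear_proj)

lemma degop_layer: "x \<in> layer j \<Longrightarrow> degop x = real j *\<^sub>R x"
proof -
  assume x: "x \<in> layer j"
  have "degop x = (\<Sum>i=1..m. if i = j then real j *\<^sub>R x else 0)"
    unfolding degop_def by (rule sum.cong) (auto simp: proj_layer[OF x])
  also have "\<dots> = real j *\<^sub>R x" using x by (auto simp: layer_def split: if_splits)
  finally show ?thesis .
qed

text \<open>Degrees add under the bracket, which is the Leibniz rule for homogeneous vectors;
  bilinearity does the rest.\<close>

lemma degop_derivation: "degop (br x y) = br (degop x) y + br x (degop y)"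
proof -
  have *: "degop (br (proj p x) (proj q y)) = br (degop (proj p x)) (proj q y) + br (proj p x) (degop (proj q y))" for p q
    by (subst degop_layer[OF br_layer[OF proj_in_layer proj_in_layer]], (subst degop_layer[OF proj_in_layer])+)
       (simp add: br_scale_left br_scale_right scaleR_left_distrib)
  have d: "degop z = (\<Sum>p=1..m. degop (proj p z))" for z
    by (simp add: sum_proj' flip: linear_sum[OF linear_degop])
  have "degop (br x y) = (\<Sum>p=1..m. \<Sum>q=1..m. degop (br (proj p x) (proj q y)))"
    by (subst br_expand) (simp only: linear_sum[OF linear_degop])
  also have "\<dots> = (\<Sum>p=1..m. \<Sum>q=1..m. br (degop (proj p x)) (proj q y))
      + (\<Sum>p=1..m. \<Sum>q=1..m. br (proj p x) (degop (proj q y)))"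
    by (simp add: * sum.distrib)
  also have "(\<Sum>p=1..m. \<Sum>q=1..m. br (degop (proj p x)) (proj q y)) = br (degop x) y"
    by (simp only: d[of x] br_sum_left br_sum_right[symmetric] sum_proj)
  also have "(\<Sum>p=1..m. \<Sum>q=1..m. br (proj p x) (degop (proj q y))) = br x (degop y)"
    by (simp only: d[of y] br_sum_right[symmetric] br_sum_left[symmetric] sum_proj)
  finally show ?thesis .
qed

lemma degop_eq_0: "degop x = 0 \<Longrightarrow> x = 0"
proof (rule proj_eqI)
  fix i assume d: "degop x = 0" and i: "i \<in> {1..m}"
  have "proj i (degop x) = (\<Sum>j=1..m. real j *\<^sub>R proj i (proj j x))"
    by (simp add: degop_def linear_sum[OF linear_proj] linear_scale[OF linear_proj])
  also have "\<dots> = (\<Sum>j=1..m. if i = j then real i *\<^sub>R proj i x else 0)"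
    by (rule sum.cong) (auto simp: proj_proj)
  also have "\<dots> = real i *\<^sub>R proj i x" using i by simp
  finally show "proj i x = proj i 0" using d i by simp
qed

text \<open>The automorphic dilations. They replace Euclidean scaling in the cutoffs, because a
  horizontal derivative of a dilated function picks up exactly one factor r.\<close>

definition dil :: "real \<Rightarrow> complex^'n \<Rightarrow> complex^'n" where
  "dil r x = (\<Sum>i=1..m. r ^ i *\<^sub>R proj i x)"

lemma linear_dil: "linear (dil r)"
  unfolding dil_def by (intro linear_compose_sum ballI linear_compose_scale_right linear_proj)

lemma dil_layer: "x \<in> layer j \<Longrightarrow> dil r x = r ^ j *\<^sub>R x"
proof -
  assume x: "x \<in> layer j"
  have "dil r x = (\<Sum>i=1..m. if i = j then r ^ j *\<^sub>R x else 0)"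
    unfolding dil_def by (rule sum.cong) (auto simp: proj_layer[OF x])
  also have "\<dots> = r ^ j *\<^sub>R x" using x by (auto simp: layer_def split: if_splits)
  finally show ?thesis .
qed

lemma proj_dil: "proj i (dil r x) = r ^ i *\<^sub>R proj i x"
proof -
  have "proj i (dil r x) = (\<Sum>j=1..m. r ^ j *\<^sub>R proj i (proj j x))"
    by (simp add: dil_def linear_sum[OF linear_proj] linear_scale[OF linear_proj])
  also have "\<dots> = (\<Sum>j=1..m. if i = j then r ^ i *\<^sub>R proj i x else 0)"
    by (rule sum.cong) (auto simp: proj_proj)
  also have "\<dots> = r ^ i *\<^sub>R proj i x" by (cases "i \<in> {1..m}") (auto simp: proj_out)
  finally show ?thesis .
qed

lemma dil_br: "dil r (br x y) = br (dil r x) (dil r y)"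
proof -
  have *: "dil r (br (proj p x) (proj q y)) = br (dil r (proj p x)) (dil r (proj q y))" for p q
    by (subst dil_layer[OF br_layer[OF proj_in_layer proj_in_layer]], (subst dil_layer[OF proj_in_layer])+)
       (simp add: br_scale_left br_scale_right power_add)
  have d: "dil r z = (\<Sum>p=1..m. dil r (proj p z))" for z
    by (simp add: sum_proj' flip: linear_sum[OF linear_dil])
  have "dil r (br x y) = (\<Sum>p=1..m. \<Sum>q=1..m. dil r (br (proj p x) (proj q y)))"
    by (subst br_expand) (simp only: linear_sum[OF linear_dil])
  also have "\<dots> = br (\<Sum>p=1..m. dil r (proj p x)) (\<Sum>q=1..m. dil r (proj q y))"
    by (subst br_sum_left) (simp only: * br_sum_right)
  finally show ?thesis by (simp only: d[symmetric])
qed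

lemma nbr_dil: "w \<noteq> [] \<Longrightarrow> nbr br (map (dil r) w) = dil r (nbr br w)"
  by (induction w rule: induct_list012) (auto simp: dil_br)

end

section \<open>Power series in nilpotent operators\<close>

text \<open>Evaluation of a formal power series at an operator. When f^K = 0 the truncation loses
  nothing and evaluation is a ring homomorphism, so identities for exp and log are inherited from
  formal power series.\<close>

definition opser :: "nat \<Rightarrow> real fps \<Rightarrow> ('a::real_vector \<Rightarrow> 'a) \<Rightarrow> 'a \<Rightarrow> 'a" where
  "opser K c f v = (\<Sum>n<K. fps_nth c n *\<^sub>R (f ^^ n) v)"

lemma linear_funpow:
  fixes f :: "'a::real_vector \<Rightarrow> 'a" assumes "linear f" shows "linear (f ^^ n)"
proof (induction n)
  case (Suc n) then show ?case using linear_compose[OF Suc assms] by (simp add: comp_def)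
qed (simp add: id_def linear_ident)

lemma linear_opser: "linear f \<Longrightarrow> linear (opser K c f)"
  unfolding opser_def
  by (intro linear_compose_sum ballI linear_compose_scale_right linear_funpow)

lemma funpow_nilpotent_ge:
  fixes f :: "'a::real_vector \<Rightarrow> 'a"
  assumes "linear f" "\<And>v. (f ^^ K) v = 0" "K \<le> n"
  shows "(f ^^ n) v = 0"
proof -
  have "(f ^^ n) v = (f ^^ (n - K)) ((f ^^ K) v)"
    using assms(3) funpow_add[of "n - K" K f] by simp
  then show ?thesis by (simp add: assms linear_0[OF linear_funpow[OF assms(1)]])
qed

lemma opser_mult:
  assumes f: "linear f" "\<And>v. (f ^^ K) v = 0"
  shows "opser K (c * d) f v = opser K c f (opser K d f v)"
proof -
  let ?g = "\<lambda>i j. (fps_nth c i * fps_nth d j) *\<^sub>R (f ^^ (i + j)) v"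
  have "opser K c f (opser K d f v) = (\<Sum>i<K. \<Sum>j<K. ?g i j)"
    by (simp add: opser_def linear_sum[OF linear_funpow[OF f(1)]] linear_scale[OF linear_funpow[OF f(1)]]
        scaleR_sum_right funpow_add)
  also have "\<dots> = (\<Sum>(i,j)\<in>{..<K}\<times>{..<K}. ?g i j)" by (simp add: sum.cartesian_product)
  \<comment> \<open>Pairs of the square with i + j >= K contribute nothing by nilpotency; what
    remains is the Cauchy product.\<close>
  also have "\<dots> = (\<Sum>(i,j)\<in>{(i,j). i + j < K}. ?g i j)"
  proof (rule sum.mono_neutral_right)
    show "\<forall>p\<in>{..<K} \<times> {..<K} - {(i, j). i + j < K}. (case p of (i, j) \<Rightarrow> ?g i j) = 0"
    proof
      fix p assume "p \<in> {..<K} \<times> {..<K} - {(i, j). i + j < K}"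
      then have "K \<le> fst p + snd p" by (auto simp: not_less)
      then show "(case p of (i, j) \<Rightarrow> ?g i j) = 0"
        using funpow_nilpotent_ge[OF f, of "fst p + snd p" v] by (simp add: case_prod_unfold)
    qed
  qed auto
  also have "\<dots> = (\<Sum>k<K. \<Sum>i\<le>k. ?g i (k - i))" by (rule sum.triangle_reindex)
  also have "\<dots> = opser K (c * d) f v"
    by (simp add: opser_def fps_mult_nth scaleR_sum_left atLeast0AtMost)
  finally show ?thesis ..
qed

lemma opser_one: "0 < K \<Longrightarrow> opser K 1 f v = v"
  by (simp add: opser_def if_distrib[of "\<lambda>c. c *\<^sub>R _"] cong: if_cong)

lemma opser_add: "opser K (c + d) f v = opser K c f v + opser K d f v"
  and opser_diff: "opser K (c - d) f v = opser K c f v - opser K d f v"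
  by (simp_all add: opser_def scaleR_add_left scaleR_diff_left sum.distrib sum_subtractf)

lemma opser_X:
  assumes "0 < K" "\<And>v. (f ^^ K) v = 0"
  shows "opser K fps_X f v = f v"
proof (cases "K = 1")
  case True then show ?thesis using assms(2)[of v] by (simp add: opser_def)
next
  case False
  then have "(\<Sum>n<K. fps_nth fps_X n *\<^sub>R (f ^^ n) v) = (\<Sum>n<K. if n = 1 then f v else 0)"
    by (intro sum.cong) auto
  then show ?thesis using assms False by (simp add: opser_def)
qed

lemma opser_power:
  assumes f: "linear f" "\<And>v. (f ^^ K) v = 0" and K: "0 < K"
  shows "opser K (d ^ i) f v = (opser K d f ^^ i) v"
proof (induction i)
  case (Suc i) then show ?case by (simp add: opser_mult[OF f])
qed (simp add: opser_one K)

text \<open>With zero constant term the power \<open>d ^ i\<close> starts at degree i, so the inner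
  sum over i <= n extends to all i < K and the order of summation can be exchanged.\<close>

lemma opser_compose:
  assumes f: "linear f" "\<And>v. (f ^^ K) v = 0" and K: "0 < K" and d: "fps_nth d 0 = 0"
  shows "opser K (c oo d) f v = opser K c (opser K d f) v"
proof -
  have z: "fps_nth (d ^ i) n = 0" if "n < i" for i n
    using startsby_zero_power_prefix[OF d] that by blast
  have "opser K (c oo d) f v = (\<Sum>n<K. \<Sum>i=0..n. (fps_nth c i * fps_nth (d ^ i) n) *\<^sub>R (f ^^ n) v)"
    by (simp add: opser_def fps_compose_nth scaleR_sum_left)
  also have "\<dots> = (\<Sum>n<K. \<Sum>i<K. (fps_nth c i * fps_nth (d ^ i) n) *\<^sub>R (f ^^ n) v)"
    by (intro sum.cong refl sum.mono_neutral_left) (auto simp: z)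
  also have "\<dots> = (\<Sum>i<K. fps_nth c i *\<^sub>R opser K (d ^ i) f v)"
    by (subst sum.swap) (simp add: opser_def scaleR_sum_right)
  also have "\<dots> = opser K c (opser K d f) v"
    by (simp add: opser_power[OF f K]) (simp add: opser_def)
  finally show ?thesis .
qed

section \<open>Exponential and logarithm of a nilpotent operator\<close>

lemma fps_exp_ln_compose: "fps_exp 1 oo fps_ln 1 = (1 + fps_X :: real fps)"
proof -
  have "(fps_exp 1 - 1 :: real fps) oo fps_ln 1 = fps_X"
    using fps_inv_fps_exp_compose(2)[of "1::real"] by (simp add: fps_ln_fps_exp_inv)
  then show ?thesis by (simp add: fps_compose_sub_distrib algebra_simps)
qed

lemma fps_ln_exp_compose: "fps_ln 1 oo (fps_exp 1 - 1) = (fps_X :: real fps)"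
  using fps_inv_fps_exp_compose(1)[of "1::real"] by (simp add: fps_ln_fps_exp_inv)

lemma opser_exp_ln:
  assumes f: "linear f" "\<And>v. (f ^^ K) v = 0" and K: "0 < K"
  shows "opser K (fps_exp 1) (opser K (fps_ln 1) f) v = v + f v"
  by (simp add: opser_compose[OF f K, symmetric] fps_exp_ln_compose opser_add opser_one[OF K] opser_X[OF K f(2)])

lemma opser_ln_exp:
  assumes f: "linear f" "\<And>v. (f ^^ K) v = 0" and K: "0 < K"
  shows "opser K (fps_ln 1) (\<lambda>w. opser K (fps_exp 1) f w - w) v = f v"
proof -
  have "opser K (fps_exp 1 - 1) f = (\<lambda>w. opser K (fps_exp 1) f w - w)"
    by (rule ext) (simp add: opser_diff opser_one[OF K])
  then show ?thesis
    using opser_compose[OF f K, of "fps_exp 1 - 1" "fps_ln 1" v]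
    by (simp add: fps_ln_exp_compose opser_X[OF K f(2)])
qed

text \<open>With f = 1 + N these expand f^n and the geometric sum (f^n - 1) / N. The number of terms
  is K whatever n is, so both are polynomials in n; \<open>binomial_identity_linear_part\<close>
  depends on that.\<close>

lemma funpow_binomial:
  assumes f: "linear f" and N: "N = (\<lambda>w. f w - w)" and nil: "\<And>v. (N ^^ K) v = 0" and K: "0 < K"
  shows "(f ^^ n) w = (\<Sum>j<K. real (n choose j) *\<^sub>R (N ^^ j) w)"
    and "(\<Sum>i<n. (f ^^ i) w) = (\<Sum>j<K. real (n choose Suc j) *\<^sub>R (N ^^ j) w)"
proof -
  have lN: "linear N" unfolding N by (intro linear_compose_sub f linear_ident)
  have shift: "(\<Sum>j<K. c (Suc j) *\<^sub>R (N ^^ Suc j) w) + c 0 *\<^sub>R w = (\<Sum>j<K. c j *\<^sub>R (N ^^ j) w)" for c :: "nat \<Rightarrow> real"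
  proof -
    have "(\<Sum>j<K. c j *\<^sub>R (N ^^ j) w) = (\<Sum>j<Suc K. c j *\<^sub>R (N ^^ j) w)"
      by (simp add: nil)
    also have "\<dots> = c 0 *\<^sub>R w + (\<Sum>j<K. c (Suc j) *\<^sub>R (N ^^ Suc j) w)"
      by (subst sum.lessThan_Suc_shift) simp
    finally show ?thesis by simp
  qed
  have NN: "N (\<Sum>j<K. c j *\<^sub>R (N ^^ j) w) = (\<Sum>j<K. c j *\<^sub>R (N ^^ Suc j) w)" for c :: "nat \<Rightarrow> real"
    by (simp add: linear_sum[OF lN] linear_scale[OF lN])
  have ff: "f v = v + N v" for v by (simp add: N)
  show A: "(f ^^ n) w = (\<Sum>j<K. real (n choose j) *\<^sub>R (N ^^ j) w)" for n
  proof (induction n)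
    case 0
    have "(\<Sum>j<K. real (0 choose j) *\<^sub>R (N ^^ j) w) = (\<Sum>j<K. if j = 0 then w else 0)"
      by (intro sum.cong) auto
    then show ?case using K by simp
  next
    case (Suc n)
    have "(f ^^ Suc n) w = (\<Sum>j<K. real (n choose j) *\<^sub>R (N ^^ j) w)
        + (\<Sum>j<K. real (n choose j) *\<^sub>R (N ^^ Suc j) w)"
      by (simp only: funpow.simps comp_apply Suc ff NN)
    also have "(\<Sum>j<K. real (n choose j) *\<^sub>R (N ^^ j) w)
       = (\<Sum>j<K. real (n choose Suc j) *\<^sub>R (N ^^ Suc j) w) + w"
      by (subst shift[of "\<lambda>j. real (n choose j)", symmetric]) simp
    finally have "(f ^^ Suc n) w = (\<Sum>j<K. real (Suc n choose Suc j) *\<^sub>R (N ^^ Suc j) w) + real (Suc n choose 0) *\<^sub>R w"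
      by (simp add: scaleR_add_left sum.distrib)
    then show ?case by (simp only: shift[of "\<lambda>j. real (Suc n choose j)"])
  qed
  show "(\<Sum>i<n. (f ^^ i) w) = (\<Sum>j<K. real (n choose Suc j) *\<^sub>R (N ^^ j) w)"
    by (induction n) (simp_all add: A scaleR_add_left sum.distrib)
qed

section \<open>Derivatives at zero of binomial polynomials\<close>

fun gbin_poly :: "nat \<Rightarrow> real poly" where
  "gbin_poly 0 = 1"
| "gbin_poly (Suc j) = smult (1 / real (Suc j)) (gbin_poly j * [:- real j, 1:])"

lemma poly_gbin_poly: "poly (gbin_poly j) (real n) = real (n choose j)"
proof (induction j)
  case (Suc j)
  have "real (n choose Suc j) * real (Suc j) = real (n choose j) * (real n - real j)"
  proof (cases "j \<le> n")
    case True
    have "(n choose Suc j) * Suc j = (n choose j) * (n - j)"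
      using binomial_absorb_comp[of n j] binomial_absorption[of j n]
      by (metis Suc_times_binomial_eq add.commute mult.commute binomial_absorption[of j] times_binomial_minus1_eq diff_Suc_1 binomial_absorb_comp zero_less_Suc)
    then show ?thesis using True by (metis of_nat_diff of_nat_mult)
  qed (simp add: binomial_eq_0)
  then show ?case by (simp add: Suc field_simps)
qed simp

lemma coeff0_gbin_poly: "poly.coeff (gbin_poly j) 0 = (if j = 0 then 1 else 0)"
  by (induction j) (auto simp: coeff_mult)

lemma coeff1_gbin_poly: "poly.coeff (gbin_poly (Suc j)) (Suc 0) = (-1) ^ j / real (Suc j)"
proof (induction j)
  case (Suc j)
  have "poly.coeff (gbin_poly (Suc (Suc j))) (Suc 0)
     = 1 / real (Suc (Suc j)) * (poly.coeff (gbin_poly (Suc j)) (Suc 0) * (- real (Suc j)) + poly.coeff (gbin_poly (Suc j)) 0)"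
    by (simp only: gbin_poly.simps(2)[of "Suc j"] coeff_smult) (simp add: coeff_mult del: gbin_poly.simps)
  also have "\<dots> = (-1) ^ Suc j / real (Suc (Suc j))"
    by (simp only: Suc coeff0_gbin_poly) (simp add: divide_simps, simp add: algebra_simps)
  finally show ?case .
qed (simp add: coeff_mult)

text \<open>The derivative of (1 + N)^x at x = 0 is log(1 + N). On coefficients this says that x
  choose j has as linear coefficient that of X^j in log(1 + X).\<close>

lemma coeff1_gbin_poly_eq_ln: "poly.coeff (gbin_poly j) (Suc 0) = fps_nth (fps_ln 1) j"
  by (cases j) (simp_all add: coeff1_gbin_poly fps_ln_nth del: gbin_poly.simps(2))

lemma poly_zero_on_nats:
  fixes p :: "real poly" assumes "\<And>n. poly p (real n) = 0" shows "p = 0"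
proof (rule ccontr)
  assume "p \<noteq> 0"
  then have "finite {x. poly p x = 0}" by (rule poly_roots_finite)
  moreover have "range real \<subseteq> {x. poly p x = 0}" using assms by auto
  ultimately have "finite (range real)" using finite_subset by blast
  then show False using finite_imageD[of real UNIV] by (simp add: inj_of_nat)
qed

text \<open>An identity between binomial polynomials in n that holds for all naturals n holds
  for all real n; this compares the derivatives of both sides at n = 0.\<close>

lemma binomial_identity_linear_part:
  fixes M :: "nat \<Rightarrow> 'a::euclidean_space" and B :: "nat \<Rightarrow> nat \<Rightarrow> 'a"
  assumes K: "0 < K"
    and "\<And>n. (\<Sum>j<K. real (n choose j) *\<^sub>R M j)
       = (\<Sum>j<K. \<Sum>i<K. (real (n choose Suc j) * real (n choose i)) *\<^sub>R B j i)"
  shows "(\<Sum>j<K. fps_nth (fps_ln 1) j *\<^sub>R M j) = (\<Sum>j<K. fps_nth (fps_ln 1) (Suc j) *\<^sub>R B j 0)"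
proof (rule euclidean_eqI)
  fix b :: 'a assume "b \<in> Basis"
  let ?p = "(\<Sum>j<K. smult (M j \<bullet> b) (gbin_poly j))
      - (\<Sum>j<K. \<Sum>i<K. smult (B j i \<bullet> b) (gbin_poly (Suc j) * gbin_poly i))"
  have "poly ?p (real n) = 0" for n
  proof -
    have "poly ?p (real n) = (\<Sum>j<K. real (n choose j) *\<^sub>R M j) \<bullet> b
       - (\<Sum>j<K. \<Sum>i<K. (real (n choose Suc j) * real (n choose i)) *\<^sub>R B j i) \<bullet> b"
      by (simp add: poly_sum poly_gbin_poly inner_sum_left algebra_simps del: gbin_poly.simps binomial_Suc_Suc)
    then show ?thesis by (simp only: assms(2))
  qed
  then have "?p = 0" by (rule poly_zero_on_nats)
  then have "poly.coeff ?p (Suc 0) = 0" by simp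
  moreover have "poly.coeff (gbin_poly (Suc j) * gbin_poly i) (Suc 0) = (if i = 0 then fps_nth (fps_ln 1) (Suc j) else 0)" for i j
  proof -
    have "poly.coeff (gbin_poly (Suc j) * gbin_poly i) (Suc 0)
      = poly.coeff (gbin_poly (Suc j)) 0 * poly.coeff (gbin_poly i) (Suc 0)
        + poly.coeff (gbin_poly (Suc j)) (Suc 0) * poly.coeff (gbin_poly i) 0"
      by (simp add: coeff_mult del: gbin_poly.simps)
    then show ?thesis by (simp only: coeff0_gbin_poly coeff1_gbin_poly_eq_ln) simp
  qed
  ultimately have "(\<Sum>j<K. (M j \<bullet> b) * fps_nth (fps_ln 1) j)
      = (\<Sum>j<K. \<Sum>i<K. (B j i \<bullet> b) * (if i = 0 then fps_nth (fps_ln 1) (Suc j) else 0))"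
    by (simp add: coeff_sum coeff1_gbin_poly_eq_ln del: gbin_poly.simps)
  also have "\<dots> = (\<Sum>j<K. (B j 0 \<bullet> b) * fps_nth (fps_ln 1) (Suc j))"
    using K by (intro sum.cong refl) (simp add: if_distrib[of "\<lambda>c. _ * c"] cong: if_cong)
  finally show "(\<Sum>j<K. fps_nth (fps_ln 1) j *\<^sub>R M j) \<bullet> b = (\<Sum>j<K. fps_nth (fps_ln 1) (Suc j) *\<^sub>R B j 0) \<bullet> b"
    by (simp add: inner_sum_left mult.commute)
qed

section \<open>The Baker-Campbell-Hausdorff group law\<close>

context stratified_lie
begin

text \<open>The adjoint action on the extension of the Lie algebra by its grading derivation.
  This representation is faithful, which reduces identities in the group to identities
  between unipotent operators.\<close>

definition adh :: "complex^'n \<Rightarrow> (complex^'n) \<times> real \<Rightarrow> (complex^'n) \<times> real" where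
  "adh x w = (br x (fst w) - snd w *\<^sub>R degop x, 0)"

lemma linear_adh: "linear (adh x)"
  by (rule linearI) (auto simp: adh_def br_add_right br_scale_right algebra_simps scaleR_add_left)

lemma linear_adh_left: "linear (\<lambda>x. adh x w)"
  by (rule linearI)
    (auto simp: adh_def br_add_left br_scale_left algebra_simps linear_add[OF linear_degop] linear_scale[OF linear_degop])

lemma adh_zero [simp]: "adh 0 w = 0" "adh x 0 = 0"
  using linear_0[OF linear_adh_left] linear_0[OF linear_adh] by auto

lemma adh_scale: "adh (t *\<^sub>R x) w = t *\<^sub>R adh x w"
  using linear_scale[OF linear_adh_left] .

lemma adh_add: "adh (x + y) w = adh x w + adh y w"
  using linear_add[OF linear_adh_left] .

lemma adh_pair: "adh x (v, 0) = (br x v, 0)"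
  by (simp add: adh_def)

lemma adh_adh: "adh x (adh y w) = adh (br x y) w + adh y (adh x w)"
  using br_anti[of "degop x" y]
  by (auto simp: adh_def br_diff_right br_scale_right degop_derivation jacobi[of x y] algebra_simps)

lemma adh_inj: assumes "\<And>w. adh x w = adh y w" shows "x = y"
proof -
  have "degop x = degop y" using assms[of "(0,1)"] by (simp add: adh_def)
  then have "degop (x - y) = 0" by (simp add: linear_diff[OF linear_degop])
  then show ?thesis using degop_eq_0 by force
qed

text \<open>The derivation direction has degree 0 and occurs only there, since every value of
  \<open>adh\<close> has second component 0. Hence each \<open>adh x\<close> raises the degree by
  one.\<close>

definition hfilt :: "nat \<Rightarrow> ((complex^'n) \<times> real) set" where
  "hfilt j = (if j = 0 then UNIV else filt j \<times> {0})"

lemma subspace_hfilt: "subspace (hfilt j)"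
  using subspace_filt[of j] by (auto simp: hfilt_def subspace_def zero_prod_def)

lemma hfilt_antimono: "i \<le> j \<Longrightarrow> hfilt j \<subseteq> hfilt i"
  using filt_antimono[of i j] by (auto simp: hfilt_def)

lemma adh_hfilt: "w \<in> hfilt j \<Longrightarrow> adh x w \<in> hfilt (Suc j)"
  using br_filt[of "fst w" j x] by (cases "j = 0") (auto simp: hfilt_def adh_def filt_one)

text \<open>The degrees 0 to m of the extended space make m + 1 steps, one more than the layers of
  the Lie algebra.\<close>

abbreviation "K \<equiv> Suc m"

lemma hfilt_top: "hfilt K = {0}"
  using filt_top[of K] by (auto simp: hfilt_def zero_prod_def)

lemma hfilt_funpow: "(\<And>j w. w \<in> hfilt j \<Longrightarrow> f w \<in> hfilt (Suc j)) \<Longrightarrow> w \<in> hfilt j \<Longrightarrow> (f ^^ n) w \<in> hfilt (j + n)"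
  by (induction n) auto

lemma hfilt_nilpotent: "(\<And>j w. w \<in> hfilt j \<Longrightarrow> f w \<in> hfilt (Suc j)) \<Longrightarrow> (f ^^ K) w = 0"
  using hfilt_funpow[of f w 0 K] hfilt_top by (auto simp: hfilt_def)

lemma adh_nilpotent: "(adh x ^^ K) w = 0"
  by (rule hfilt_nilpotent[OF adh_hfilt])

lemma adh_funpow_pair: "(adh x ^^ n) (v, 0) = ((br x ^^ n) v, 0)"
  by (induction n) (auto simp: adh_pair)

lemma linear_br: "linear (br x)"
  using bilinear_br by (simp add: bilinear_def)

lemma br_nilpotent: "(br x ^^ K) v = 0"
  using adh_nilpotent[of x "(v,0)"] by (simp only: adh_funpow_pair) (simp add: zero_prod_def)

lemma adh_scale_funpow: "(adh (t *\<^sub>R x) ^^ n) w = t ^ n *\<^sub>R (adh x ^^ n) w"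
  by (induction n) (auto simp: adh_scale linear_scale[OF linear_adh])

lemma br_scale_funpow: "(br (t *\<^sub>R x) ^^ n) w = t ^ n *\<^sub>R (br x ^^ n) w"
  by (induction n) (auto simp: br_scale_left br_scale_right)

definition eadh :: "complex^'n \<Rightarrow> (complex^'n) \<times> real \<Rightarrow> (complex^'n) \<times> real" where
  "eadh x = opser K (fps_exp 1) (adh x)"

definition Adj :: "complex^'n \<Rightarrow> complex^'n \<Rightarrow> complex^'n" where
  "Adj x = opser K (fps_exp 1) (br x)"

lemma linear_eadh: "linear (eadh x)"
  unfolding eadh_def by (rule linear_opser[OF linear_adh])

lemma linear_Adj: "linear (Adj x)"
  unfolding Adj_def by (rule linear_opser[OF linear_br])

lemma eadh_scale: "eadh (t *\<^sub>R x) w = opser K (fps_exp t) (adh x) w"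
  by (simp add: eadh_def opser_def adh_scale_funpow)

lemma eadh_eq: "eadh (t *\<^sub>R x) w = (\<Sum>n<K. (t ^ n / fact n) *\<^sub>R (adh x ^^ n) w)"
  by (simp only: eadh_scale opser_def fps_exp_nth of_nat_fact)

lemma Adj_eq: "Adj (t *\<^sub>R x) v = (\<Sum>n<K. (t ^ n / fact n) *\<^sub>R (br x ^^ n) v)"
  by (simp add: Adj_def opser_def br_scale_funpow del: sum.lessThan_Suc)

lemma eadh_add: "eadh (s *\<^sub>R x) (eadh (t *\<^sub>R x) w) = eadh ((s + t) *\<^sub>R x) w"
  unfolding eadh_scale by (simp add: fps_exp_add_mult opser_mult[OF linear_adh adh_nilpotent])

lemma eadh_0: "eadh 0 w = w"
  using eadh_scale[of 0 0 w] by (simp add: opser_one)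

lemma eadh_minus: "eadh (- x) (eadh x w) = w"
  using eadh_add[of "-1" x 1 w] by (simp add: eadh_0)

lemma eadh_pair: "eadh x (v, 0) = (Adj x v, 0)"
proof -
  have "eadh x (v, 0) = (\<Sum>n<K. (1 / fact n) *\<^sub>R (adh x ^^ n) (v, 0))"
    using eadh_eq[of 1 x "(v,0)"] by simp
  also have "\<dots> = (\<Sum>n<K. ((1 / fact n) *\<^sub>R (br x ^^ n) v, 0))"
    by (simp only: adh_funpow_pair scaleR_Pair scaleR_zero_right)
  also have "\<dots> = (Adj x v, 0)"
    using Adj_eq[of 1 x v] by (simp add: sum_prod del: sum.lessThan_Suc)
  finally show ?thesis .
qed

lemma eadh_hfilt: assumes "w \<in> hfilt j" shows "eadh x w - w \<in> hfilt (Suc j)"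
proof -
  have "eadh x w = (\<Sum>n<K. (1 / fact n) *\<^sub>R (adh x ^^ n) w)"
    using eadh_eq[of 1 x w] by simp
  also have "\<dots> = w + (\<Sum>n<m. (1 / fact (Suc n)) *\<^sub>R (adh x ^^ Suc n) w)"
    by (subst sum.lessThan_Suc_shift) simp
  finally have e: "eadh x w - w = (\<Sum>n<m. (1 / fact (Suc n)) *\<^sub>R (adh x ^^ Suc n) w)" by simp
  have "(adh x ^^ Suc n) w \<in> hfilt (Suc j)" for n
    using hfilt_funpow[of "adh x", OF adh_hfilt assms, of "Suc n"] hfilt_antimono[of "Suc j" "j + Suc n"] by auto
  then show ?thesis unfolding e
    by (intro subspace_sum[OF subspace_hfilt] subspace_scale[OF subspace_hfilt])
qed

text \<open>The operator form of g a g^-1 = Ad(g) a. By \<open>adh_adh\<close>, \<open>adh x\<close>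
  acts as a derivation on the action of a on w; its n-th power divided by n! therefore obeys the
  Leibniz formula, and summing over n gives the product of the two exponential series.\<close>

lemma eadh_adh: "eadh x (adh a w) = adh (Adj x a) (eadh x w)"
proof -
  define \<alpha> where "\<alpha> i = (1 / fact i) *\<^sub>R (br x ^^ i) a" for i
  define \<omega> where "\<omega> i = (1 / fact i) *\<^sub>R (adh x ^^ i) w" for i
  have \<alpha>: "br x (\<alpha> i) = real (Suc i) *\<^sub>R \<alpha> (Suc i)" for i
    by (simp add: \<alpha>_def br_scale_right)
  have \<omega>: "adh x (\<omega> i) = real (Suc i) *\<^sub>R \<omega> (Suc i)" for i
    by (simp add: \<omega>_def linear_scale[OF linear_adh])
  have S: "(1 / fact n) *\<^sub>R (adh x ^^ n) (adh a w) = (\<Sum>i\<le>n. adh (\<alpha> i) (\<omega> (n - i)))" for n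
  proof (induction n)
    case 0 then show ?case by (simp add: \<alpha>_def \<omega>_def)
  next
    case (Suc n)
    have "adh x (\<Sum>i\<le>n. adh (\<alpha> i) (\<omega> (n - i)))
      = (\<Sum>i\<le>n. real (Suc i) *\<^sub>R adh (\<alpha> (Suc i)) (\<omega> (n - i)))
       + (\<Sum>i\<le>n. real (Suc n - i) *\<^sub>R adh (\<alpha> i) (\<omega> (Suc n - i)))"
      by (simp add: linear_sum[OF linear_adh] adh_adh[of x] \<alpha> \<omega> adh_scale sum.distrib
          linear_scale[OF linear_adh] Suc_diff_le del: of_nat_Suc)
    also have "(\<Sum>i\<le>n. real (Suc i) *\<^sub>R adh (\<alpha> (Suc i)) (\<omega> (n - i)))
       = (\<Sum>i\<le>Suc n. real i *\<^sub>R adh (\<alpha> i) (\<omega> (Suc n - i)))"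
      by (subst sum.atMost_Suc_shift) simp
    also have "(\<Sum>i\<le>n. real (Suc n - i) *\<^sub>R adh (\<alpha> i) (\<omega> (Suc n - i)))
       = (\<Sum>i\<le>Suc n. real (Suc n - i) *\<^sub>R adh (\<alpha> i) (\<omega> (Suc n - i)))"
      by simp
    also have "(\<Sum>i\<le>Suc n. real i *\<^sub>R adh (\<alpha> i) (\<omega> (Suc n - i))) + \<dots>
      = (\<Sum>i\<le>Suc n. real (Suc n) *\<^sub>R adh (\<alpha> i) (\<omega> (Suc n - i)))"
      unfolding sum.distrib[symmetric] scaleR_add_left[symmetric]
      by (intro sum.cong refl) (simp flip: of_nat_add)
    finally have *: "adh x (\<Sum>i\<le>n. adh (\<alpha> i) (\<omega> (n - i)))
       = real (Suc n) *\<^sub>R (\<Sum>i\<le>Suc n. adh (\<alpha> i) (\<omega> (Suc n - i)))"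
      by (simp only: scaleR_sum_right)
    have "(1 / fact (Suc n)) *\<^sub>R (adh x ^^ Suc n) (adh a w)
       = (1 / real (Suc n)) *\<^sub>R adh x ((1 / fact n) *\<^sub>R (adh x ^^ n) (adh a w))"
      by (simp add: linear_scale[OF linear_adh])
    also have "\<dots> = (\<Sum>i\<le>Suc n. adh (\<alpha> i) (\<omega> (Suc n - i)))"
      unfolding Suc * by simp
    finally show ?case .
  qed
  have z\<alpha>: "\<alpha> i = 0" if "K \<le> i" for i
    using funpow_nilpotent_ge[OF linear_br br_nilpotent that] by (simp add: \<alpha>_def)
  have z\<omega>: "\<omega> i = 0" if "K \<le> i" for i
    using funpow_nilpotent_ge[OF linear_adh adh_nilpotent that] by (simp add: \<omega>_def)
  have "eadh x (adh a w) = (\<Sum>n<K. (1 / fact n) *\<^sub>R (adh x ^^ n) (adh a w))"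
    using eadh_eq[of 1 x] by simp
  \<comment> \<open>Extended to n < 2K so that the triangle i + j < 2K contains the whole square i,
    j < K of possibly nonzero products.\<close>
  also have "\<dots> = (\<Sum>n<K+K. (1 / fact n) *\<^sub>R (adh x ^^ n) (adh a w))"
    by (rule sum.mono_neutral_left) (auto simp: funpow_nilpotent_ge[OF linear_adh adh_nilpotent])
  also have "\<dots> = (\<Sum>n<K+K. \<Sum>i\<le>n. adh (\<alpha> i) (\<omega> (n - i)))" by (simp only: S)
  also have "\<dots> = (\<Sum>(i,j)\<in>{(i,j). i + j < K+K}. adh (\<alpha> i) (\<omega> j))" by (rule sum.triangle_reindex[symmetric])
  also have "\<dots> = (\<Sum>(i,j)\<in>{..<K}\<times>{..<K}. adh (\<alpha> i) (\<omega> j))"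
  proof (rule sum.mono_neutral_right)
    show "finite {(i, j). i + j < K + K}"
      by (rule finite_subset[of _ "{..<K+K}\<times>{..<K+K}"]) auto
    show "\<forall>p\<in>{(i, j). i + j < K + K} - {..<K} \<times> {..<K}. (case p of (i, j) \<Rightarrow> adh (\<alpha> i) (\<omega> j)) = 0"
    proof
      fix p assume "p \<in> {(i, j). i + j < K + K} - {..<K} \<times> {..<K}"
      then have "K \<le> fst p \<or> K \<le> snd p" by (cases p) (auto simp: not_less)
      then show "(case p of (i, j) \<Rightarrow> adh (\<alpha> i) (\<omega> j)) = 0"
        using z\<alpha>[of "fst p"] z\<omega>[of "snd p"] by (auto simp: case_prod_unfold)
    qed
  qed auto
  also have "\<dots> = (\<Sum>i<K. \<Sum>j<K. adh (\<alpha> i) (\<omega> j))" by (simp only: sum.cartesian_product)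
  also have "\<dots> = adh (\<Sum>i<K. \<alpha> i) (\<Sum>j<K. \<omega> j)"
    unfolding linear_sum[OF linear_adh_left] linear_sum[OF linear_adh] by (rule sum.swap)
  also have "\<dots> = adh (Adj x a) (eadh x w)"
    using eadh_eq[of 1 x] Adj_eq[of 1 x] by (simp add: \<alpha>_def \<omega>_def del: sum.lessThan_Suc)
  finally show ?thesis .
qed

text \<open>The logarithm recovers \<open>adh x\<close> from its exponential, and \<open>adh\<close>
  is injective. The group axioms below are read off from products of exponentials in this
  way.\<close>

lemma eadh_inj: assumes "\<And>w. eadh x w = eadh y w" shows "x = y"
proof (rule adh_inj)
  fix w
  have "adh z w = opser K (fps_ln 1) (\<lambda>w. eadh z w - w) w" for z
    unfolding eadh_def by (rule opser_ln_exp[OF linear_adh adh_nilpotent, symmetric]) simp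
  then show "adh x w = adh y w" using assms by simp
qed

lemma eadh_has_vector_derivative:
  assumes "(w has_vector_derivative w') (at t)"
  shows "((\<lambda>t. eadh (t *\<^sub>R x) (w t)) has_vector_derivative
      eadh (t *\<^sub>R x) w' + adh x (eadh (t *\<^sub>R x) (w t))) (at t)"
proof -
  have l: "((\<lambda>t. (adh x ^^ n) (w t)) has_vector_derivative (adh x ^^ n) w') (at t)" for n
    by (rule bounded_linear.has_vector_derivative[OF _ assms])
       (simp add: linear_conv_bounded_linear[symmetric] linear_funpow linear_adh)
  have "((\<lambda>t. \<Sum>n<K. (t ^ n / fact n) *\<^sub>R (adh x ^^ n) (w t)) has_vector_derivative
     (\<Sum>n<K. (t ^ n / fact n) *\<^sub>R (adh x ^^ n) w' + (real n * t ^ (n - 1) / fact n) *\<^sub>R (adh x ^^ n) (w t))) (at t)"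
    by (intro has_vector_derivative_sum has_vector_derivative_scaleR l)
       (auto intro!: derivative_eq_intros)
  moreover have "(\<Sum>n<K. (real n * t ^ (n - 1) / fact n) *\<^sub>R (adh x ^^ n) (w t)) = adh x (eadh (t *\<^sub>R x) (w t))"
  proof -
    have "(\<Sum>n<K. (real n * t ^ (n - 1) / fact n) *\<^sub>R (adh x ^^ n) (w t))
       = (\<Sum>n<m. (t ^ n / fact n) *\<^sub>R (adh x ^^ Suc n) (w t))"
      by (subst sum.lessThan_Suc_shift) (auto intro!: sum.cong)
    also have "\<dots> = (\<Sum>n<K. (t ^ n / fact n) *\<^sub>R (adh x ^^ Suc n) (w t))"
      using adh_nilpotent[of x "w t"] by simp
    also have "\<dots> = adh x (eadh (t *\<^sub>R x) (w t))"
      by (simp add: eadh_eq linear_sum[OF linear_adh] linear_scale[OF linear_adh] linear_add[OF linear_adh])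
    finally show ?thesis .
  qed
  ultimately show ?thesis by (simp only: eadh_eq sum.distrib)
qed

section \<open>Words in Dynkin's formula\<close>

abbreviation mul :: "complex^'n \<Rightarrow> complex^'n \<Rightarrow> complex^'n"  (infixl "\<odot>" 70)
  where "mul \<equiv> bch br m"

lemma nbr_filt: "w \<noteq> [] \<Longrightarrow> nbr br w \<in> filt (length w)"
  by (induction w rule: induct_list012) (auto simp: filt_one br_filt)

lemma nbr_long: "m < length w \<Longrightarrow> nbr br w = 0"
  using nbr_filt[of w] filt_top[of "length w"] by (cases w) auto

definition bidx :: "(nat \<times> nat) set" where
  "bidx = {..m} \<times> {..m} - {(0,0)}"

text \<open>Compared with \<open>dynkin_idx\<close> there is no bound on the total length, so that a
  word of n + 1 pairs is an arbitrary pair followed by a word of n pairs. The additional words are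
  longer than m and their brackets vanish.\<close>

definition words :: "nat \<Rightarrow> (nat \<times> nat) list set" where
  "words n = {rs. set rs \<subseteq> bidx \<and> length rs = n}"

definition wtotal :: "(nat \<times> nat) list \<Rightarrow> nat" where
  "wtotal rs = (\<Sum>p\<leftarrow>rs. fst p + snd p)"

definition wfact :: "(nat \<times> nat) list \<Rightarrow> real" where
  "wfact rs = (\<Prod>p\<leftarrow>rs. fact (fst p) * fact (snd p))"

lemma finite_bidx: "finite bidx" by (simp add: bidx_def)

lemma finite_words: "finite (words n)"
  unfolding words_def by (rule finite_lists_length_eq[OF finite_bidx])

lemma length_dynkin_word: "length (dynkin_word x y rs) = wtotal rs"
  by (induction rs) (auto simp: dynkin_word_def wtotal_def)

lemma dynkin_word_Cons:
  "dynkin_word x y (p # rs) = replicate (fst p) x @ replicate (snd p) y @ dynkin_word x y rs"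
  by (simp add: dynkin_word_def case_prod_unfold)

lemma dynkin_word_scale: "dynkin_word (t *\<^sub>R x) (t *\<^sub>R y) rs = map (scaleR t) (dynkin_word x y rs)"
  by (induction rs) (auto simp: dynkin_word_def)

lemma nbr_scale: "nbr br (map (scaleR t) w) = t ^ length w *\<^sub>R nbr br w"
  by (induction w rule: induct_list012) (auto simp: br_scale_left br_scale_right)

lemma nbr_replicate_append: "w \<noteq> [] \<Longrightarrow> nbr br (replicate r x @ w) = (br x ^^ r) (nbr br w)"
proof (induction r)
  case (Suc r)
  then obtain b w' where "replicate r x @ w = b # w'" by (cases "replicate r x @ w") auto
  then show ?case using Suc by simp
qed simp

lemma nbr_replicate: "nbr br (replicate r x) = (if r = 1 then x else 0)"
proof (cases r)
  case (Suc q)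
  show ?thesis
  proof (cases q)
    case (Suc p)
    then have "replicate r x = replicate q x @ [x]" using \<open>r = Suc q\<close> by (simp add: replicate_append_same)
    then have "nbr br (replicate r x) = (br x ^^ q) x" using nbr_replicate_append[of "[x]" q x] by simp
    also have "\<dots> = (br x ^^ p) (br x x)" using Suc by (simp add: funpow_swap1)
    finally show ?thesis using \<open>r = Suc q\<close> Suc by (simp add: linear_0[OF linear_funpow[OF linear_br]])
  qed (use Suc in simp)
qed simp

lemma words_wtotal: "rs \<in> words n \<Longrightarrow> n \<le> wtotal rs"
proof (induction rs arbitrary: n)
  case (Cons p rs)
  then have "rs \<in> words (n - 1)" "n \<noteq> 0" "p \<in> bidx" by (auto simp: words_def)
  then show ?case using Cons.IH[of "n - 1"] by (cases p) (auto simp: bidx_def wtotal_def)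
qed (simp add: words_def)

lemma dynkin_idx_words: "dynkin_idx m n = {rs \<in> words n. wtotal rs \<le> m}"
proof -
  have "p \<in> bidx" if "p \<in> set rs" "1 \<le> fst p + snd p" "wtotal rs \<le> m" for p rs
  proof -
    have "fst p + snd p \<le> wtotal rs"
      unfolding wtotal_def by (rule member_le_sum_list) (use that(1) in auto)
    then show ?thesis using that by (cases p) (auto simp: bidx_def)
  qed
  moreover have "1 \<le> fst p + snd p" if "p \<in> bidx" for p
    using that by (cases p) (auto simp: bidx_def)
  ultimately show ?thesis unfolding dynkin_idx_def words_def wtotal_def[symmetric] by auto
qed

lemma bch_ray:
  "(t *\<^sub>R x) \<odot> (t *\<^sub>R y) = (\<Sum>n\<in>{1..m}. \<Sum>rs\<in>words n.
     ((-1) ^ (n - 1) / (real n * real (wtotal rs) * wfact rs) * t ^ wtotal rs) *\<^sub>R nbr br (dynkin_word x y rs))"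
  unfolding bch_def dynkin_idx_words wtotal_def[symmetric] wfact_def[symmetric] dynkin_word_scale nbr_scale
    length_dynkin_word scaleR_scaleR
  by (intro sum.cong refl sum.mono_neutral_left)
     (auto simp: finite_words not_le length_dynkin_word nbr_long)

text \<open>The contribution of n pairs to the t-derivative of the product of tx and ty, without the
  factor (-1)^(n-1)/n. Differentiating t^l cancels the word length l in Dynkin's denominators and
  leaves coefficients of exponential series.\<close>

definition dterm :: "complex^'n \<Rightarrow> complex^'n \<Rightarrow> nat \<Rightarrow> real \<Rightarrow> complex^'n" where
  "dterm x y n t = (\<Sum>rs\<in>words n. (t ^ (wtotal rs - 1) / wfact rs) *\<^sub>R nbr br (dynkin_word x y rs))"

lemma words_Suc: "words (Suc n) = (\<lambda>(p, rs). p # rs) ` (bidx \<times> words n)"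
  by (auto simp: words_def length_Suc_conv image_iff)

lemma sum_words_Suc: "(\<Sum>rs\<in>words (Suc n). f rs) = (\<Sum>p\<in>bidx. \<Sum>rs\<in>words n. f (p # rs))"
  unfolding words_Suc
  by (subst sum.reindex) (auto simp: inj_on_def case_prod_unfold sum.cartesian_product)

lemma sum_bidx: "(\<Sum>p\<in>bidx. f p) = (\<Sum>r<K. \<Sum>s<K. f (r, s)) - f (0, 0)" for f :: "nat \<times> nat \<Rightarrow> 'b::ab_group_add"
proof -
  have "(\<Sum>p\<in>bidx. f p) = (\<Sum>p\<in>{..m} \<times> {..m}. f p) - (\<Sum>p\<in>{(0,0)}. f p)"
    unfolding bidx_def by (rule sum_diff) auto
  then show ?thesis by (simp add: sum.cartesian_product lessThan_Suc_atMost del: sum.lessThan_Suc)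
qed

lemma Adj_Adj_eq:
  "Adj (t *\<^sub>R x) (Adj (t *\<^sub>R y) v) = (\<Sum>r<K. \<Sum>s<K. (t ^ (r + s) / (fact r * fact s)) *\<^sub>R (br x ^^ r) ((br y ^^ s) v))"
  unfolding Adj_eq
  by (simp add: linear_sum[OF linear_funpow[OF linear_br]] linear_scale[OF linear_funpow[OF linear_br]]
      scaleR_sum_right power_add del: sum.lessThan_Suc)

lemma dterm_one: "dterm x y (Suc 0) t = x + Adj (t *\<^sub>R x) y"
proof -
  let ?f = "\<lambda>(r,s). (t ^ (r + s - 1) / (fact r * fact s)) *\<^sub>R nbr br (replicate r x @ replicate s y)"
  have w0: "words 0 = {[]}" by (auto simp: words_def)
  have "dterm x y (Suc 0) t = (\<Sum>p\<in>bidx. ?f p)"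
    unfolding dterm_def sum_words_Suc w0
    by (simp add: wtotal_def wfact_def dynkin_word_def case_prod_unfold)
  also have "\<dots> = (\<Sum>r<K. \<Sum>s<K. ?f (r, s))"
    by (subst sum_bidx) simp
  \<comment> \<open>A right-nested bracket ending in two equal letters is zero, so among the words
    x^r y^s only x itself and those with s = 1 survive.\<close>
  also have "\<dots> = (\<Sum>r<K. \<Sum>s<K. (if r = 1 \<and> s = 0 then x else 0) + (if s = 1 then (t ^ r / fact r) *\<^sub>R (br x ^^ r) y else 0))"
  proof (intro sum.cong refl)
    fix r s :: nat
    show "?f (r, s) = (if r = 1 \<and> s = 0 then x else 0) + (if s = 1 then (t ^ r / fact r) *\<^sub>R (br x ^^ r) y else 0)"
    proof (cases "s = 0")
      case True then show ?thesis by (auto simp: nbr_replicate)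
    next
      case False
      then show ?thesis
        by (auto simp: nbr_replicate_append nbr_replicate linear_0[OF linear_funpow[OF linear_br]])
    qed
  qed
  also have "\<dots> = (\<Sum>r<K. \<Sum>s<K. if r = 1 \<and> s = 0 then x else 0)
      + (\<Sum>r<K. \<Sum>s<K. if s = 1 then (t ^ r / fact r) *\<^sub>R (br x ^^ r) y else 0)"
    by (simp only: sum.distrib)
  also have "(\<Sum>r<K. \<Sum>s<K. if r = 1 \<and> s = 0 then x else 0) = (\<Sum>r<K. if r = 1 then x else 0)"
    by (intro sum.cong refl) (auto simp: sum.delta simp del: sum.lessThan_Suc)
  also have "\<dots> = x" using m_pos by (simp add: sum.delta del: sum.lessThan_Suc)
  also have "(\<Sum>r<K. \<Sum>s<K. if s = 1 then (t ^ r / fact r) *\<^sub>R (br x ^^ r) y else 0) = Adj (t *\<^sub>R x) y"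
    using m_pos by (simp add: sum.delta Adj_eq del: sum.lessThan_Suc)
  finally show ?thesis .
qed

text \<open>A leading pair (r, s) applies (ad x)^r (ad y)^s with weight t^(r+s)/(r! s!). Summed over
  all pairs this is Ad(tx) Ad(ty); the excluded pair (0, 0) accounts for the subtracted
  identity.\<close>

lemma dterm_Suc:
  assumes n: "1 \<le> n"
  shows "dterm x y (Suc n) t = Adj (t *\<^sub>R x) (Adj (t *\<^sub>R y) (dterm x y n t)) - dterm x y n t"
proof -
  let ?g = "\<lambda>(r,s). (t ^ (r + s) / (fact r * fact s)) *\<^sub>R (br x ^^ r) ((br y ^^ s) (dterm x y n t))"
  have "dterm x y (Suc n) t = (\<Sum>p\<in>bidx. ?g p)"
    unfolding dterm_def[of x y "Suc n"] sum_words_Suc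
  proof (intro sum.cong refl)
    fix p assume "p \<in> bidx"
    obtain r s where p: "p = (r, s)" by (cases p)
    have "(\<Sum>rs\<in>words n. (t ^ (wtotal (p # rs) - 1) / wfact (p # rs)) *\<^sub>R nbr br (dynkin_word x y (p # rs)))
      = (\<Sum>rs\<in>words n. (t ^ (r + s) / (fact r * fact s)) *\<^sub>R (br x ^^ r) ((br y ^^ s)
           ((t ^ (wtotal rs - 1) / wfact rs) *\<^sub>R nbr br (dynkin_word x y rs))))"
    proof (intro sum.cong refl)
      fix rs assume rs: "rs \<in> words n"
      \<comment> \<open>Positive length makes the natural-number subtraction in the exponent exact
        and the remaining word nonempty.\<close>
      have tot: "1 \<le> wtotal rs" using words_wtotal[OF rs] n by simp
      then have ne: "dynkin_word x y rs \<noteq> []" using length_dynkin_word[of x y rs] by force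
      have e: "wtotal (p # rs) - 1 = r + s + (wtotal rs - 1)" using tot by (simp add: p wtotal_def)
      have "nbr br (dynkin_word x y (p # rs)) = (br x ^^ r) ((br y ^^ s) (nbr br (dynkin_word x y rs)))"
        using ne by (simp add: dynkin_word_Cons p nbr_replicate_append)
      then show "(t ^ (wtotal (p # rs) - 1) / wfact (p # rs)) *\<^sub>R nbr br (dynkin_word x y (p # rs))
        = (t ^ (r + s) / (fact r * fact s)) *\<^sub>R (br x ^^ r) ((br y ^^ s)
           ((t ^ (wtotal rs - 1) / wfact rs) *\<^sub>R nbr br (dynkin_word x y rs)))"
        unfolding e by (simp add: p wfact_def linear_scale[OF linear_funpow[OF linear_br]] power_add)
    qed
    also have "\<dots> = ?g p"
      by (simp add: p dterm_def linear_sum[OF linear_funpow[OF linear_br]] scaleR_sum_right)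
    finally show "(\<Sum>rs\<in>words n. (t ^ (wtotal (p # rs) - 1) / wfact (p # rs)) *\<^sub>R nbr br (dynkin_word x y (p # rs))) = ?g p" .
  qed
  also have "\<dots> = (\<Sum>r<K. \<Sum>s<K. ?g (r, s)) - ?g (0, 0)" by (rule sum_bidx)
  also have "\<dots> = Adj (t *\<^sub>R x) (Adj (t *\<^sub>R y) (dterm x y n t)) - dterm x y n t"
    by (simp only: Adj_Adj_eq) simp
  finally show ?thesis .
qed

lemma bch_ray_derivative:
  "((\<lambda>t. (t *\<^sub>R x) \<odot> (t *\<^sub>R y)) has_vector_derivative
     (\<Sum>n\<in>{1..m}. ((-1) ^ (n - 1) / real n) *\<^sub>R dterm x y n t)) (at t)"
proof -
  have "((\<lambda>t. ((-1) ^ (n - 1) / (real n * real (wtotal rs) * wfact rs) * t ^ wtotal rs) *\<^sub>R nbr br (dynkin_word x y rs))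
     has_vector_derivative ((-1) ^ (n - 1) / real n) *\<^sub>R ((t ^ (wtotal rs - 1) / wfact rs) *\<^sub>R nbr br (dynkin_word x y rs))) (at t)"
    if "n \<in> {1..m}" "rs \<in> words n" for n rs
  proof -
    have tot: "wtotal rs \<noteq> 0" using words_wtotal[OF that(2)] that(1) by auto
    have "((\<lambda>t. (-1) ^ (n - 1) / (real n * real (wtotal rs) * wfact rs) * t ^ wtotal rs) has_field_derivative
        (-1) ^ (n - 1) / (real n * real (wtotal rs) * wfact rs) * (real (wtotal rs) * t ^ (wtotal rs - 1))) (at t)"
      by (rule DERIV_cmult) (use DERIV_pow[of "wtotal rs" t] in simp)
    also have "(-1) ^ (n - 1) / (real n * real (wtotal rs) * wfact rs) * (real (wtotal rs) * t ^ (wtotal rs - 1))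
       = ((-1) ^ (n - 1) / real n) * (t ^ (wtotal rs - 1) / wfact rs)"
    proof -
      have "wfact rs \<noteq> 0" by (induction rs) (auto simp: wfact_def)
      then show ?thesis using tot that(1) by simp
    qed
    finally have "((\<lambda>t. (-1) ^ (n - 1) / (real n * real (wtotal rs) * wfact rs) * t ^ wtotal rs) has_real_derivative
       ((-1) ^ (n - 1) / real n) * (t ^ (wtotal rs - 1) / wfact rs)) (at t)" .
    from has_vector_derivative_scaleR[OF this has_vector_derivative_const[of "nbr br (dynkin_word x y rs)"]]
    show ?thesis by simp
  qed
  then show ?thesis
    unfolding bch_ray dterm_def scaleR_sum_right by (intro has_vector_derivative_sum) auto
qed

text \<open>Let E(t) be the product of the exponentials of tx and ty; then E' = ad(a) E with a(t) =
  x + Ad(tx) y. The derivative of E^n is known for every natural n and is polynomial in n. Its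
  linear coefficient at n = 0 is the derivative of log E, which thus equals ad(z(t)), where z is a
  combination of iterates on a with logarithm coefficients. The same z is the derivative of Dynkin's
  formula along the ray, so log E(1) is ad of the product.\<close>

theorem eadh_mul: "eadh (x \<odot> y) w = eadh x (eadh y w)"
proof -
  define E where "E t w = eadh (t *\<^sub>R x) (eadh (t *\<^sub>R y) w)" for t w
  define N where "N t w = E t w - w" for t w
  define Eg where "Eg t v = Adj (t *\<^sub>R x) (Adj (t *\<^sub>R y) v)" for t v
  define Ng where "Ng t v = Eg t v - v" for t v
  define a where "a t = x + Adj (t *\<^sub>R x) y" for t
  have lE: "linear (E t)" for t
    unfolding E_def using linear_compose[OF linear_eadh linear_eadh] by (simp add: comp_def)
  have lN: "linear (N t)" for t
    unfolding N_def by (intro linear_compose_sub lE linear_ident)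
  have lEg: "linear (Eg t)" for t
    unfolding Eg_def using linear_compose[OF linear_Adj linear_Adj] by (simp add: comp_def)
  have lNg: "linear (Ng t)" for t
    unfolding Ng_def by (intro linear_compose_sub lEg linear_ident)
  have Efilt: "N t w \<in> hfilt (Suc j)" if "w \<in> hfilt j" for t w j
  proof -
    have 1: "eadh (t *\<^sub>R y) w - w \<in> hfilt (Suc j)" by (rule eadh_hfilt[OF that])
    then have "eadh (t *\<^sub>R y) w - w \<in> hfilt j" using hfilt_antimono[of j "Suc j"] by auto
    then have "eadh (t *\<^sub>R y) w \<in> hfilt j" using subspace_add[OF subspace_hfilt _ that, of "eadh (t *\<^sub>R y) w - w"] by simp
    from subspace_add[OF subspace_hfilt eadh_hfilt[OF this] 1, of "t *\<^sub>R x"]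
    show ?thesis by (simp add: N_def E_def)
  qed
  have Nnil: "(N t ^^ K) w = 0" for t w
    by (rule hfilt_nilpotent[OF Efilt])
  have Epair: "E t (v, 0) = (Eg t v, 0)" for t v by (simp add: E_def Eg_def eadh_pair)
  have Npair: "(N t ^^ n) (v, 0) = ((Ng t ^^ n) v, 0)" for t v n
    by (induction n) (auto simp: N_def Ng_def Epair)
  have Ngnil: "(Ng t ^^ K) v = 0" for t v
    using Nnil[of t "(v,0)"] by (simp only: Npair) (simp add: zero_prod_def)
  have Eadh: "E t (adh b w) = adh (Eg t b) (E t w)" for t b w
    by (simp add: E_def Eg_def eadh_adh)
  have dE: "((\<lambda>t. E t (w t)) has_vector_derivative E t w' + adh (a t) (E t (w t))) (at t)"
    if "(w has_vector_derivative w') (at t)" for w w' t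
  proof -
    have "((\<lambda>t. eadh (t *\<^sub>R x) (eadh (t *\<^sub>R y) (w t))) has_vector_derivative
      eadh (t *\<^sub>R x) (eadh (t *\<^sub>R y) w' + adh y (eadh (t *\<^sub>R y) (w t)))
        + adh x (eadh (t *\<^sub>R x) (eadh (t *\<^sub>R y) (w t)))) (at t)"
      by (intro eadh_has_vector_derivative that)
    then show ?thesis
      by (simp add: E_def a_def adh_add linear_add[OF linear_eadh] eadh_adh algebra_simps)
  qed
  \<comment> \<open>The product rule produces ad(a) between powers of E; moving it to the left past
    E replaces a by \<open>Eg t a\<close>.\<close>
  have dEn: "((\<lambda>t. (E t ^^ n) w) has_vector_derivative adh (\<Sum>i<n. (Eg t ^^ i) (a t)) ((E t ^^ n) w)) (at t)" for n t w
  proof (induction n)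
    case (Suc n)
    have "Eg t (\<Sum>i<n. (Eg t ^^ i) (a t)) + a t = (\<Sum>i<Suc n. (Eg t ^^ i) (a t))"
      by (subst sum.lessThan_Suc_shift) (simp add: linear_sum[OF lEg])
    then have "adh (\<Sum>i<Suc n. (Eg t ^^ i) (a t)) ((E t ^^ Suc n) w)
       = E t (adh (\<Sum>i<n. (Eg t ^^ i) (a t)) ((E t ^^ n) w)) + adh (a t) (E t ((E t ^^ n) w))"
      by (simp add: Eadh adh_add flip: adh_add del: sum.lessThan_Suc)
    then show ?case using dE[OF Suc] by simp
  qed simp
  have "\<exists>M. ((\<lambda>t. (N t ^^ j) w) has_vector_derivative M) (at t)" for j t w
  proof (induction j)
    case 0
    show ?case by (intro exI[of _ 0]) simp
  next
    case (Suc j)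
    then obtain M where M: "((\<lambda>t. (N t ^^ j) w) has_vector_derivative M) (at t)" by blast
    have e: "(N t ^^ Suc j) w = E t ((N t ^^ j) w) - (N t ^^ j) w" for t
      using N_def[of t "(N t ^^ j) w"] by simp
    show ?case
      unfolding e using has_vector_derivative_diff[OF dE[OF M] M] by blast
  qed
  then have "(\<lambda>t. (N t ^^ j) w) differentiable at t" for j t w
    using differentiableI_vector by blast
  then have M: "((\<lambda>t. (N t ^^ j) w) has_vector_derivative vector_derivative (\<lambda>t. (N t ^^ j) w) (at t)) (at t)" for j t w
    by (simp add: vector_derivative_works)
  define M where "M j t w = vector_derivative (\<lambda>t. (N t ^^ j) w) (at t)" for j t w
  note M = M[folded M_def]
  define U where "U t w = opser K (fps_ln 1) (N t) w" for t w
  define z where "z t = (\<Sum>j<K. fps_nth (fps_ln 1) (Suc j) *\<^sub>R (Ng t ^^ j) (a t))" for t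
  \<comment> \<open>Compares the linear coefficients in n of the derivative of E^n, computed once
    from the binomial expansion and once from \<open>dEn\<close>.\<close>
  have ident: "(\<Sum>j<K. fps_nth (fps_ln 1) j *\<^sub>R M j t w) = adh (z t) w" for t w
  proof -
    let ?B = "\<lambda>j i. adh ((Ng t ^^ j) (a t)) ((N t ^^ i) w)"
    have "(\<Sum>j<K. real (n choose j) *\<^sub>R M j t w)
       = (\<Sum>j<K. \<Sum>i<K. (real (n choose Suc j) * real (n choose i)) *\<^sub>R ?B j i)" for n
    proof -
      have En: "(E t ^^ n) w = (\<Sum>j<K. real (n choose j) *\<^sub>R (N t ^^ j) w)" for t
        by (rule funpow_binomial(1)[OF lE _ Nnil]) (auto simp: N_def)
      have "((\<lambda>t. \<Sum>j<K. real (n choose j) *\<^sub>R (N t ^^ j) w) has_vector_derivative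
         (\<Sum>j<K. real (n choose j) *\<^sub>R M j t w)) (at t)"
        by (intro has_vector_derivative_sum bounded_linear.has_vector_derivative[OF bounded_linear_scaleR_right] M)
      moreover have "((\<lambda>t. \<Sum>j<K. real (n choose j) *\<^sub>R (N t ^^ j) w) has_vector_derivative
          adh (\<Sum>i<n. (Eg t ^^ i) (a t)) ((E t ^^ n) w)) (at t)"
        using dEn[of n w t] by (simp only: En)
      ultimately have "(\<Sum>j<K. real (n choose j) *\<^sub>R M j t w) = adh (\<Sum>i<n. (Eg t ^^ i) (a t)) ((E t ^^ n) w)"
        by (rule vector_derivative_unique_at)
      also have "(\<Sum>i<n. (Eg t ^^ i) (a t)) = (\<Sum>j<K. real (n choose Suc j) *\<^sub>R (Ng t ^^ j) (a t))"
        by (rule funpow_binomial(2)[OF lEg _ Ngnil]) (auto simp: Ng_def)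
      also have "adh \<dots> ((E t ^^ n) w) = (\<Sum>j<K. \<Sum>i<K. (real (n choose Suc j) * real (n choose i)) *\<^sub>R ?B j i)"
        unfolding En linear_sum[OF linear_adh] linear_sum[OF linear_adh_left] linear_scale[OF linear_adh]
          adh_scale scaleR_scaleR
        by (subst sum.swap) (simp only: scaleR_sum_right scaleR_scaleR mult.commute)
      finally show ?thesis .
    qed
    then have "(\<Sum>j<K. fps_nth (fps_ln 1) j *\<^sub>R M j t w) = (\<Sum>j<K. fps_nth (fps_ln 1) (Suc j) *\<^sub>R ?B j 0)"
      by (rule binomial_identity_linear_part[rotated]) simp
    also have "\<dots> = adh (z t) w"
      by (simp only: z_def linear_sum[OF linear_adh_left] adh_scale funpow_0)
    finally show ?thesis .
  qed
  have dU: "((\<lambda>t. U t w) has_vector_derivative adh (z t) w) (at t)" for t w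
    unfolding U_def opser_def ident[symmetric]
    by (intro has_vector_derivative_sum bounded_linear.has_vector_derivative[OF bounded_linear_scaleR_right] M)
  have dterm_Ng: "dterm x y (Suc n) t = (Ng t ^^ n) (a t)" for n t
    by (induction n) (simp_all add: dterm_one a_def dterm_Suc Ng_def Eg_def)
  have z_eq: "(\<Sum>n\<in>{1..m}. ((-1) ^ (n - 1) / real n) *\<^sub>R dterm x y n t) = z t" for t
  proof -
    \<comment> \<open>The sum z has m + 1 terms and Dynkin's formula m; the surplus term vanishes
      because a(t) already has degree 1.\<close>
    have z0: "(Ng t ^^ m) (a t) = 0"
    proof -
      have "(a t, 0::real) \<in> hfilt (Suc 0)" by (simp add: hfilt_def filt_one)
      from hfilt_funpow[of "N t", OF Efilt this, of m]
      have "(N t ^^ m) (a t, 0) \<in> hfilt K" by simp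
      then show ?thesis by (simp only: hfilt_top Npair) (simp add: zero_prod_def)
    qed
    have "(\<Sum>n\<in>{1..m}. ((-1) ^ (n - 1) / real n) *\<^sub>R dterm x y n t)
       = (\<Sum>n<m. ((-1) ^ n / real (Suc n)) *\<^sub>R (Ng t ^^ n) (a t))"
      by (rule sum.reindex_bij_witness[of _ Suc "\<lambda>n. n - 1"]) (auto simp: dterm_Ng[symmetric])
    also have "\<dots> = z t" unfolding z_def by (simp add: z0 fps_ln_nth)
    finally show ?thesis .
  qed
  \<comment> \<open>Both curves have derivative ad(z(t)) and start at 0.\<close>
  have U1: "U 1 w = adh (x \<odot> y) w" for w
  proof -
    let ?g = "\<lambda>t. U t w - adh ((t *\<^sub>R x) \<odot> (t *\<^sub>R y)) w"
    have "(?g has_vector_derivative 0) (at t)" for t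
    proof -
      have "((\<lambda>t. adh ((t *\<^sub>R x) \<odot> (t *\<^sub>R y)) w) has_vector_derivative adh (z t) w) (at t)"
        using bounded_linear.has_vector_derivative[OF _ bch_ray_derivative[of x y t, unfolded z_eq], of "\<lambda>v. adh v w"] linear_adh_left[of w]
        by (simp add: linear_conv_bounded_linear)
      from has_vector_derivative_diff[OF dU[of w] this] show ?thesis by simp
    qed
    then obtain c where c: "?g t = c" for t
      using has_vector_derivative_zero_constant[of UNIV ?g] by auto
    have N0: "N 0 = (\<lambda>w. 0)" by (rule ext) (simp add: N_def E_def eadh_0)
    have N0': "(N 0 ^^ n) w = (if n = 0 then w else 0)" for n
      by (cases n) (auto simp: N0)
    have "U 0 w = 0" unfolding U_def opser_def by (intro sum.neutral) (auto simp: N0')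
    moreover have "(0::complex^'n) \<odot> 0 = 0"
      using bch_ray[of 0 x y] words_wtotal by (auto intro!: sum.neutral simp: power_0_left)
    ultimately have "c = 0" using c[of 0] by simp
    then show ?thesis using c[of 1] by simp
  qed
  have "eadh (x \<odot> y) w = opser K (fps_exp 1) (U 1) w"
    unfolding eadh_def using U1 by (simp add: U1[symmetric, abs_def])
  also have "\<dots> = w + N 1 w"
    unfolding U_def by (rule opser_exp_ln[OF lN Nnil]) simp
  also have "\<dots> = eadh x (eadh y w)" by (simp add: N_def E_def)
  finally show ?thesis .
qed

section \<open>Group axioms, inverses and conjugation\<close>

lemma mul_assoc: "x \<odot> y \<odot> z = x \<odot> (y \<odot> z)"
  by (rule eadh_inj) (simp add: eadh_mul)

lemma mul_zero_right [simp]: "x \<odot> 0 = x"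
  and mul_zero_left [simp]: "0 \<odot> x = x"
  by (rule eadh_inj, simp add: eadh_mul eadh_0)+

lemma mul_minus_left [simp]: "(- x) \<odot> x = 0"
  and mul_minus_right [simp]: "x \<odot> (- x) = 0"
  using eadh_minus[of "- x"] by (auto intro!: eadh_inj simp: eadh_mul eadh_0 eadh_minus)

lemma mul_scale: "(s *\<^sub>R x) \<odot> (t *\<^sub>R x) = (s + t) *\<^sub>R x"
  by (rule eadh_inj) (simp add: eadh_mul eadh_add)

lemma mul_cancel_left [simp]: "(- x) \<odot> (x \<odot> y) = y" "x \<odot> ((- x) \<odot> y) = y"
  by (simp_all flip: mul_assoc)

lemma mul_cancel_right [simp]: "y \<odot> x \<odot> (- x) = y" "y \<odot> (- x) \<odot> x = y"
  by (simp_all add: mul_assoc)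

lemma minus_mul: "- (x \<odot> y) = (- y) \<odot> (- x)"
proof -
  have "(- y) \<odot> (- x) = (- y) \<odot> (- x) \<odot> (x \<odot> y \<odot> (- (x \<odot> y)))" by simp
  also have "\<dots> = (- y) \<odot> ((- x) \<odot> (x \<odot> y)) \<odot> (- (x \<odot> y))" by (simp only: mul_assoc)
  finally show ?thesis by simp
qed

text \<open>Under the faithful representation, conjugation turns the exponential of v into that of
  Ad(x) v, term by term in the series by \<open>eadh_adh\<close>.\<close>

lemma mul_conj: "x \<odot> v \<odot> (- x) = Adj x v"
proof (rule eadh_inj)
  fix w
  have e: "(\<Sum>n<K. (1 / fact n) *\<^sub>R (adh v ^^ n) w) = eadh v w" for v w
    using eadh_eq[of 1 v w] by simp
  have p: "(adh (Adj x v) ^^ n) w = eadh x ((adh v ^^ n) (eadh (- x) w))" for n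
  proof (induction n)
    case 0 show ?case using eadh_minus[of "- x" w] by simp
  next
    case (Suc n)
    have "(adh (Adj x v) ^^ Suc n) w = adh (Adj x v) (eadh x ((adh v ^^ n) (eadh (- x) w)))" by (simp add: Suc)
    then show ?case by (simp add: eadh_adh)
  qed
  have "eadh (Adj x v) w = (\<Sum>n<K. (1 / fact n) *\<^sub>R eadh x ((adh v ^^ n) (eadh (- x) w)))"
    by (simp only: e[symmetric] p)
  also have "\<dots> = eadh x (eadh v (eadh (- x) w))"
    by (simp only: e[of v, symmetric] linear_sum[OF linear_eadh] linear_scale[OF linear_eadh])
  finally show "eadh (x \<odot> v \<odot> (- x)) w = eadh (Adj x v) w" by (simp add: eadh_mul)
qed

lemma dil_mul: "dil r (x \<odot> y) = dil r x \<odot> dil r y"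
proof -
  have w: "dynkin_word (dil r x) (dil r y) rs = map (dil r) (dynkin_word x y rs)" for rs
    by (induction rs) (auto simp: dynkin_word_def)
  have n: "nbr br (map (dil r) w) = dil r (nbr br w)" for w
    by (cases "w = []") (auto simp: nbr_dil linear_0[OF linear_dil])
  show ?thesis
    by (simp add: bch_def w n linear_sum[OF linear_dil] linear_scale[OF linear_dil])
qed

end

section \<open>Smooth functions\<close>

text \<open>Testing the derivative on fixed vectors keeps the type of the function unchanged, so the
  recursion stays within one type and product and chain rules follow by induction on k.
  \<open>smooth_fn\<close> speaks only of directional derivatives; \<open>smooth_fn_iff\<close>
  shows that the two notions agree.\<close>

fun Ck :: "nat \<Rightarrow> ('a::real_normed_vector \<Rightarrow> 'b::real_normed_vector) \<Rightarrow> bool" where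
  "Ck 0 f = continuous_on UNIV f"
| "Ck (Suc k) f = (\<exists>f'. (\<forall>x. (f has_derivative f' x) (at x)) \<and> (\<forall>v. Ck k (\<lambda>x. f' x v)))"

lemma Ck_SucI: "(\<And>x. (f has_derivative f' x) (at x)) \<Longrightarrow> (\<And>v. Ck k (\<lambda>x. f' x v)) \<Longrightarrow> Ck (Suc k) f"
  by auto

lemma Ck_SucE:
  assumes "Ck (Suc k) f"
  obtains f' where "\<And>x. (f has_derivative f' x) (at x)" "\<And>v. Ck k (\<lambda>x. f' x v)"
  using assms by auto

lemma Ck_Suc_imp: "Ck (Suc k) f \<Longrightarrow> Ck k f"
proof (induction k arbitrary: f)
  case 0
  then obtain f' where "\<And>x. (f has_derivative f' x) (at x)" by auto
  then show ?case by (auto simp: continuous_on_eq_continuous_at intro: has_derivative_continuous)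
next
  case (Suc k)
  then obtain f' where "\<And>x. (f has_derivative f' x) (at x)" "\<And>v. Ck (Suc k) (\<lambda>x. f' x v)"
    by (metis Ck.simps(2))
  then show ?case using Suc.IH by (intro Ck_SucI) auto
qed

lemma Ck_const: "Ck k (\<lambda>x. c)"
proof (induction k arbitrary: c)
  case (Suc k) then show ?case by (intro Ck_SucI[of _ "\<lambda>_ _. 0"]) auto
qed simp

lemma Ck_bounded_linear: assumes "bounded_linear f" shows "Ck k f"
proof (cases k)
  case 0
  then show ?thesis using assms bounded_linear.linear linear_continuous_on by auto
next
  case (Suc j)
  then show ?thesis using Ck_const bounded_linear_imp_has_derivative[OF assms]
    by (auto intro!: Ck_SucI[of _ "\<lambda>_. f"] simp del: Ck.simps)
qed

lemma Ck_linear: "linear f \<Longrightarrow> Ck k f" for f :: "'a::euclidean_space \<Rightarrow> 'b::real_normed_vector"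
  by (simp add: Ck_bounded_linear linear_conv_bounded_linear)

lemma Ck_add: "Ck k f \<Longrightarrow> Ck k g \<Longrightarrow> Ck k (\<lambda>x. f x + g x)"
proof (induction k arbitrary: f g)
  case 0 then show ?case by (auto intro: continuous_intros)
next
  case (Suc k)
  obtain f' where f: "\<And>x. (f has_derivative f' x) (at x)" "\<And>v. Ck k (\<lambda>x. f' x v)"
    using Suc.prems(1) by (rule Ck_SucE) (rule that)
  obtain g' where g: "\<And>x. (g has_derivative g' x) (at x)" "\<And>v. Ck k (\<lambda>x. g' x v)"
    using Suc.prems(2) by (rule Ck_SucE) (rule that)
  show ?case
    by (rule Ck_SucI[of _ "\<lambda>x v. f' x v + g' x v"]) (use f g Suc.IH in \<open>auto intro: has_derivative_add\<close>)
qed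

lemma Ck_linear_comp: assumes "bounded_linear h" "Ck k f" shows "Ck k (\<lambda>x. h (f x))"
  using assms(2)
proof (induction k arbitrary: f)
  case 0 then show ?case using bounded_linear.continuous_on[OF assms(1)] by auto
next
  case (Suc k)
  obtain f' where f: "\<And>x. (f has_derivative f' x) (at x)" "\<And>v. Ck k (\<lambda>x. f' x v)"
    using Suc.prems(1) by (rule Ck_SucE) (rule that)
  show ?case
    by (rule Ck_SucI[of _ "\<lambda>x v. h (f' x v)"])
       (rule bounded_linear.has_derivative[OF assms(1) f(1)], rule Suc.IH[OF f(2)])
qed

lemma Ck_sum: "(\<And>i. i \<in> I \<Longrightarrow> Ck k (f i)) \<Longrightarrow> Ck k (\<lambda>x. \<Sum>i\<in>I. f i x)"
  by (induction I rule: infinite_finite_induct) (auto intro: Ck_add Ck_const)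

lemma Ck_bilinear:
  assumes h: "bounded_bilinear h" shows "Ck k f \<Longrightarrow> Ck k g \<Longrightarrow> Ck k (\<lambda>x. h (f x) (g x))"
proof (induction k arbitrary: f g)
  case 0 then show ?case using bounded_bilinear.continuous_on[OF h] by auto
next
  case (Suc k)
  obtain f' where f: "\<And>x. (f has_derivative f' x) (at x)" "\<And>v. Ck k (\<lambda>x. f' x v)"
    using Suc.prems(1) by (rule Ck_SucE) (rule that)
  obtain g' where g: "\<And>x. (g has_derivative g' x) (at x)" "\<And>v. Ck k (\<lambda>x. g' x v)"
    using Suc.prems(2) by (rule Ck_SucE) (rule that)
  show ?case
    by (rule Ck_SucI[of _ "\<lambda>x v. h (f x) (g' x v) + h (f' x v) (g x)"])
       (rule bounded_bilinear.FDERIV[OF h f(1) g(1)], intro Ck_add Suc.IH f g Suc.prems[THEN Ck_Suc_imp])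
qed

lemma Ck_comp:
  fixes g :: "'b::euclidean_space \<Rightarrow> 'c::real_normed_vector" and F :: "'a::real_normed_vector \<Rightarrow> 'b"
  shows "Ck k g \<Longrightarrow> Ck k F \<Longrightarrow> Ck k (\<lambda>x. g (F x))"
proof (induction k arbitrary: g F)
  case 0
  then show ?case by (auto intro!: continuous_on_compose2[of UNIV g])
next
  case (Suc k)
  obtain g' where g: "\<And>x. (g has_derivative g' x) (at x)" "\<And>v. Ck k (\<lambda>x. g' x v)"
    using Suc.prems(1) by (rule Ck_SucE) (rule that)
  obtain F' where F: "\<And>x. (F has_derivative F' x) (at x)" "\<And>v. Ck k (\<lambda>x. F' x v)"
    using Suc.prems(2) by (rule Ck_SucE) (rule that)
  \<comment> \<open>\<open>Ck\<close> controls g' only along fixed vectors, whereas F' x v moves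
    with x; expanding in the basis reduces to fixed ones.\<close>
  have e: "g' y v = (\<Sum>b\<in>Basis. (v \<bullet> b) *\<^sub>R g' y b)" for y v
  proof -
    have l: "linear (g' y)" using g(1) has_derivative_linear by blast
    have "g' y v = g' y (\<Sum>b\<in>Basis. (v \<bullet> b) *\<^sub>R b)" by (simp add: euclidean_representation)
    then show ?thesis by (simp add: linear_sum[OF l] linear_scale[OF l])
  qed
  show ?case
  proof (rule Ck_SucI)
    show "((\<lambda>x. g (F x)) has_derivative (\<lambda>v. g' (F x) (F' x v))) (at x)" for x
      by (rule has_derivative_compose[OF F(1) g(1)])
    show "Ck k (\<lambda>x. g' (F x) (F' x v))" for v
      by (subst e) (intro Ck_sum Ck_bilinear[OF bounded_bilinear_scaleR] Ck_linear_comp[OF bounded_linear_inner_left]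
        F(2) Suc.IH g(2) Ck_Suc_imp[OF Suc.prems(2)])
  qed
qed

lemma Ck_inverse:
  fixes f :: "'a::real_normed_vector \<Rightarrow> real"
  assumes pos: "\<And>x. f x \<noteq> 0" shows "Ck k f \<Longrightarrow> Ck k (\<lambda>x. inverse (f x))"
proof (induction k)
  case 0 then show ?case using pos by (auto intro!: continuous_intros)
next
  case (Suc k)
  obtain f' where f: "\<And>x. (f has_derivative f' x) (at x)" "\<And>v. Ck k (\<lambda>x. f' x v)"
    using Suc.prems(1) by (rule Ck_SucE) (rule that)
  have I: "Ck k (\<lambda>x. inverse (f x))" using Suc Ck_Suc_imp by blast
  show ?case
    by (rule Ck_SucI[of _ "\<lambda>x v. - (inverse (f x) * f' x v * inverse (f x))"])
       (use f pos I in \<open>auto intro!: Ck_bilinear[OF bounded_bilinear_mult] Ck_linear_comp[OF bounded_linear_minus[OF bounded_linear_ident]] has_derivative_inverse\<close>)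
qed

lemma Ck_sqrt:
  fixes f :: "'a::real_normed_vector \<Rightarrow> real"
  assumes pos: "\<And>x. 0 < f x" shows "Ck k f \<Longrightarrow> Ck k (\<lambda>x. sqrt (f x))"
proof (induction k)
  case 0 then show ?case by (auto intro!: continuous_intros)
next
  case (Suc k)
  obtain f' where f: "\<And>x. (f has_derivative f' x) (at x)" "\<And>v. Ck k (\<lambda>x. f' x v)"
    using Suc.prems(1) by (rule Ck_SucE) (rule that)
  have S: "Ck k (\<lambda>x. sqrt (f x))" using Suc Ck_Suc_imp by blast
  have nz: "sqrt (f x) \<noteq> 0" for x using pos[of x] by simp
  have I: "Ck k (\<lambda>x. inverse (sqrt (f x)))" by (rule Ck_inverse[OF nz S])
  show ?case
  proof (rule Ck_SucI[of _ "\<lambda>x v. inverse (sqrt (f x)) / 2 * f' x v"])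
    show "((\<lambda>x. sqrt (f x)) has_derivative (\<lambda>v. inverse (sqrt (f x)) / 2 * f' x v)) (at x)" for x
      using has_derivative_compose[OF f(1) DERIV_real_sqrt[OF pos, unfolded has_field_derivative_def], of x] by simp
    show "Ck k (\<lambda>x. inverse (sqrt (f x)) / 2 * f' x v)" for v
      by (intro Ck_bilinear[OF bounded_bilinear_mult] f(2) Ck_linear_comp[OF bounded_linear_divide] I)
  qed
qed

definition smooth :: "('a::real_normed_vector \<Rightarrow> 'b::real_normed_vector) \<Rightarrow> bool" where
  "smooth f \<longleftrightarrow> (\<forall>k. Ck k f)"

lemma smooth_continuous: "smooth f \<Longrightarrow> continuous_on UNIV f"
  unfolding smooth_def using Ck.simps(1) by blast

lemma smooth_const: "smooth (\<lambda>x. c)" by (simp add: smooth_def Ck_const)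
lemma smooth_bounded_linear: "bounded_linear f \<Longrightarrow> smooth f" by (simp add: smooth_def Ck_bounded_linear)
lemma smooth_linear: "linear f \<Longrightarrow> smooth f" for f :: "'a::euclidean_space \<Rightarrow> 'b::real_normed_vector"
  by (simp add: smooth_def Ck_linear)
lemma smooth_ident: "smooth (\<lambda>x. x)" by (rule smooth_bounded_linear[OF bounded_linear_ident])
lemma smooth_add: "smooth f \<Longrightarrow> smooth g \<Longrightarrow> smooth (\<lambda>x. f x + g x)" by (simp add: smooth_def Ck_add)
lemma smooth_linear_comp: "bounded_linear h \<Longrightarrow> smooth f \<Longrightarrow> smooth (\<lambda>x. h (f x))"
  by (simp add: smooth_def Ck_linear_comp)
lemma smooth_sum: "(\<And>i. i \<in> I \<Longrightarrow> smooth (f i)) \<Longrightarrow> smooth (\<lambda>x. \<Sum>i\<in>I. f i x)"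
  by (simp add: smooth_def Ck_sum)
lemma smooth_bilinear: "bounded_bilinear h \<Longrightarrow> smooth f \<Longrightarrow> smooth g \<Longrightarrow> smooth (\<lambda>x. h (f x) (g x))"
  by (simp add: smooth_def Ck_bilinear)
lemma smooth_comp: "smooth g \<Longrightarrow> smooth F \<Longrightarrow> smooth (\<lambda>x. g (F x))"
  for g :: "'b::euclidean_space \<Rightarrow> 'c::real_normed_vector" and F :: "'a::real_normed_vector \<Rightarrow> 'b"
  by (simp add: smooth_def Ck_comp)
lemma smooth_inverse: "(\<And>x. f x \<noteq> 0) \<Longrightarrow> smooth f \<Longrightarrow> smooth (\<lambda>x. inverse (f x))"
  for f :: "'a::real_normed_vector \<Rightarrow> real" by (simp add: smooth_def Ck_inverse)
lemma smooth_sqrt: "(\<And>x. 0 < f x) \<Longrightarrow> smooth f \<Longrightarrow> smooth (\<lambda>x. sqrt (f x))"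
  for f :: "'a::real_normed_vector \<Rightarrow> real" by (simp add: smooth_def Ck_sqrt)

lemmas smooth_scaleR = smooth_bilinear[OF bounded_bilinear_scaleR]
lemmas smooth_inner = smooth_bilinear[OF bounded_bilinear_inner]

lemma smooth_mult: "smooth f \<Longrightarrow> smooth g \<Longrightarrow> smooth (\<lambda>x. f x * g x)"
  for f g :: "'a::real_normed_vector \<Rightarrow> 'b::real_normed_algebra"
  by (rule smooth_bilinear[OF bounded_bilinear_mult])

lemma smooth_minus: "smooth f \<Longrightarrow> smooth (\<lambda>x. - f x)"
  by (rule smooth_linear_comp[OF bounded_linear_minus[OF bounded_linear_ident]])

lemma smooth_diff: "smooth f \<Longrightarrow> smooth g \<Longrightarrow> smooth (\<lambda>x. f x - g x)"
  using smooth_add[of f "\<lambda>x. - g x"] smooth_minus[of g] by simp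

lemma smooth_of_real: "smooth f \<Longrightarrow> smooth (\<lambda>x. complex_of_real (f x))"
  by (rule smooth_linear_comp[OF bounded_linear_of_real])

lemma smooth_prod: "finite I \<Longrightarrow> (\<And>i. i \<in> I \<Longrightarrow> smooth (f i)) \<Longrightarrow> smooth (\<lambda>x. \<Prod>i\<in>I. f i x)"
  for f :: "'i \<Rightarrow> 'a::real_normed_vector \<Rightarrow> real"
  by (induction I rule: finite_induct) (auto intro: smooth_mult smooth_const)

lemma smooth_Pair: "smooth f \<Longrightarrow> smooth g \<Longrightarrow> smooth (\<lambda>x. (f x, g x))"
proof -
  assume f: "smooth f" and g: "smooth g"
  have "smooth (\<lambda>x. (f x, 0) + (0, g x))"
    by (intro smooth_add smooth_linear_comp[OF _ f, of "\<lambda>y. (y, 0)"] smooth_linear_comp[OF _ g, of "\<lambda>y. (0, y)"]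
        bounded_linear_Pair bounded_linear_ident bounded_linear_zero)
  then show ?thesis by simp
qed

lemma smooth_derivative:
  assumes "smooth f"
  obtains f' where "\<And>x. (f has_derivative f' x) (at x)" "\<And>v. smooth (\<lambda>x. f' x v)"
proof -
  define f' where "f' x = frechet_derivative f (at x)" for x
  have d: "(f has_derivative f' x) (at x)" for x
  proof -
    have "Ck (Suc 0) f" using assms smooth_def by blast
    then obtain g where "(f has_derivative g x) (at x)" by auto
    then show ?thesis unfolding f'_def using differentiableI frechet_derivative_works by blast
  qed
  moreover have "Ck k (\<lambda>x. f' x v)" for k v
  proof -
    have "Ck (Suc k) f" using assms smooth_def by blast
    then obtain g where g: "\<And>x. (f has_derivative g x) (at x)" "\<And>v. Ck k (\<lambda>x. g x v)" by auto
    have "g x = f' x" for x using has_derivative_unique[OF g(1) d] .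
    then show ?thesis using g(2)[of v] by simp
  qed
  ultimately show thesis using that smooth_def by blast
qed

section \<open>Comparison with iterated directional derivatives\<close>

lemma dderiv_eq:
  assumes "(f has_derivative f') (at x)" shows "dderiv v f x = f' v"
    and "((\<lambda>t. f (x + t *\<^sub>R v)) has_vector_derivative f' v) (at 0)"
proof -
  have 1: "((\<lambda>t::real. x + t *\<^sub>R v) has_derivative (\<lambda>t. t *\<^sub>R v)) (at 0)"
    by (auto intro!: derivative_eq_intros)
  have "((\<lambda>t. f (x + t *\<^sub>R v)) has_derivative (\<lambda>t. f' (t *\<^sub>R v))) (at 0)"
    by (rule has_derivative_compose[OF 1]) (use assms in simp)
  then show d: "((\<lambda>t. f (x + t *\<^sub>R v)) has_vector_derivative f' v) (at 0)"
    using linear_scale[OF has_derivative_linear[OF assms]] by (simp add: has_vector_derivative_def)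
  show "dderiv v f x = f' v" unfolding dderiv_def by (rule vector_derivative_at[OF d])
qed

lemma smooth_dderiv: assumes "smooth f" shows "smooth (dderiv v f)"
proof -
  obtain f' where f: "\<And>x. (f has_derivative f' x) (at x)" "\<And>v. smooth (\<lambda>x. f' x v)"
    using assms by (rule smooth_derivative) (rule that)
  have "dderiv v f = (\<lambda>x. f' x v)" by (rule ext) (rule dderiv_eq(1)[OF f(1)])
  then show ?thesis using f(2) by simp
qed

lemma smooth_imp_smooth_fn: assumes "smooth f" shows "smooth_fn f"
proof -
  have it: "smooth (iter_dderiv vs f)" for vs
    by (induction vs) (auto simp: assms intro: smooth_dderiv)
  show ?thesis unfolding smooth_fn_def
  proof (intro allI conjI)
    fix vs v x
    show "continuous_on UNIV (iter_dderiv vs f)" using it smooth_continuous by blast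
    obtain g where "(iter_dderiv vs f has_derivative g x) (at x)"
      using it[of vs] by (rule smooth_derivative) blast
    from dderiv_eq(2)[OF this]
    show "(\<lambda>t. iter_dderiv vs f (x + t *\<^sub>R v)) differentiable at 0"
      using differentiableI_vector by blast
  qed
qed

text \<open>Continuity of the directional derivatives along a basis gives differentiability; the
  increment is split into increments along the coordinate directions.\<close>

lemma has_derivative_partials:
  fixes f :: "'a::euclidean_space \<Rightarrow> 'b::real_normed_vector"
  assumes d: "\<And>b x. b \<in> Basis \<Longrightarrow> ((\<lambda>t. f (x + t *\<^sub>R b)) has_vector_derivative D b x) (at 0)"
    and c: "\<And>b. b \<in> Basis \<Longrightarrow> continuous_on UNIV (D b)"
  shows "(f has_derivative (\<lambda>h. \<Sum>b\<in>Basis. (h \<bullet> b) *\<^sub>R D b x)) (at x)"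
proof -
  have dt: "((\<lambda>t. f (y + t *\<^sub>R b)) has_vector_derivative D b (y + s *\<^sub>R b)) (at s)" if "b \<in> Basis" for b y s
  proof -
    have 1: "((\<lambda>t. t - s) has_vector_derivative 1) (at s)"
      by (auto intro!: derivative_eq_intros simp: has_vector_derivative_def)
    have "((\<lambda>t. f ((y + s *\<^sub>R b) + t *\<^sub>R b)) has_vector_derivative D b (y + s *\<^sub>R b)) (at (s - s))"
      using d[OF that] by simp
    from vector_diff_chain_at[OF 1 this] show ?thesis
      by (simp add: comp_def add.assoc flip: scaleR_add_left)
  qed
  have key: "\<exists>\<delta>>0. \<forall>h. norm h < \<delta> \<longrightarrow>
      norm (f (x + (\<Sum>b\<in>S. (h \<bullet> b) *\<^sub>R b)) - f x - (\<Sum>b\<in>S. (h \<bullet> b) *\<^sub>R D b x)) \<le> e * real (card S) * norm h"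
    if "finite S" "S \<subseteq> Basis" "0 < e" for S and e :: real
    using that
  proof (induction S rule: finite_induct)
    case empty then show ?case by (auto intro!: exI[of _ 1])
  next
    case (insert b S)
    then obtain \<delta>1 where \<delta>1: "\<delta>1 > 0" "\<And>h. norm h < \<delta>1 \<Longrightarrow>
      norm (f (x + (\<Sum>b\<in>S. (h \<bullet> b) *\<^sub>R b)) - f x - (\<Sum>b\<in>S. (h \<bullet> b) *\<^sub>R D b x)) \<le> e * real (card S) * norm h"
      by auto
    have "isCont (D b) x" using c insert.prems by (simp add: continuous_on_eq_continuous_at)
    then obtain \<delta>2 where \<delta>2: "\<delta>2 > 0" "\<And>y. norm (y - x) < \<delta>2 \<Longrightarrow> norm (D b y - D b x) < e"
      using \<open>0 < e\<close> unfolding continuous_at_eps_delta dist_norm by blast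
    define \<delta> where "\<delta> = min \<delta>1 (\<delta>2 / (real (card (insert b S)) + 1))"
    have "\<delta> > 0" using \<delta>1 \<delta>2 by (simp add: \<delta>_def)
    show ?case
    proof (intro exI[of _ \<delta>] conjI allI impI \<open>\<delta> > 0\<close>)
      fix h :: 'a assume h: "norm h < \<delta>"
      let ?y = "x + (\<Sum>b\<in>S. (h \<bullet> b) *\<^sub>R b)"
      have hb: "\<bar>h \<bullet> c\<bar> \<le> norm h" if "c \<in> Basis" for c using that by (rule Basis_le_norm)
      have near: "norm (?y + t *\<^sub>R b - x) < \<delta>2" if "\<bar>t\<bar> \<le> norm h" for t
      proof -
        have "norm (?y + t *\<^sub>R b - x) \<le> norm (\<Sum>b\<in>S. (h \<bullet> b) *\<^sub>R b) + norm (t *\<^sub>R b)"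
          using norm_triangle_ineq[of "(\<Sum>b\<in>S. (h \<bullet> b) *\<^sub>R b)" "t *\<^sub>R b"] by (simp add: algebra_simps)
        also have "norm (\<Sum>b\<in>S. (h \<bullet> b) *\<^sub>R b) \<le> (\<Sum>b\<in>S. norm h)"
          by (rule sum_norm_le) (use insert.prems hb in auto)
        also have "norm (t *\<^sub>R b) \<le> norm h" using that insert.prems by simp
        also have "(\<Sum>b\<in>S. norm h) + norm h = norm h * real (card (insert b S))"
          using insert.hyps by (simp add: algebra_simps)
        also have "\<dots> \<le> norm h * (real (card (insert b S)) + 1)" by (simp add: mult_left_mono)
        also have "\<dots> < \<delta>2" using h by (simp add: \<delta>_def field_simps)
        finally show ?thesis by simp
      qed
      let ?g = "\<lambda>t. f (?y + t *\<^sub>R b) - t *\<^sub>R D b x"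
      have "norm (?g (h \<bullet> b) - ?g 0) \<le> e * norm (h \<bullet> b - 0)"
      proof (rule differentiable_bound[of "closed_segment 0 (h \<bullet> b)"])
        fix t assume t: "t \<in> closed_segment 0 (h \<bullet> b)"
        then have tn: "\<bar>t\<bar> \<le> norm h"
          using hb[of b] insert.prems by (auto simp: closed_segment_eq_real_ivl split: if_splits)
        have "(?g has_vector_derivative D b (?y + t *\<^sub>R b) - D b x) (at t)"
          using insert.prems by (intro has_vector_derivative_diff dt) (auto intro!: derivative_eq_intros simp: has_vector_derivative_def)
        then show "(?g has_derivative (\<lambda>s. s *\<^sub>R (D b (?y + t *\<^sub>R b) - D b x))) (at t within closed_segment 0 (h \<bullet> b))"
          by (simp add: has_vector_derivative_def has_derivative_at_withinI)
        show "onorm (\<lambda>s. s *\<^sub>R (D b (?y + t *\<^sub>R b) - D b x)) \<le> e"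
          using \<delta>2(2)[OF near[OF tn]]
          by (intro onorm_le) (simp add: mult.commute[of e] mult_left_mono)
      qed auto
      also have "\<dots> \<le> e * norm h" using hb[of b] insert.prems by (auto intro!: mult_left_mono)
      finally have 1: "norm (f (?y + (h \<bullet> b) *\<^sub>R b) - f ?y - (h \<bullet> b) *\<^sub>R D b x) \<le> e * norm h"
        by (simp add: algebra_simps)
      have 2: "norm (f ?y - f x - (\<Sum>b\<in>S. (h \<bullet> b) *\<^sub>R D b x)) \<le> e * real (card S) * norm h"
        using \<delta>1(2)[of h] h by (simp add: \<delta>_def)
      have "norm (f (x + (\<Sum>b\<in>insert b S. (h \<bullet> b) *\<^sub>R b)) - f x - (\<Sum>b\<in>insert b S. (h \<bullet> b) *\<^sub>R D b x))
         = norm ((f (?y + (h \<bullet> b) *\<^sub>R b) - f ?y - (h \<bullet> b) *\<^sub>R D b x) + (f ?y - f x - (\<Sum>b\<in>S. (h \<bullet> b) *\<^sub>R D b x)))"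
        using insert.hyps by (simp add: algebra_simps)
      also have "\<dots> \<le> e * norm h + e * real (card S) * norm h"
        using 1 2 norm_triangle_mono by blast
      also have "\<dots> = e * real (card (insert b S)) * norm h" using insert.hyps by (simp add: algebra_simps)
      finally show "norm (f (x + (\<Sum>b\<in>insert b S. (h \<bullet> b) *\<^sub>R b)) - f x - (\<Sum>b\<in>insert b S. (h \<bullet> b) *\<^sub>R D b x))
         \<le> e * real (card (insert b S)) * norm h" .
    qed
  qed
  show ?thesis unfolding has_derivative_at_alt
  proof (intro conjI allI impI)
    show "bounded_linear (\<lambda>h. \<Sum>b\<in>Basis. (h \<bullet> b) *\<^sub>R D b x)"
      by (intro bounded_linear_sum bounded_linear_scaleR_const bounded_linear_inner_left)
    fix e :: real assume "0 < e"
    then have "0 < e / real (DIM('a))" by simp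
    from key[OF finite_Basis subset_refl this] obtain \<delta> where "\<delta> > 0" and *: "\<And>h. norm h < \<delta> \<Longrightarrow>
      norm (f (x + (\<Sum>b\<in>Basis. (h \<bullet> b) *\<^sub>R b)) - f x - (\<Sum>b\<in>Basis. (h \<bullet> b) *\<^sub>R D b x))
        \<le> e / real DIM('a) * real DIM('a) * norm h" by blast
    show "\<exists>\<delta>>0. \<forall>y. norm (y - x) < \<delta> \<longrightarrow>
        norm (f y - f x - (\<Sum>b\<in>Basis. ((y - x) \<bullet> b) *\<^sub>R D b x)) \<le> e * norm (y - x)"
    proof (intro exI[of _ \<delta>] conjI allI impI \<open>\<delta> > 0\<close>)
      fix y assume "norm (y - x) < \<delta>"
      from *[OF this] show "norm (f y - f x - (\<Sum>b\<in>Basis. ((y - x) \<bullet> b) *\<^sub>R D b x)) \<le> e * norm (y - x)"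
        by (simp add: euclidean_representation)
    qed
  qed
qed

lemma smooth_fn_dderiv: "smooth_fn f \<Longrightarrow> smooth_fn (dderiv v f)"
  unfolding smooth_fn_def
proof (intro allI)
  fix vs
  assume *: "\<forall>vs. continuous_on UNIV (iter_dderiv vs f) \<and> (\<forall>v x. (\<lambda>t. iter_dderiv vs f (x + t *\<^sub>R v)) differentiable at 0)"
  have "iter_dderiv vs (dderiv v f) = iter_dderiv (vs @ [v]) f" by (induction vs) auto
  then show "continuous_on UNIV (iter_dderiv vs (dderiv v f)) \<and>
     (\<forall>v' x. (\<lambda>t. iter_dderiv vs (dderiv v f) (x + t *\<^sub>R v')) differentiable at 0)"
    using * by metis
qed

lemma smooth_fn_imp_smooth:
  fixes f :: "'a::euclidean_space \<Rightarrow> 'b::real_normed_vector"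
  assumes "smooth_fn f" shows "smooth f"
proof -
  have "Ck k f" for k using assms
  proof (induction k arbitrary: f)
    case 0 then have "continuous_on UNIV (iter_dderiv [] f)" unfolding smooth_fn_def by blast
    then show ?case by simp
  next
    case (Suc k)
    have "((\<lambda>t. f (x + t *\<^sub>R b)) has_vector_derivative dderiv b f x) (at 0)" for b x
    proof -
      have "(\<lambda>t. iter_dderiv [] f (x + t *\<^sub>R b)) differentiable at 0"
        using Suc.prems unfolding smooth_fn_def by blast
      then show ?thesis by (simp add: dderiv_def vector_derivative_works)
    qed
    moreover have "continuous_on UNIV (dderiv b f)" for b
    proof -
      have "continuous_on UNIV (iter_dderiv [b] f)" using Suc.prems unfolding smooth_fn_def by blast
      then show ?thesis by simp
    qed
    ultimately have d: "(f has_derivative (\<lambda>h. \<Sum>b\<in>Basis. (h \<bullet> b) *\<^sub>R dderiv b f x)) (at x)" for x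
      by (intro has_derivative_partials) auto
    show ?case
      by (rule Ck_SucI[OF d], intro Ck_sum Ck_bilinear[OF bounded_bilinear_scaleR] Ck_const Suc.IH smooth_fn_dderiv Suc.prems)
  qed
  then show ?thesis by (simp add: smooth_def)
qed

lemma smooth_fn_iff: "smooth_fn f \<longleftrightarrow> smooth f" for f :: "'a::euclidean_space \<Rightarrow> 'b::real_normed_vector"
  using smooth_fn_imp_smooth smooth_imp_smooth_fn by blast

section \<open>Bump functions\<close>

text \<open>The family exp(-1/t) t^-n is closed under differentiation up to linear combinations, so
  smoothness of all members follows from one induction on the order.\<close>

definition expinv :: "nat \<Rightarrow> real \<Rightarrow> real" where
  "expinv n t = (if t \<le> 0 then 0 else exp (- inverse t) * inverse t ^ n)"

lemma expinv_tendsto_0: "(expinv n \<longlongrightarrow> 0) (at 0)"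
proof -
  have "((\<lambda>x::real. x ^ n / exp x) \<longlongrightarrow> 0) at_top" by (rule tendsto_power_div_exp_0)
  then have "((\<lambda>t::real. inverse t ^ n / exp (inverse t)) \<longlongrightarrow> 0) (at_right 0)"
    using filterlim_inverse_at_top_right by (rule filterlim_compose)
  then have 1: "(expinv n \<longlongrightarrow> 0) (at_right 0)"
    by (rule Lim_transform_eventually) (auto simp: eventually_at expinv_def exp_minus field_simps intro!: exI[of _ 1])
  have 2: "(expinv n \<longlongrightarrow> 0) (at_left 0)"
    by (rule Lim_transform_eventually[OF tendsto_const]) (auto simp: eventually_at expinv_def intro!: exI[of _ 1])
  show ?thesis using 1 2 by (rule filterlim_split_at[rotated])
qed

lemma expinv_derivative:
  "(expinv n has_real_derivative (expinv (n + 2) t - real n * expinv (n + 1) t)) (at t)"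
proof -
  consider "t < 0" | "t > 0" | "t = 0" by linarith
  then show ?thesis
  proof cases
    case 1
    have "((\<lambda>_. 0) has_real_derivative 0) (at t)" by simp
    then have "(expinv n has_real_derivative 0) (at t)"
      by (rule has_field_derivative_transform_within_open[of _ _ _ "{..<0}"]) (use 1 in \<open>auto simp: expinv_def\<close>)
    then show ?thesis using 1 by (simp add: expinv_def)
  next
    case 2
    have d1: "((\<lambda>t. exp (- inverse t)) has_real_derivative exp (- inverse t) * (inverse t)\<^sup>2) (at t)"
      using 2 by (auto intro!: derivative_eq_intros simp: power2_eq_square)
    have "((\<lambda>t. inverse t) has_real_derivative - (inverse t)\<^sup>2) (at t)"
      using 2 by (auto intro!: derivative_eq_intros simp: power2_eq_square)
    from DERIV_power[OF this, of n]
    have d2: "((\<lambda>t. inverse t ^ n) has_real_derivative real n * (- (inverse t)\<^sup>2 * inverse t ^ (n - 1))) (at t)"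
      by simp
    have "exp (- inverse t) * (inverse t)\<^sup>2 * inverse t ^ n + real n * (- (inverse t)\<^sup>2 * inverse t ^ (n - 1)) * exp (- inverse t)
       = exp (- inverse t) * inverse t ^ (n + 2) - real n * (exp (- inverse t) * inverse t ^ (n + 1))"
      by (cases n) (simp_all add: power2_eq_square algebra_simps)
    with DERIV_mult[OF d1 d2]
    have "((\<lambda>t. exp (- inverse t) * inverse t ^ n) has_real_derivative
       exp (- inverse t) * inverse t ^ (n + 2) - real n * (exp (- inverse t) * inverse t ^ (n + 1))) (at t)"
      by simp
    then have "(expinv n has_real_derivative exp (- inverse t) * inverse t ^ (n + 2) - real n * (exp (- inverse t) * inverse t ^ (n + 1))) (at t)"
      by (rule has_field_derivative_transform_within_open[of _ _ _ "{0<..}"]) (use 2 in \<open>auto simp: expinv_def\<close>)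
    then show ?thesis using 2 by (simp add: expinv_def)
  next
    case 3
    \<comment> \<open>At 0 the difference quotient is \<open>expinv (Suc n)\<close> itself, which
      tends to 0.\<close>
    have "((\<lambda>h. (expinv n (0 + h) - expinv n 0) / h) \<longlongrightarrow> 0) (at 0)"
      by (rule Lim_transform_eventually[OF expinv_tendsto_0[of "Suc n"]])
         (auto simp: eventually_at expinv_def field_simps intro!: exI[of _ 1])
    then show ?thesis using 3 by (simp add: DERIV_def expinv_def)
  qed
qed

lemma smooth_expinv: "smooth (expinv n)"
proof -
  have "Ck k (expinv n)" for k
  proof (induction k arbitrary: n)
    case 0
    have "isCont (expinv n) t" for t using DERIV_isCont[OF expinv_derivative] .
    then show ?case by (simp add: continuous_on_eq_continuous_at)
  next
    case (Suc k)
    show ?case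
    proof (rule Ck_SucI)
      show "(expinv n has_derivative (\<lambda>v. (expinv (n + 2) t - real n * expinv (n + 1) t) * v)) (at t)" for t
        using expinv_derivative[of n t] by (simp add: has_field_derivative_def)
      show "Ck k (\<lambda>t. (expinv (n + 2) t - real n * expinv (n + 1) t) * v)" for v
      proof -
        have "Ck k (\<lambda>t. v * expinv (n + 2) t + (- v * real n) * expinv (n + 1) t)"
          by (intro Ck_add Ck_linear_comp[OF bounded_linear_mult_right] Suc)
        then show ?thesis by (simp add: algebra_simps)
      qed
    qed
  qed
  then show ?thesis by (simp add: smooth_def)
qed

definition sstep :: "real \<Rightarrow> real" where
  "sstep t = expinv 0 t * inverse (expinv 0 t + expinv 0 (1 - t))"

lemma expinv0_nonneg: "0 \<le> expinv 0 t" by (simp add: expinv_def)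

lemma sstep_denom: "0 < expinv 0 t + expinv 0 (1 - t)"
  by (auto simp: expinv_def add_pos_pos)

lemma smooth_sstep: "smooth sstep"
proof -
  have 1: "smooth (\<lambda>x. expinv 0 (1 - x))"
    by (rule smooth_comp[OF smooth_expinv]) (intro smooth_diff smooth_const smooth_ident)
  have 2: "expinv 0 x + expinv 0 (1 - x) \<noteq> 0" for x using sstep_denom[of x] by simp
  show ?thesis
    unfolding sstep_def[abs_def] by (rule smooth_mult[OF smooth_expinv smooth_inverse[OF 2 smooth_add[OF smooth_expinv 1]]])
qed

lemma sstep_0: "t \<le> 0 \<Longrightarrow> sstep t = 0" by (simp add: sstep_def expinv_def)
lemma sstep_1: "1 \<le> t \<Longrightarrow> sstep t = 1"
  using sstep_denom[of t] by (simp add: sstep_def expinv_def)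

lemma sstep_bounds: "0 \<le> sstep t" "sstep t \<le> 1"
  using sstep_denom[of t] expinv0_nonneg[of t] expinv0_nonneg[of "1 - t"]
  by (auto simp: sstep_def field_simps)

section \<open>Test functions\<close>

lemma test_fn_iff: "test_fn f \<longleftrightarrow> smooth f \<and> bounded {x. f x \<noteq> 0}"
  by (simp add: test_fn_def smooth_fn_iff compact_closure)

lemma test_fn_smooth: "test_fn f \<Longrightarrow> smooth f" by (simp add: test_fn_iff)

lemma test_fnI: "smooth f \<Longrightarrow> bounded B \<Longrightarrow> (\<And>x. x \<notin> B \<Longrightarrow> f x = 0) \<Longrightarrow> test_fn f"
  unfolding test_fn_iff by (auto intro: bounded_subset)

lemma test_fn_add: "test_fn f \<Longrightarrow> test_fn g \<Longrightarrow> test_fn (\<lambda>x. f x + g x)"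
  unfolding test_fn_iff
  by (auto intro: smooth_add bounded_subset[of "{x. f x \<noteq> 0} \<union> {x. g x \<noteq> 0}"])

lemma test_fn_smooth_mult: "smooth g \<Longrightarrow> test_fn f \<Longrightarrow> test_fn (\<lambda>x. g x * f x)"
  unfolding test_fn_iff
  by (auto intro: smooth_mult bounded_subset[of "{x. f x \<noteq> 0}"])

lemma test_fn_diff: "test_fn f \<Longrightarrow> test_fn g \<Longrightarrow> test_fn (\<lambda>x. f x - g x)"
  using test_fn_add[of f "\<lambda>x. (-1) * g x"] test_fn_smooth_mult[OF smooth_const, of g "-1"] by simp

lemma test_fn_zero: "test_fn (\<lambda>x. 0)" by (simp add: test_fn_iff smooth_const)

lemma test_fn_sum: "(\<And>i. i \<in> I \<Longrightarrow> test_fn (f i)) \<Longrightarrow> test_fn (\<lambda>x. \<Sum>i\<in>I. f i x)"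
  by (induction I rule: infinite_finite_induct) (auto intro: test_fn_add test_fn_zero)

lemma bounded_support_bound:
  fixes f :: "'a::euclidean_space \<Rightarrow> 'b::real_normed_vector"
  assumes "continuous_on UNIV f" "bounded {x. f x \<noteq> 0}"
  obtains C where "0 \<le> C" "\<And>x. norm (f x) \<le> C"
proof -
  let ?S = "closure {x. f x \<noteq> 0}"
  have "compact ?S" using assms(2) by (simp add: compact_closure)
  then have "compact (f ` ?S)" using assms(1) by (intro compact_continuous_image) (auto intro: continuous_on_subset)
  then obtain C where "0 < C" and C: "\<And>y. y \<in> f ` ?S \<Longrightarrow> norm y \<le> C"
    using compact_imp_bounded bounded_pos by metis
  have "norm (f x) \<le> C" for x
    using C[of "f x"] closure_subset[of "{x. f x \<noteq> 0}"] \<open>0 < C\<close> by (cases "f x = 0") auto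
  then show thesis using that[of C] \<open>0 < C\<close> by auto
qed

lemma test_fn_bounded:
  assumes "test_fn f" obtains C where "0 \<le> C" "\<And>x. cmod (f x) \<le> C"
  using bounded_support_bound[of f, OF smooth_continuous] assms that unfolding test_fn_iff by blast

lemma bounded_support_integrable:
  fixes f :: "'a::euclidean_space \<Rightarrow> 'b::euclidean_space"
  assumes f: "f \<in> borel_measurable borel" and B: "bounded B" "\<And>x. x \<notin> B \<Longrightarrow> f x = 0"
    and C: "\<And>x. norm (f x) \<le> C"
  shows "integrable lborel f"
proof -
  obtain R where R: "B \<subseteq> cball 0 R" using B(1) by (auto simp: bounded_iff subset_eq)
  have "integrable lborel (\<lambda>x. indicator (cball (0::'a) R) x *\<^sub>R C)"
    using emeasure_bounded_finite[of "cball 0 R :: 'a set"]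
    by (intro integrable_scaleR_left integrable_real_indicator) auto
  then show ?thesis
  proof (rule Bochner_Integration.integrable_bound)
    show "AE x in lborel. norm (f x) \<le> norm (indicator (cball 0 R) x *\<^sub>R C)"
    proof (rule AE_I2)
      fix x show "norm (f x) \<le> norm (indicator (cball 0 R) x *\<^sub>R C)"
        using B(2)[of x] C[of x] R by (cases "x \<in> B") (auto simp: indicator_def)
    qed
  qed (use f in simp)
qed

lemma test_fn_integrable: assumes "test_fn f" shows "integrable lborel f"
proof -
  obtain C where "\<And>x. cmod (f x) \<le> C" using test_fn_bounded[OF assms] by blast
  then show ?thesis
    by (rule bounded_support_integrable[of f "{x. f x \<noteq> 0}" C, rotated 3])
       (use assms smooth_continuous[of f] borel_measurable_continuous_onI[of f] in \<open>simp_all add: test_fn_iff\<close>)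
qed

section \<open>Measurability and differentiation under the integral\<close>

lemma continuous_borel: "continuous_on UNIV f \<Longrightarrow> f \<in> borel_measurable borel"
  by (rule borel_measurable_continuous_onI)

lemma smooth_borel: "smooth f \<Longrightarrow> f \<in> borel_measurable borel"
  by (intro continuous_borel smooth_continuous)

lemma has_vector_derivative_iff_quotient:
  "(f has_vector_derivative D) (at 0) \<longleftrightarrow> ((\<lambda>h. (f h - f 0) /\<^sub>R h) \<longlongrightarrow> D) (at 0)"
proof -
  have "(f has_vector_derivative D) (at 0) \<longleftrightarrow> ((\<lambda>h. norm (f h - f 0 - h *\<^sub>R D) / norm h) \<longlongrightarrow> 0) (at 0)"
    by (simp add: has_vector_derivative_def has_derivative_iff_norm bounded_linear_scaleR_left)
  also have "\<dots> \<longleftrightarrow> ((\<lambda>h. norm ((f h - f 0) /\<^sub>R h - D)) \<longlongrightarrow> 0) (at 0)"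
  proof (rule tendsto_cong)
    have "norm (f h - f 0 - h *\<^sub>R D) / norm h = norm ((f h - f 0) /\<^sub>R h - D)" if "h \<noteq> 0" for h
    proof -
      have "(f h - f 0) /\<^sub>R h - D = (f h - f 0 - h *\<^sub>R D) /\<^sub>R h" using that by (simp add: algebra_simps)
      then show ?thesis by (simp add: divide_inverse mult.commute)
    qed
    then show "\<forall>\<^sub>F h in at 0. norm (f h - f 0 - h *\<^sub>R D) / norm h = norm ((f h - f 0) /\<^sub>R h - D)"
      by (auto simp: eventually_at intro!: exI[of _ 1])
  qed
  also have "\<dots> \<longleftrightarrow> ((\<lambda>h. (f h - f 0) /\<^sub>R h) \<longlongrightarrow> D) (at 0)"
    by (simp add: tendsto_norm_zero_iff LIM_zero_iff)
  finally show ?thesis .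
qed

lemma integral_difference_quotient:
  fixes F :: "real \<Rightarrow> 'a::euclidean_space \<Rightarrow> 'b::euclidean_space"
  assumes F: "\<And>h. integrable lborel (F h)" and G: "G \<in> borel_measurable lborel"
    and d: "\<And>x. ((\<lambda>h. F h x) has_vector_derivative G x) (at 0)"
    and B: "bounded B" "\<And>h x. \<bar>h\<bar> \<le> 1 \<Longrightarrow> norm (F h x - F 0 x) \<le> \<bar>h\<bar> * (indicator B x * C)" and C: "0 \<le> C"
  shows "((\<lambda>h. integral\<^sup>L lborel (F h)) has_vector_derivative integral\<^sup>L lborel G) (at 0)"
proof -
  obtain R where R: "B \<subseteq> cball 0 R" using B(1) by (auto simp: bounded_iff subset_eq)
  have bnd: "integrable lborel (\<lambda>x. indicator (cball (0::'a) R) x *\<^sub>R C)"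
    using emeasure_bounded_finite[of "cball 0 R :: 'a set"]
    by (intro integrable_scaleR_left integrable_real_indicator) auto
  have "((\<lambda>h. (integral\<^sup>L lborel (F h) - integral\<^sup>L lborel (F 0)) /\<^sub>R h) \<longlongrightarrow> integral\<^sup>L lborel G) (at 0)"
    unfolding tendsto_at_iff_sequentially comp_def
  proof (intro allI impI)
    fix h :: "nat \<Rightarrow> real" assume h: "\<forall>i. h i \<in> UNIV - {0}" and h0: "h \<longlonglongrightarrow> 0"
    \<comment> \<open>The domination is available only for |h| <= 1; the finitely many larger terms
      are replaced by 1, which does not affect the limit.\<close>
    define k where "k i = (if \<bar>h i\<bar> \<le> 1 then h i else 1)" for i
    have ev: "\<forall>\<^sub>F i in sequentially. k i = h i"
    proof -
      have "\<forall>\<^sub>F i in sequentially. dist (h i) 0 < 1" using h0 tendstoD zero_less_one by blast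
      then show ?thesis by eventually_elim (simp add: k_def)
    qed
    have k0: "k \<longlonglongrightarrow> 0" using h0 by (rule Lim_transform_eventually) (use ev in \<open>auto elim: eventually_mono\<close>)
    have kn: "k i \<noteq> 0" "\<bar>k i\<bar> \<le> 1" for i using h by (auto simp: k_def)
    have "(\<lambda>i. integral\<^sup>L lborel (\<lambda>x. (F (k i) x - F 0 x) /\<^sub>R k i)) \<longlonglongrightarrow> integral\<^sup>L lborel G"
    proof (rule integral_dominated_convergence[OF G _ bnd])
      show "(\<lambda>x. (F (k i) x - F 0 x) /\<^sub>R k i) \<in> borel_measurable lborel" for i
        using F by (intro borel_measurable_scaleR borel_measurable_diff) auto
      show "AE x in lborel. (\<lambda>i. (F (k i) x - F 0 x) /\<^sub>R k i) \<longlonglongrightarrow> G x"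
      proof (rule AE_I2)
        fix x
        have "((\<lambda>h. (F h x - F 0 x) /\<^sub>R h) \<longlongrightarrow> G x) (at 0)"
          using d[of x] by (simp add: has_vector_derivative_iff_quotient)
        then show "(\<lambda>i. (F (k i) x - F 0 x) /\<^sub>R k i) \<longlonglongrightarrow> G x"
          unfolding tendsto_at_iff_sequentially comp_def using kn k0 by auto
      qed
      show "AE x in lborel. norm ((F (k i) x - F 0 x) /\<^sub>R k i) \<le> indicator (cball 0 R) x *\<^sub>R C" for i
      proof (rule AE_I2)
        fix x
        have "norm (F (k i) x - F 0 x) \<le> \<bar>k i\<bar> * (indicator B x * C)" using B(2) kn by auto
        also have "\<dots> \<le> \<bar>k i\<bar> * (indicator (cball 0 R) x * C)"
          using R C by (intro mult_left_mono mult_right_mono) (auto simp: indicator_def)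
        finally have *: "norm (F (k i) x - F 0 x) \<le> \<bar>k i\<bar> * (indicator (cball 0 R) x * C)" .
        show "norm ((F (k i) x - F 0 x) /\<^sub>R k i) \<le> indicator (cball 0 R) x *\<^sub>R C"
        proof -
          have "norm ((F (k i) x - F 0 x) /\<^sub>R k i) = norm (F (k i) x - F 0 x) / \<bar>k i\<bar>"
            by (simp only: norm_scaleR abs_inverse) (simp add: divide_inverse mult.commute)
          then show ?thesis using * kn(1)[of i] by (simp add: divide_le_eq mult.commute)
        qed
      qed
    qed
    moreover have "integral\<^sup>L lborel (\<lambda>x. (F (k i) x - F 0 x) /\<^sub>R k i) = (integral\<^sup>L lborel (F (k i)) - integral\<^sup>L lborel (F 0)) /\<^sub>R k i" for i
      using F by (simp add: Bochner_Integration.integral_diff)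
    ultimately have "(\<lambda>i. (integral\<^sup>L lborel (F (k i)) - integral\<^sup>L lborel (F 0)) /\<^sub>R k i) \<longlonglongrightarrow> integral\<^sup>L lborel G"
      by (simp only:)
    then show "(\<lambda>i. (integral\<^sup>L lborel (F (h i)) - integral\<^sup>L lborel (F 0)) /\<^sub>R h i) \<longlonglongrightarrow> integral\<^sup>L lborel G"
      by (rule Lim_transform_eventually) (use ev in \<open>auto elim: eventually_mono\<close>)
  qed
  then show ?thesis by (simp add: has_vector_derivative_iff_quotient)
qed

lemma integral_translate:
  fixes f :: "'a::euclidean_space \<Rightarrow> 'b::euclidean_space"
  assumes f: "f \<in> borel_measurable borel"
  shows "integral\<^sup>L lborel (\<lambda>x. f (x + v)) = integral\<^sup>L lborel f"
proof -
  have "integral\<^sup>L lborel f = integral\<^sup>L (distr lborel borel ((+) v)) f" by (simp add: lborel_distr_plus)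
  also have "\<dots> = integral\<^sup>L lborel (\<lambda>x. f (v + x))"
  proof (rule integral_distr)
    show "(+) v \<in> measurable lborel borel" by simp
    show "f \<in> borel_measurable borel" by (rule f)
  qed
  finally show ?thesis by (simp add: add.commute)
qed

text \<open>Products of smooth steps approach the indicator of an open box from below, so test
  functions determine the mass of boxes, and boxes form an intersection-stable generator.\<close>

lemma measure_eqI_test_fn:
  fixes M N :: "(complex^'n) measure"
  assumes sets: "sets M = sets borel" "sets N = sets borel"
    and fin: "\<And>a b. emeasure M (box a b) < \<infinity>" "\<And>a b. emeasure N (box a b) < \<infinity>"
    and eq: "\<And>\<phi>. test_fn \<phi> \<Longrightarrow> integral\<^sup>L M \<phi> = integral\<^sup>L N \<phi>"
  shows "M = N"
proof -
  have box_eq: "emeasure M (box a b) = emeasure N (box a b)" for a b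
  proof -
    define \<phi> where "\<phi> n x = (\<Prod>e\<in>Basis. sstep (real n * (x \<bullet> e - a \<bullet> e)) * sstep (real n * (b \<bullet> e - x \<bullet> e)))" for n and x :: "complex^'n"
    have out: "\<phi> n x = 0" if xo: "x \<notin> box a b" for n x
    proof -
      obtain e where e: "e \<in> Basis" "\<not> (a \<bullet> e < x \<bullet> e \<and> x \<bullet> e < b \<bullet> e)" using xo unfolding mem_box by blast
      then have "sstep (real n * (x \<bullet> e - a \<bullet> e)) * sstep (real n * (b \<bullet> e - x \<bullet> e)) = 0"
        using sstep_0[of "real n * (x \<bullet> e - a \<bullet> e)"] sstep_0[of "real n * (b \<bullet> e - x \<bullet> e)"]
        by (auto simp: mult_nonneg_nonpos not_less)
      then show ?thesis unfolding \<phi>_def using e(1) by (intro prod_zero) auto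
    qed
    have bnd: "0 \<le> \<phi> n x" "\<phi> n x \<le> indicator (box a b) x" for n x
    proof -
      show "0 \<le> \<phi> n x" unfolding \<phi>_def by (intro prod_nonneg ballI mult_nonneg_nonneg sstep_bounds)
      have "\<phi> n x \<le> 1" unfolding \<phi>_def by (intro prod_le_1 conjI mult_nonneg_nonneg mult_le_one sstep_bounds)
      then show "\<phi> n x \<le> indicator (box a b) x" using out[of x n] by (auto simp: indicator_def)
    qed
    have sm: "smooth (\<phi> n)" for n
      unfolding \<phi>_def
      by (intro smooth_prod smooth_mult smooth_comp[OF smooth_sstep] smooth_diff smooth_const smooth_inner smooth_ident finite_Basis)
    have test: "test_fn (\<lambda>x. complex_of_real (\<phi> n x))" for n
      by (rule test_fnI[of _ "box a b"]) (auto intro!: smooth_of_real sm simp: out)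
    have lim: "(\<lambda>n. \<phi> n x) \<longlonglongrightarrow> indicator (box a b) x" for x
    proof (cases "x \<in> box a b")
      case False then show ?thesis by (simp add: out)
    next
      case True
      have "\<forall>\<^sub>F n in sequentially. 1 \<le> real n * c" if "0 < c" for c
      proof -
        obtain n0 where "1 / c < real n0" using reals_Archimedean2 by blast
        then show ?thesis using that by (intro eventually_sequentiallyI[of n0]) (auto simp: field_simps intro: order_trans[of _ "c * real n0"])
      qed
      then have "\<forall>\<^sub>F n in sequentially. \<forall>e\<in>Basis. 1 \<le> real n * (x \<bullet> e - a \<bullet> e) \<and> 1 \<le> real n * (b \<bullet> e - x \<bullet> e)"
        using True by (intro eventually_ball_finite ballI eventually_conj) (auto simp: mem_box)
      then have "\<forall>\<^sub>F n in sequentially. \<phi> n x = 1"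
        by eventually_elim (auto simp: \<phi>_def sstep_1 intro!: prod.neutral)
      then show ?thesis using True by (simp add: tendsto_eventually)
    qed
    have conv: "(\<lambda>n. integral\<^sup>L L (\<phi> n)) \<longlonglongrightarrow> measure L (box a b)"
      if L: "sets L = sets borel" "emeasure L (box a b) < \<infinity>" for L :: "(complex^'n) measure"
    proof -
      have ii: "integrable L (indicator (box a b) :: _ \<Rightarrow> real)"
        by (rule integrable_real_indicator) (use L in auto)
      have "(\<lambda>n. integral\<^sup>L L (\<phi> n)) \<longlonglongrightarrow> integral\<^sup>L L (indicator (box a b))"
      proof (rule integral_dominated_convergence[OF _ _ ii])
        show "(indicator (box a b) :: _ \<Rightarrow> real) \<in> borel_measurable L" using ii by auto
        show "\<phi> n \<in> borel_measurable L" for n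
          using smooth_borel[OF sm] L(1) by (simp cong: measurable_cong_sets)
      qed (use lim bnd in auto)
      then show ?thesis using L by (simp add: sets_eq_imp_space_eq[OF L(1)])
    qed
    have "integral\<^sup>L M (\<phi> n) = integral\<^sup>L N (\<phi> n)" for n
      using eq[OF test[of n]] by simp
    then have "measure M (box a b) = measure N (box a b)"
      using conv[OF sets(1) fin(1)] conv[OF sets(2) fin(2)] LIMSEQ_unique by simp
    then show ?thesis using fin[of a b] by (simp add: emeasure_eq_ennreal_measure less_top[symmetric])
  qed
  show ?thesis
  proof (rule measure_eqI_generator_eq[where E="range (\<lambda>(a, b). box a b)" and \<Omega>=UNIV and A="\<lambda>n. box (- (real n *\<^sub>R One)) (real n *\<^sub>R One)"])
    show "Int_stable (range (\<lambda>(a, b). box a b :: (complex^'n) set))"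
      by (auto simp: Int_stable_def box_Int_box)
    have "sets borel = sigma_sets UNIV (range (\<lambda>(a, b). box a b :: (complex^'n) set))"
      by (subst borel_eq_box) (simp add: sets_measure_of)
    then show "sets M = sigma_sets UNIV (range (\<lambda>(a, b). box a b))" "sets N = sigma_sets UNIV (range (\<lambda>(a, b). box a b))"
      using sets by auto
    show "(\<Union>i. box (- (real i *\<^sub>R One)) (real i *\<^sub>R One)) = (UNIV :: (complex^'n) set)" by (rule UN_box_eq_UNIV)
    show "emeasure M (box (- (real i *\<^sub>R One)) (real i *\<^sub>R One)) \<noteq> \<infinity>" for i
      using fin(1) by (simp add: less_top[symmetric])
  qed (use box_eq in auto)
qed

lemma continuous_AE_eq:
  fixes f g :: "'a::euclidean_space \<Rightarrow> 'b::{real_normed_vector, second_countable_topology}"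
  assumes "continuous_on UNIV f" "continuous_on UNIV g" and ae: "AE x in lborel. f x = g x"
  shows "f x = g x"
proof (rule ccontr)
  assume ne: "f x \<noteq> g x"
  let ?S = "{x. f x \<noteq> g x}"
  have op: "open ?S" using open_Collect_neq[OF assms(1,2)] .
  obtain N where N: "{x \<in> space lborel. \<not> f x = g x} \<subseteq> N" "emeasure lborel N = 0" "N \<in> sets lborel"
    using AE_E[OF ae] by blast
  then have "emeasure lborel ?S = 0" using emeasure_mono[of ?S N lborel] by auto
  moreover obtain a b where ab: "x \<in> box a b" "box a b \<subseteq> ?S"
  proof -
    obtain e where "0 < e" "ball x e \<subseteq> ?S" using op ne openE by blast
    then show thesis using rational_boxes[of e x] that by blast
  qed
  ultimately have "emeasure lborel (box a b) = 0"
    using emeasure_mono[OF ab(2), of lborel] op by auto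
  moreover have "0 < emeasure lborel (box a b)"
  proof -
    have lt: "a \<bullet> i < b \<bullet> i" if "i \<in> Basis" for i using ab(1) that by (auto simp: mem_box dest: less_trans)
    then have "0 < (\<Prod>i\<in>Basis. (b - a) \<bullet> i)" by (intro prod_pos) (auto simp: inner_diff_left)
    then show ?thesis using lt by (subst emeasure_lborel_box) (auto intro: less_imp_le)
  qed
  ultimately show False by simp
qed

section \<open>Left-invariant vector fields and Lebesgue measure\<close>

lemma subspace_vector_derivative:
  fixes S :: "'a::euclidean_space set"
  assumes "subspace S" "\<And>h. g h - g 0 \<in> S" "(g has_vector_derivative D) (at 0)"
  shows "D \<in> S"
proof (rule Lim_in_closed_set[OF closed_subspace[OF assms(1)]])
  show "((\<lambda>h. (g h - g 0) /\<^sub>R h) \<longlongrightarrow> D) (at 0)"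
    using assms(3) by (simp add: has_vector_derivative_iff_quotient)
  show "\<forall>\<^sub>F h in at 0. (g h - g 0) /\<^sub>R h \<in> S"
    using assms by (auto intro!: always_eventually subspace_scale)
qed simp

text \<open>This is tr(AB) = tr(BA), the trace being the sum of the diagonal matrix entries.\<close>

lemma sum_Basis_inner_commute:
  fixes A B :: "'a::euclidean_space \<Rightarrow> 'a"
  assumes "linear A" "linear B"
  shows "(\<Sum>b\<in>Basis. A (B b) \<bullet> b) = (\<Sum>b\<in>Basis. B (A b) \<bullet> b)"
proof -
  have e: "F (G b) \<bullet> b = (\<Sum>c\<in>Basis. (G b \<bullet> c) * (F c \<bullet> b))" if F: "linear F" for F G :: "'a \<Rightarrow> 'a" and b
  proof -
    have "F (G b) = F (\<Sum>c\<in>Basis. (G b \<bullet> c) *\<^sub>R c)" by (simp add: euclidean_representation)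
    then show ?thesis by (simp add: linear_sum[OF F] linear_scale[OF F] inner_sum_left)
  qed
  show ?thesis
    unfolding e[OF assms(1), of B] e[OF assms(2), of A] by (subst sum.swap) (simp add: mult.commute)
qed

lemma test_fn_dderiv: assumes "test_fn f" shows "test_fn (dderiv v f)"
proof (rule test_fnI[of _ "closure {x. f x \<noteq> 0}"])
  show "smooth (dderiv v f)" using assms by (simp add: test_fn_iff smooth_dderiv)
  show "bounded (closure {x. f x \<noteq> 0})" using assms by (simp add: test_fn_iff bounded_closure)
  fix x assume x: "x \<notin> closure {x. f x \<noteq> 0}"
  have "((\<lambda>x. 0) has_derivative (\<lambda>v. 0)) (at x)" by simp
  then have "(f has_derivative (\<lambda>v. 0)) (at x)"
    by (rule has_derivative_transform_within_open[of _ _ _ _ "- closure {x. f x \<noteq> 0}"])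
       (use x closure_subset[of "{x. f x \<noteq> 0}"] in auto)
  then show "dderiv v f x = 0" by (rule dderiv_eq(1))
qed

text \<open>The integral of a translate does not depend on the translation; its derivative at 0,
  taken under the integral, is the claim.\<close>

lemma integral_dderiv_0: assumes f: "test_fn f" shows "integral\<^sup>L lborel (dderiv v f) = 0"
proof -
  obtain f' where f': "\<And>x. (f has_derivative f' x) (at x)"
    using test_fn_smooth[OF f] by (rule smooth_derivative) blast
  have dd: "dderiv v f x = f' x v" for x by (rule dderiv_eq(1)[OF f'])
  obtain C where C: "0 \<le> C" "\<And>x. cmod (dderiv v f x) \<le> C"
    using test_fn_bounded[OF test_fn_dderiv[OF f]] by blast
  have bl: "f \<in> borel_measurable borel" using smooth_borel[OF test_fn_smooth[OF f]] .
  have ii: "integrable lborel (\<lambda>x. f (x + h *\<^sub>R v))" for h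
  proof -
    have "integrable (distr lborel borel ((+) (h *\<^sub>R v))) f"
      using test_fn_integrable[OF f] by (simp add: lborel_distr_plus)
    then show ?thesis by (subst (asm) integrable_distr_eq) (auto simp: bl add.commute)
  qed
  obtain R where R: "\<And>x. f x \<noteq> 0 \<Longrightarrow> norm x \<le> R"
    using f unfolding test_fn_iff bounded_iff by auto
  let ?B = "cball (0::complex^'a) (R + norm v)"
  have "((\<lambda>h. integral\<^sup>L lborel (\<lambda>x. f (x + h *\<^sub>R v))) has_vector_derivative integral\<^sup>L lborel (dderiv v f)) (at 0)"
  proof (rule integral_difference_quotient[OF ii, where B="?B" and C=C])
    show "dderiv v f \<in> borel_measurable lborel"
      using smooth_borel[OF smooth_dderiv[OF test_fn_smooth[OF f]]] by simp
    show "((\<lambda>h. f (x + h *\<^sub>R v)) has_vector_derivative dderiv v f x) (at 0)" for x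
      using dderiv_eq(2)[OF f'] dd by simp
    fix h :: real and x assume h: "\<bar>h\<bar> \<le> 1"
    show "norm (f (x + h *\<^sub>R v) - f (x + 0 *\<^sub>R v)) \<le> \<bar>h\<bar> * (indicator ?B x * C)"
    proof (cases "x \<in> ?B")
      case True
      have "norm (f (x + h *\<^sub>R v) - f (x + 0 *\<^sub>R v)) \<le> C * norm (h - 0)"
      proof (rule differentiable_bound[of UNIV "\<lambda>t. f (x + t *\<^sub>R v)" "\<lambda>t s. s *\<^sub>R f' (x + t *\<^sub>R v) v"])
        fix t :: real
        have 1: "((\<lambda>t::real. x + t *\<^sub>R v) has_derivative (\<lambda>s. s *\<^sub>R v)) (at t)"
          by (auto intro!: derivative_eq_intros)
        show "((\<lambda>t. f (x + t *\<^sub>R v)) has_derivative (\<lambda>s. s *\<^sub>R f' (x + t *\<^sub>R v) v)) (at t within UNIV)"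
          using has_derivative_compose[OF 1 f'] linear_scale[OF has_derivative_linear[OF f']] by simp
        show "onorm (\<lambda>s. s *\<^sub>R f' (x + t *\<^sub>R v) v) \<le> C"
          using C(2)[of "x + t *\<^sub>R v"] by (intro onorm_le) (simp add: dd mult.commute[of C] mult_left_mono)
      qed auto
      then show ?thesis using True by (simp add: mult.commute)
    next
      case False
      have "norm (h *\<^sub>R v) \<le> norm v" using h mult_right_mono[of "\<bar>h\<bar>" 1 "norm v"] by simp
      then have "f (x + h *\<^sub>R v) = 0"
        using False R[of "x + h *\<^sub>R v"] norm_triangle_ineq4[of "x + h *\<^sub>R v" "h *\<^sub>R v"] by force
      moreover have "f x = 0" using False R[of x] norm_ge_zero[of v] by force
      ultimately show ?thesis using C(1) by simp
    qed
  qed (use C in auto)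
  moreover have "integral\<^sup>L lborel (\<lambda>x. f (x + h *\<^sub>R v)) = integral\<^sup>L lborel f" for h
    by (rule integral_translate[OF bl])
  ultimately have "((\<lambda>h::real. integral\<^sup>L lborel f) has_vector_derivative integral\<^sup>L lborel (dderiv v f)) (at 0)" by simp
  then show ?thesis using vector_derivative_unique_at[OF has_vector_derivative_const] by metis
qed

context stratified_lie
begin

text \<open>Turns a word in the values of two functions into a word of functions, so that regularity
  can be proved by induction over the list. It serves smoothness here and complex differentiability
  in \<open>vel_cscale\<close>.\<close>

lemma dynkin_word_fun: "dynkin_word (f z) (g z) rs = map (\<lambda>h. h z) (dynkin_word f g rs)"
  by (induction rs) (auto simp: dynkin_word_def)

lemma smooth_nbr: "(\<And>f. f \<in> set fs \<Longrightarrow> smooth f) \<Longrightarrow> smooth (\<lambda>z. nbr br (map (\<lambda>h. h z) fs))"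
proof (induction fs rule: induct_list012)
  case (3 f g fs)
  then have "smooth (\<lambda>z. nbr br (map (\<lambda>h. h z) (g # fs)))" "smooth f" by auto
  from smooth_bilinear[OF bounded_bilinear_br this(2,1)] show ?case by simp
qed (auto intro: smooth_const)

lemma set_dynkin_word: "set (dynkin_word x y rs) \<subseteq> {x, y}"
proof (induction rs)
  case (Cons p rs)
  have "set (replicate (fst p) x) \<subseteq> {x, y}" "set (replicate (snd p) y) \<subseteq> {x, y}"
    by (simp_all add: set_replicate_conv_if)
  then show ?case using Cons by (simp add: dynkin_word_Cons)
qed (simp add: dynkin_word_def)

lemma smooth_mul: assumes "smooth f" "smooth g" shows "smooth (\<lambda>z. f z \<odot> g z)"
  unfolding bch_def
proof (intro smooth_sum smooth_scaleR smooth_const)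
  fix rs show "smooth (\<lambda>z. nbr br (dynkin_word (f z) (g z) rs))"
    unfolding dynkin_word_fun by (rule smooth_nbr) (use assms set_dynkin_word[of f g rs] in auto)
qed

lemma continuous_mul: "continuous_on UNIV f \<Longrightarrow> continuous_on UNIV g \<Longrightarrow> continuous_on UNIV (\<lambda>z. f z \<odot> g z)"
  for f g :: "'z::topological_space \<Rightarrow> _"
proof -
  have "smooth (\<lambda>z. fst z \<odot> snd z)"
    by (intro smooth_mul smooth_bounded_linear bounded_linear_fst bounded_linear_snd)
  then have "continuous_on UNIV (\<lambda>z. fst z \<odot> snd z)" by (rule smooth_continuous)
  moreover assume "continuous_on UNIV f" "continuous_on UNIV g"
  ultimately show ?thesis
    using continuous_on_compose2[of UNIV "\<lambda>z. fst z \<odot> snd z" UNIV "\<lambda>z. (f z, g z)"]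
    by (simp add: continuous_on_Pair)
qed

text \<open>The value at x of the left-invariant field that equals v at the identity, that is, the
  differential at 0 of left translation by x applied to v.\<close>

definition vel :: "complex^'n \<Rightarrow> complex^'n \<Rightarrow> complex^'n" where
  "vel x v = vector_derivative (\<lambda>t. x \<odot> (t *\<^sub>R v)) (at 0)"

lemma vel_props:
  obtains P' where "\<And>x. ((\<lambda>y. x \<odot> y) has_derivative P' x) (at 0)" "\<And>x v. vel x v = P' x v"
    "\<And>v. smooth (\<lambda>x. P' x v)"
proof -
  let ?P = "\<lambda>z. fst z \<odot> snd z"
  have "smooth ?P" by (intro smooth_mul smooth_bounded_linear bounded_linear_fst bounded_linear_snd)
  then obtain Q where Q: "\<And>z. (?P has_derivative Q z) (at z)" "\<And>v. smooth (\<lambda>z. Q z v)"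
    by (rule smooth_derivative) (rule that)
  have d: "((\<lambda>y. x \<odot> y) has_derivative (\<lambda>v. Q (x, 0) (0, v))) (at 0)" for x
  proof -
    have "((\<lambda>y. (x, y)) has_derivative (\<lambda>v. (0, v))) (at 0)" by (auto intro!: derivative_eq_intros)
    from has_derivative_compose[OF this, of ?P] show ?thesis using Q(1)[of "(x, 0)"] by simp
  qed
  have "vel x v = Q (x, 0) (0, v)" for x v
    using dderiv_eq(1)[OF d[of x], of v] by (simp add: vel_def dderiv_def)
  moreover have "smooth (\<lambda>x. Q (x, 0) (0, v))" for v
    by (rule smooth_comp[OF Q(2)]) (intro smooth_Pair smooth_ident smooth_const)
  ultimately show thesis using that[of "\<lambda>x v. Q (x, 0) (0, v)"] d by blast
qed

lemma vel_has_derivative: "((\<lambda>y. x \<odot> y) has_derivative vel x) (at 0)"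
proof (rule vel_props)
  fix P' :: "complex^'n \<Rightarrow> complex^'n \<Rightarrow> complex^'n"
  assume d: "\<And>x. ((\<lambda>y. x \<odot> y) has_derivative P' x) (at 0)" and e: "\<And>x v. vel x v = P' x v"
  have "vel x = P' x" using e by auto
  then show ?thesis using d[of x] by simp
qed

lemma linear_vel: "linear (vel x)"
  using vel_has_derivative by (rule has_derivative_linear)

lemma smooth_vel: "smooth (\<lambda>x. vel x v)"
  by (rule vel_props) simp

lemma vel_has_vector_derivative: "((\<lambda>t. x \<odot> (t *\<^sub>R v)) has_vector_derivative vel x v) (at 0)"
  using dderiv_eq(2)[OF vel_has_derivative[of x], of v] by simp

section \<open>Left-invariant derivatives\<close>

abbreviation lv where "lv \<equiv> lvf mul"

lemma lv_has_vector_derivative_0: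
  assumes "(f has_derivative f') (at x)"
  shows "((\<lambda>t. f (x \<odot> (t *\<^sub>R v))) has_vector_derivative f' (vel x v)) (at 0)"
  using vector_derivative_diff_chain_within[OF vel_has_vector_derivative[of x v], of f f'] assms
  by (simp add: comp_def has_derivative_at_withinI)

lemma lv_eq: "(f has_derivative f') (at x) \<Longrightarrow> lv v f x = f' (vel x v)"
  unfolding lvf_def by (rule vector_derivative_at[OF lv_has_vector_derivative_0])

lemma lv_linear: 
  assumes "(f has_derivative f') (at x)" shows "linear (\<lambda>v. lv v f x)"
  using linear_compose[OF linear_vel has_derivative_linear[OF assms]] lv_eq[OF assms] by (simp add: comp_def)

lemma smooth_has_derivative: "smooth f \<Longrightarrow> (f has_derivative (\<lambda>v. dderiv v f x)) (at x)"
proof -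
  assume "smooth f"
  then obtain f' where f': "\<And>x. (f has_derivative f' x) (at x)" by (rule smooth_derivative) blast
  have "f' x = (\<lambda>v. dderiv v f x)" using dderiv_eq(1)[OF f'] by auto
  then show ?thesis using f'[of x] by simp
qed

lemma lv_expand:
  assumes "smooth f" shows "lv v f x = (\<Sum>b\<in>Basis. (vel x v \<bullet> b) *\<^sub>R dderiv b f x)"
proof -
  note d = smooth_has_derivative[OF assms, of x]
  note l = has_derivative_linear[OF d]
  have "dderiv (vel x v) f x = dderiv (\<Sum>b\<in>Basis. (vel x v \<bullet> b) *\<^sub>R b) f x" by (simp add: euclidean_representation)
  also have "\<dots> = (\<Sum>b\<in>Basis. (vel x v \<bullet> b) *\<^sub>R dderiv b f x)"
    using linear_sum[OF l, of "\<lambda>b. (vel x v \<bullet> b) *\<^sub>R b" Basis] linear_scale[OF l] by simp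
  finally show ?thesis by (simp add: lv_eq[OF d])
qed

lemma smooth_lv: assumes "smooth f" shows "smooth (lv v f)"
proof -
  have "lv v f = (\<lambda>x. \<Sum>b\<in>Basis. (vel x v \<bullet> b) *\<^sub>R dderiv b f x)"
    using lv_expand[OF assms] by auto
  then show ?thesis
    using assms by (auto intro!: smooth_sum smooth_scaleR smooth_inner smooth_vel smooth_const smooth_dderiv)
qed

lemma test_fn_lv: assumes "test_fn f" shows "test_fn (lv v f)"
proof -
  have "lv v f = (\<lambda>x. \<Sum>b\<in>Basis. of_real (vel x v \<bullet> b) * dderiv b f x)"
    using lv_expand[OF test_fn_smooth[OF assms]] by (auto simp: scaleR_conv_of_real)
  then show ?thesis
    using assms by (auto intro!: test_fn_sum test_fn_smooth_mult smooth_of_real smooth_inner smooth_vel smooth_const test_fn_dderiv)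
qed

lemma lv_has_vector_derivative:
  assumes "smooth f"
  shows "((\<lambda>t. f (x \<odot> (t *\<^sub>R v))) has_vector_derivative lv v f (x \<odot> (t *\<^sub>R v))) (at t)"
proof -
  note d = smooth_has_derivative[OF assms, of "x \<odot> (t *\<^sub>R v)"]
  have 1: "((\<lambda>s. s - t) has_vector_derivative 1) (at t)"
    by (auto intro!: derivative_eq_intros simp: has_vector_derivative_def)
  have "((\<lambda>s. f ((x \<odot> (t *\<^sub>R v)) \<odot> (s *\<^sub>R v))) has_vector_derivative lv v f (x \<odot> (t *\<^sub>R v))) (at (t - t))"
    using lv_has_vector_derivative_0[OF d, of v] lv_eq[OF d, of v] by simp
  from vector_diff_chain_at[OF 1 this] show ?thesis
    by (simp add: comp_def mul_assoc mul_scale)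
qed

text \<open>Since x (tv) y = (x y)(y^-1 (tv) y), right translation commutes with left-invariant
  fields only up to the replacement of v by Ad(-y) v.\<close>

lemma lv_right_translate: "lv v (\<lambda>x. f (x \<odot> y)) x = lv (Adj (- y) v) f (x \<odot> y)"
proof -
  have "x \<odot> (t *\<^sub>R v) \<odot> y = x \<odot> y \<odot> (t *\<^sub>R Adj (- y) v)" for t
  proof -
    have "t *\<^sub>R Adj (- y) v = (- y) \<odot> (t *\<^sub>R v) \<odot> y"
      using mul_conj[of "- y" "t *\<^sub>R v"] linear_scale[OF linear_Adj] by simp
    then show ?thesis by (simp add: mul_assoc)
  qed
  then show ?thesis by (simp add: lvf_def)
qed

lemma lv_dil: "lv v (\<lambda>x. f (dil r x)) x = lv (dil r v) f (dil r x)"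
  by (simp add: lvf_def dil_mul linear_scale[OF linear_dil])

text \<open>Along a one-parameter subgroup the iterated field is a second derivative in one real
  variable, which exposes the effect of reversing time used in \<open>lv_lv_flip\<close>.\<close>

lemma lv_lv: "lv v (lv v f) x = vector_derivative (\<lambda>s. vector_derivative (\<lambda>t. f (x \<odot> (t *\<^sub>R v))) (at s)) (at 0)"
proof -
  have "lv v f (x \<odot> (s *\<^sub>R v)) = vector_derivative (\<lambda>t. f (x \<odot> (t *\<^sub>R v))) (at s)" for s
  proof -
    let ?q = "\<lambda>t. f (x \<odot> (t *\<^sub>R v))"
    have "(?q has_vector_derivative D) (at s) \<longleftrightarrow> ((\<lambda>t. ?q (s + t)) has_vector_derivative D) (at 0)" for D
    proof
      assume a: "(?q has_vector_derivative D) (at s)"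
      have 1: "((\<lambda>t. s + t) has_vector_derivative 1) (at 0)"
        by (auto intro!: derivative_eq_intros simp: has_vector_derivative_def)
      show "((\<lambda>t. ?q (s + t)) has_vector_derivative D) (at 0)"
        using vector_diff_chain_at[OF 1, of ?q D] a by (simp add: comp_def)
    next
      assume a: "((\<lambda>t. ?q (s + t)) has_vector_derivative D) (at 0)"
      have 1: "((\<lambda>t. t - s) has_vector_derivative 1) (at s)"
        by (auto intro!: derivative_eq_intros simp: has_vector_derivative_def)
      show "(?q has_vector_derivative D) (at s)"
        using vector_diff_chain_at[OF 1, of "\<lambda>t. ?q (s + t)" D] a by (simp add: comp_def)
    qed
    then have "vector_derivative ?q (at s) = vector_derivative (\<lambda>t. ?q (s + t)) (at 0)"
      unfolding vector_derivative_def by simp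
    then show ?thesis by (simp add: lvf_def mul_assoc mul_scale)
  qed
  then show ?thesis by (subst lvf_def) simp
qed

section \<open>The product modulo higher layers\<close>

definition words2 :: "nat \<Rightarrow> (nat \<times> nat) list set" where
  "words2 n = {rs \<in> words n. 2 \<le> wtotal rs}"

definition dcoef :: "nat \<Rightarrow> (nat \<times> nat) list \<Rightarrow> real" where
  "dcoef n rs = (-1) ^ (n - 1) / (real n * real (wtotal rs) * wfact rs)"

lemma mul_expand:
  "x \<odot> y = x + y + (\<Sum>n\<in>{1..m}. \<Sum>rs\<in>words2 n. dcoef n rs *\<^sub>R nbr br (dynkin_word x y rs))"
proof -
  let ?f = "\<lambda>n rs. dcoef n rs *\<^sub>R nbr br (dynkin_word x y rs)"
  have e: "x \<odot> y = (\<Sum>n\<in>{1..m}. \<Sum>rs\<in>words n. ?f n rs)"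
    using bch_ray[of 1 x y] by (simp add: dcoef_def)
  have n1: "(\<Sum>rs\<in>words 1. ?f 1 rs) = x + y + (\<Sum>rs\<in>words2 1. ?f 1 rs)"
  proof -
    have w: "words 1 = insert [(1,0)] (insert [(0,1)] (words2 1))"
    proof (intro equalityI subsetI)
      fix rs assume "rs \<in> words 1"
      then obtain p q where "rs = [(p,q)]" "(p, q) \<in> bidx" by (auto simp: words_def length_Suc_conv)
      then show "rs \<in> insert [(1,0)] (insert [(0,1)] (words2 1))"
        by (cases "p + q \<le> 1") (auto simp: words2_def words_def wtotal_def bidx_def)
    qed (use m_pos in \<open>auto simp: words2_def words_def bidx_def\<close>)
    have "finite (words2 1)" "[(1,0)] \<notin> words2 1" "[(0,1)] \<notin> words2 1"
      using finite_words[of 1] by (auto simp: words2_def wtotal_def)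
    then show ?thesis unfolding w
      by (simp add: dcoef_def wtotal_def wfact_def dynkin_word_def)
  qed
  have n2: "words n = words2 n" if "2 \<le> n" for n
    using words_wtotal[of _ n] that by (force simp: words2_def)
  have "(\<Sum>n\<in>{1..m}. \<Sum>rs\<in>words n. ?f n rs) = (\<Sum>rs\<in>words 1. ?f 1 rs) + (\<Sum>n\<in>{1..m}-{1}. \<Sum>rs\<in>words n. ?f n rs)"
    using m_pos by (intro sum.remove) auto
  also have "(\<Sum>n\<in>{1..m}-{1}. \<Sum>rs\<in>words n. ?f n rs) = (\<Sum>n\<in>{1..m}-{1}. \<Sum>rs\<in>words2 n. ?f n rs)"
    by (intro sum.cong refl) (simp add: n2)
  also have "(\<Sum>rs\<in>words 1. ?f 1 rs) + \<dots> = x + y + ((\<Sum>rs\<in>words2 1. ?f 1 rs) + (\<Sum>n\<in>{1..m}-{1}. \<Sum>rs\<in>words2 n. ?f n rs))"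
    unfolding n1 by (simp add: add.assoc)
  also have "(\<Sum>rs\<in>words2 1. ?f 1 rs) + (\<Sum>n\<in>{1..m}-{1}. \<Sum>rs\<in>words2 n. ?f n rs) = (\<Sum>n\<in>{1..m}. \<Sum>rs\<in>words2 n. ?f n rs)"
    using m_pos by (intro sum.remove[symmetric]) auto
  finally show ?thesis unfolding e .
qed

text \<open>All terms of the product beyond x + y are genuine brackets, hence of degree at least 2.
  This makes linear functions of the \<open>V 1\<close>-component homomorphisms.\<close>

lemma proj_one_mul: "proj 1 (x \<odot> y) = proj 1 x + proj 1 y"
proof -
  have "nbr br (dynkin_word x y rs) \<in> filt 2" if "2 \<le> wtotal rs" for rs
  proof -
    have "dynkin_word x y rs \<noteq> []" using length_dynkin_word[of x y rs] that by force
    then show ?thesis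
      using nbr_filt[of "dynkin_word x y rs"] filt_antimono[OF that] length_dynkin_word[of x y rs] by auto
  qed
  then have "(\<Sum>n\<in>{1..m}. \<Sum>rs\<in>words2 n. dcoef n rs *\<^sub>R nbr br (dynkin_word x y rs)) \<in> filt 2"
    by (intro subspace_sum[OF subspace_filt] subspace_scale[OF subspace_filt]) (auto simp: words2_def)
  then have "proj 1 (\<Sum>n\<in>{1..m}. \<Sum>rs\<in>words2 n. dcoef n rs *\<^sub>R nbr br (dynkin_word x y rs)) = 0"
    unfolding filt_def by auto
  then show ?thesis by (subst mul_expand) (simp add: proj_add)
qed

text \<open>By [a, A] - [b, B] = [a - b, A] + [b, A - B], every term contains a difference in
  \<open>filt i\<close>; as soon as there are two letters it also sits inside a bracket, which
  raises the degree by one.\<close>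

lemma nbr_diff_filt:
  "list_all2 (\<lambda>a b. a - b \<in> filt i) ws us \<Longrightarrow> 1 \<le> i \<Longrightarrow> ws \<noteq> [] \<Longrightarrow>
    nbr br ws - nbr br us \<in> filt i \<and> (2 \<le> length ws \<longrightarrow> nbr br ws - nbr br us \<in> filt (Suc i))"
proof (induction ws arbitrary: us rule: induct_list012)
  case (3 a a' ws)
  then obtain b b' us' where us: "us = b # b' # us'" and ab: "a - b \<in> filt i"
    and l: "list_all2 (\<lambda>a b. a - b \<in> filt i) (a' # ws) (b' # us')"
    by (auto simp: list_all2_Cons1)
  let ?A = "nbr br (a' # ws)" and ?B = "nbr br (b' # us')"
  have "?A - ?B \<in> filt i" using 3(2)[OF l] 3(4) by simp
  then have "br b (?A - ?B) \<in> filt (Suc i)" by (rule br_filt)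
  moreover have "br (a - b) ?A \<in> filt (Suc i)" by (rule br_filt_left[OF ab])
  moreover have "br a ?A - br b ?B = br (a - b) ?A + br b (?A - ?B)"
    by (simp add: br_diff_left br_diff_right)
  ultimately have "nbr br (a # a' # ws) - nbr br us \<in> filt (Suc i)"
    using us subspace_add[OF subspace_filt] by simp
  then show ?case using filt_antimono[of i "Suc i"] by auto
qed (auto simp: list_all2_Cons1)

text \<open>Right translation is the identity plus strictly triangular terms in the grading. This
  gives vanishing divergence of the left-invariant fields and, in degree m, the additivity of
  central elements.\<close>

lemma mul_diff_filt:
  assumes "w \<in> filt i" "1 \<le> i" shows "(x + w) \<odot> y - x \<odot> y - w \<in> filt (Suc i)"
proof -
  have l: "list_all2 (\<lambda>a b. a - b \<in> filt i) (dynkin_word (x + w) y rs) (dynkin_word x y rs)" for rs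
  proof (induction rs)
    case (Cons p rs)
    have "list_all2 (\<lambda>a b. a - b \<in> filt i) (replicate (fst p) (x + w)) (replicate (fst p) x)"
      "list_all2 (\<lambda>a b. a - b \<in> filt i) (replicate (snd p) y) (replicate (snd p) y)"
      using assms(1) subspace_0[OF subspace_filt, of i] by (auto simp: list_all2_conv_all_nth)
    then show ?case unfolding dynkin_word_Cons using Cons by (intro list_all2_appendI)
  qed (simp add: dynkin_word_def)
  have "nbr br (dynkin_word (x + w) y rs) - nbr br (dynkin_word x y rs) \<in> filt (Suc i)" if "2 \<le> wtotal rs" for rs
  proof -
    have "length (dynkin_word (x + w) y rs) = wtotal rs" by (rule length_dynkin_word)
    then show ?thesis using nbr_diff_filt[OF l assms(2), of rs] that by force
  qed
  then have "(\<Sum>n\<in>{1..m}. \<Sum>rs\<in>words2 n. dcoef n rs *\<^sub>R (nbr br (dynkin_word (x + w) y rs) - nbr br (dynkin_word x y rs))) \<in> filt (Suc i)"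
    by (intro subspace_sum[OF subspace_filt] subspace_scale[OF subspace_filt]) (auto simp: words2_def)
  moreover have "(x + w) \<odot> y - x \<odot> y - w = (\<Sum>n\<in>{1..m}. \<Sum>rs\<in>words2 n. dcoef n rs *\<^sub>R (nbr br (dynkin_word (x + w) y rs) - nbr br (dynkin_word x y rs)))"
    unfolding mul_expand[of "x + w"] mul_expand[of x] by (simp add: scaleR_diff_right sum_subtractf)
  ultimately show ?thesis by simp
qed

lemma vel_diff_filt:
  assumes "w \<in> filt i" "1 \<le> i" shows "vel (x + w) v - vel x v \<in> filt (Suc i)"
proof (rule subspace_vector_derivative[OF subspace_filt])
  let ?g = "\<lambda>t. (x + w) \<odot> (t *\<^sub>R v) - x \<odot> (t *\<^sub>R v)"
  show "(?g has_vector_derivative vel (x + w) v - vel x v) (at 0)"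
    by (intro has_vector_derivative_diff vel_has_vector_derivative)
  show "?g h - ?g 0 \<in> filt (Suc i)" for h
    using mul_diff_filt[OF assms, of x "h *\<^sub>R v"] by simp
qed

text \<open>The derivative of a left-invariant field is strictly triangular with respect to the
  grading, so the field is divergence free.\<close>

lemma trace_zero:
  assumes T: "linear T" and tri: "\<And>i v. v \<in> layer i \<Longrightarrow> 1 \<le> i \<Longrightarrow> T v \<in> filt (Suc i)"
  shows "(\<Sum>b\<in>Basis. T b \<bullet> b) = 0"
proof -
  have tz: "(\<Sum>b\<in>Basis. T (proj i b) \<bullet> b) = 0" if "i \<in> {1..m}" for i
  proof -
    have lT: "linear (\<lambda>b. T (proj i b))" using linear_compose[OF linear_proj T] by (simp add: comp_def)
    have "(\<Sum>b\<in>Basis. T (proj i b) \<bullet> b) = (\<Sum>b\<in>Basis. (\<Sum>j=1..m. proj j (T (proj i b))) \<bullet> b)"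
      by (simp only: sum_proj)
    also have "\<dots> = (\<Sum>j=1..m. \<Sum>b\<in>Basis. proj j (T (proj i b)) \<bullet> b)"
      unfolding inner_sum_left by (rule sum.swap)
    also have "\<dots> = 0"
    proof (rule sum.neutral, rule ballI)
      fix j assume "j \<in> {1..m}"
      show "(\<Sum>b\<in>Basis. proj j (T (proj i b)) \<bullet> b) = 0"
      \<comment> \<open>Diagonal blocks vanish by triangularity, off-diagonal ones because tr(P_j T
        P_i) = tr(T P_i P_j).\<close>
      proof (cases "j = i")
        case True
        have "proj j (T (proj i b)) = 0" for b
          using tri[OF proj_in_layer, of i b] that True by (simp add: filt_def)
        then show ?thesis by simp
      next
        case False
        have "(\<Sum>b\<in>Basis. proj j (T (proj i b)) \<bullet> b) = (\<Sum>b\<in>Basis. T (proj i (proj j b)) \<bullet> b)"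
          by (rule sum_Basis_inner_commute[OF linear_proj lT])
        then show ?thesis using False by (simp add: proj_proj linear_0[OF T])
      qed
    qed
    finally show ?thesis .
  qed
  have "(\<Sum>i=1..m. T (proj i b)) = T b" for b
    by (simp only: linear_sum[OF T, symmetric] sum_proj)
  then have "(\<Sum>b\<in>Basis. T b \<bullet> b) = (\<Sum>b\<in>Basis. (\<Sum>i=1..m. T (proj i b)) \<bullet> b)" by (simp only:)
  also have "\<dots> = (\<Sum>i=1..m. \<Sum>b\<in>Basis. T (proj i b) \<bullet> b)"
    unfolding inner_sum_left by (rule sum.swap)
  also have "\<dots> = 0" by (rule sum.neutral) (use tz in auto)
  finally show ?thesis .
qed

text \<open>Zero divergence turns the derivative along the field into a sum of directional
  derivatives of test functions, each with integral 0.\<close>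

lemma integral_lv_0: assumes f: "test_fn f" shows "integral\<^sup>L lborel (lv v f) = 0"
proof -
  note sf = test_fn_smooth[OF f]
  let ?c = "\<lambda>x. vel x v"
  let ?g = "\<lambda>b x. complex_of_real (?c x \<bullet> b) * f x"
  have tg: "test_fn (?g b)" for b
    by (intro test_fn_smooth_mult smooth_of_real smooth_inner smooth_vel smooth_const f)
  have dg: "dderiv b (?g b) x = complex_of_real (?c x \<bullet> b) * dderiv b f x + complex_of_real (dderiv b ?c x \<bullet> b) * f x" for b x
  proof -
    have "((\<lambda>x. complex_of_real (?c x \<bullet> b)) has_derivative (\<lambda>w. complex_of_real (dderiv w ?c x \<bullet> b))) (at x)"
      by (intro bounded_linear.has_derivative[OF bounded_linear_of_real]
          bounded_linear.has_derivative[OF bounded_linear_inner_left] smooth_has_derivative[OF smooth_vel])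
    from has_derivative_mult[OF this smooth_has_derivative[OF sf]]
    show ?thesis by (rule dderiv_eq(1))
  qed
  have tr: "(\<Sum>b\<in>Basis. dderiv b ?c x \<bullet> b) = 0" for x
  proof (rule trace_zero)
    show "linear (\<lambda>b. dderiv b ?c x)" using has_derivative_linear[OF smooth_has_derivative[OF smooth_vel]] .
    fix i w assume w: "w \<in> layer i" "1 \<le> i"
    show "dderiv w ?c x \<in> filt (Suc i)"
    proof (rule subspace_vector_derivative[OF subspace_filt])
      show "((\<lambda>h. vel (x + h *\<^sub>R w) v) has_vector_derivative dderiv w ?c x) (at 0)"
        using dderiv_eq(2)[OF smooth_has_derivative[OF smooth_vel[of v], of x], of w] by simp
      show "vel (x + h *\<^sub>R w) v - vel (x + 0 *\<^sub>R w) v \<in> filt (Suc i)" for h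
      proof -
        have "h *\<^sub>R w \<in> filt i" using w(1) layer_subset_filt[of i] by (intro subspace_scale[OF subspace_filt]) auto
        from vel_diff_filt[OF this w(2), of x v] show ?thesis by simp
      qed
    qed
  qed
  have "lv v f x = (\<Sum>b\<in>Basis. dderiv b (?g b) x)" for x
  proof -
    have "(\<Sum>b\<in>Basis. dderiv b (?g b) x) = (\<Sum>b\<in>Basis. complex_of_real (?c x \<bullet> b) * dderiv b f x)
        + complex_of_real (\<Sum>b\<in>Basis. dderiv b ?c x \<bullet> b) * f x"
      by (simp only: dg sum.distrib sum_distrib_right of_real_sum)
    then show ?thesis unfolding tr using lv_expand[OF sf, of v x] by (simp add: scaleR_conv_of_real)
  qed
  then have "lv v f = (\<lambda>x. \<Sum>b\<in>Basis. dderiv b (?g b) x)" by auto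
  then have "integral\<^sup>L lborel (lv v f) = (\<Sum>b\<in>Basis. integral\<^sup>L lborel (dderiv b (?g b)))"
    using test_fn_integrable[OF test_fn_dderiv[OF tg]] by (simp add: Bochner_Integration.integral_sum)
  then show ?thesis by (simp add: integral_dderiv_0[OF tg])
qed

end

section \<open>Invariance of Lebesgue measure under the group\<close>

lemma lborel_distr_minus: "distr lborel borel uminus = (lborel :: 'a::euclidean_space measure)"
proof -
  have "lborel = density (distr lborel borel (\<lambda>x::'a. 0 + (-1) *\<^sub>R x)) (\<lambda>_. \<bar>-1::real\<bar>^DIM('a))"
    by (rule lborel_affine) simp
  then show ?thesis by (simp add: density_1)
qed

context stratified_lie
begin

text \<open>The translation runs over a whole segment of parameters, which gives one bounded set
  outside which all nearby translates vanish, as differentiation under the integral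
  requires.\<close>

lemma bounded_right_preimage:
  assumes "bounded S" shows "bounded {x. \<exists>t\<in>{-1..1}. x \<odot> (t *\<^sub>R y) \<in> S}"
proof -
  let ?f = "\<lambda>z. fst z \<odot> (- (snd z *\<^sub>R y))"
  have "compact (closure S \<times> {-1..1::real})" using assms by (intro compact_Times) (auto simp: compact_closure)
  moreover have "continuous_on UNIV ?f" by (intro continuous_mul continuous_intros)
  ultimately have "compact (?f ` (closure S \<times> {-1..1}))"
    by (intro compact_continuous_image) (auto intro: continuous_on_subset)
  then have b: "bounded (?f ` (closure S \<times> {-1..1}))" by (rule compact_imp_bounded)
  have "{x. \<exists>t\<in>{-1..1}. x \<odot> (t *\<^sub>R y) \<in> S} \<subseteq> ?f ` (closure S \<times> {-1..1})"
  proof clarify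
    fix x t assume t: "t \<in> {-1..1::real}" and S: "x \<odot> (t *\<^sub>R y) \<in> S"
    have "x = ?f (x \<odot> (t *\<^sub>R y), t)" by simp
    moreover have "(x \<odot> (t *\<^sub>R y), t) \<in> closure S \<times> {-1..1}" using t S closure_subset by auto
    ultimately show "x \<in> ?f ` (closure S \<times> {-1..1})" by blast
  qed
  then show ?thesis using b bounded_subset by blast
qed

lemma test_fn_right_translate: assumes "test_fn f" shows "test_fn (\<lambda>x. f (x \<odot> y))"
proof (rule test_fnI)
  show "smooth (\<lambda>x. f (x \<odot> y))"
    by (rule smooth_comp[OF test_fn_smooth[OF assms]]) (intro smooth_mul smooth_ident smooth_const)
  show "bounded {x. \<exists>t\<in>{-1..1::real}. x \<odot> (t *\<^sub>R y) \<in> {x. f x \<noteq> 0}}"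
    using assms by (intro bounded_right_preimage) (simp add: test_fn_iff)
  show "f (x \<odot> y) = 0" if "x \<notin> {x. \<exists>t\<in>{-1..1::real}. x \<odot> (t *\<^sub>R y) \<in> {x. f x \<noteq> 0}}" for x
    using that by (auto dest!: bspec[of _ _ 1])
qed

lemma test_fn_minus_arg: assumes "test_fn f" shows "test_fn (\<lambda>x. f (- x))"
proof (rule test_fnI)
  show "smooth (\<lambda>x. f (- x))"
    by (rule smooth_comp[OF test_fn_smooth[OF assms]]) (intro smooth_minus smooth_ident)
  show "bounded (uminus ` {x. f x \<noteq> 0})" using assms by (simp add: test_fn_iff bounded_uminus)
  show "f (- x) = 0" if "x \<notin> uminus ` {x. f x \<noteq> 0}" for x using that by (force simp: image_iff)
qed

text \<open>Along the one-parameter group of v the derivative of the integral is the integral of a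
  left-invariant derivative of a test function, hence 0.\<close>

lemma integral_right_translate_test: assumes f: "test_fn f"
  shows "integral\<^sup>L lborel (\<lambda>x. f (x \<odot> v)) = integral\<^sup>L lborel f"
proof -
  let ?g = "\<lambda>t. integral\<^sup>L lborel (\<lambda>x. f (x \<odot> (t *\<^sub>R v)))"
  have "(?g has_vector_derivative 0) (at t)" for t
  proof -
    define \<psi> where "\<psi> x = f (x \<odot> (t *\<^sub>R v))" for x
    have t\<psi>: "test_fn \<psi>" unfolding \<psi>_def by (rule test_fn_right_translate[OF f])
    obtain C where C: "0 \<le> C" "\<And>x. cmod (lv v \<psi> x) \<le> C" using test_fn_bounded[OF test_fn_lv[OF t\<psi>]] by blast
    let ?B = "{x. \<exists>t\<in>{-1..1}. x \<odot> (t *\<^sub>R v) \<in> {x. \<psi> x \<noteq> 0}}"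
    have "((\<lambda>h. integral\<^sup>L lborel (\<lambda>x. \<psi> (x \<odot> (h *\<^sub>R v)))) has_vector_derivative integral\<^sup>L lborel (lv v \<psi>)) (at 0)"
    proof (rule integral_difference_quotient[where B="?B" and C=C])
      show "integrable lborel (\<lambda>x. \<psi> (x \<odot> (h *\<^sub>R v)))" for h
        by (rule test_fn_integrable[OF test_fn_right_translate[OF t\<psi>]])
      show "lv v \<psi> \<in> borel_measurable lborel" using smooth_borel[OF test_fn_smooth[OF test_fn_lv[OF t\<psi>]]] by simp
      show "((\<lambda>h. \<psi> (x \<odot> (h *\<^sub>R v))) has_vector_derivative lv v \<psi> x) (at 0)" for x
        using lv_has_vector_derivative[OF test_fn_smooth[OF t\<psi>], of x v 0] by simp
      show "bounded ?B" using t\<psi> by (intro bounded_right_preimage) (simp add: test_fn_iff)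
      fix h :: real and x assume h: "\<bar>h\<bar> \<le> 1"
      show "norm (\<psi> (x \<odot> (h *\<^sub>R v)) - \<psi> (x \<odot> (0 *\<^sub>R v))) \<le> \<bar>h\<bar> * (indicator ?B x * C)"
      proof (cases "x \<in> ?B")
        case True
        have "norm (\<psi> (x \<odot> (h *\<^sub>R v)) - \<psi> (x \<odot> (0 *\<^sub>R v))) \<le> C * norm (h - 0)"
        proof (rule differentiable_bound[of UNIV "\<lambda>t. \<psi> (x \<odot> (t *\<^sub>R v))" "\<lambda>t s. s *\<^sub>R lv v \<psi> (x \<odot> (t *\<^sub>R v))"])
          fix t :: real
          show "((\<lambda>t. \<psi> (x \<odot> (t *\<^sub>R v))) has_derivative (\<lambda>s. s *\<^sub>R lv v \<psi> (x \<odot> (t *\<^sub>R v)))) (at t within UNIV)"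
            using lv_has_vector_derivative[OF test_fn_smooth[OF t\<psi>], of x v t] by (simp add: has_vector_derivative_def)
          show "onorm (\<lambda>s. s *\<^sub>R lv v \<psi> (x \<odot> (t *\<^sub>R v))) \<le> C"
            using C(2)[of "x \<odot> (t *\<^sub>R v)"] by (intro onorm_le) (simp add: mult.commute[of C] mult_left_mono)
        qed auto
        then show ?thesis using True by (simp add: mult.commute)
      next
        case False
        have "\<psi> (x \<odot> (h *\<^sub>R v)) = 0" "\<psi> (x \<odot> (0 *\<^sub>R v)) = 0"
          using False h by (auto simp: abs_le_iff dest!: bspec[of _ _ 0])
        then show ?thesis using C(1) by simp
      qed
    qed (use C in auto)
    then have "((\<lambda>h. ?g (t + h)) has_vector_derivative 0) (at (t - t))"
      unfolding integral_lv_0[OF t\<psi>] by (simp add: \<psi>_def mul_assoc mul_scale add.commute)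
    moreover have 1: "((\<lambda>s. s - t) has_vector_derivative 1) (at t)"
      by (auto intro!: derivative_eq_intros simp: has_vector_derivative_def)
    ultimately show ?thesis using vector_diff_chain_at[OF 1, of "\<lambda>h. ?g (t + h)" 0] by (simp add: comp_def)
  qed
  then obtain c where "?g t = c" for t using has_vector_derivative_zero_constant[of UNIV ?g] by auto
  from this[of 0] this[of 1] show ?thesis by simp
qed

lemma measurable_mul [measurable]:
  assumes [measurable]: "f \<in> borel_measurable M" "g \<in> borel_measurable M"
  shows "(\<lambda>z. f z \<odot> g z) \<in> borel_measurable M"
proof -
  have "continuous_on UNIV (\<lambda>z. fst z \<odot> snd z)" by (intro continuous_mul continuous_intros)
  then have 1: "(\<lambda>z. fst z \<odot> snd z) \<in> borel_measurable borel" by (rule continuous_borel)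
  have 2: "(\<lambda>z. (f z, g z)) \<in> measurable M (borel :: ((complex^'n) \<times> (complex^'n)) measure)"
    by (rule borel_measurable_Pair[OF assms])
  show ?thesis using measurable_compose[OF 2 1] by simp
qed

lemma lborel_distr_right: "distr lborel borel (\<lambda>x. x \<odot> y) = lborel"
proof (rule measure_eqI_test_fn)
  show "emeasure (distr lborel borel (\<lambda>x. x \<odot> y)) (box a b) < \<infinity>" for a b
  proof -
    have "emeasure (distr lborel borel (\<lambda>x. x \<odot> y)) (box a b) = emeasure lborel ((\<lambda>x. x \<odot> y) -` box a b)"
      by (subst emeasure_distr) (auto intro!: measurable_mul)
    also have "\<dots> < \<infinity>"
    proof (rule emeasure_bounded_finite)
      have "bounded {x. \<exists>t\<in>{-1..1}. x \<odot> (t *\<^sub>R y) \<in> box a b}" by (intro bounded_right_preimage) simp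
      then show "bounded ((\<lambda>x. x \<odot> y) -` box a b)" by (rule bounded_subset) (auto intro!: bexI[of _ 1])
    qed
    finally show ?thesis .
  qed
  show "emeasure lborel (box a b) < \<infinity>" for a b :: "complex^'n" by (intro emeasure_bounded_finite) simp
  show "integral\<^sup>L (distr lborel borel (\<lambda>x. x \<odot> y)) \<phi> = integral\<^sup>L lborel \<phi>" if "test_fn \<phi>" for \<phi>
    using smooth_borel[OF test_fn_smooth[OF that]] integral_right_translate_test[OF that, of y]
    by (subst integral_distr) (auto intro!: measurable_mul)
qed auto

lemma nn_integral_minus: "f \<in> borel_measurable borel \<Longrightarrow> (\<integral>\<^sup>+x. f (- x) \<partial>lborel) = (\<integral>\<^sup>+x. f x \<partial>lborel)"
  for f :: "complex^'n \<Rightarrow> ennreal"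
  by (subst (2) lborel_distr_minus[symmetric]) (simp add: nn_integral_distr)

lemma nn_integral_right: assumes "f \<in> borel_measurable borel"
  shows "(\<integral>\<^sup>+x. f (x \<odot> y) \<partial>lborel) = (\<integral>\<^sup>+x. f x \<partial>lborel)"
  using assms by (subst (2) lborel_distr_right[of y, symmetric]) (auto simp: nn_integral_distr)

text \<open>Inversion is x -> -x; it preserves Lebesgue measure and exchanges left with right
  translations.\<close>

lemma nn_integral_left: assumes f: "f \<in> borel_measurable borel"
  shows "(\<integral>\<^sup>+x. f (y \<odot> x) \<partial>lborel) = (\<integral>\<^sup>+x. f x \<partial>lborel)"
proof -
  have "(\<integral>\<^sup>+x. f (y \<odot> x) \<partial>lborel) = (\<integral>\<^sup>+x. f (y \<odot> (- x)) \<partial>lborel)"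
    using f by (subst nn_integral_minus[of "\<lambda>x. f (y \<odot> x)", symmetric]) auto
  also have "\<dots> = (\<integral>\<^sup>+x. f (- (x \<odot> (- y))) \<partial>lborel)" by (simp add: minus_mul)
  also have "\<dots> = (\<integral>\<^sup>+x. f (- x) \<partial>lborel)"
    using f by (subst nn_integral_right[of "\<lambda>x. f (- x)"]) auto
  also have "\<dots> = (\<integral>\<^sup>+x. f x \<partial>lborel)" by (rule nn_integral_minus[OF f])
  finally show ?thesis .
qed

lemma integral_minus_arg: "f \<in> borel_measurable borel \<Longrightarrow> integral\<^sup>L lborel (\<lambda>x. f (- x)) = integral\<^sup>L lborel f"
  for f :: "complex^'n \<Rightarrow> 'b::{banach, second_countable_topology}"
  by (subst (2) lborel_distr_minus[symmetric]) (simp add: integral_distr)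

subsection \<open>Differentiation rules\<close>

lemma lv_const [simp]: "lv v (\<lambda>x. c) x = 0" by (simp add: lvf_def)

lemma lv_add: "smooth f \<Longrightarrow> smooth g \<Longrightarrow> lv v (\<lambda>x. f x + g x) x = lv v f x + lv v g x"
  using lv_eq[OF has_derivative_add[OF smooth_has_derivative smooth_has_derivative], of f g v x]
    lv_eq[OF smooth_has_derivative, of f v x] lv_eq[OF smooth_has_derivative, of g v x] by simp

lemma lv_mult: "smooth f \<Longrightarrow> smooth g \<Longrightarrow> lv v (\<lambda>x. f x * g x) x = f x * lv v g x + lv v f x * g x"
  for f g :: "complex^'n \<Rightarrow> 'b::real_normed_algebra"
  using lv_eq[OF has_derivative_mult[OF smooth_has_derivative smooth_has_derivative], of f g v x]
    lv_eq[OF smooth_has_derivative, of f v x] lv_eq[OF smooth_has_derivative, of g v x] by simp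

lemma lv_cmult: "smooth f \<Longrightarrow> lv v (\<lambda>x. c * f x) x = c * lv v f x"
  for f :: "complex^'n \<Rightarrow> 'b::real_normed_algebra"
  using lv_mult[OF smooth_const, of f v c x] by simp

lemma lv_diff: "smooth f \<Longrightarrow> smooth g \<Longrightarrow> lv v (\<lambda>x. f x - g x) x = lv v f x - lv v g x"
  using lv_eq[OF has_derivative_diff[OF smooth_has_derivative smooth_has_derivative], of f g v x]
    lv_eq[OF smooth_has_derivative, of f v x] lv_eq[OF smooth_has_derivative, of g v x] by simp

lemma lv_of_real: "smooth f \<Longrightarrow> lv v (\<lambda>x. complex_of_real (f x)) x = complex_of_real (lv v f x)"
  using lv_eq[OF bounded_linear.has_derivative[OF bounded_linear_of_real smooth_has_derivative], of f v x]
    lv_eq[OF smooth_has_derivative, of f v x] by simp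

lemma lv_scale: "smooth f \<Longrightarrow> lv (r *\<^sub>R v) f x = r *\<^sub>R lv v f x"
  using linear_scale[OF lv_linear[OF smooth_has_derivative]] by blast

lemma lv_sum_vec: "smooth f \<Longrightarrow> lv (\<Sum>i\<in>I. c i *\<^sub>R v i) f x = (\<Sum>i\<in>I. c i *\<^sub>R lv (v i) f x)"
  using linear_sum[OF lv_linear[OF smooth_has_derivative], of f "\<lambda>i. c i *\<^sub>R v i" I x] by (simp add: lv_scale)

lemma lv_locally_const:
  assumes "open S" "x \<in> S" "\<And>y. y \<in> S \<Longrightarrow> f y = c" shows "lv v f x = 0"
proof -
  have "((\<lambda>x. c) has_derivative (\<lambda>v. 0)) (at x)" by simp
  then have "(f has_derivative (\<lambda>v. 0)) (at x)"
    by (rule has_derivative_transform_within_open[OF _ assms(1,2)]) (use assms in auto)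
  then show ?thesis by (rule lv_eq)
qed

subsection \<open>Cutoff functions\<close>

text \<open>A squared norm adapted to the grading: dilation by r multiplies its i-th term by r^(2i),
  so it can be compared before and after dilation term by term.\<close>

definition hn :: "complex^'n \<Rightarrow> real" where
  "hn x = (\<Sum>i=1..m. proj i x \<bullet> proj i x)"

text \<open>Equal to 1 up to \<open>hn x\<close> = 1 and to 0 from 4 on. The ratio 4 matches
  \<open>hn_dil_2\<close>: dilation by 2 carries the region where the cutoff varies into the region
  where it vanishes.\<close>

definition cut :: "complex^'n \<Rightarrow> real" where
  "cut x = sstep ((4 - hn x) / 3)"

lemma smooth_hn: "smooth hn"
  unfolding hn_def by (intro smooth_sum smooth_inner smooth_linear linear_proj)

lemma smooth_cut: "smooth cut"
  unfolding cut_def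
  by (rule smooth_comp[OF smooth_sstep], rule smooth_linear_comp[OF bounded_linear_divide], intro smooth_diff smooth_const smooth_hn)

lemma cut_1: "hn x \<le> 1 \<Longrightarrow> cut x = 1" and cut_0: "4 \<le> hn x \<Longrightarrow> cut x = 0"
  by (simp_all add: cut_def sstep_1 sstep_0)

lemma cut_bounds: "0 \<le> cut x" "cut x \<le> 1" by (simp_all add: cut_def sstep_bounds)

lemma hn_minus: "hn (- x) = hn x" by (simp add: hn_def linear_neg[OF linear_proj])

lemma cut_minus: "cut (- x) = cut x" by (simp add: cut_def hn_minus)

lemma norm_le_hn: "(norm x)\<^sup>2 \<le> real m * hn x"
proof -
  have "norm x \<le> (\<Sum>i=1..m. norm (proj i x))"
    using norm_sum[of "\<lambda>i. proj i x" "{1..m}"] by (simp only: sum_proj)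
  then have "(norm x)\<^sup>2 \<le> (\<Sum>i=1..m. norm (proj i x))\<^sup>2" by (simp add: power_mono)
  also have "\<dots> \<le> real (card {1..m}) * (\<Sum>i=1..m. (norm (proj i x))\<^sup>2)" using sum_squared_le_sum_of_squares[of "\<lambda>i. norm (proj i x)" "{1..m}"] by (simp add: mult.commute)
  also have "\<dots> = real m * hn x" by (simp add: hn_def power2_norm_eq_inner)
  finally show ?thesis .
qed

lemma hn_nonneg: "0 \<le> hn x" by (simp add: hn_def sum_nonneg)

lemma hn_dil: "hn (dil r x) = (\<Sum>i=1..m. (r ^ i)\<^sup>2 * (proj i x \<bullet> proj i x))"
  by (simp add: hn_def proj_dil power2_eq_square mult.assoc)

lemma hn_dil_2: "4 * hn x \<le> hn (dil 2 x)"
  unfolding hn_dil unfolding hn_def sum_distrib_left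
proof (rule sum_mono)
  fix i assume "i \<in> {1..m}"
  then have "(2::real) ^ 1 \<le> 2 ^ i" by (intro power_increasing) auto
  then have "(2::real)\<^sup>2 \<le> (2 ^ i)\<^sup>2" by (intro power_mono) auto
  then show "4 * (proj i x \<bullet> proj i x) \<le> (2 ^ i)\<^sup>2 * (proj i x \<bullet> proj i x)" by (intro mult_right_mono) auto
qed

lemma hn_dil_small:
  assumes "0 < R" "R \<le> 1" shows "hn (dil R x) \<le> R\<^sup>2 * hn x" "(R ^ m)\<^sup>2 * hn x \<le> hn (dil R x)"
proof -
  show "hn (dil R x) \<le> R\<^sup>2 * hn x"
    unfolding hn_dil unfolding hn_def sum_distrib_left
  proof (rule sum_mono)
    fix i assume "i \<in> {1..m}"
    then have "R ^ i \<le> R ^ 1" using assms by (intro power_decreasing) auto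
    then have "(R ^ i)\<^sup>2 \<le> R\<^sup>2" using assms by (intro power_mono) auto
    then show "(R ^ i)\<^sup>2 * (proj i x \<bullet> proj i x) \<le> R\<^sup>2 * (proj i x \<bullet> proj i x)" by (intro mult_right_mono) auto
  qed
  show "(R ^ m)\<^sup>2 * hn x \<le> hn (dil R x)"
    unfolding hn_dil unfolding hn_def sum_distrib_left
  proof (rule sum_mono)
    fix i assume "i \<in> {1..m}"
    then have "R ^ m \<le> R ^ i" using assms by (intro power_decreasing) auto
    then have "(R ^ m)\<^sup>2 \<le> (R ^ i)\<^sup>2" using assms by (intro power_mono) auto
    then show "(R ^ m)\<^sup>2 * (proj i x \<bullet> proj i x) \<le> (R ^ i)\<^sup>2 * (proj i x \<bullet> proj i x)" by (intro mult_right_mono) auto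
  qed
qed

lemma dil_dil: "dil r (dil s x) = dil (r * s) x"
  unfolding dil_def[of r] dil_def[of "r * s"] proj_dil by (simp add: power_mult_distrib)

lemma dil_1: "dil 1 x = x"
  unfolding dil_def by (simp add: sum_proj')

lemma dil_minus: "dil r (- x) = - dil r x" by (rule linear_neg[OF linear_dil])

lemma bounded_hn: "bounded {x. hn x \<le> c}"
proof -
  have "norm x \<le> sqrt (real m * c)" if "hn x \<le> c" for x
    using norm_le_hn[of x] mult_left_mono[OF that, of "real m"] by (intro real_le_rsqrt) auto
  then show ?thesis by (auto simp: bounded_iff)
qed

definition cutR :: "real \<Rightarrow> complex^'n \<Rightarrow> real" where
  "cutR R x = cut (dil (1 / R) x)"

lemma cutR_bounds: "0 \<le> cutR R x" "cutR R x \<le> 1" by (simp_all add: cutR_def cut_bounds)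

lemma smooth_cutR: "smooth (cutR R)"
  unfolding cutR_def by (intro smooth_comp[OF smooth_cut] smooth_linear linear_dil)

lemma cutR_minus: "cutR R (- x) = cutR R x" by (simp add: cutR_def dil_minus cut_minus)

lemma cutR_0 [simp]: "cutR R 0 = 1" by (simp add: cutR_def linear_0[OF linear_dil] cut_1 hn_def)

lemma test_fn_cutR: assumes "0 < R" shows "test_fn (\<lambda>x. complex_of_real (cutR R x))"
proof (rule test_fnI[of _ "dil R ` {x. hn x \<le> 4}"])
  show "smooth (\<lambda>x. complex_of_real (cutR R x))" by (intro smooth_of_real smooth_cutR)
  show "bounded (dil R ` {x. hn x \<le> 4})"
    by (rule bounded_linear_image[OF bounded_hn]) (use linear_dil in \<open>simp add: linear_conv_bounded_linear\<close>)
  fix x assume x: "x \<notin> dil R ` {x. hn x \<le> 4}"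
  have "x = dil R (dil (1 / R) x)" using assms by (simp add: dil_dil dil_1)
  then have "\<not> hn (dil (1 / R) x) \<le> 4" using x by blast
  then show "complex_of_real (cutR R x) = 0" by (simp add: cutR_def cut_0)
qed

lemma cutR_1: assumes "1 \<le> R" "hn x \<le> R\<^sup>2" shows "cutR R x = 1"
proof -
  have "hn (dil (1 / R) x) \<le> (1 / R)\<^sup>2 * hn x" using assms(1) by (intro hn_dil_small) auto
  also have "\<dots> \<le> (1 / R)\<^sup>2 * R\<^sup>2" using assms by (intro mult_left_mono) auto
  also have "\<dots> = 1" using assms by (simp add: power_divide)
  finally show ?thesis by (simp add: cutR_def cut_1)
qed

lemma cutR_0_far: assumes "1 \<le> R" "4 * (R ^ m)\<^sup>2 \<le> hn x" shows "cutR R x = 0"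
proof -
  have "4 = ((1 / R) ^ m)\<^sup>2 * (4 * (R ^ m)\<^sup>2)" using assms(1) by (simp add: power_divide)
  also have "\<dots> \<le> ((1 / R) ^ m)\<^sup>2 * hn x" using assms by (intro mult_left_mono) auto
  also have "\<dots> \<le> hn (dil (1 / R) x)" using assms(1) by (intro hn_dil_small) auto
  finally show ?thesis by (simp add: cutR_def cut_0)
qed

lemma lv_cutR: assumes "v \<in> layer 1" shows "lv v (cutR R) x = (1 / R) * lv v cut (dil (1 / R) x)"
  unfolding cutR_def lv_dil using assms by (simp add: dil_layer[OF assms] lv_scale[OF smooth_cut] del: One_nat_def)

end

section \<open>Tails and moments of the heat kernel\<close>

locale heat_group = stratified_lie br m V
  for br :: "complex^'n \<Rightarrow> complex^'n \<Rightarrow> complex^'n" and m :: nat and V :: "nat \<Rightarrow> (complex^'n) set" +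
  fixes k :: nat and xs :: "nat \<Rightarrow> complex^'n" and rho :: "real \<Rightarrow> complex^'n \<Rightarrow> real"
  assumes span_xs: "span (xs ` {1..k} \<union> (cJ \<circ> xs) ` {1..k}) = V 1"
    and heat: "heat_kernel mul (sublap mul k xs) rho"
begin

text \<open>One family for the fields X_j (flag False) and Y_j (flag True), so that the sublaplacian
  and the form become single sums.\<close>

definition zt :: "nat \<times> bool \<Rightarrow> complex^'n" where
  "zt i = (if snd i then cJ (xs (fst i)) else xs (fst i))"

definition zidx :: "(nat \<times> bool) set" where "zidx = {1..k} \<times> UNIV"

lemma finite_zidx [simp]: "finite zidx" by (simp add: zidx_def)

lemma sum_zidx: "(\<Sum>i\<in>zidx. f (zt i)) = (\<Sum>j\<in>{1..k}. f (xs j) + f (cJ (xs j)))"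
proof -
  have "(\<Sum>i\<in>zidx. f (zt i)) = (\<Sum>j\<in>{1..k}. \<Sum>b\<in>UNIV. f (zt (j, b)))"
    unfolding zidx_def by (simp add: sum.cartesian_product)
  then show ?thesis by (simp add: UNIV_bool zt_def add.commute)
qed

lemma layer_1: "layer 1 = V 1" using m_pos by (simp add: layer_def)

lemma zt_layer: "i \<in> zidx \<Longrightarrow> zt i \<in> layer 1"
  unfolding layer_1 span_xs[symmetric] by (intro span_base) (auto simp: zidx_def zt_def)

abbreviation lap :: "(complex^'n \<Rightarrow> complex) \<Rightarrow> complex^'n \<Rightarrow> complex" where
  "lap \<equiv> sublap mul k xs"

lemma lap_eq: "lap f x = (\<Sum>i\<in>zidx. lv (zt i) (lv (zt i) f) x)"
  unfolding sublap_def by (rule sum_zidx[of "\<lambda>v. lv v (lv v f) x", symmetric])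

lemma test_fn_lap: "test_fn f \<Longrightarrow> test_fn (lap f)"
  unfolding lap_eq[abs_def] by (intro test_fn_sum test_fn_lv)

lemma rho_smooth: "0 < s \<Longrightarrow> smooth (rho s)"
  and rho_pos: "0 < s \<Longrightarrow> 0 < rho s y"
  and rho_integrable: "0 < s \<Longrightarrow> integrable lborel (rho s)"
  and rho_integral: "0 < s \<Longrightarrow> integral\<^sup>L lborel (rho s) = 1"
  using heat unfolding heat_kernel_def by (auto simp: smooth_fn_iff)

lemma rho_borel: "0 < s \<Longrightarrow> rho s \<in> borel_measurable borel"
  by (rule smooth_borel[OF rho_smooth])

abbreviation PP :: "real \<Rightarrow> (complex^'n \<Rightarrow> complex) \<Rightarrow> complex^'n \<Rightarrow> complex" where
  "PP s f x \<equiv> heat_conv mul (rho s) f x"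

lemma PP_deriv: "test_fn f \<Longrightarrow> 0 < s \<Longrightarrow>
    ((\<lambda>s. PP s f x) has_vector_derivative (1/4) *\<^sub>R PP s (lap f) x) (at s)"
  and PP_lim: "test_fn f \<Longrightarrow> ((\<lambda>s. PP s f x) \<longlongrightarrow> f x) (at_right 0)"
  using heat unfolding heat_kernel_def by blast+

lemma rho_mult_integrable:
  fixes f :: "complex^'n \<Rightarrow> complex"
  assumes "0 < s" "f \<in> borel_measurable borel" "\<And>y. cmod (f y) \<le> C"
  shows "integrable lborel (\<lambda>y. f y * complex_of_real (rho s y))"
proof (rule Bochner_Integration.integrable_bound[of _ "\<lambda>y. C * rho s y"])
  show "integrable lborel (\<lambda>y. C * rho s y)" using rho_integrable[OF assms(1)] by simp
  show "(\<lambda>y. f y * complex_of_real (rho s y)) \<in> borel_measurable lborel"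
    using assms(2) rho_borel[OF assms(1)] by measurable
  show "AE x in lborel. norm (f x * complex_of_real (rho s x)) \<le> norm (C * rho s x)"
    using assms(3) rho_pos[OF assms(1)]
    by (intro AE_I2) (auto simp: norm_mult abs_mult less_imp_le intro!: mult_right_mono intro: order_trans[OF _ abs_ge_self])
qed

lemma PP_bound:
  assumes "0 < s" "\<And>y. cmod (f y) \<le> C" shows "cmod (PP s f x) \<le> C"
proof (cases "integrable lborel (\<lambda>y. f (x \<odot> (- y)) * complex_of_real (rho s y))")
  case True
  have "cmod (PP s f x) \<le> integral\<^sup>L lborel (\<lambda>y. cmod (f (x \<odot> (- y)) * complex_of_real (rho s y)))"
    unfolding heat_conv_def by (rule integral_norm_bound)
  also have "\<dots> \<le> integral\<^sup>L lborel (\<lambda>y. C * rho s y)"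
    using True rho_integrable[OF assms(1)] assms(2) rho_pos[OF assms(1)]
    by (intro integral_mono integrable_norm) (auto simp: norm_mult less_imp_le intro!: mult_right_mono)
  also have "\<dots> = C" by (simp add: rho_integral[OF assms(1)])
  finally show ?thesis .
next
  \<comment> \<open>A non-integrable product has integral 0 by convention, which satisfies the
    bound.\<close>
  case False
  then show ?thesis using order_trans[OF norm_ge_zero assms(2)]
    by (simp add: heat_conv_def not_integrable_integral_eq)
qed

lemma PP_lipschitz:
  assumes f: "test_fn f" and st: "0 < s" "s \<le> t" and B: "\<And>u. s \<le> u \<Longrightarrow> u \<le> t \<Longrightarrow> cmod (PP u (lap f) x) \<le> B"
  shows "cmod (PP t f x - PP s f x) \<le> B / 4 * (t - s)"
proof -
  have "norm (PP t f x - PP s f x) \<le> B / 4 * norm (t - s)"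
  proof (rule differentiable_bound[of "{s..t}" "\<lambda>s. PP s f x" "\<lambda>u h. h *\<^sub>R ((1/4) *\<^sub>R PP u (lap f) x)"])
    fix u assume u: "u \<in> {s..t}"
    show "((\<lambda>s. PP s f x) has_derivative (\<lambda>h. h *\<^sub>R ((1/4) *\<^sub>R PP u (lap f) x))) (at u within {s..t})"
      using PP_deriv[OF f, of u x] u st by (auto simp: has_vector_derivative_def intro: has_derivative_at_withinI)
    show "onorm (\<lambda>h. h *\<^sub>R ((1/4) *\<^sub>R PP u (lap f) x)) \<le> B / 4"
      using B[of u] u by (intro onorm_le) (auto simp: mult.commute[of B] intro!: mult_left_mono)
  qed (use st in auto)
  then show ?thesis using st by simp
qed

text \<open>The derivative formula is available only at positive times, so time 0 enters as a limit
  of the Lipschitz estimate.\<close>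

lemma PP_near_0:
  assumes f: "test_fn f" and s: "0 < s" and B: "\<And>u. 0 < u \<Longrightarrow> u \<le> s \<Longrightarrow> cmod (PP u (lap f) x) \<le> B"
  shows "cmod (PP s f x - f x) \<le> B / 4 * s"
proof (rule tendsto_upperbound)
  show "((\<lambda>u. cmod (PP s f x - PP u f x)) \<longlongrightarrow> cmod (PP s f x - f x)) (at_right 0)"
    by (intro tendsto_intros PP_lim[OF f])
  have B0: "0 \<le> B" using B[of s] s norm_ge_zero order_trans by blast
  show "\<forall>\<^sub>F u in at_right 0. cmod (PP s f x - PP u f x) \<le> B / 4 * s"
    unfolding eventually_at_right_field
  proof (intro exI[of _ s] conjI allI impI s)
    fix u assume u: "0 < u" "u < s"
    have "cmod (PP s f x - PP u f x) \<le> B / 4 * (s - u)" by (rule PP_lipschitz[OF f]) (use u B in auto)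
    also have "\<dots> \<le> B / 4 * s" using u B0 by (intro mult_left_mono) auto
    finally show "cmod (PP s f x - PP u f x) \<le> B / 4 * s" .
  qed
qed simp

text \<open>A smooth substitute for the mass of the kernel outside a dilated ball of radius R. By
  \<open>PP_cutR\<close> it is one minus the semigroup applied to a test function at the identity,
  hence accessible to the heat equation.\<close>

definition tailp :: "real \<Rightarrow> real \<Rightarrow> real" where
  "tailp R s = integral\<^sup>L lborel (\<lambda>y. (1 - cutR R y) * rho s y)"

lemma cutR_rho_integrable:
  assumes "0 < s" shows "integrable lborel (\<lambda>y. (1 - cutR R y) * rho s y)" "integrable lborel (\<lambda>y. cutR R y * rho s y)"
proof -
  have b: "cutR R \<in> borel_measurable borel" by (rule smooth_borel[OF smooth_cutR])
  show "integrable lborel (\<lambda>y. (1 - cutR R y) * rho s y)"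
    by (rule Bochner_Integration.integrable_bound[OF rho_integrable[OF assms]])
       (use b rho_borel[OF assms] cutR_bounds rho_pos[OF assms] in \<open>auto simp: abs_mult less_imp_le intro!: AE_I2 mult_left_le_one_le\<close>)
  show "integrable lborel (\<lambda>y. cutR R y * rho s y)"
    by (rule Bochner_Integration.integrable_bound[OF rho_integrable[OF assms]])
       (use b rho_borel[OF assms] cutR_bounds rho_pos[OF assms] in \<open>auto simp: abs_mult less_imp_le intro!: AE_I2 mult_left_le_one_le\<close>)
qed

lemma tailp_nonneg: "0 < s \<Longrightarrow> 0 \<le> tailp R s"
  unfolding tailp_def using cutR_bounds rho_pos by (intro Bochner_Integration.integral_nonneg) (auto simp: less_imp_le)

lemma tailp_le_1: assumes "0 < s" shows "tailp R s \<le> 1"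
proof -
  have "tailp R s \<le> integral\<^sup>L lborel (rho s)"
    unfolding tailp_def using cutR_rho_integrable[OF assms] rho_integrable[OF assms] cutR_bounds rho_pos[OF assms]
    by (intro integral_mono) (auto simp: less_imp_le intro!: mult_left_le_one_le)
  then show ?thesis by (simp add: rho_integral[OF assms])
qed

lemma PP_cutR: assumes "0 < s" shows "PP s (\<lambda>x. complex_of_real (cutR R x)) 0 = complex_of_real (1 - tailp R s)"
proof -
  have "PP s (\<lambda>x. complex_of_real (cutR R x)) 0 = complex_of_real (integral\<^sup>L lborel (\<lambda>y. cutR R y * rho s y))"
    unfolding heat_conv_def by (simp add: cutR_minus flip: of_real_mult)
  moreover have "tailp R s = 1 - integral\<^sup>L lborel (\<lambda>y. cutR R y * rho s y)"
    unfolding tailp_def using cutR_rho_integrable[OF assms] rho_integrable[OF assms]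
    by (simp add: left_diff_distrib rho_integral[OF assms])
  ultimately show ?thesis by simp
qed

definition lapcut :: "complex^'n \<Rightarrow> real" where
  "lapcut y = (\<Sum>i\<in>zidx. lv (zt i) (lv (zt i) cut) y)"

lemma lap_cutR: "lap (\<lambda>x. complex_of_real (cutR R x)) x = complex_of_real ((1 / R)\<^sup>2 * lapcut (dil (1 / R) x))"
proof -
  have "lv (zt i) (lv (zt i) (\<lambda>x. complex_of_real (cutR R x))) x
     = complex_of_real ((1 / R)\<^sup>2 * lv (zt i) (lv (zt i) cut) (dil (1 / R) x))" if i: "i \<in> zidx" for i
  proof -
    have "lv (zt i) (\<lambda>x. complex_of_real (cutR R x)) = (\<lambda>x. complex_of_real ((1 / R) * lv (zt i) cut (dil (1 / R) x)))"
      by (rule ext) (simp only: lv_of_real[OF smooth_cutR] lv_cutR[OF zt_layer[OF i]])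
    moreover have s1: "smooth (\<lambda>x. lv (zt i) cut (dil (1 / R) x))"
      by (rule smooth_comp[OF smooth_lv[OF smooth_cut] smooth_linear[OF linear_dil]])
    have "lv (zt i) (\<lambda>x. complex_of_real ((1 / R) * lv (zt i) cut (dil (1 / R) x))) x
       = complex_of_real ((1 / R) * lv (zt i) (\<lambda>x. lv (zt i) cut (dil (1 / R) x)) x)"
      by (subst lv_of_real) (simp_all only: lv_cmult[OF s1] smooth_mult[OF smooth_const s1])
    moreover have "lv (zt i) (\<lambda>x. lv (zt i) cut (dil (1 / R) x)) x = (1 / R) * lv (zt i) (lv (zt i) cut) (dil (1 / R) x)"
      unfolding lv_dil dil_layer[OF zt_layer[OF i]] by (simp add: lv_scale[OF smooth_lv[OF smooth_cut]])
    ultimately show ?thesis by (simp add: power2_eq_square)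
  qed
  then show ?thesis unfolding lap_eq lapcut_def by (simp add: sum_distrib_left)
qed

text \<open>Second derivatives of \<open>cut\<close> live where 1 <= hn y <= 4, and there 1 -
  cut(dil 2 y) = 1. After rescaling, the sublaplacian of the cutoff at radius R is bounded by the
  tail weight at radius R/2.\<close>

lemma lapcut_bound: obtains C where "0 \<le> C" "\<And>y. \<bar>lapcut y\<bar> \<le> C * (1 - cut (dil 2 y))"
proof -
  have z1: "lapcut y = 0" if "hn y < 1" for y
  proof -
    have op: "open {y. hn y < 1}" using smooth_continuous[OF smooth_hn] by (intro open_Collect_less) auto
    have "lv (zt i) cut y = 0" if "hn y < 1" for i y
      by (rule lv_locally_const[OF op]) (use that cut_1 in auto)
    then have "lv (zt i) (lv (zt i) cut) y = 0" for i
      by (intro lv_locally_const[OF op]) (use that in auto)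
    then show ?thesis by (simp add: lapcut_def)
  qed
  have z2: "lapcut y = 0" if "4 < hn y" for y
  proof -
    have op: "open {y. 4 < hn y}" using smooth_continuous[OF smooth_hn] by (intro open_Collect_less) auto
    have "lv (zt i) cut y = 0" if "4 < hn y" for i y
      by (rule lv_locally_const[OF op]) (use that cut_0 in auto)
    then have "lv (zt i) (lv (zt i) cut) y = 0" for i
      by (intro lv_locally_const[OF op]) (use that in auto)
    then show ?thesis by (simp add: lapcut_def)
  qed
  have "smooth lapcut" unfolding lapcut_def[abs_def] by (intro smooth_sum smooth_lv smooth_cut)
  moreover have "bounded {x. lapcut x \<noteq> 0}"
    by (rule bounded_subset[OF bounded_hn[of 4]]) (use z2 in \<open>force simp: not_less[symmetric]\<close>)
  ultimately obtain C where C: "0 \<le> C" "\<And>y. norm (lapcut y) \<le> C"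
    using bounded_support_bound smooth_continuous by metis
  have "\<bar>lapcut y\<bar> \<le> C * (1 - cut (dil 2 y))" for y
  proof (cases "hn y < 1")
    case True then show ?thesis using z1 C(1) cut_bounds[of "dil 2 y"] by simp
  next
    case False
    then have "cut (dil 2 y) = 0" using hn_dil_2[of y] by (intro cut_0) simp
    then show ?thesis using C(2)[of y] by simp
  qed
  then show thesis using that C(1) by blast
qed

text \<open>The heat equation for the cutoff bounds the tail at radius R and time s by C s / (4 R^2)
  times a bound for the tails at radius R/2 up to time s. Each pass of the induction gains a factor
  R^-2.\<close>

lemma tail_decay:
  assumes "0 < t"
  shows "\<exists>A\<ge>0. \<forall>R>0. \<forall>s. 0 < s \<longrightarrow> s \<le> t \<longrightarrow> tailp R s \<le> A / R ^ (2 * q)"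
proof (induction q)
  case 0 then show ?case using tailp_le_1 by (intro exI[of _ 1]) auto
next
  case (Suc q)
  then obtain A where A: "0 \<le> A" "\<And>R s. 0 < R \<Longrightarrow> 0 < s \<Longrightarrow> s \<le> t \<Longrightarrow> tailp R s \<le> A / R ^ (2 * q)" by blast
  obtain C where C: "0 \<le> C" "\<And>y. \<bar>lapcut y\<bar> \<le> C * (1 - cut (dil 2 y))" using lapcut_bound by blast
  let ?A = "C * A * 2 ^ (2 * q) / 4 * t"
  have "tailp R s \<le> ?A / R ^ (2 * Suc q)" if R: "0 < R" and s: "0 < s" "s \<le> t" for R s
  proof -
    let ?f = "\<lambda>x. complex_of_real (cutR R x)"
    let ?B = "C * A * 2 ^ (2 * q) / R ^ (2 * Suc q)"
    have B: "cmod (PP u (lap ?f) 0) \<le> ?B" if u: "0 < u" "u \<le> s" for u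
    proof -
      have "cmod (PP u (lap ?f) 0) \<le> integral\<^sup>L lborel (\<lambda>y. cmod (lap ?f (0 \<odot> (- y)) * complex_of_real (rho u y)))"
        unfolding heat_conv_def by (rule integral_norm_bound)
      also have "\<dots> \<le> integral\<^sup>L lborel (\<lambda>y. C * (1 / R)\<^sup>2 * ((1 - cutR (R / 2) y) * rho u y))"
      proof (rule integral_mono)
        have tl: "test_fn (lap ?f)" by (rule test_fn_lap[OF test_fn_cutR[OF R]])
        obtain D where D: "\<And>x. cmod (lap ?f x) \<le> D" using test_fn_bounded[OF tl] by blast
        have "integrable lborel (\<lambda>y. lap ?f (- y) * complex_of_real (rho u y))"
          by (rule rho_mult_integrable[OF u(1), of _ D])
             (use D smooth_borel[OF test_fn_smooth[OF test_fn_minus_arg[OF tl]]] in auto)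
        then show "integrable lborel (\<lambda>y. cmod (lap ?f (0 \<odot> (- y)) * complex_of_real (rho u y)))" by simp
        show "integrable lborel (\<lambda>y. C * (1 / R)\<^sup>2 * ((1 - cutR (R / 2) y) * rho u y))"
          using cutR_rho_integrable[OF u(1)] by simp
        fix y
        have "cmod (lap ?f (- y)) \<le> (1 / R)\<^sup>2 * (C * (1 - cut (dil 2 (dil (1 / R) (- y)))))"
          unfolding lap_cutR norm_of_real abs_mult using C(2)[of "dil (1 / R) (- y)"] by (intro mult_mono) auto
        also have "cut (dil 2 (dil (1 / R) (- y))) = cutR (R / 2) y"
          using cutR_minus[of "R / 2" y] by (simp add: cutR_def dil_dil)
        finally have "cmod (lap ?f (- y)) \<le> C * (1 / R)\<^sup>2 * (1 - cutR (R / 2) y)" by (simp add: mult_ac)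
        then show "cmod (lap ?f (0 \<odot> (- y)) * complex_of_real (rho u y)) \<le> C * (1 / R)\<^sup>2 * ((1 - cutR (R / 2) y) * rho u y)"
          using rho_pos[OF u(1), of y] mult_right_mono[of _ _ "rho u y"] by (simp add: norm_mult mult.assoc[symmetric])
      qed
      also have "\<dots> = C * (1 / R)\<^sup>2 * tailp (R / 2) u" by (simp add: tailp_def)
      also have "\<dots> \<le> C * (1 / R)\<^sup>2 * (A / (R / 2) ^ (2 * q))"
        using A(2)[of "R / 2" u] R u s C(1) by (intro mult_left_mono) auto
      also have "\<dots> = ?B" using R by (simp add: power_divide field_simps power2_eq_square)
      finally show ?thesis .
    qed
    have "cmod (PP s ?f 0 - ?f 0) \<le> ?B / 4 * s" by (rule PP_near_0[OF test_fn_cutR[OF R] s(1) B])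
    also have "PP s ?f 0 - ?f 0 = complex_of_real (- tailp R s)" by (simp add: PP_cutR[OF s(1)])
    finally have "tailp R s \<le> ?B / 4 * s" using tailp_nonneg[OF s(1), of R] by (simp add: norm_of_real)
    also have "\<dots> \<le> ?B / 4 * t" using s A(1) C(1) R by (intro mult_left_mono) auto
    also have "\<dots> = ?A / R ^ (2 * Suc q)" by simp
    finally show ?thesis .
  qed
  then show ?case using A(1) C(1) assms by (intro exI[of _ ?A]) auto
qed

lemma moment_bound:
  assumes "0 < t"
  obtains C where "0 \<le> C" "\<And>s. 0 < s \<Longrightarrow> s \<le> t \<Longrightarrow> (\<integral>\<^sup>+y. ennreal ((1 + norm y) ^ q * rho s y) \<partial>lborel) \<le> ennreal C"
proof -
  \<comment> \<open>On the j-th dyadic shell the norm is at most of order 2^(m(j+1)), so its q-th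
    power grows like 2^(mqj). Tail decay 2^(-2Kj) beats this and leaves a factor 2^-j to
    sum.\<close>
  define K where "K = m * q + 1"
  obtain A where A: "0 \<le> A" "\<And>R s. 0 < R \<Longrightarrow> 0 < s \<Longrightarrow> s \<le> t \<Longrightarrow> tailp R s \<le> A / R ^ (2 * K)"
    using tail_decay[OF assms, of K] by blast
  define b where "b = (1 + 2 * sqrt (real m))"
  have b1: "1 \<le> b" by (simp add: b_def)
  define a where "a j = (b * 2 ^ (m * (j + 1))) ^ q" for j :: nat
  have a0: "0 \<le> a j" for j using b1 by (simp add: a_def)
  have nb: "1 + norm y \<le> b * c" if "hn y \<le> 4 * c\<^sup>2" "1 \<le> c" for y c
  proof -
    have "(norm y)\<^sup>2 \<le> real m * (4 * c\<^sup>2)" using norm_le_hn[of y] mult_left_mono[OF that(1), of "real m"] by simp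
    also have "\<dots> = (2 * sqrt (real m) * c)\<^sup>2" by (simp add: power_mult_distrib)
    finally have "norm y \<le> 2 * sqrt (real m) * c" by (rule power2_le_imp_le) (use that(2) in simp)
    then show ?thesis using that(2) by (simp add: b_def algebra_simps)
  qed
  have pt: "ennreal ((1 + norm y) ^ q) \<le> ennreal (b ^ q) + (\<Sum>j. ennreal (a j * (1 - cutR (2 ^ j) y)))" for y
  proof (cases "hn y < 4")
    case True
    then have "(1 + norm y) ^ q \<le> b ^ q" using nb[of y 1] by (intro power_mono) auto
    then show ?thesis by (simp add: ennreal_leI add_increasing2)
  next
    case False
    have ex: "\<exists>j. hn y < 4 * (2 ^ (m * (j + 1)))\<^sup>2"
    proof -
      obtain n where n: "hn y < 2 ^ n" using real_arch_pow[of 2 "hn y"] by auto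
      have "n \<le> m * (n + 1)" using mult_le_mono[of 1 m n "n + 1"] m_pos by simp
      then have "(2::real) ^ n \<le> 2 ^ (m * (n + 1))" by (intro power_increasing) auto
      also have "\<dots> \<le> (2 ^ (m * (n + 1)))\<^sup>2" by (simp add: power2_eq_square)
      also have "\<dots> \<le> 4 * (2 ^ (m * (n + 1)))\<^sup>2" by simp
      finally show ?thesis using n by (intro exI[of _ n]) linarith
    qed
    \<comment> \<open>The index of the dyadic shell containing y. There \<open>cutR (2 ^ j)\<close>
      vanishes, so the j-th term of the series alone dominates.\<close>
    define j where "j = (LEAST j. hn y < 4 * (2 ^ (m * (j + 1)))\<^sup>2)"
    have j1: "hn y < 4 * (2 ^ (m * (j + 1)))\<^sup>2" unfolding j_def by (rule LeastI_ex[OF ex])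
    have j2: "4 * (2 ^ (m * j))\<^sup>2 \<le> hn y"
    proof (cases j)
      case 0 then show ?thesis using False by simp
    next
      case (Suc i)
      then have "i < j" by simp
      then have "\<not> hn y < 4 * (2 ^ (m * (i + 1)))\<^sup>2" unfolding j_def by (rule not_less_Least)
      then show ?thesis using Suc by simp
    qed
    have "cutR (2 ^ j) y = 0" by (rule cutR_0_far) (use j2 in \<open>auto simp: power_mult[symmetric] mult.commute\<close>)
    then have "ennreal (a j) = ennreal (a j * (1 - cutR (2 ^ j) y))" by simp
    also have "\<dots> \<le> (\<Sum>j. ennreal (a j * (1 - cutR (2 ^ j) y)))"
      using sum_le_suminf[of "\<lambda>j. ennreal (a j * (1 - cutR (2 ^ j) y))" "{j}"] by simp
    finally have "ennreal (a j) \<le> (\<Sum>j. ennreal (a j * (1 - cutR (2 ^ j) y)))" .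
    moreover have "(1 + norm y) ^ q \<le> a j"
      unfolding a_def using nb[of y "2 ^ (m * (j + 1))"] j1 by (intro power_mono) auto
    ultimately show ?thesis by (meson add_increasing ennreal_leI order_trans zero_le)
  qed
  let ?C = "b ^ q + 2 * ((b * 2 ^ m) ^ q * A)"
  have "(\<integral>\<^sup>+y. ennreal ((1 + norm y) ^ q * rho s y) \<partial>lborel) \<le> ennreal ?C" if s: "0 < s" "s \<le> t" for s
  proof -
    have [measurable]: "rho s \<in> borel_measurable borel" by (rule rho_borel[OF s(1)])
    have [measurable]: "cutR R \<in> borel_measurable borel" for R by (rule smooth_borel[OF smooth_cutR])
    have r0: "0 \<le> rho s y" for y using rho_pos[OF s(1)] less_imp_le by blast
    have "(\<integral>\<^sup>+y. ennreal ((1 + norm y) ^ q * rho s y) \<partial>lborel)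
       \<le> (\<integral>\<^sup>+y. (ennreal (b ^ q) * ennreal (rho s y) + (\<Sum>j. ennreal (a j * ((1 - cutR (2 ^ j) y) * rho s y)))) \<partial>lborel)"
    proof (rule nn_integral_mono)
      fix y
      have "ennreal ((1 + norm y) ^ q * rho s y) = ennreal ((1 + norm y) ^ q) * ennreal (rho s y)"
        by (simp add: ennreal_mult r0)
      also have "\<dots> \<le> (ennreal (b ^ q) + (\<Sum>j. ennreal (a j * (1 - cutR (2 ^ j) y)))) * ennreal (rho s y)"
        by (rule mult_right_mono[OF pt]) simp
      also have "\<dots> = ennreal (b ^ q) * ennreal (rho s y) + (\<Sum>j. ennreal (a j * (1 - cutR (2 ^ j) y)) * ennreal (rho s y))"
        by (simp add: distrib_right)
      also have "(\<Sum>j. ennreal (a j * (1 - cutR (2 ^ j) y)) * ennreal (rho s y)) = (\<Sum>j. ennreal (a j * ((1 - cutR (2 ^ j) y) * rho s y)))"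
        using a0 cutR_bounds r0 by (intro suminf_cong) (simp add: ennreal_mult[symmetric] mult.assoc)
      finally show "ennreal ((1 + norm y) ^ q * rho s y) \<le> ennreal (b ^ q) * ennreal (rho s y) + (\<Sum>j. ennreal (a j * ((1 - cutR (2 ^ j) y) * rho s y)))" .
    qed
    also have "\<dots> = ennreal (b ^ q) * (\<integral>\<^sup>+y. ennreal (rho s y) \<partial>lborel) + (\<Sum>j. \<integral>\<^sup>+y. ennreal (a j * ((1 - cutR (2 ^ j) y) * rho s y)) \<partial>lborel)"
      by (subst nn_integral_add) (auto simp: nn_integral_cmult nn_integral_suminf)
    also have "(\<integral>\<^sup>+y. ennreal (rho s y) \<partial>lborel) = 1"
      using nn_integral_eq_integral[OF rho_integrable[OF s(1)]] r0 rho_integral[OF s(1)] by simp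
    also have "(\<Sum>j. \<integral>\<^sup>+y. ennreal (a j * ((1 - cutR (2 ^ j) y) * rho s y)) \<partial>lborel) \<le> (\<Sum>j. ennreal ((b * 2 ^ m) ^ q * A * (1/2) ^ j))"
    proof (intro suminf_le allI)
      fix j
      have "(\<integral>\<^sup>+y. ennreal (a j * ((1 - cutR (2 ^ j) y) * rho s y)) \<partial>lborel) = ennreal (a j * tailp (2 ^ j) s)"
        unfolding tailp_def using cutR_rho_integrable(1)[OF s(1)] a0 cutR_bounds r0
        by (subst nn_integral_eq_integral) auto
      also have "a j * tailp (2 ^ j) s \<le> a j * (A / (2 ^ j) ^ (2 * K))"
        using A(2)[of "2 ^ j" s] s a0 by (intro mult_left_mono) auto
      also have "\<dots> = (b * 2 ^ m) ^ q * A * (2 ^ (m * q * j) / 2 ^ (j * (2 * K)))"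
        by (simp add: a_def power_mult_distrib power_add distrib_left power_mult[symmetric] mult_ac)
      also have "\<dots> \<le> (b * 2 ^ m) ^ q * A * (1/2) ^ j"
      proof (rule mult_left_mono)
        have "(2::real) ^ (m * q * j) * 2 ^ j = 2 ^ (m * q * j + j)" by (simp add: power_add)
        also have "\<dots> \<le> 2 ^ (j * (2 * K))" by (intro power_increasing) (auto simp: K_def algebra_simps)
        finally show "2 ^ (m * q * j) / 2 ^ (j * (2 * K)) \<le> (1 / 2 :: real) ^ j" by (simp add: field_simps power_divide)
        show "0 \<le> (b * 2 ^ m) ^ q * A" using b1 A(1) by simp
      qed
      finally show "(\<integral>\<^sup>+y. ennreal (a j * ((1 - cutR (2 ^ j) y) * rho s y)) \<partial>lborel) \<le> ennreal ((b * 2 ^ m) ^ q * A * (1/2) ^ j)"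
        by (simp add: ennreal_leI)
    qed auto
    also have "(\<Sum>j. ennreal ((b * 2 ^ m) ^ q * A * (1/2) ^ j)) = ennreal (\<Sum>j. (b * 2 ^ m) ^ q * A * (1/2) ^ j)"
      using b1 A(1) by (intro suminf_ennreal2) (auto intro!: summable_mult summable_geometric)
    also have "(\<Sum>j. (b * 2 ^ m) ^ q * A * (1/2) ^ j) = 2 * ((b * 2 ^ m) ^ q * A)"
      by (subst suminf_mult) (auto simp: summable_geometric suminf_geometric)
    also have "ennreal (b ^ q) * 1 + ennreal (2 * ((b * 2 ^ m) ^ q * A)) = ennreal ?C"
      using b1 A(1) by (simp add: ennreal_plus[symmetric] del: ennreal_plus)
    finally show ?thesis by simp
  qed
  moreover have "0 \<le> ?C" using b1 A(1) by simp
  ultimately show thesis using that by blast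
qed

lemma moment_integrable:
  assumes "0 < s" shows "integrable lborel (\<lambda>y. (1 + norm y) ^ q * rho s y)"
proof (rule integrableI_bounded)
  show "(\<lambda>y. (1 + norm y) ^ q * rho s y) \<in> borel_measurable lborel" using rho_borel[OF assms] by measurable
  obtain C where C: "(\<integral>\<^sup>+y. ennreal ((1 + norm y) ^ q * rho s y) \<partial>lborel) \<le> ennreal C"
    using moment_bound[OF assms, of q] assms by blast
  have "(\<integral>\<^sup>+y. ennreal (norm ((1 + norm y) ^ q * rho s y)) \<partial>lborel) = (\<integral>\<^sup>+y. ennreal ((1 + norm y) ^ q * rho s y) \<partial>lborel)"
    using rho_pos[OF assms] by (intro nn_integral_cong) (simp add: abs_mult less_imp_le)
  then show "(\<integral>\<^sup>+y. ennreal (norm ((1 + norm y) ^ q * rho s y)) \<partial>lborel) < \<infinity>"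
    using C by (simp add: le_less_trans)
qed

lemma moment_bound_integral:
  assumes "0 < t"
  obtains C where "0 \<le> C" "\<And>s. 0 < s \<Longrightarrow> s \<le> t \<Longrightarrow> integral\<^sup>L lborel (\<lambda>y. (1 + norm y) ^ q * rho s y) \<le> C"
proof -
  obtain C where C: "0 \<le> C" "\<And>s. 0 < s \<Longrightarrow> s \<le> t \<Longrightarrow> (\<integral>\<^sup>+y. ennreal ((1 + norm y) ^ q * rho s y) \<partial>lborel) \<le> ennreal C"
    using moment_bound[OF assms, of q] by blast
  have "integral\<^sup>L lborel (\<lambda>y. (1 + norm y) ^ q * rho s y) \<le> C" if "0 < s" "s \<le> t" for s
  proof -
    have "ennreal (integral\<^sup>L lborel (\<lambda>y. (1 + norm y) ^ q * rho s y)) \<le> ennreal C"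
      using C(2)[OF that] rho_pos[OF that(1)] by (subst nn_integral_eq_integral[symmetric, OF moment_integrable[OF that(1)]]) (auto simp: less_imp_le)
    then show ?thesis using C(1) by simp
  qed
  then show thesis using that C(1) by blast
qed

end

section \<open>Symmetry and the convolution semigroup\<close>

text \<open>A quadratic modulus of continuity forces a zero derivative. It replaces differentiation
  of a function of two times along a line, where only Taylor estimates in each time separately are
  available.\<close>

lemma square_bound_imp_const:
  fixes f :: "real \<Rightarrow> 'a::real_normed_vector"
  assumes S: "open S" "convex S" and b: "\<And>x y. x \<in> S \<Longrightarrow> y \<in> S \<Longrightarrow> norm (f y - f x) \<le> C * (y - x)\<^sup>2"
    and xy: "x \<in> S" "y \<in> S"
  shows "f x = f y"
proof (rule has_derivative_zero_unique[OF S(2) _ xy])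
  fix z assume z: "z \<in> S"
  have "((\<lambda>y. norm (f y - f z) / norm (y - z)) \<longlongrightarrow> 0) (at z)"
  proof (rule Lim_null_comparison)
    show "((\<lambda>y. \<bar>C\<bar> * \<bar>y - z\<bar>) \<longlongrightarrow> 0) (at z)" by (auto intro!: tendsto_eq_intros)
    have "\<forall>\<^sub>F y in at z. y \<in> S" using S(1) z by (simp add: eventually_at_topological) blast
    then show "\<forall>\<^sub>F y in at z. norm (norm (f y - f z) / norm (y - z)) \<le> \<bar>C\<bar> * \<bar>y - z\<bar>"
    proof eventually_elim
      fix y assume "y \<in> S"
      then have *: "norm (f y - f z) \<le> \<bar>C\<bar> * (y - z)\<^sup>2"
        using b[OF z, of y] mult_right_mono[OF abs_ge_self[of C], of "(y - z)\<^sup>2"] by simp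
      show "norm (norm (f y - f z) / norm (y - z)) \<le> \<bar>C\<bar> * \<bar>y - z\<bar>"
      proof (cases "y = z")
        case False
        have "(y - z)\<^sup>2 = \<bar>y - z\<bar> * \<bar>y - z\<bar>" by (metis power2_abs power2_eq_square)
        then have "norm (f y - f z) \<le> (\<bar>C\<bar> * \<bar>y - z\<bar>) * \<bar>y - z\<bar>" using * by (simp add: mult.assoc)
        then show ?thesis using False by (simp add: pos_divide_le_eq)
      qed simp
    qed
  qed
  then show "(f has_derivative (\<lambda>h. 0)) (at z within S)"
    using has_derivative_iff_norm[of f "\<lambda>h. 0" z UNIV] has_derivative_at_withinI[of f "\<lambda>h. 0" z S] by simp
qed

context heat_group
begin

section \<open>Growth of the adjoint action\<close>

lemma continuous_br_funpow: "continuous_on UNIV (\<lambda>y. (br (- y) ^^ n) v)"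
proof (induction n)
  case (Suc n)
  then show ?case by (auto intro!: bounded_bilinear.continuous_on[OF bounded_bilinear_br] continuous_intros)
qed simp

lemma Adj_sum: "Adj x v = (\<Sum>n<K. (1 / fact n) *\<^sub>R (br x ^^ n) v)"
  using Adj_eq[of 1 x v] by simp

lemma continuous_Adj: "continuous_on UNIV (\<lambda>y. Adj (- y) v)"
  unfolding Adj_sum by (intro continuous_intros continuous_br_funpow)

text \<open>The exponential series stops after the m-th power of ad(-y), so the growth is polynomial
  of degree m and the moments of the kernel absorb it.\<close>

lemma Adj_bound: obtains B where "0 \<le> B" "\<And>y v. norm (Adj (- y) v) \<le> B * (1 + norm y) ^ m * norm v"
proof -
  obtain B0 where "0 < B0" and B0: "\<And>x y. norm (br x y) \<le> norm x * norm y * B0"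
    using bounded_bilinear.pos_bounded[OF bounded_bilinear_br] by blast
  define B where "B = max B0 1"
  have B: "norm (br x y) \<le> B * norm x * norm y" "1 \<le> B" for x y
  proof -
    have "norm (br x y) \<le> norm x * norm y * B0" by (rule B0)
    also have "\<dots> \<le> norm x * norm y * B" by (intro mult_left_mono) (auto simp: B_def)
    finally show "norm (br x y) \<le> B * norm x * norm y" by (simp add: mult_ac)
  qed (simp add: B_def)
  have p: "norm ((br (- y) ^^ n) v) \<le> (B * norm y) ^ n * norm v" for y v n
  proof (induction n)
    case (Suc n)
    have "norm ((br (- y) ^^ Suc n) v) \<le> B * norm y * norm ((br (- y) ^^ n) v)" using B(1)[of "- y"] by simp
    also have "\<dots> \<le> B * norm y * ((B * norm y) ^ n * norm v)" using Suc B(2) by (intro mult_left_mono) auto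
    finally show ?case by (simp add: mult_ac)
  qed simp
  have "norm (Adj (- y) v) \<le> (real K * B ^ m) * (1 + norm y) ^ m * norm v" for y v
  proof -
    have "norm (Adj (- y) v) \<le> (\<Sum>n<K. (B * (1 + norm y)) ^ m * norm v)"
      unfolding Adj_sum
    proof (rule sum_norm_le)
      fix n assume n: "n \<in> {..<K}"
      have "norm ((1 / fact n) *\<^sub>R (br (- y) ^^ n) v) \<le> norm ((br (- y) ^^ n) v)"
        using mult_left_mono[OF fact_ge_1, of "norm ((br (- y) ^^ n) v)" n] by (simp add: divide_le_eq)
      also have "\<dots> \<le> (B * norm y) ^ n * norm v" by (rule p)
      also have "\<dots> \<le> (B * (1 + norm y)) ^ n * norm v"
        using B(2) by (intro mult_right_mono power_mono mult_left_mono) auto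
      also have "\<dots> \<le> (B * (1 + norm y)) ^ m * norm v"
      proof (intro mult_right_mono power_increasing)
        show "1 \<le> B * (1 + norm y)" using B(2) mult_mono[of 1 B 1 "1 + norm y"] by simp
      qed (use n in auto)
      finally show "norm ((1 / fact n) *\<^sub>R (br (- y) ^^ n) v) \<le> (B * (1 + norm y)) ^ m * norm v" .
    qed
    also have "\<dots> = (real K * B ^ m) * (1 + norm y) ^ m * norm v" by (simp add: power_mult_distrib del: sum.lessThan_Suc)
    finally show ?thesis .
  qed
  moreover have "0 \<le> real K * B ^ m" using B(2) by simp
  ultimately show thesis using that by blast
qed

definition polyb :: "(complex^'n \<Rightarrow> complex) \<Rightarrow> bool" where
  "polyb c \<longleftrightarrow> (\<exists>C\<ge>0. \<exists>q. \<forall>y. cmod (c y) \<le> C * (1 + norm y) ^ q)"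

lemma polyb_mult: "polyb c \<Longrightarrow> polyb d \<Longrightarrow> polyb (\<lambda>y. c y * d y)"
proof -
  assume "polyb c" "polyb d"
  then obtain C p D q where C: "0 \<le> C" "\<And>y. cmod (c y) \<le> C * (1 + norm y) ^ p" and D: "0 \<le> D" "\<And>y. cmod (d y) \<le> D * (1 + norm y) ^ q"
    unfolding polyb_def by blast
  have "cmod (c y * d y) \<le> C * D * (1 + norm y) ^ (p + q)" for y
  proof -
    have "cmod (c y * d y) \<le> (C * (1 + norm y) ^ p) * (D * (1 + norm y) ^ q)"
      unfolding norm_mult using C D by (intro mult_mono) auto
    then show ?thesis by (simp add: power_add mult_ac)
  qed
  then show ?thesis unfolding polyb_def using C(1) D(1) mult_nonneg_nonneg by blast
qed

lemma polyb_Adj: "polyb (\<lambda>y. complex_of_real (Adj (- y) v \<bullet> b))"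
proof -
  obtain B where B: "0 \<le> B" "\<And>y v. norm (Adj (- y) v) \<le> B * (1 + norm y) ^ m * norm v" using Adj_bound by blast
  have "cmod (complex_of_real (Adj (- y) v \<bullet> b)) \<le> (B * norm v * norm b) * (1 + norm y) ^ m" for y
  proof -
    have "cmod (complex_of_real (Adj (- y) v \<bullet> b)) \<le> norm (Adj (- y) v) * norm b"
      using Cauchy_Schwarz_ineq2 by simp
    also have "\<dots> \<le> B * (1 + norm y) ^ m * norm v * norm b" using B by (intro mult_right_mono) auto
    finally show ?thesis by (simp add: mult_ac)
  qed
  then show ?thesis unfolding polyb_def using B(1) by (intro exI[of _ "B * norm v * norm b"] conjI exI[of _ m]) auto
qed

text \<open>Differentiating a right translate along a left-invariant field produces the entries of the
  adjoint action of the translating element, hence the polynomially bounded coefficients.\<close>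

inductive polytest :: "(complex^'n \<Rightarrow> complex^'n \<Rightarrow> complex) \<Rightarrow> bool" where
  base: "test_fn \<phi> \<Longrightarrow> continuous_on UNIV c \<Longrightarrow> polyb c \<Longrightarrow> polytest (\<lambda>y x. c y * \<phi> (x \<odot> y))"
| add: "polytest \<Psi> \<Longrightarrow> polytest \<Psi>' \<Longrightarrow> polytest (\<lambda>y x. \<Psi> y x + \<Psi>' y x)"

lemma polyb_const: "polyb (\<lambda>y. a)"
  unfolding polyb_def by (intro exI[of _ "cmod a"] conjI exI[of _ 0]) auto

lemma polytest_translate: "test_fn \<phi> \<Longrightarrow> polytest (\<lambda>y x. \<phi> (x \<odot> y))"
  using polytest.base[of \<phi> "\<lambda>y. 1"] polyb_const[of 1] by simp

lemma polytest_sum: "finite I \<Longrightarrow> (\<And>i. i \<in> I \<Longrightarrow> polytest (\<Psi> i)) \<Longrightarrow> polytest (\<lambda>y x. \<Sum>i\<in>I. \<Psi> i y x)"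
proof (induction I rule: finite_induct)
  case empty then show ?case using polytest.base[OF test_fn_zero continuous_on_const polyb_const] by simp
next
  case (insert i I) then show ?case by (simp add: polytest.add)
qed

lemma polytest_test: "polytest \<Psi> \<Longrightarrow> test_fn (\<Psi> y)"
  by (induction rule: polytest.induct)
     (auto intro!: test_fn_add test_fn_smooth_mult[OF smooth_const] test_fn_right_translate)

lemma polytest_continuous: "polytest \<Psi> \<Longrightarrow> continuous_on UNIV (\<lambda>z. \<Psi> (snd z) (fst z))"
proof (induction rule: polytest.induct)
  case (base \<phi> c)
  have "continuous_on UNIV (\<lambda>z. \<phi> (fst z \<odot> snd z))"
    by (rule continuous_on_compose2[OF smooth_continuous[OF test_fn_smooth[OF base(1)]]])
       (auto intro!: continuous_mul continuous_intros)
  moreover have "continuous_on UNIV (\<lambda>z::_\<times>_. c (snd z))"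
    by (rule continuous_on_compose2[OF base(2)]) (auto intro!: continuous_intros)
  ultimately show ?case by (intro continuous_intros) auto
qed (intro continuous_intros)

lemma polytest_bound: "polytest \<Psi> \<Longrightarrow> \<exists>C\<ge>0. \<exists>q. \<forall>x y. cmod (\<Psi> y x) \<le> C * (1 + norm y) ^ q"
proof (induction rule: polytest.induct)
  case (base \<phi> c)
  obtain D where D: "0 \<le> D" "\<And>x. cmod (\<phi> x) \<le> D" using test_fn_bounded[OF base(1)] by blast
  obtain C q where C: "0 \<le> C" "\<And>y. cmod (c y) \<le> C * (1 + norm y) ^ q" using base(3) unfolding polyb_def by blast
  have "cmod (c y * \<phi> (x \<odot> y)) \<le> (C * D) * (1 + norm y) ^ q" for x y
  proof -
    have "cmod (c y * \<phi> (x \<odot> y)) \<le> (C * (1 + norm y) ^ q) * D"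
      unfolding norm_mult using C D by (intro mult_mono) auto
    then show ?thesis by (simp add: mult_ac)
  qed
  then show ?case using C(1) D(1) mult_nonneg_nonneg by blast
next
  case (add \<Psi> \<Psi>')
  obtain C p where C: "0 \<le> C" "\<And>x y. cmod (\<Psi> y x) \<le> C * (1 + norm y) ^ p" using add.IH(1) by blast
  obtain D q where D: "0 \<le> D" "\<And>x y. cmod (\<Psi>' y x) \<le> D * (1 + norm y) ^ q" using add.IH(2) by blast
  have "cmod (\<Psi> y x + \<Psi>' y x) \<le> (C + D) * (1 + norm y) ^ (p + q)" for x y
  proof -
    have "cmod (\<Psi> y x + \<Psi>' y x) \<le> C * (1 + norm y) ^ p + D * (1 + norm y) ^ q"
      using C(2) D(2) norm_triangle_mono by blast
    also have "\<dots> \<le> C * (1 + norm y) ^ (p + q) + D * (1 + norm y) ^ (p + q)"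
      using C(1) D(1) by (intro add_mono mult_left_mono power_increasing) auto
    finally show ?thesis by (simp add: distrib_right)
  qed
  then show ?case using C(1) D(1) add_nonneg_nonneg by blast
qed

lemma polytest_lv: "polytest \<Psi> \<Longrightarrow> polytest (\<lambda>y. lv v (\<Psi> y))"
proof (induction rule: polytest.induct)
  case (base \<phi> c)
  have s: "smooth (\<lambda>x. \<phi> (x \<odot> y))" for y by (rule test_fn_smooth[OF test_fn_right_translate[OF base(1)]])
  have "lv v (\<lambda>x. c y * \<phi> (x \<odot> y)) x
     = (\<Sum>b\<in>Basis. (c y * complex_of_real (Adj (- y) v \<bullet> b)) * lv b \<phi> (x \<odot> y))" for x y
  proof -
    have "Adj (- y) v = (\<Sum>b\<in>Basis. (Adj (- y) v \<bullet> b) *\<^sub>R b)" by (simp add: euclidean_representation)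
    then have "lv (Adj (- y) v) \<phi> (x \<odot> y) = (\<Sum>b\<in>Basis. (Adj (- y) v \<bullet> b) *\<^sub>R lv b \<phi> (x \<odot> y))"
      using lv_sum_vec[OF test_fn_smooth[OF base(1)], of "\<lambda>b. Adj (- y) v \<bullet> b" "\<lambda>b. b" Basis "x \<odot> y"] by simp
    then show ?thesis
      by (simp add: lv_cmult[OF s] lv_right_translate sum_distrib_left scaleR_conv_of_real mult.assoc)
  qed
  then have "(\<lambda>y. lv v (\<lambda>x. c y * \<phi> (x \<odot> y)))
     = (\<lambda>y x. \<Sum>b\<in>Basis. (c y * complex_of_real (Adj (- y) v \<bullet> b)) * lv b \<phi> (x \<odot> y))" by auto
  moreover have "polytest (\<lambda>y x. \<Sum>b\<in>Basis. (c y * complex_of_real (Adj (- y) v \<bullet> b)) * lv b \<phi> (x \<odot> y))"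
    by (intro polytest_sum polytest.base test_fn_lv base polyb_mult polyb_Adj continuous_intros continuous_Adj finite_Basis)
  ultimately show ?case by simp
next
  case (add \<Psi> \<Psi>')
  have "(\<lambda>y. lv v (\<lambda>x. \<Psi> y x + \<Psi>' y x)) = (\<lambda>y x. lv v (\<Psi> y) x + lv v (\<Psi>' y) x)"
    by (intro ext) (rule lv_add[OF test_fn_smooth[OF polytest_test[OF add.hyps(1)]] test_fn_smooth[OF polytest_test[OF add.hyps(2)]]])
  then show ?case using polytest.add[OF add.IH] by simp
qed

lemma polytest_lap: "polytest \<Psi> \<Longrightarrow> polytest (\<lambda>y. lap (\<Psi> y))"
  unfolding lap_eq[abs_def] by (intro polytest_sum polytest_lv) auto

text \<open>The second time derivative is controlled by the supremum of the twice applied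
  sublaplacian, because the semigroup is a contraction; the remainder is therefore uniform in r and
  x.\<close>

lemma PP_taylor:
  assumes f: "test_fn f" and r: "0 < r" and h: "0 \<le> h" and B: "\<And>x. cmod (lap (lap f) x) \<le> B"
  shows "cmod (PP (r + h) f x - PP r f x - (h / 4) *\<^sub>R PP r (lap f) x) \<le> B * h\<^sup>2"
proof -
  have B0: "0 \<le> B" using B[of 0] norm_ge_zero order_trans by blast
  let ?G = "\<lambda>u. PP u f x - (u / 4) *\<^sub>R PP r (lap f) x"
  have "norm (?G (r + h) - ?G r) \<le> (B * h) * norm ((r + h) - r)"
  proof (rule differentiable_bound[of "{r..r+h}" ?G "\<lambda>u t. t *\<^sub>R ((1/4) *\<^sub>R PP u (lap f) x - (1/4) *\<^sub>R PP r (lap f) x)"])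
    fix u assume u: "u \<in> {r..r+h}"
    have "((\<lambda>u. (u / 4) *\<^sub>R PP r (lap f) x) has_vector_derivative (1/4) *\<^sub>R PP r (lap f) x) (at u)"
      by (auto intro!: derivative_eq_intros simp: has_vector_derivative_def)
    with PP_deriv[OF f, of u x] u r
    have "(?G has_vector_derivative (1/4) *\<^sub>R PP u (lap f) x - (1/4) *\<^sub>R PP r (lap f) x) (at u)"
      by (intro has_vector_derivative_diff) auto
    then show "(?G has_derivative (\<lambda>t. t *\<^sub>R ((1/4) *\<^sub>R PP u (lap f) x - (1/4) *\<^sub>R PP r (lap f) x))) (at u within {r..r+h})"
      by (auto simp: has_vector_derivative_def intro: has_derivative_at_withinI)
    have "cmod (PP u (lap f) x - PP r (lap f) x) \<le> B / 4 * (u - r)"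
      by (rule PP_lipschitz[OF test_fn_lap[OF f]]) (use u r B PP_bound in auto)
    also have "\<dots> \<le> B / 4 * h" using u B0 by (intro mult_left_mono) auto
    finally have "cmod ((1/4) *\<^sub>R PP u (lap f) x - (1/4) *\<^sub>R PP r (lap f) x) \<le> B / 4 * h / 4"
      by (simp add: scaleR_diff_right[symmetric] del: scaleR_diff_right)
    also have "\<dots> \<le> B * h" using B0 h by simp
    finally have *: "cmod ((1/4) *\<^sub>R PP u (lap f) x - (1/4) *\<^sub>R PP r (lap f) x) \<le> B * h" .
    show "onorm (\<lambda>t. t *\<^sub>R ((1/4) *\<^sub>R PP u (lap f) x - (1/4) *\<^sub>R PP r (lap f) x)) \<le> B * h"
      using * by (intro onorm_le) (simp only: norm_scaleR mult.commute[of "B * h"] real_norm_def mult_left_mono abs_ge_zero)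
  qed (use h in auto)
  then show ?thesis using h by (simp add: algebra_simps add_divide_distrib power2_eq_square scaleR_add_left)
qed

text \<open>The integral of \<open>\<Psi> y (- x)\<close> against rho_r(x) rho_s(y) in both
  variables. The sign comes from the inverse in the definition of the semigroup; once the kernel is
  even, translates of a test function give its pairing with the convolution of the two
  kernels.\<close>

definition HH :: "(complex^'n \<Rightarrow> complex^'n \<Rightarrow> complex) \<Rightarrow> real \<Rightarrow> real \<Rightarrow> complex" where
  "HH \<Psi> r s = integral\<^sup>L lborel (\<lambda>y. PP r (\<Psi> y) 0 * complex_of_real (rho s y))"

lemma PP_at_0: "PP r f 0 = integral\<^sup>L lborel (\<lambda>x. f (- x) * complex_of_real (rho r x))"
  by (simp add: heat_conv_def)

text \<open>The integrand is bounded in x and grows polynomially in y; the moments of the kernel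
  make Fubini applicable.\<close>

lemma polytest_integrable_pair:
  assumes \<Psi>: "polytest \<Psi>" and r: "0 < r" and s: "0 < s"
  shows "integrable (lborel \<Otimes>\<^sub>M lborel) (\<lambda>(y, x). \<Psi> y (- x) * complex_of_real (rho r x) * complex_of_real (rho s y))"
proof -
  obtain C q where C: "0 \<le> C" "\<And>x y. cmod (\<Psi> y x) \<le> C * (1 + norm y) ^ q" using polytest_bound[OF \<Psi>] by blast
  have [measurable]: "rho r \<in> borel_measurable borel" "rho s \<in> borel_measurable borel" using rho_borel r s by auto
  have "continuous_on UNIV (\<lambda>z. \<Psi> (fst z) (- snd z))"
  proof -
    have "continuous_on UNIV (\<lambda>z::(complex^'n) \<times> (complex^'n). (- snd z, fst z))"
      by (intro continuous_on_Pair continuous_on_minus continuous_on_snd continuous_on_fst continuous_on_id)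
    from continuous_on_compose2[OF polytest_continuous[OF \<Psi>] this] show ?thesis by simp
  qed
  then have m1[measurable]: "(\<lambda>z. \<Psi> (fst z) (- snd z)) \<in> borel_measurable (borel \<Otimes>\<^sub>M borel)"
    by (subst borel_prod) (rule continuous_borel)
  have meas: "(\<lambda>(y, x). \<Psi> y (- x) * complex_of_real (rho r x) * complex_of_real (rho s y)) \<in> borel_measurable (lborel \<Otimes>\<^sub>M lborel)"
    unfolding case_prod_unfold by measurable
  have ib: "integrable lborel (\<lambda>x. \<Psi> y (- x) * complex_of_real (rho r x))" for y
    by (rule rho_mult_integrable[OF r, of _ "C * (1 + norm y) ^ q"])
       (use C smooth_borel[OF test_fn_smooth[OF test_fn_minus_arg[OF polytest_test[OF \<Psi>]]]] in auto)
  have inner: "integral\<^sup>L lborel (\<lambda>x. norm (\<Psi> y (- x) * complex_of_real (rho r x) * complex_of_real (rho s y))) \<le> C * ((1 + norm y) ^ q * rho s y)" for y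
  proof -
    have "integral\<^sup>L lborel (\<lambda>x. norm (\<Psi> y (- x) * complex_of_real (rho r x) * complex_of_real (rho s y)))
       \<le> integral\<^sup>L lborel (\<lambda>x. C * (1 + norm y) ^ q * rho s y * rho r x)"
    proof (rule integral_mono)
      show "integrable lborel (\<lambda>x. norm (\<Psi> y (- x) * complex_of_real (rho r x) * complex_of_real (rho s y)))"
        using ib[of y] by (intro integrable_norm) auto
      show "integrable lborel (\<lambda>x. C * (1 + norm y) ^ q * rho s y * rho r x)" using rho_integrable[OF r] by simp
      fix x
      have "norm (\<Psi> y (- x)) * rho r x * rho s y \<le> C * (1 + norm y) ^ q * rho r x * rho s y"
        using C(2)[of y "- x"] rho_pos[OF r, of x] rho_pos[OF s, of y] by (intro mult_right_mono) auto
      then show "norm (\<Psi> y (- x) * complex_of_real (rho r x) * complex_of_real (rho s y)) \<le> C * (1 + norm y) ^ q * rho s y * rho r x"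
        using rho_pos[OF r, of x] rho_pos[OF s, of y] by (simp add: norm_mult mult_ac)
    qed
    then show ?thesis using rho_integral[OF r] by (simp add: mult_ac)
  qed
  show ?thesis
  proof (rule lborel_pair.Fubini_integrable[OF meas])
    show "integrable lborel (\<lambda>y. \<integral>x. norm (case (y, x) of (y, x) \<Rightarrow> \<Psi> y (- x) * complex_of_real (rho r x) * complex_of_real (rho s y)) \<partial>lborel)"
    proof (rule Bochner_Integration.integrable_bound[of _ "\<lambda>y. C * ((1 + norm y) ^ q * rho s y)"])
      show "integrable lborel (\<lambda>y. C * ((1 + norm y) ^ q * rho s y))" using moment_integrable[OF s] by simp
      show "(\<lambda>y. \<integral>x. norm (case (y, x) of (y, x) \<Rightarrow> \<Psi> y (- x) * complex_of_real (rho r x) * complex_of_real (rho s y)) \<partial>lborel) \<in> borel_measurable lborel"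
        using meas by (intro lborel.borel_measurable_lebesgue_integral) (auto simp: case_prod_unfold)
      show "AE y in lborel. norm (\<integral>x. norm (case (y, x) of (y, x) \<Rightarrow> \<Psi> y (- x) * complex_of_real (rho r x) * complex_of_real (rho s y)) \<partial>lborel) \<le> norm (C * ((1 + norm y) ^ q * rho s y))"
      proof (rule AE_I2)
        fix y
        have "0 \<le> (\<integral>x. norm (\<Psi> y (- x) * complex_of_real (rho r x) * complex_of_real (rho s y)) \<partial>lborel)"
          by (intro Bochner_Integration.integral_nonneg) auto
        with inner[of y] show "norm (\<integral>x. norm (case (y, x) of (y, x) \<Rightarrow> \<Psi> y (- x) * complex_of_real (rho r x) * complex_of_real (rho s y)) \<partial>lborel) \<le> norm (C * ((1 + norm y) ^ q * rho s y))"
          by simp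
      qed
    qed
    show "AE y in lborel. integrable lborel (\<lambda>x. case (y, x) of (y, x) \<Rightarrow> \<Psi> y (- x) * complex_of_real (rho r x) * complex_of_real (rho s y))"
      using ib by (intro AE_I2) auto
  qed
qed

lemma HH_integrable:
  assumes "polytest \<Psi>" "0 < r" "0 < s"
  shows "integrable lborel (\<lambda>y. PP r (\<Psi> y) 0 * complex_of_real (rho s y))"
proof -
  have "integrable lborel (\<lambda>y. \<integral>x. \<Psi> y (- x) * complex_of_real (rho r x) * complex_of_real (rho s y) \<partial>lborel)"
    using lborel_pair.integrable_fst'[OF polytest_integrable_pair[OF assms]] by simp
  then show ?thesis by (simp add: PP_at_0)
qed

lemma HH_swap:
  assumes \<Psi>: "polytest \<Psi>" and \<Phi>: "polytest \<Phi>" and r: "0 < r" and s: "0 < s" and eq: "\<And>x y. \<Psi> y (- x) = \<Phi> x (- y)"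
  shows "HH \<Psi> r s = HH \<Phi> s r"
proof -
  let ?f = "\<lambda>y x. \<Psi> y (- x) * complex_of_real (rho r x) * complex_of_real (rho s y)"
  have "HH \<Psi> r s = (\<integral>y. \<integral>x. ?f y x \<partial>lborel \<partial>lborel)" by (simp add: HH_def PP_at_0)
  also have "\<dots> = (\<integral>x. \<integral>y. ?f y x \<partial>lborel \<partial>lborel)"
    using lborel_pair.Fubini_integral[OF polytest_integrable_pair[OF \<Psi> r s]] by simp
  also have "\<dots> = (\<integral>x. (\<integral>y. \<Phi> x (- y) * complex_of_real (rho s y) \<partial>lborel) * complex_of_real (rho r x) \<partial>lborel)"
    by (intro Bochner_Integration.integral_cong refl) (simp add: eq mult_ac flip: integral_mult_left_zero)
  finally show ?thesis by (simp add: HH_def PP_at_0)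
qed

text \<open>Both sides are second derivatives at 0 of the curve t -> phi((-x)(tv)y), on one side run
  backwards, and a second derivative does not see the change of sign.\<close>

lemma lv_lv_flip:
  assumes "smooth \<phi>"
  shows "lv v (lv v (\<lambda>x. \<phi> (x \<odot> y))) (- x) = lv v (lv v (\<lambda>z. \<phi> (- (z \<odot> x)))) (- y)"
proof -
  define \<psi> where "\<psi> = (\<lambda>x. \<phi> (x \<odot> y))"
  have s\<psi>: "smooth \<psi>" unfolding \<psi>_def by (rule smooth_comp[OF assms]) (intro smooth_mul smooth_ident smooth_const)
  have flip: "\<phi> (- ((- y) \<odot> (t *\<^sub>R v) \<odot> x)) = \<psi> ((- x) \<odot> ((- t) *\<^sub>R v))" for t
    by (simp add: \<psi>_def minus_mul mul_assoc)
  have m: "((\<lambda>t. - t) has_vector_derivative -1) (at s)" for s :: real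
    by (auto intro!: derivative_eq_intros simp: has_vector_derivative_def)
  have d1: "((\<lambda>t. \<psi> ((- x) \<odot> ((- t) *\<^sub>R v))) has_vector_derivative - lv v \<psi> ((- x) \<odot> ((- s) *\<^sub>R v))) (at s)" for s
    using vector_diff_chain_at[OF m lv_has_vector_derivative[OF s\<psi>, of "- x" v "- s"]] by (simp add: comp_def)
  have d2: "((\<lambda>s. - lv v \<psi> ((- x) \<odot> ((- s) *\<^sub>R v))) has_vector_derivative lv v (lv v \<psi>) (- x)) (at 0)"
    using has_vector_derivative_minus[OF vector_diff_chain_at[OF m, of "\<lambda>t. lv v \<psi> ((- x) \<odot> (t *\<^sub>R v))" "lv v (lv v \<psi>) (- x)" 0]]
      lv_has_vector_derivative[OF smooth_lv[OF s\<psi>], of v "- x" v 0] by (simp add: comp_def)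
  have "lv v (lv v (\<lambda>z. \<phi> (- (z \<odot> x)))) (- y) = lv v (lv v \<psi>) (- x)"
    unfolding lv_lv[of v "\<lambda>z. \<phi> (- (z \<odot> x))"] flip vector_derivative_at[OF d1] by (rule vector_derivative_at[OF d2])
  then show ?thesis by (simp add: \<psi>_def)
qed

lemma lap_flip: "smooth \<phi> \<Longrightarrow> lap (\<lambda>x. \<phi> (x \<odot> y)) (- x) = lap (\<lambda>z. \<phi> (- (z \<odot> x))) (- y)"
  unfolding lap_eq by (intro sum.cong refl lv_lv_flip)

lemma poly_integral_bound:
  assumes g: "integrable lborel (\<lambda>y. g y * complex_of_real (rho s y))" and s: "0 < s" and b: "\<And>y. cmod (g y) \<le> C * (1 + norm y) ^ q"
    and M: "integral\<^sup>L lborel (\<lambda>y. (1 + norm y) ^ q * rho s y) \<le> M" and C: "0 \<le> C"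
  shows "cmod (integral\<^sup>L lborel (\<lambda>y. g y * complex_of_real (rho s y))) \<le> C * M"
proof -
  have "cmod (integral\<^sup>L lborel (\<lambda>y. g y * complex_of_real (rho s y))) \<le> integral\<^sup>L lborel (\<lambda>y. cmod (g y * complex_of_real (rho s y)))"
    by (rule integral_norm_bound)
  also have "\<dots> \<le> integral\<^sup>L lborel (\<lambda>y. C * ((1 + norm y) ^ q * rho s y))"
  proof (rule integral_mono)
    show "integrable lborel (\<lambda>y. C * ((1 + norm y) ^ q * rho s y))" using moment_integrable[OF s] by simp
    show "cmod (g y * complex_of_real (rho s y)) \<le> C * ((1 + norm y) ^ q * rho s y)" for y
      using mult_right_mono[OF b[of y], of "rho s y"] rho_pos[OF s, of y] by (simp add: norm_mult mult.assoc)
  qed (use g in simp)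
  also have "\<dots> \<le> C * M" using M C by (simp add: mult_left_mono)
  finally show ?thesis .
qed

text \<open>The constant must not vary along the segment r + s = t: \<open>PP_taylor\<close> is
  uniform in r, and the moments are bounded uniformly for times up to t.\<close>

lemma HH_taylor:
  assumes \<Psi>: "polytest \<Psi>" and t: "0 < t"
  obtains C where "0 \<le> C" "\<And>r s h. 0 < r \<Longrightarrow> 0 < s \<Longrightarrow> s \<le> t \<Longrightarrow> 0 \<le> h \<Longrightarrow>
     cmod (HH \<Psi> (r + h) s - HH \<Psi> r s - (h / 4) *\<^sub>R HH (\<lambda>y. lap (\<Psi> y)) r s) \<le> C * h\<^sup>2"
proof -
  note \<Psi>1 = polytest_lap[OF \<Psi>]
  obtain C0 q where C0: "0 \<le> C0" "\<And>x y. cmod (lap (lap (\<Psi> y)) x) \<le> C0 * (1 + norm y) ^ q"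
    using polytest_bound[OF polytest_lap[OF \<Psi>1]] by blast
  obtain M where M: "0 \<le> M" "\<And>s. 0 < s \<Longrightarrow> s \<le> t \<Longrightarrow> integral\<^sup>L lborel (\<lambda>y. (1 + norm y) ^ q * rho s y) \<le> M"
    using moment_bound_integral[OF t] by blast
  have "cmod (HH \<Psi> (r + h) s - HH \<Psi> r s - (h / 4) *\<^sub>R HH (\<lambda>y. lap (\<Psi> y)) r s) \<le> C0 * M * h\<^sup>2"
    if r: "0 < r" and s: "0 < s" "s \<le> t" and h: "0 \<le> h" for r s h
  proof -
    have rh: "0 < r + h" using r h by simp
    let ?g = "\<lambda>y. PP (r + h) (\<Psi> y) 0 - PP r (\<Psi> y) 0 - (h / 4) *\<^sub>R PP r (lap (\<Psi> y)) 0"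
    note i = HH_integrable[OF \<Psi> rh s(1)] HH_integrable[OF \<Psi> r s(1)] HH_integrable[OF \<Psi>1 r s(1)]
    have e: "(\<lambda>y. ?g y * complex_of_real (rho s y)) = (\<lambda>y. PP (r + h) (\<Psi> y) 0 * complex_of_real (rho s y)
        - PP r (\<Psi> y) 0 * complex_of_real (rho s y) - (h / 4) *\<^sub>R (PP r (lap (\<Psi> y)) 0 * complex_of_real (rho s y)))"
      by (simp add: left_diff_distrib)
    have gi: "integrable lborel (\<lambda>y. ?g y * complex_of_real (rho s y))"
      unfolding e using i by (intro Bochner_Integration.integrable_diff integrable_scaleR_right) auto
    have "HH \<Psi> (r + h) s - HH \<Psi> r s - (h / 4) *\<^sub>R HH (\<lambda>y. lap (\<Psi> y)) r s = integral\<^sup>L lborel (\<lambda>y. ?g y * complex_of_real (rho s y))"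
      unfolding e HH_def using i
      by (subst Bochner_Integration.integral_diff, intro Bochner_Integration.integrable_diff, simp_all only: integrable_scaleR_right)
         (subst Bochner_Integration.integral_diff, auto)
    also have "cmod \<dots> \<le> (C0 * h\<^sup>2) * M"
    proof (rule poly_integral_bound[OF gi s(1) _ M(2)[OF s]])
      show "cmod (?g y) \<le> C0 * h\<^sup>2 * (1 + norm y) ^ q" for y
        using PP_taylor[OF polytest_test[OF \<Psi>] r h C0(2), of y 0] by (simp add: mult_ac)
    qed (use C0 in auto)
    finally show ?thesis by (simp add: mult_ac)
  qed
  then show thesis using that C0(1) M(1) mult_nonneg_nonneg by blast
qed

lemma polytest_at_0_integrable:
  assumes \<Psi>: "polytest \<Psi>" and s: "0 < s"
  shows "integrable lborel (\<lambda>y. \<Psi> y 0 * complex_of_real (rho s y))"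
proof -
  obtain C q where C: "0 \<le> C" "\<And>x y. cmod (\<Psi> y x) \<le> C * (1 + norm y) ^ q" using polytest_bound[OF \<Psi>] by blast
  have [measurable]: "rho s \<in> borel_measurable borel" by (rule rho_borel[OF s])
  have "continuous_on UNIV (\<lambda>y. \<Psi> y 0)"
    using continuous_on_compose2[OF polytest_continuous[OF \<Psi>], of UNIV "\<lambda>y. (0, y)"]
    by (simp add: continuous_on_Pair continuous_on_const continuous_on_id)
  then have [measurable]: "(\<lambda>y. \<Psi> y 0) \<in> borel_measurable borel" by (rule continuous_borel)
  show ?thesis
  proof (rule Bochner_Integration.integrable_bound[of _ "\<lambda>y. C * ((1 + norm y) ^ q * rho s y)"])
    show "integrable lborel (\<lambda>y. C * ((1 + norm y) ^ q * rho s y))" using moment_integrable[OF s] by simp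
    show "AE y in lborel. norm (\<Psi> y 0 * complex_of_real (rho s y)) \<le> norm (C * ((1 + norm y) ^ q * rho s y))"
    proof (rule AE_I2)
      fix y
      have "cmod (\<Psi> y 0) * rho s y \<le> C * (1 + norm y) ^ q * rho s y"
        using C(2) rho_pos[OF s, of y] by (intro mult_right_mono) auto
      then show "norm (\<Psi> y 0 * complex_of_real (rho s y)) \<le> norm (C * ((1 + norm y) ^ q * rho s y))"
        using rho_pos[OF s, of y] C(1) by (simp add: norm_mult abs_mult mult.assoc)
    qed
  qed measurable
qed

lemma HH_near_0:
  assumes \<Psi>: "polytest \<Psi>" and t: "0 < t"
  obtains C where "0 \<le> C" "\<And>r s. 0 < r \<Longrightarrow> 0 < s \<Longrightarrow> s \<le> t \<Longrightarrow>
     cmod (HH \<Psi> r s - integral\<^sup>L lborel (\<lambda>y. \<Psi> y 0 * complex_of_real (rho s y))) \<le> C * r"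
proof -
  note \<Psi>1 = polytest_lap[OF \<Psi>]
  obtain C0 q where C0: "0 \<le> C0" "\<And>x y. cmod (lap (\<Psi> y) x) \<le> C0 * (1 + norm y) ^ q"
    using polytest_bound[OF \<Psi>1] by blast
  obtain M where M: "0 \<le> M" "\<And>s. 0 < s \<Longrightarrow> s \<le> t \<Longrightarrow> integral\<^sup>L lborel (\<lambda>y. (1 + norm y) ^ q * rho s y) \<le> M"
    using moment_bound_integral[OF t] by blast
  have "cmod (HH \<Psi> r s - integral\<^sup>L lborel (\<lambda>y. \<Psi> y 0 * complex_of_real (rho s y))) \<le> C0 * M * r"
    if r: "0 < r" and s: "0 < s" "s \<le> t" for r s
  proof -
    let ?g = "\<lambda>y. PP r (\<Psi> y) 0 - \<Psi> y 0"
    note i = HH_integrable[OF \<Psi> r s(1)] polytest_at_0_integrable[OF \<Psi> s(1)]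
    have e: "(\<lambda>y. ?g y * complex_of_real (rho s y)) = (\<lambda>y. PP r (\<Psi> y) 0 * complex_of_real (rho s y) - \<Psi> y 0 * complex_of_real (rho s y))"
      by (simp add: left_diff_distrib)
    have gi: "integrable lborel (\<lambda>y. ?g y * complex_of_real (rho s y))"
      unfolding e by (rule Bochner_Integration.integrable_diff[OF i])
    have "HH \<Psi> r s - integral\<^sup>L lborel (\<lambda>y. \<Psi> y 0 * complex_of_real (rho s y)) = integral\<^sup>L lborel (\<lambda>y. ?g y * complex_of_real (rho s y))"
      unfolding e HH_def by (rule Bochner_Integration.integral_diff[OF i, symmetric])
    also have "cmod \<dots> \<le> (C0 * r) * M"
    proof (rule poly_integral_bound[OF gi s(1) _ M(2)[OF s]])
      show "cmod (?g y) \<le> C0 * r * (1 + norm y) ^ q" for y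
      proof -
        have "cmod (?g y) \<le> C0 * (1 + norm y) ^ q / 4 * r"
          by (rule PP_near_0[OF polytest_test[OF \<Psi>] r]) (rule PP_bound[OF _ C0(2)])
        also have "\<dots> \<le> C0 * (1 + norm y) ^ q * r" using C0(1) r by (simp add: divide_le_eq)
        finally show ?thesis by (simp add: mult_ac)
      qed
    qed (use C0 r in auto)
    finally show ?thesis by (simp add: mult_ac)
  qed
  then show thesis using that C0(1) M(1) mult_nonneg_nonneg by blast
qed

text \<open>Along r + s = t the function H(r,s) is constant: the fields acting on the left and on the
  right factor agree in the middle of the product x y, so both partial derivatives of H coincide.\<close>

lemma HH_convolution:
  assumes \<phi>: "test_fn \<phi>" and r: "0 < r" and s: "0 < s"
  shows "HH (\<lambda>y x. \<phi> (x \<odot> y)) r s = integral\<^sup>L lborel (\<lambda>x. \<phi> (- x) * complex_of_real (rho (r + s) x))"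
    and "HH (\<lambda>y x. \<phi> (x \<odot> y)) r s = integral\<^sup>L lborel (\<lambda>y. \<phi> y * complex_of_real (rho (r + s) y))"
proof -
  define t where "t = r + s"
  have t: "0 < t" using r s by (simp add: t_def)
  let ?\<Psi> = "\<lambda>y x. \<phi> (x \<odot> y)" and ?\<Phi> = "\<lambda>y x. \<phi> (- (x \<odot> y))"
  have p\<Psi>: "polytest ?\<Psi>" by (rule polytest_translate[OF \<phi>])
  have p\<Phi>: "polytest ?\<Phi>" by (rule polytest_translate[OF test_fn_minus_arg[OF \<phi>]])
  have sw0: "HH ?\<Psi> r s = HH ?\<Phi> s r" if "0 < r" "0 < s" for r s
    by (rule HH_swap[OF p\<Psi> p\<Phi> that]) (simp add: minus_mul)
  have sw1: "HH (\<lambda>y. lap (?\<Psi> y)) r s = HH (\<lambda>y. lap (?\<Phi> y)) s r" if "0 < r" "0 < s" for r s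
    by (rule HH_swap[OF polytest_lap[OF p\<Psi>] polytest_lap[OF p\<Phi>] that]) (rule lap_flip[OF test_fn_smooth[OF \<phi>]])
  obtain C1 where C1: "0 \<le> C1" "\<And>r s h. 0 < r \<Longrightarrow> 0 < s \<Longrightarrow> s \<le> t \<Longrightarrow> 0 \<le> h \<Longrightarrow>
     cmod (HH ?\<Psi> (r + h) s - HH ?\<Psi> r s - (h / 4) *\<^sub>R HH (\<lambda>y. lap (?\<Psi> y)) r s) \<le> C1 * h\<^sup>2"
    using HH_taylor[OF p\<Psi> t] by blast
  obtain C2 where C2: "0 \<le> C2" "\<And>r s h. 0 < r \<Longrightarrow> 0 < s \<Longrightarrow> s \<le> t \<Longrightarrow> 0 \<le> h \<Longrightarrow>
     cmod (HH ?\<Phi> (r + h) s - HH ?\<Phi> r s - (h / 4) *\<^sub>R HH (\<lambda>y. lap (?\<Phi> y)) r s) \<le> C2 * h\<^sup>2"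
    using HH_taylor[OF p\<Phi> t] by blast
  define K' where "K' u = HH ?\<Psi> (t - u) u" for u
  \<comment> \<open>Both values are compared with H at the times (t - y, x). Raising the first time
    by h and raising the second by h have the same first-order effect by \<open>sw1\<close>, so only
    quadratic remainders are left.\<close>
  have step: "cmod (K' y - K' x) \<le> (C1 + C2) * (y - x)\<^sup>2" if "x \<in> {0<..<t}" "y \<in> {0<..<t}" "x \<le> y" for x y
  proof -
    define h where "h = y - x"
    have h: "0 \<le> h" "0 < t - y" "0 < x" "x \<le> t" "t - y \<le> t" "t - y + h = t - x" "x + h = y" using that by (auto simp: h_def)
    let ?A = "HH ?\<Psi> (t - x) x - HH ?\<Psi> (t - y) x - (h / 4) *\<^sub>R HH (\<lambda>y. lap (?\<Psi> y)) (t - y) x"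
    let ?B = "HH ?\<Psi> (t - y) y - HH ?\<Psi> (t - y) x - (h / 4) *\<^sub>R HH (\<lambda>y. lap (?\<Psi> y)) (t - y) x"
    have A: "cmod ?A \<le> C1 * h\<^sup>2" using C1(2)[OF h(2,3,4,1)] by (simp only: h(6))
    have "cmod (HH ?\<Phi> (x + h) (t - y) - HH ?\<Phi> x (t - y) - (h / 4) *\<^sub>R HH (\<lambda>y. lap (?\<Phi> y)) x (t - y)) \<le> C2 * h\<^sup>2"
      by (rule C2(2)[OF h(3,2,5,1)])
    then have B: "cmod ?B \<le> C2 * h\<^sup>2"
      using sw0[of "t - y" y] sw0[of "t - y" x] sw1[of "t - y" x] h that by (simp only: h(7))
    have "K' y - K' x = ?B - ?A" by (simp add: K'_def)
    then have "cmod (K' y - K' x) \<le> cmod ?B + cmod ?A" using norm_triangle_ineq4 by metis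
    then show ?thesis using A B by (simp add: h_def distrib_right)
  qed
  have step': "cmod (K' y - K' x) \<le> (C1 + C2) * (y - x)\<^sup>2" if "x \<in> {0<..<t}" "y \<in> {0<..<t}" for x y
    using step[of x y] step[of y x] that by (cases "x \<le> y") (auto simp: norm_minus_commute power2_commute)
  have const: "K' u = K' s" if "u \<in> {0<..<t}" for u
    by (rule square_bound_imp_const[of "{0<..<t}" K' "C1 + C2"]) (use step' that r s in \<open>auto simp: t_def\<close>)
  have Ks: "K' s = HH ?\<Psi> r s" by (simp add: K'_def t_def)
  have cont: "((\<lambda>u. PP u f 0) \<longlongrightarrow> PP t f 0) (at t)" if "test_fn f" for f
    using has_vector_derivative_continuous[OF PP_deriv[OF that t, of 0]] by (simp add: continuous_within)
  obtain D1 where D1: "0 \<le> D1" "\<And>r s. 0 < r \<Longrightarrow> 0 < s \<Longrightarrow> s \<le> t \<Longrightarrow>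
     cmod (HH ?\<Psi> r s - integral\<^sup>L lborel (\<lambda>y. ?\<Psi> y 0 * complex_of_real (rho s y))) \<le> D1 * r"
    using HH_near_0[OF p\<Psi> t] by blast
  obtain D2 where D2: "0 \<le> D2" "\<And>r s. 0 < r \<Longrightarrow> 0 < s \<Longrightarrow> s \<le> t \<Longrightarrow>
     cmod (HH ?\<Phi> r s - integral\<^sup>L lborel (\<lambda>y. ?\<Phi> y 0 * complex_of_real (rho s y))) \<le> D2 * r"
    using HH_near_0[OF p\<Phi> t] by blast
  have ev: "\<forall>\<^sub>F u in at_left t. u \<in> {0<..<t}"
    using t by (auto simp: eventually_at_left_field intro!: exI[of _ 0])
  \<comment> \<open>The constant is identified at the ends of the segment: letting one or the other
    kernel shrink to the identity gives the pairing of rho_t with the test function or with its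
    reflection.\<close>
  have lim_eq: "K' s = PP t f 0" if f: "test_fn f" and b: "\<And>u. u \<in> {0<..<t} \<Longrightarrow> cmod (K' s - PP u f 0) \<le> D * (t - u)" for f D
  proof -
    have "((\<lambda>u. PP u f 0 - K' s) \<longlongrightarrow> 0) (at_left t)"
    proof (rule Lim_null_comparison)
      show "\<forall>\<^sub>F u in at_left t. norm (PP u f 0 - K' s) \<le> D * (t - u)"
        using ev by eventually_elim (use b in \<open>simp add: norm_minus_commute\<close>)
      show "((\<lambda>u. D * (t - u)) \<longlongrightarrow> 0) (at_left t)" by (auto intro!: tendsto_eq_intros)
    qed
    then have "((\<lambda>u. PP u f 0) \<longlongrightarrow> K' s) (at_left t)" by (simp add: LIM_zero_iff)
    moreover have "((\<lambda>u. PP u f 0) \<longlongrightarrow> PP t f 0) (at_left t)"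
      using cont[OF f] by (rule tendsto_within_subset) auto
    ultimately show ?thesis using tendsto_unique[of "at_left t"] by (simp add: trivial_limit_at_left_real)
  qed
  have "K' s = PP t \<phi> 0"
  proof (rule lim_eq[OF \<phi>, of D2])
    fix u assume u: "u \<in> {0<..<t}"
    have "cmod (HH ?\<Phi> (t - u) u - integral\<^sup>L lborel (\<lambda>y. ?\<Phi> y 0 * complex_of_real (rho u y))) \<le> D2 * (t - u)"
      using u by (intro D2(2)) auto
    moreover have "HH ?\<Phi> (t - u) u = K' s"
      using sw0[of u "t - u"] const[of "t - u"] u by (simp add: K'_def)
    ultimately show "cmod (K' s - PP u \<phi> 0) \<le> D2 * (t - u)" by (simp add: PP_at_0)
  qed
  then show "HH ?\<Psi> r s = integral\<^sup>L lborel (\<lambda>x. \<phi> (- x) * complex_of_real (rho (r + s) x))"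
    by (simp add: Ks PP_at_0 t_def)
  have "K' s = PP t (\<lambda>x. \<phi> (- x)) 0"
  proof (rule lim_eq[OF test_fn_minus_arg[OF \<phi>], of D1])
    fix u assume u: "u \<in> {0<..<t}"
    have "cmod (HH ?\<Psi> (t - u) u - integral\<^sup>L lborel (\<lambda>y. ?\<Psi> y 0 * complex_of_real (rho u y))) \<le> D1 * (t - u)"
      using u by (intro D1(2)) auto
    moreover have "HH ?\<Psi> (t - u) u = K' s" using const[OF u] by (simp add: K'_def)
    ultimately show "cmod (K' s - PP u (\<lambda>x. \<phi> (- x)) 0) \<le> D1 * (t - u)" by (simp add: PP_at_0)
  qed
  then show "HH ?\<Psi> r s = integral\<^sup>L lborel (\<lambda>y. \<phi> y * complex_of_real (rho (r + s) y))"
    by (simp add: Ks PP_at_0 t_def)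
qed

section \<open>The kernels as probability measures\<close>

abbreviation mu :: "real \<Rightarrow> (complex^'n) measure" where
  "mu s \<equiv> density lborel (\<lambda>x. ennreal (rho s x))"

lemma emeasure_mu_UNIV: "0 < s \<Longrightarrow> emeasure (mu s) UNIV = 1"
  using nn_integral_eq_integral[OF rho_integrable, of s] rho_borel[of s] rho_pos[of s] rho_integral[of s]
  by (simp add: emeasure_density less_imp_le)

lemma prob_finite_box: "emeasure M UNIV = 1 \<Longrightarrow> sets M = sets borel \<Longrightarrow> emeasure M (box a b) < \<infinity>"
  for M :: "(complex^'n) measure"
  using emeasure_mono[of "box a b" UNIV M] by (auto intro: le_less_trans)

lemma integral_mu: "0 < s \<Longrightarrow> f \<in> borel_measurable borel \<Longrightarrow> integral\<^sup>L (mu s) f = integral\<^sup>L lborel (\<lambda>x. f x * complex_of_real (rho s x))"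
  using rho_borel[of s] rho_pos[of s] by (subst integral_density) (auto simp: less_imp_le scaleR_conv_of_real mult.commute)

text \<open>The two evaluations of the same constant in \<open>HH_convolution\<close> say that rho_t
  and its reflection agree on test functions, hence as measures and, by continuity,
  pointwise.\<close>

lemma rho_even: assumes t: "0 < t" shows "rho t (- x) = rho t x"
proof -
  have [measurable]: "rho t \<in> borel_measurable borel" by (rule rho_borel[OF t])
  let ?N = "distr (mu t) borel uminus"
  have "?N = mu t"
  proof (rule measure_eqI_test_fn)
    have "emeasure ?N UNIV = 1" using emeasure_mu_UNIV[OF t] by (subst emeasure_distr) auto
    then show "emeasure ?N (box a b) < \<infinity>" for a b by (rule prob_finite_box) simp
    show "emeasure (mu t) (box a b) < \<infinity>" for a b using emeasure_mu_UNIV[OF t] by (rule prob_finite_box) simp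
    fix \<phi> :: "complex^'n \<Rightarrow> complex" assume \<phi>: "test_fn \<phi>"
    have [measurable]: "\<phi> \<in> borel_measurable borel" by (rule smooth_borel[OF test_fn_smooth[OF \<phi>]])
    have "integral\<^sup>L ?N \<phi> = integral\<^sup>L (mu t) (\<lambda>x. \<phi> (- x))" by (subst integral_distr) auto
    also have "\<dots> = integral\<^sup>L lborel (\<lambda>x. \<phi> (- x) * complex_of_real (rho t x))" by (rule integral_mu[OF t]) auto
    also have "\<dots> = integral\<^sup>L lborel (\<lambda>x. \<phi> x * complex_of_real (rho t x))"
      using HH_convolution[OF \<phi>, of "t/2" "t/2"] t by simp
    also have "\<dots> = integral\<^sup>L (mu t) \<phi>" by (rule integral_mu[OF t, symmetric]) auto
    finally show "integral\<^sup>L ?N \<phi> = integral\<^sup>L (mu t) \<phi>" .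
  qed auto
  moreover have "?N = density lborel (\<lambda>x. ennreal (rho t (- x)))"
  proof -
    have "density (distr lborel borel uminus) (\<lambda>x. ennreal (rho t (- x))) = distr (density lborel (\<lambda>x. ennreal (rho t (- (- x))))) borel uminus"
      by (rule density_distr) auto
    then show ?thesis by (simp add: lborel_distr_minus)
  qed
  ultimately have "density lborel (\<lambda>x. ennreal (rho t (- x))) = mu t" by simp
  then have "AE x in lborel. ennreal (rho t (- x)) = ennreal (rho t x)"
    by (subst (asm) sigma_finite_measure.density_unique_iff[OF sigma_finite_lborel])
       (auto intro!: sigma_finite_measure.sigma_finite_iff_density_finite[THEN iffD2])
  then have "AE x in lborel. rho t (- x) = rho t x"
    by eventually_elim (use rho_pos[OF t] in \<open>auto simp: less_imp_le\<close>)
  moreover have "continuous_on UNIV (rho t)" by (rule smooth_continuous[OF rho_smooth[OF t]])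
  moreover from this have "continuous_on UNIV (\<lambda>x. rho t (- x))"
    by (rule continuous_on_compose2) (auto intro!: continuous_intros)
  ultimately show ?thesis using continuous_AE_eq[of "\<lambda>x. rho t (- x)" "rho t" x] by simp
qed

end

lemma AE_dense:
  fixes P :: "'a::euclidean_space \<Rightarrow> bool"
  assumes "AE x in lborel. P x" "0 < e" shows "\<exists>x\<in>ball 0 e. P x"
proof (rule ccontr)
  assume n: "\<not> (\<exists>x\<in>ball 0 e. P x)"
  let ?f = "\<lambda>x::'a. max 0 (e - norm x)"
  have "AE x in lborel. ?f x = 0" using assms(1) by eventually_elim (use n in auto)
  then have "?f 0 = 0" by (intro continuous_AE_eq[of ?f "\<lambda>_. 0"]) (auto intro!: continuous_intros)
  then show False using assms(2) by simp
qed

lemma continuous_AE_le: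
  fixes f g :: "'a::euclidean_space \<Rightarrow> real"
  assumes "continuous_on UNIV f" "continuous_on UNIV g" "AE x in lborel. f x \<le> g x"
  shows "f x \<le> g x"
proof -
  have "AE x in lborel. max 0 (f x - g x) = 0" using assms(3) by eventually_elim auto
  then have "max 0 (f x - g x) = 0"
    by (rule continuous_AE_eq[rotated 2]) (intro continuous_intros assms)+
  then show ?thesis by simp
qed

lemma term_le_suminf: "f j \<le> (\<Sum>j. f j)" for f :: "nat \<Rightarrow> ennreal"
  using sum_le_suminf[of f "{j}"] by simp

text \<open>On the j-th dyadic shell the volume is of order 2^(jd) and the integrand of order
  2^(-j(d+1)), which leaves a geometric series.\<close>

lemma nn_integral_inverse_power_finite:
  "(\<integral>\<^sup>+y. ennreal (1 / (1 + norm (y::'a::euclidean_space)) ^ (DIM('a) + 1)) \<partial>lborel) < \<infinity>"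
proof -
  let ?d = "DIM('a)"
  have pt: "ennreal (1 / (1 + norm y) ^ (?d + 1)) \<le> (\<Sum>j. ennreal (1 / (2 ^ j) ^ (?d + 1)) * indicator (ball 0 (2 ^ (j + 1))) y)" for y :: 'a
  proof -
    have ex: "\<exists>j. 1 + norm y < 2 ^ (j + 1)"
    proof -
      obtain n where n: "1 + norm y < 2 ^ n" using real_arch_pow[of 2 "1 + norm y"] by auto
      have "(2::real) ^ n \<le> 2 ^ (n + 1)" by simp
      then show ?thesis using n by (intro exI[of _ n]) linarith
    qed
    define j where "j = (LEAST j. 1 + norm y < 2 ^ (j + 1))"
    have j1: "1 + norm y < 2 ^ (j + 1)" unfolding j_def by (rule LeastI_ex[OF ex])
    have j2: "2 ^ j \<le> 1 + norm y"
    proof (cases j)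
      case (Suc i)
      then have "i < j" by simp
      then have "\<not> 1 + norm y < 2 ^ (i + 1)" unfolding j_def by (rule not_less_Least)
      then show ?thesis using Suc by simp
    qed simp
    have "1 / (1 + norm y) ^ (?d + 1) \<le> 1 / (2 ^ j) ^ (?d + 1)"
      using j2 by (intro divide_left_mono power_mono) (auto simp: add_pos_nonneg)
    then have "ennreal (1 / (1 + norm y) ^ (?d + 1)) \<le> ennreal (1 / (2 ^ j) ^ (?d + 1)) * indicator (ball 0 (2 ^ (j + 1))) y"
      using j1 by (simp add: ennreal_leI indicator_def del: power_Suc)
    also have "\<dots> \<le> (\<Sum>j. ennreal (1 / (2 ^ j) ^ (?d + 1)) * indicator (ball 0 (2 ^ (j + 1))) y)"
      by (rule term_le_suminf[of "\<lambda>j. ennreal (1 / (2 ^ j) ^ (?d + 1)) * indicator (ball 0 (2 ^ (j + 1))) y"])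
    finally show ?thesis .
  qed
  have vol: "emeasure lborel (ball (0::'a) R) \<le> ennreal ((2 * R) ^ ?d)" if "0 < R" for R
  proof -
    have "ball (0::'a) R \<subseteq> cbox (- (R *\<^sub>R One)) (R *\<^sub>R One)"
    proof
      fix y :: 'a assume y: "y \<in> ball 0 R"
      have "\<bar>y \<bullet> b\<bar> \<le> R" if "b \<in> Basis" for b using Basis_le_norm[OF that, of y] y by simp
      then show "y \<in> cbox (- (R *\<^sub>R One)) (R *\<^sub>R One)" by (auto simp: mem_box abs_le_iff) (metis minus_le_iff)
    qed
    then have "emeasure lborel (ball (0::'a) R) \<le> emeasure lborel (cbox (- (R *\<^sub>R One)) (R *\<^sub>R One :: 'a))"
      by (intro emeasure_mono) auto
    also have "\<dots> = ennreal (\<Prod>b\<in>Basis. ((R *\<^sub>R One) - (- (R *\<^sub>R One))) \<bullet> (b::'a))"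
      using that by (intro emeasure_lborel_cbox) auto
    also have "(\<Prod>b\<in>Basis. ((R *\<^sub>R One) - (- (R *\<^sub>R One))) \<bullet> (b::'a)) = (2 * R) ^ ?d"
    proof -
      have "(\<Prod>b\<in>Basis. ((R *\<^sub>R One) - (- (R *\<^sub>R One))) \<bullet> (b::'a)) = (\<Prod>b\<in>(Basis::'a set). 2 * R)"
        by (rule prod.cong) (auto simp: inner_diff_left inner_add_left)
      then show ?thesis by simp
    qed
    finally show ?thesis .
  qed
  have "(\<integral>\<^sup>+y. ennreal (1 / (1 + norm (y::'a)) ^ (?d + 1)) \<partial>lborel)
     \<le> (\<integral>\<^sup>+y. (\<Sum>j. ennreal (1 / (2 ^ j) ^ (?d + 1)) * indicator (ball (0::'a) (2 ^ (j + 1))) y) \<partial>lborel)"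
    by (rule nn_integral_mono[OF pt])
  also have "\<dots> = (\<Sum>j. ennreal (1 / (2 ^ j) ^ (?d + 1)) * emeasure lborel (ball (0::'a) (2 ^ (j + 1))))"
  proof (subst nn_integral_suminf)
    show "(\<lambda>y. ennreal (1 / (2 ^ j) ^ (?d + 1)) * indicator (ball (0::'a) (2 ^ (j + 1))) y) \<in> borel_measurable lborel" for j
      by (intro borel_measurable_times_ennreal borel_measurable_const borel_measurable_indicator) simp
    show "(\<Sum>j. \<integral>\<^sup>+y. ennreal (1 / (2 ^ j) ^ (?d + 1)) * indicator (ball (0::'a) (2 ^ (j + 1))) y \<partial>lborel)
       = (\<Sum>j. ennreal (1 / (2 ^ j) ^ (?d + 1)) * emeasure lborel (ball (0::'a) (2 ^ (j + 1))))"
      by (intro suminf_cong nn_integral_cmult_indicator) simp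
  qed
  also have "\<dots> \<le> (\<Sum>j. ennreal (4 ^ ?d * (1/2) ^ j))"
  proof (intro suminf_le allI)
    fix j
    have "ennreal (1 / (2 ^ j) ^ (?d + 1)) * emeasure lborel (ball (0::'a) (2 ^ (j + 1)))
       \<le> ennreal (1 / (2 ^ j) ^ (?d + 1)) * ennreal ((2 * 2 ^ (j + 1)) ^ ?d)"
      by (intro mult_left_mono vol) auto
    also have "\<dots> = ennreal (1 / (2 ^ j) ^ (?d + 1) * (2 * 2 ^ (j + 1)) ^ ?d)" by (rule ennreal_mult[symmetric]) auto
    also have "1 / (2 ^ j) ^ (?d + 1) * (2 * 2 ^ (j + 1)) ^ ?d = 4 ^ ?d * (1/2 :: real) ^ j"
    proof -
      have "(2 * 2 ^ (j + 1) :: real) ^ ?d = 4 ^ ?d * (2 ^ j) ^ ?d" by (simp add: power_mult_distrib)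
      then show ?thesis by (simp add: power_divide)
    qed
    finally show "ennreal (1 / (2 ^ j) ^ (?d + 1)) * emeasure lborel (ball (0::'a) (2 ^ (j + 1))) \<le> ennreal (4 ^ ?d * (1/2) ^ j)" .
  qed auto
  also have "\<dots> = ennreal (\<Sum>j. 4 ^ ?d * (1/2) ^ j)"
    by (intro suminf_ennreal2) (auto intro!: summable_mult summable_geometric)
  finally show ?thesis by (simp add: le_less_trans)
qed

context heat_group
begin

lemma nn_rho: "0 < s \<Longrightarrow> (\<integral>\<^sup>+x. ennreal (rho s x) \<partial>lborel) = 1"
  using nn_integral_eq_integral[OF rho_integrable, of s] rho_pos[of s] rho_integral[of s] by (simp add: less_imp_le)

lemma mu_convolution:
  assumes r: "0 < r" and s: "0 < s"
  shows "distr (mu r \<Otimes>\<^sub>M mu s) borel (\<lambda>z. fst z \<odot> snd z) = mu (r + s)"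
proof -
  have [measurable]: "rho r \<in> borel_measurable borel" "rho s \<in> borel_measurable borel" using rho_borel r s by auto
  have rs: "0 < r + s" using r s by simp
  interpret R: finite_measure "mu r" by (rule finite_measureI) (use emeasure_mu_UNIV[OF r] in simp)
  interpret S: finite_measure "mu s" by (rule finite_measureI) (use emeasure_mu_UNIV[OF s] in simp)
  interpret RS: pair_sigma_finite "mu r" "mu s" ..
  interpret F: finite_measure "mu r \<Otimes>\<^sub>M mu s"
    by (rule finite_measure_pair_measure) (rule R.finite_measure_axioms S.finite_measure_axioms)+
  let ?N = "distr (mu r \<Otimes>\<^sub>M mu s) borel (\<lambda>z. fst z \<odot> snd z)"
  have mm[measurable]: "(\<lambda>z. fst z \<odot> snd z) \<in> measurable (mu r \<Otimes>\<^sub>M mu s) borel"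
    by (rule measurable_mul) auto
  show ?thesis
  proof (rule measure_eqI_test_fn)
    have "emeasure ?N UNIV = emeasure (mu r \<Otimes>\<^sub>M mu s) (space (mu r \<Otimes>\<^sub>M mu s))" by (subst emeasure_distr) auto
    also have "\<dots> = emeasure (mu r) UNIV * emeasure (mu s) UNIV"
      using S.emeasure_pair_measure_Times[of UNIV "mu r" UNIV] by (simp add: space_pair_measure)
    finally have "emeasure ?N UNIV = 1" using emeasure_mu_UNIV[OF r] emeasure_mu_UNIV[OF s] by simp
    then show "emeasure ?N (box a b) < \<infinity>" for a b by (rule prob_finite_box) simp
    show "emeasure (mu (r + s)) (box a b) < \<infinity>" for a b using emeasure_mu_UNIV[OF rs] by (rule prob_finite_box) simp
    fix \<phi> :: "complex^'n \<Rightarrow> complex" assume \<phi>: "test_fn \<phi>"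
    have [measurable]: "\<phi> \<in> borel_measurable borel" by (rule smooth_borel[OF test_fn_smooth[OF \<phi>]])
    obtain C where C: "\<And>x. cmod (\<phi> x) \<le> C" using test_fn_bounded[OF \<phi>] by blast
    have int: "integrable (mu r \<Otimes>\<^sub>M mu s) (\<lambda>z. \<phi> (fst z \<odot> snd z))"
      by (rule F.integrable_const_bound[of _ C]) (use C in auto)
    have "integral\<^sup>L ?N \<phi> = integral\<^sup>L (mu r \<Otimes>\<^sub>M mu s) (\<lambda>z. \<phi> (fst z \<odot> snd z))" by (subst integral_distr) auto
    also have "\<dots> = (\<integral>y. \<integral>x. \<phi> (x \<odot> y) \<partial>mu r \<partial>mu s)"
      using RS.integral_snd[of "\<lambda>x y. \<phi> (x \<odot> y)"] int by (simp add: case_prod_unfold)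
    also have "\<dots> = (\<integral>y. PP r (\<lambda>x. \<phi> (x \<odot> y)) 0 \<partial>mu s)"
    proof (intro Bochner_Integration.integral_cong refl)
      fix y
      have "(\<integral>x. \<phi> (x \<odot> y) \<partial>mu r) = (\<integral>x. \<phi> (x \<odot> y) * complex_of_real (rho r x) \<partial>lborel)"
        by (rule integral_mu[OF r]) (auto intro!: measurable_compose[OF _ \<open>\<phi> \<in> borel_measurable borel\<close>])
      \<comment> \<open>The substitution of -x together with evenness matches the inverse built into
        the semigroup, so that the inner integral becomes a value of \<open>PP\<close> at the
        identity.\<close>
      also have "\<dots> = (\<integral>x. \<phi> ((- x) \<odot> y) * complex_of_real (rho r (- x)) \<partial>lborel)"
        by (rule integral_minus_arg[symmetric]) auto
      also have "\<dots> = PP r (\<lambda>x. \<phi> (x \<odot> y)) 0" by (simp add: PP_at_0 rho_even[OF r])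
      finally show "(\<integral>x. \<phi> (x \<odot> y) \<partial>mu r) = PP r (\<lambda>x. \<phi> (x \<odot> y)) 0" .
    qed
    also have "\<dots> = HH (\<lambda>y x. \<phi> (x \<odot> y)) r s"
    proof -
      have m: "(\<lambda>y. PP r (\<lambda>x. \<phi> (x \<odot> y)) 0) \<in> borel_measurable borel"
        unfolding PP_at_0 by (intro lborel.borel_measurable_lebesgue_integral) (auto simp: case_prod_unfold intro!: borel_measurable_times measurable_compose[OF _ \<open>\<phi> \<in> borel_measurable borel\<close>])
      show ?thesis unfolding HH_def by (rule integral_mu[OF s m])
    qed
    also have "\<dots> = integral\<^sup>L (mu (r + s)) \<phi>" using HH_convolution(2)[OF \<phi> r s] by (simp add: integral_mu[OF rs])
    finally show "integral\<^sup>L ?N \<phi> = integral\<^sup>L (mu (r + s)) \<phi>" .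
  qed auto
qed

text \<open>The convolution of two kernels, taken in the extended nonnegative reals so that it makes
  sense before any bound on the kernel is known.\<close>

definition cv :: "real \<Rightarrow> real \<Rightarrow> complex^'n \<Rightarrow> ennreal" where
  "cv r s z = (\<integral>\<^sup>+x. ennreal (rho r x) * ennreal (rho s ((- x) \<odot> z)) \<partial>lborel)"

lemma rho_cv_AE:
  assumes r: "0 < r" and s: "0 < s" shows "AE z in lborel. ennreal (rho (r + s) z) = cv r s z"
proof -
  have [measurable]: "rho r \<in> borel_measurable borel" "rho s \<in> borel_measurable borel" "rho (r + s) \<in> borel_measurable borel"
    using rho_borel r s by auto
  have [measurable]: "cv r s \<in> borel_measurable borel" unfolding cv_def[abs_def] by measurable
  interpret S: finite_measure "mu s" by (rule finite_measureI) (use emeasure_mu_UNIV[OF s] in simp)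
  have "mu (r + s) = density lborel (cv r s)"
  proof (rule measure_eqI)
    fix A assume "A \<in> sets (mu (r + s))"
    then have [measurable]: "A \<in> sets borel" by simp
    have "emeasure (mu (r + s)) A = emeasure (distr (mu r \<Otimes>\<^sub>M mu s) borel (\<lambda>z. fst z \<odot> snd z)) A"
      by (simp only: mu_convolution[OF r s])
    also have "\<dots> = (\<integral>\<^sup>+z. indicator A z \<partial>distr (mu r \<Otimes>\<^sub>M mu s) borel (\<lambda>z. fst z \<odot> snd z))" by simp
    also have "\<dots> = (\<integral>\<^sup>+z. indicator A (fst z \<odot> snd z) \<partial>(mu r \<Otimes>\<^sub>M mu s))"
      by (rule nn_integral_distr) auto
    also have "\<dots> = (\<integral>\<^sup>+x. \<integral>\<^sup>+y. indicator A (x \<odot> y) \<partial>mu s \<partial>mu r)"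
      by (subst S.nn_integral_fst[symmetric]) auto
    also have "\<dots> = (\<integral>\<^sup>+x. ennreal (rho r x) * (\<integral>\<^sup>+y. ennreal (rho s y) * indicator A (x \<odot> y) \<partial>lborel) \<partial>lborel)"
      by (simp add: nn_integral_density)
    also have "\<dots> = (\<integral>\<^sup>+x. ennreal (rho r x) * (\<integral>\<^sup>+z. ennreal (rho s ((- x) \<odot> z)) * indicator A z \<partial>lborel) \<partial>lborel)"
    proof (rule nn_integral_cong)
      fix x
      have "(\<integral>\<^sup>+y. ennreal (rho s y) * indicator A (x \<odot> y) \<partial>lborel) = (\<integral>\<^sup>+z. ennreal (rho s ((- x) \<odot> z)) * indicator A z \<partial>lborel)"
        using nn_integral_left[of "\<lambda>z. ennreal (rho s ((- x) \<odot> z)) * indicator A z" x] by simp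
      then show "ennreal (rho r x) * (\<integral>\<^sup>+y. ennreal (rho s y) * indicator A (x \<odot> y) \<partial>lborel)
          = ennreal (rho r x) * (\<integral>\<^sup>+z. ennreal (rho s ((- x) \<odot> z)) * indicator A z \<partial>lborel)" by (simp only:)
    qed
    also have "\<dots> = (\<integral>\<^sup>+x. \<integral>\<^sup>+z. ennreal (rho r x) * ennreal (rho s ((- x) \<odot> z)) * indicator A z \<partial>lborel \<partial>lborel)"
      by (simp add: nn_integral_cmult mult.assoc)
    also have "\<dots> = (\<integral>\<^sup>+z. \<integral>\<^sup>+x. ennreal (rho r x) * ennreal (rho s ((- x) \<odot> z)) * indicator A z \<partial>lborel \<partial>lborel)"
      by (rule lborel_pair.Fubini'[symmetric]) (simp add: case_prod_unfold)
    also have "\<dots> = (\<integral>\<^sup>+z. cv r s z * indicator A z \<partial>lborel)"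
      by (simp add: cv_def nn_integral_multc)
    also have "\<dots> = emeasure (density lborel (cv r s)) A" by (simp add: emeasure_density)
    finally show "emeasure (mu (r + s)) A = emeasure (density lborel (cv r s)) A" .
  qed simp
  then show ?thesis
    by (subst (asm) sigma_finite_measure.density_unique_iff[OF sigma_finite_lborel]) auto
qed

text \<open>With r = s/2, rho_s(z) is the integral of rho_r(x) rho_r(x^-1 z), at most the squared L2
  norm of rho_r by 2pq <= p^2 + q^2 and invariance; by evenness the case z = 0 should give that
  norm. The convolution formula is so far known only almost everywhere, so the value at 0 is reached
  along a sequence, and Fatou's lemma gives the inequality in the direction needed.\<close>

lemma rho_le_0: assumes s: "0 < s" shows "rho s z \<le> rho s 0"
proof -
  define r where "r = s / 2"
  have r: "0 < r" "r + r = s" using s by (auto simp: r_def)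
  have [measurable]: "rho r \<in> borel_measurable borel" using rho_borel r by auto
  have cont: "continuous_on UNIV (rho r)" "continuous_on UNIV (rho s)" using smooth_continuous[OF rho_smooth] r(1) s by auto
  have ae: "AE z in lborel. ennreal (rho s z) = cv r r z" using rho_cv_AE[OF r(1) r(1)] r(2) by simp
  define sq where "sq = (\<integral>\<^sup>+x. ennreal ((rho r x)\<^sup>2) \<partial>lborel)"
  have sq: "sq \<le> ennreal (rho s 0)"
  proof -
    have "\<exists>z\<in>ball 0 (1 / real (Suc n)). ennreal (rho s z) = cv r r z" for n by (rule AE_dense[OF ae]) simp
    then obtain z where z: "\<And>n. z n \<in> ball 0 (1 / real (Suc n))" "\<And>n. ennreal (rho s (z n)) = cv r r (z n)" by metis
    have z0: "z \<longlonglongrightarrow> 0"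
    proof (rule Lim_null_comparison)
      show "\<forall>\<^sub>F n in sequentially. norm (z n) \<le> 1 / real (Suc n)" using z(1) by (intro always_eventually) (auto intro: less_imp_le)
      show "(\<lambda>n. 1 / real (Suc n)) \<longlonglongrightarrow> 0" using LIMSEQ_inverse_real_of_nat by (simp add: inverse_eq_divide)
    qed
    have l1: "(\<lambda>n. ennreal (rho r x) * ennreal (rho r ((- x) \<odot> z n))) \<longlonglongrightarrow> ennreal ((rho r x)\<^sup>2)" for x
    proof -
      have "continuous_on UNIV (\<lambda>y. (- x) \<odot> y)" by (intro continuous_mul continuous_intros)
      then have "continuous_on UNIV (\<lambda>y. rho r x * rho r ((- x) \<odot> y))"
        by (intro continuous_on_mult continuous_on_const continuous_on_compose2[OF cont(1)]) auto
      then have "(\<lambda>n. rho r x * rho r ((- x) \<odot> z n)) \<longlonglongrightarrow> rho r x * rho r ((- x) \<odot> 0)"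
        using continuous_on_tendsto_compose[OF _ z0, of UNIV "\<lambda>y. rho r x * rho r ((- x) \<odot> y)"] by simp
      then have "(\<lambda>n. rho r x * rho r ((- x) \<odot> z n)) \<longlonglongrightarrow> (rho r x)\<^sup>2"
        using rho_even[OF r(1), of x] by (simp add: power2_eq_square)
      then have "(\<lambda>n. ennreal (rho r x * rho r ((- x) \<odot> z n))) \<longlonglongrightarrow> ennreal ((rho r x)\<^sup>2)" by (rule tendsto_ennrealI)
      then show ?thesis using rho_pos[OF r(1)] by (simp add: ennreal_mult less_imp_le)
    qed
    have "sq = (\<integral>\<^sup>+x. liminf (\<lambda>n. ennreal (rho r x) * ennreal (rho r ((- x) \<odot> z n))) \<partial>lborel)"
      unfolding sq_def by (intro nn_integral_cong) (simp add: lim_imp_Liminf[OF _ l1])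
    also have "\<dots> \<le> liminf (\<lambda>n. cv r r (z n))" unfolding cv_def by (rule nn_integral_liminf) measurable
    also have "\<dots> = liminf (\<lambda>n. ennreal (rho s (z n)))" by (simp add: z(2))
    also have "\<dots> = ennreal (rho s 0)"
    proof (rule lim_imp_Liminf)
      show "(\<lambda>n. ennreal (rho s (z n))) \<longlonglongrightarrow> ennreal (rho s 0)"
        using continuous_on_tendsto_compose[OF cont(2) z0] by (intro tendsto_ennrealI) auto
    qed simp
    finally show ?thesis .
  qed
  have "AE z in lborel. rho s z \<le> rho s 0"
    using ae
  proof eventually_elim
    fix z assume e: "ennreal (rho s z) = cv r r z"
    have inv: "(\<integral>\<^sup>+x. ennreal ((rho r ((- x) \<odot> z))\<^sup>2) \<partial>lborel) = sq"
    proof -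
      have "(\<integral>\<^sup>+x. ennreal ((rho r ((- x) \<odot> z))\<^sup>2) \<partial>lborel) = (\<integral>\<^sup>+x. ennreal ((rho r (x \<odot> z))\<^sup>2) \<partial>lborel)"
        by (rule nn_integral_minus[of "\<lambda>x. ennreal ((rho r (x \<odot> z))\<^sup>2)"]) measurable
      also have "\<dots> = sq" unfolding sq_def by (rule nn_integral_right[of "\<lambda>x. ennreal ((rho r x)\<^sup>2)"]) measurable
      finally show ?thesis .
    qed
    have "2 * cv r r z = (\<integral>\<^sup>+x. 2 * (ennreal (rho r x) * ennreal (rho r ((- x) \<odot> z))) \<partial>lborel)"
      unfolding cv_def by (rule nn_integral_cmult[symmetric]) measurable
    also have "\<dots> \<le> (\<integral>\<^sup>+x. ennreal ((rho r x)\<^sup>2) + ennreal ((rho r ((- x) \<odot> z))\<^sup>2) \<partial>lborel)"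
    proof (rule nn_integral_mono)
      fix x
      have p: "0 \<le> rho r x" "0 \<le> rho r ((- x) \<odot> z)" using rho_pos[OF r(1)] less_imp_le by auto
      have "2 * (rho r x * rho r ((- x) \<odot> z)) \<le> (rho r x)\<^sup>2 + (rho r ((- x) \<odot> z))\<^sup>2"
        using sum_squares_bound[of "rho r x" "rho r ((- x) \<odot> z)"] by simp
      then have "ennreal (2 * (rho r x * rho r ((- x) \<odot> z))) \<le> ennreal ((rho r x)\<^sup>2 + (rho r ((- x) \<odot> z))\<^sup>2)" by (rule ennreal_leI)
      then show "2 * (ennreal (rho r x) * ennreal (rho r ((- x) \<odot> z))) \<le> ennreal ((rho r x)\<^sup>2) + ennreal ((rho r ((- x) \<odot> z))\<^sup>2)"
        using p by (simp add: ennreal_mult ennreal_plus)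
    qed
    also have "\<dots> = sq + sq" by (subst nn_integral_add) (auto simp: inv sq_def)
    also have "\<dots> = 2 * sq" by (simp add: mult_2)
    also have "\<dots> \<le> 2 * ennreal (rho s 0)" by (intro mult_left_mono sq) auto
    finally have "ennreal (2 * rho s z) \<le> ennreal (2 * rho s 0)"
      unfolding e[symmetric] using rho_pos[OF s] by (simp add: ennreal_mult less_imp_le)
    then show "rho s z \<le> rho s 0" using rho_pos[OF s, of 0] rho_pos[OF s, of z] by simp
  qed
  then show ?thesis by (intro continuous_AE_le[OF cont(2) continuous_on_const])
qed

text \<open>Boundedness of rho_s makes the convolution integral continuous in z, which upgrades the
  almost everywhere identity to all points.\<close>

lemma rho_conv:
  assumes r: "0 < r" and s: "0 < s" shows "ennreal (rho (r + s) z) = cv r s z"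
proof -
  have [measurable]: "rho r \<in> borel_measurable borel" "rho s \<in> borel_measurable borel" using rho_borel r s by auto
  have cont: "continuous_on UNIV (rho s)" "continuous_on UNIV (rho (r + s))" using smooth_continuous[OF rho_smooth] r s by auto
  let ?g = "\<lambda>z. \<integral>x. rho r x * rho s ((- x) \<odot> z) \<partial>lborel"
  have bnd: "integrable lborel (\<lambda>x. rho r x * rho s 0)" using rho_integrable[OF r] by simp
  have p: "0 \<le> rho r x" "0 \<le> rho s x" for x using rho_pos r s less_imp_le by blast+
  have int: "integrable lborel (\<lambda>x. rho r x * rho s ((- x) \<odot> z))" for z
    by (rule Bochner_Integration.integrable_bound[OF bnd])
       (auto simp: abs_mult p intro!: AE_I2 mult_left_mono rho_le_0[OF s])
  have cvg: "cv r s z = ennreal (?g z)" for z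
    unfolding cv_def using nn_integral_eq_integral[OF int[of z]] p by (simp add: ennreal_mult)
  have "continuous_on UNIV ?g"
    unfolding continuous_on_sequentially
  proof (intro ballI allI impI)
    fix z and w :: "nat \<Rightarrow> complex^'n" assume "(\<forall>n. w n \<in> UNIV) \<and> w \<longlonglongrightarrow> z"
    then have w: "w \<longlonglongrightarrow> z" by simp
    show "(?g \<circ> w) \<longlonglongrightarrow> ?g z" unfolding comp_def
    proof (rule integral_dominated_convergence[OF _ _ bnd])
      show "AE x in lborel. (\<lambda>i. rho r x * rho s ((- x) \<odot> w i)) \<longlonglongrightarrow> rho r x * rho s ((- x) \<odot> z)"
      proof (rule AE_I2)
        fix x
        have "continuous_on UNIV (\<lambda>y. (- x) \<odot> y)" by (intro continuous_mul continuous_intros)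
        then have "continuous_on UNIV (\<lambda>y. rho r x * rho s ((- x) \<odot> y))"
          by (intro continuous_on_mult continuous_on_const continuous_on_compose2[OF cont(1)]) auto
        then show "(\<lambda>i. rho r x * rho s ((- x) \<odot> w i)) \<longlonglongrightarrow> rho r x * rho s ((- x) \<odot> z)"
          using w by (rule continuous_on_tendsto_compose) auto
      qed
      show "AE x in lborel. norm (rho r x * rho s ((- x) \<odot> w i)) \<le> rho r x * rho s 0" for i
        by (auto simp: abs_mult p intro!: AE_I2 mult_left_mono rho_le_0[OF s])
    qed measurable
  qed
  moreover have "AE z in lborel. rho (r + s) z = ?g z"
    using rho_cv_AE[OF r s]
  proof eventually_elim
    fix z assume "ennreal (rho (r + s) z) = cv r s z"
    then show "rho (r + s) z = ?g z" unfolding cvg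
      using rho_pos[of "r + s" z] r s p by (subst (asm) ennreal_inj) (auto simp: less_imp_le intro!: Bochner_Integration.integral_nonneg)
  qed
  ultimately have "rho (r + s) z = ?g z" by (intro continuous_AE_eq[OF cont(2)])
  then show ?thesis by (simp add: cvg)
qed

lemma rho_decreasing_sup: assumes "0 < e" "e \<le> s" shows "rho s z \<le> rho e 0"
proof (cases "e = s")
  case True then show ?thesis using rho_le_0 assms by simp
next
  case False
  then have se: "0 < s - e" using assms by simp
  have [measurable]: "rho (s - e) \<in> borel_measurable borel" by (rule rho_borel[OF se])
  have "ennreal (rho s z) = cv (s - e) e z" using rho_conv[OF se assms(1), of z] by simp
  also have "\<dots> \<le> (\<integral>\<^sup>+x. ennreal (rho (s - e) x) * ennreal (rho e 0) \<partial>lborel)"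
    unfolding cv_def by (intro nn_integral_mono mult_left_mono ennreal_leI rho_le_0[OF assms(1)]) auto
  also have "\<dots> = ennreal (rho e 0)" by (simp add: nn_integral_multc nn_rho[OF se])
  finally show ?thesis using rho_pos[OF assms(1), of 0] by simp
qed

text \<open>For the weight w = (1 + norm y)^(d + 1) one has sqrt rho <= w rho + 1/w; the first term
  is a moment of the kernel and the second is integrable.\<close>

lemma nn_sqrt_rho_finite: assumes s: "0 < s" shows "(\<integral>\<^sup>+x. ennreal (sqrt (rho s x)) \<partial>lborel) < \<infinity>"
proof -
  have [measurable]: "rho s \<in> borel_measurable borel" by (rule rho_borel[OF s])
  let ?d = "DIM(complex^'n) + 1"
  obtain C where C: "(\<integral>\<^sup>+y. ennreal ((1 + norm y) ^ ?d * rho s y) \<partial>lborel) \<le> ennreal C"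
    using moment_bound[OF s, of ?d] s by blast
  have "(\<integral>\<^sup>+x. ennreal (sqrt (rho s x)) \<partial>lborel) \<le> (\<integral>\<^sup>+y. ennreal ((1 + norm y) ^ ?d * rho s y) + ennreal (1 / (1 + norm y) ^ ?d) \<partial>lborel)"
  proof (rule nn_integral_mono)
    fix y :: "complex^'n"
    define w where "w = (1 + norm y) ^ ?d"
    have w: "0 < w" by (simp add: w_def add_pos_nonneg)
    have p: "0 \<le> rho s y" using rho_pos[OF s] less_imp_le by blast
    have "2 * (sqrt (w * rho s y) * sqrt (1 / w)) \<le> (sqrt (w * rho s y))\<^sup>2 + (sqrt (1 / w))\<^sup>2"
      using sum_squares_bound[of "sqrt (w * rho s y)" "sqrt (1 / w)"] by (simp add: mult.assoc)
    moreover have "sqrt (w * rho s y) * sqrt (1 / w) = sqrt (rho s y)" using w by (simp add: real_sqrt_mult[symmetric])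
    ultimately have "sqrt (rho s y) \<le> w * rho s y + 1 / w" proof -
      assume a: "2 * (sqrt (w * rho s y) * sqrt (1 / w)) \<le> (sqrt (w * rho s y))\<^sup>2 + (sqrt (1 / w))\<^sup>2"
        and b: "sqrt (w * rho s y) * sqrt (1 / w) = sqrt (rho s y)"
      have "2 * sqrt (rho s y) \<le> w * rho s y + 1 / w" using a w p by (simp add: b)
      then show ?thesis using real_sqrt_ge_zero[OF p] by linarith
    qed
    then have "ennreal (sqrt (rho s y)) \<le> ennreal (w * rho s y + 1 / w)" by (rule ennreal_leI)
    then show "ennreal (sqrt (rho s y)) \<le> ennreal ((1 + norm y) ^ ?d * rho s y) + ennreal (1 / (1 + norm y) ^ ?d)"
      unfolding w_def[symmetric] using w p by (simp only: ennreal_plus[symmetric] mult_nonneg_nonneg less_imp_le zero_le_divide_1_iff)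
  qed
  also have "\<dots> = (\<integral>\<^sup>+y. ennreal ((1 + norm y) ^ ?d * rho s y) \<partial>lborel) + (\<integral>\<^sup>+y. ennreal (1 / (1 + norm (y::complex^'n)) ^ ?d) \<partial>lborel)"
    by (rule nn_integral_add) auto
  also have "\<dots> < \<infinity>"
    using C nn_integral_inverse_power_finite[where 'a="complex^'n"] by (simp add: le_less_trans)
  finally show ?thesis .
qed

end

section \<open>Finite Fisher information\<close>

lemma ennreal_mult_add: "0 \<le> a \<Longrightarrow> 0 \<le> b \<Longrightarrow> 0 \<le> c \<Longrightarrow> 0 \<le> d \<Longrightarrow>
    ennreal (a * b + c * d) = ennreal a * ennreal b + ennreal c * ennreal d"
  by (simp add: ennreal_plus ennreal_mult)

context heat_group
begin

text \<open>The transition density of the heat semigroup: symmetric, invariant under left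
  translation and of mass 1 in either variable.\<close>

definition kap :: "real \<Rightarrow> complex^'n \<Rightarrow> complex^'n \<Rightarrow> ennreal" where
  "kap t x z = ennreal (rho t ((- x) \<odot> z))"

definition sr :: "real \<Rightarrow> complex^'n \<Rightarrow> ennreal" where
  "sr s x = ennreal (sqrt (rho s x))"

definition smean :: "real \<Rightarrow> real \<Rightarrow> complex^'n \<Rightarrow> ennreal" where
  "smean t s z = (\<integral>\<^sup>+x. sr s x * kap t x z \<partial>lborel)"

text \<open>As \<open>smean t s\<close> is P_t sqrt rho_s, this is its squared L2 norm, equal to the
  pairing of sqrt rho_s with P_2t sqrt rho_s by \<open>Bf_eq\<close>.\<close>

definition Bf :: "real \<Rightarrow> real \<Rightarrow> ennreal" where
  "Bf t s = (\<integral>\<^sup>+z. smean t s z * smean t s z \<partial>lborel)"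

definition Sf :: "real \<Rightarrow> ennreal" where
  "Sf s = (\<integral>\<^sup>+x. sr s x \<partial>lborel)"

lemma measurable_rho [measurable]: "0 < s \<Longrightarrow> f \<in> borel_measurable M \<Longrightarrow> (\<lambda>x. rho s (f x)) \<in> borel_measurable M"
  using measurable_compose[OF _ rho_borel] by blast

lemma measurable_kap [measurable]:
  "0 < t \<Longrightarrow> f \<in> borel_measurable M \<Longrightarrow> g \<in> borel_measurable M \<Longrightarrow> (\<lambda>x. kap t (f x) (g x)) \<in> borel_measurable M"
  unfolding kap_def by measurable

lemma measurable_sr [measurable]: "0 < s \<Longrightarrow> f \<in> borel_measurable M \<Longrightarrow> (\<lambda>x. sr s (f x)) \<in> borel_measurable M"
  unfolding sr_def by measurable

lemma measurable_smean [measurable]: "0 < s \<Longrightarrow> 0 < t \<Longrightarrow> smean t s \<in> borel_measurable borel"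
  unfolding smean_def by measurable

lemma kap_sym: "0 < t \<Longrightarrow> kap t x z = kap t z x"
  using rho_even[of t "(- x) \<odot> z"] by (simp add: kap_def minus_mul)

lemma kap_left: "kap t (w \<odot> x) (w \<odot> z) = kap t x z"
  by (simp add: kap_def minus_mul mul_assoc)

lemma nn_kap: assumes "0 < t" shows "(\<integral>\<^sup>+z. kap t x z \<partial>lborel) = 1"
  unfolding kap_def using assms nn_integral_left[of "\<lambda>z. ennreal (rho t z)" "- x"] nn_rho[OF assms] by simp

lemma nn_kap': assumes "0 < t" shows "(\<integral>\<^sup>+x. kap t x z \<partial>lborel) = 1"
  using nn_kap[OF assms, of z] by (simp add: kap_sym[OF assms, of z])

lemma rho_kap: "0 < s \<Longrightarrow> 0 < t \<Longrightarrow> (\<integral>\<^sup>+x. ennreal (rho s x) * kap t x z \<partial>lborel) = ennreal (rho (s + t) z)"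
  using rho_conv[of s t z] by (simp add: cv_def kap_def)

lemma kap_conv: assumes t: "0 < t" shows "(\<integral>\<^sup>+z. kap t x z * kap t y z \<partial>lborel) = kap (t + t) x y"
proof -
  have "(\<integral>\<^sup>+z. kap t x z * kap t y z \<partial>lborel) = (\<integral>\<^sup>+z. kap t x z * kap t z y \<partial>lborel)"
    by (simp add: kap_sym[OF t, of y])
  also have "\<dots> = (\<integral>\<^sup>+z. kap t x (x \<odot> z) * kap t (x \<odot> z) y \<partial>lborel)"
    using t by (subst nn_integral_left[of "\<lambda>z. kap t x z * kap t z y" x, symmetric]) auto
  also have "\<dots> = cv t t ((- x) \<odot> y)" by (simp add: cv_def kap_def minus_mul mul_assoc)
  also have "\<dots> = kap (t + t) x y" using rho_conv[OF t t] by (simp add: kap_def)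
  finally show ?thesis .
qed

text \<open>Jensen's inequality for the square root, from the tangent line sqrt u <= u / (2g) + g /
  2 at the point u = g^2 = rho_(s+t)(z).\<close>

lemma smean_le: assumes s: "0 < s" and t: "0 < t" shows "smean t s z \<le> sr (s + t) z"
proof -
  define g where "g = sqrt (rho (s + t) z)"
  have g: "0 < g" "g * g = rho (s + t) z" using rho_pos[of "s + t" z] s t by (auto simp: g_def)
  have "smean t s z \<le> (\<integral>\<^sup>+x. ennreal (1 / (2 * g)) * (ennreal (rho s x) * kap t x z) + ennreal (g / 2) * kap t x z \<partial>lborel)"
    unfolding smean_def
  proof (rule nn_integral_mono)
    fix x
    have p: "0 \<le> rho s x" using rho_pos[OF s, of x] by simp
    have "2 * (sqrt (rho s x) * g) \<le> rho s x + g * g"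
      using sum_squares_bound[of "sqrt (rho s x)" g] p by (simp add: power2_eq_square)
    then have "sqrt (rho s x) \<le> 1 / (2 * g) * rho s x + g / 2" using g(1) by (simp add: field_simps)
    then have "sr s x \<le> ennreal (1 / (2 * g) * rho s x + g / 2)" unfolding sr_def by (rule ennreal_leI)
    also have "\<dots> = ennreal (1 / (2 * g)) * ennreal (rho s x) + ennreal (g / 2)"
      using g(1) p by (simp add: ennreal_mult[symmetric] ennreal_plus)
    finally have "sr s x * kap t x z \<le> (ennreal (1 / (2 * g)) * ennreal (rho s x) + ennreal (g / 2)) * kap t x z"
      by (rule mult_right_mono) simp
    then show "sr s x * kap t x z \<le> ennreal (1 / (2 * g)) * (ennreal (rho s x) * kap t x z) + ennreal (g / 2) * kap t x z"
      by (simp add: distrib_right mult.assoc)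
  qed
  also have "\<dots> = ennreal (1 / (2 * g)) * ennreal (rho (s + t) z) + ennreal (g / 2) * 1"
    using s t by (subst nn_integral_add) (auto simp: nn_integral_cmult rho_kap nn_kap')
  also have "\<dots> = ennreal (1 / (2 * g) * (g * g) + g / 2)"
    using g(1) ennreal_mult_add[of "1 / (2 * g)" "g * g" "g / 2" 1] by (simp only: g(2)[symmetric]) simp
  also have "1 / (2 * g) * (g * g) + g / 2 = g" using g(1) by (simp add: field_simps)
  finally show ?thesis by (simp add: sr_def g_def)
qed

lemma nn_smean: assumes s: "0 < s" and t: "0 < t" shows "(\<integral>\<^sup>+z. smean t s z \<partial>lborel) = Sf s"
proof -
  have "(\<integral>\<^sup>+z. smean t s z \<partial>lborel) = (\<integral>\<^sup>+x. \<integral>\<^sup>+z. sr s x * kap t x z \<partial>lborel \<partial>lborel)"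
    unfolding smean_def using s t by (intro lborel_pair.Fubini') (simp add: case_prod_unfold)
  also have "\<dots> = Sf s" using s t by (simp add: nn_integral_cmult nn_kap Sf_def)
  finally show ?thesis .
qed

lemma Sf_finite: "0 < s \<Longrightarrow> Sf s < \<infinity>"
  unfolding Sf_def sr_def by (rule nn_sqrt_rho_finite)

lemma Bf_le_1: assumes s: "0 < s" and t: "0 < t" shows "Bf t s \<le> 1"
proof -
  have "Bf t s \<le> (\<integral>\<^sup>+z. sr (s + t) z * sr (s + t) z \<partial>lborel)"
    unfolding Bf_def by (intro nn_integral_mono mult_mono smean_le s t) auto
  also have "\<dots> = (\<integral>\<^sup>+z. ennreal (rho (s + t) z) \<partial>lborel)"
    using rho_pos[of "s + t"] s t by (intro nn_integral_cong) (simp add: sr_def ennreal_mult[symmetric] less_imp_le)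
  finally show ?thesis using nn_rho[of "s + t"] s t by simp
qed

text \<open>Let g = sqrt rho_(s+t) and v = P_t sqrt rho_s, so that 0 <= v <= g <= sqrt M.
  Integrating g^2 - v^2 <= 2 sqrt M (g - v) gives 1 - B <= 2 sqrt M (S(s+t) - S(s)). The terms are
  arranged as sums because subtraction in \<open>ennreal\<close> is truncated.\<close>

lemma energy_step:
  assumes s: "0 < s" and t: "0 < t" and M: "\<And>z. rho (s + t) z \<le> M"
  shows "1 + ennreal (2 * sqrt M) * Sf s \<le> Bf t s + ennreal (2 * sqrt M) * Sf (s + t)"
proof -
  have st: "0 < s + t" using s t by simp
  have "(\<integral>\<^sup>+z. ennreal (rho (s + t) z) + ennreal (2 * sqrt M) * smean t s z \<partial>lborel)
     \<le> (\<integral>\<^sup>+z. smean t s z * smean t s z + ennreal (2 * sqrt M) * sr (s + t) z \<partial>lborel)"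
  proof (rule nn_integral_mono)
    fix z
    define g where "g = sqrt (rho (s + t) z)"
    have g: "0 < g" "g * g = rho (s + t) z" "g \<le> sqrt M" using rho_pos[OF st, of z] M[of z] by (auto simp: g_def)
    have le: "smean t s z \<le> ennreal g" using smean_le[OF s t, of z] by (simp add: sr_def g_def)
    obtain v where v: "smean t s z = ennreal v" "0 \<le> v" "v \<le> g"
    proof (cases "smean t s z")
      case (real v) then show ?thesis using le g(1) that[of v] by simp
    next
      case top then show ?thesis using le by (simp add: top_unique)
    qed
    have "(g - v) * (g + v) \<le> (g - v) * (2 * sqrt M)" using v g by (intro mult_left_mono) auto
    then have "g * g + 2 * sqrt M * v \<le> v * v + 2 * sqrt M * g" by (simp add: algebra_simps)
    then have "ennreal (g * g + 2 * sqrt M * v) \<le> ennreal (v * v + 2 * sqrt M * g)" by (rule ennreal_leI)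
    moreover have "0 \<le> sqrt M" using g by linarith
    ultimately show "ennreal (rho (s + t) z) + ennreal (2 * sqrt M) * smean t s z \<le> smean t s z * smean t s z + ennreal (2 * sqrt M) * sr (s + t) z"
      using v g(1) ennreal_mult_add[of g g "2 * sqrt M" v] ennreal_mult_add[of v v "2 * sqrt M" g]
      by (simp add: sr_def g_def[symmetric] g(2)[symmetric] ennreal_mult)
  qed
  then show ?thesis
    using s t st by (simp add: nn_integral_add nn_integral_cmult nn_smean nn_rho Bf_def Sf_def)
qed

lemma Bf_eq: assumes s: "0 < s" and t: "0 < t"
  shows "Bf t s = (\<integral>\<^sup>+x. \<integral>\<^sup>+y. sr s x * sr s y * kap (t + t) x y \<partial>lborel \<partial>lborel)"
proof -
  have "Bf t s = (\<integral>\<^sup>+z. \<integral>\<^sup>+x. \<integral>\<^sup>+y. (sr s x * kap t x z) * (sr s y * kap t y z) \<partial>lborel \<partial>lborel \<partial>lborel)"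
    unfolding Bf_def
  proof (rule nn_integral_cong)
    fix z
    have "smean t s z * smean t s z = (\<integral>\<^sup>+x. (sr s x * kap t x z) * smean t s z \<partial>lborel)"
      unfolding smean_def[of t s z] using s t by (subst nn_integral_multc) auto
    also have "\<dots> = (\<integral>\<^sup>+x. \<integral>\<^sup>+y. (sr s x * kap t x z) * (sr s y * kap t y z) \<partial>lborel \<partial>lborel)"
      unfolding smean_def using s t by (subst nn_integral_cmult) auto
    finally show "smean t s z * smean t s z = (\<integral>\<^sup>+x. \<integral>\<^sup>+y. (sr s x * kap t x z) * (sr s y * kap t y z) \<partial>lborel \<partial>lborel)" .
  qed
  also have "\<dots> = (\<integral>\<^sup>+x. \<integral>\<^sup>+z. \<integral>\<^sup>+y. (sr s x * kap t x z) * (sr s y * kap t y z) \<partial>lborel \<partial>lborel \<partial>lborel)"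
    using s t by (intro lborel_pair.Fubini') (simp add: case_prod_unfold)
  also have "\<dots> = (\<integral>\<^sup>+x. \<integral>\<^sup>+y. \<integral>\<^sup>+z. (sr s x * kap t x z) * (sr s y * kap t y z) \<partial>lborel \<partial>lborel \<partial>lborel)"
    using s t by (intro nn_integral_cong lborel_pair.Fubini') (simp add: case_prod_unfold)
  also have "\<dots> = (\<integral>\<^sup>+x. \<integral>\<^sup>+y. sr s x * sr s y * kap (t + t) x y \<partial>lborel \<partial>lborel)"
  proof (intro nn_integral_cong)
    fix x y
    have "(\<integral>\<^sup>+z. (sr s x * kap t x z) * (sr s y * kap t y z) \<partial>lborel) = (\<integral>\<^sup>+z. (sr s x * sr s y) * (kap t x z * kap t y z) \<partial>lborel)"
      by (simp add: mult_ac)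
    also have "\<dots> = sr s x * sr s y * kap (t + t) x y"
      using t by (subst nn_integral_cmult) (auto simp: kap_conv)
    finally show "(\<integral>\<^sup>+z. (sr s x * kap t x z) * (sr s y * kap t y z) \<partial>lborel) = sr s x * sr s y * kap (t + t) x y" .
  qed
  finally show ?thesis .
qed

text \<open>Cauchy-Schwarz for the average over w, in the form 2(hp)(gq) <= (hp)^2 + (gq)^2, where
  the weights g and h are the square roots on the right and balance the two terms.\<close>

lemma sr_conv_le:
  assumes r: "0 < r" and s: "0 < s"
  shows "(\<integral>\<^sup>+w. ennreal (rho r w) * (sr s ((- w) \<odot> x) * sr s ((- w) \<odot> y)) \<partial>lborel) \<le> sr (r + s) x * sr (r + s) y"
proof -
  have rs: "0 < r + s" using r s by simp
  define g where "g = sqrt (rho (r + s) x)"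
  define h where "h = sqrt (rho (r + s) y)"
  have g: "0 < g" "g * g = rho (r + s) x" and h: "0 < h" "h * h = rho (r + s) y" using rho_pos[OF rs] by (auto simp: g_def h_def less_imp_le)
  have "(\<integral>\<^sup>+w. ennreal (rho r w) * (sr s ((- w) \<odot> x) * sr s ((- w) \<odot> y)) \<partial>lborel)
    \<le> (\<integral>\<^sup>+w. ennreal (h / (2 * g)) * (ennreal (rho r w) * ennreal (rho s ((- w) \<odot> x)))
        + ennreal (g / (2 * h)) * (ennreal (rho r w) * ennreal (rho s ((- w) \<odot> y))) \<partial>lborel)"
  proof (rule nn_integral_mono)
    fix w
    define p where "p = sqrt (rho s ((- w) \<odot> x))"
    define q where "q = sqrt (rho s ((- w) \<odot> y))"
    have pq: "0 \<le> p" "0 \<le> q" "p * p = rho s ((- w) \<odot> x)" "q * q = rho s ((- w) \<odot> y)"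
      using rho_pos[OF s] by (auto simp: p_def q_def less_imp_le)
    have "2 * (h * p) * (g * q) \<le> (h * p)\<^sup>2 + (g * q)\<^sup>2" by (rule sum_squares_bound)
    then have "p * q \<le> h / (2 * g) * (p * p) + g / (2 * h) * (q * q)"
      using g(1) h(1) by (simp add: field_simps power2_eq_square)
    then have "ennreal (p * q) \<le> ennreal (h / (2 * g) * (p * p) + g / (2 * h) * (q * q))" by (rule ennreal_leI)
    also have "\<dots> = ennreal (h / (2 * g)) * ennreal (p * p) + ennreal (g / (2 * h)) * ennreal (q * q)"
      by (rule ennreal_mult_add) (use g(1) h(1) pq(1,2) in auto)
    finally have "ennreal (rho r w) * ennreal (p * q) \<le> ennreal (rho r w) * (ennreal (h / (2 * g)) * ennreal (p * p) + ennreal (g / (2 * h)) * ennreal (q * q))"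
      by (rule mult_left_mono) simp
    then show "ennreal (rho r w) * (sr s ((- w) \<odot> x) * sr s ((- w) \<odot> y))
       \<le> ennreal (h / (2 * g)) * (ennreal (rho r w) * ennreal (rho s ((- w) \<odot> x)))
        + ennreal (g / (2 * h)) * (ennreal (rho r w) * ennreal (rho s ((- w) \<odot> y)))"
      unfolding sr_def p_def[symmetric] q_def[symmetric] pq(3,4)[symmetric]
      using pq(1,2) by (simp add: ennreal_mult distrib_left mult_ac)
  qed
  also have "\<dots> = ennreal (h / (2 * g)) * ennreal (rho (r + s) x) + ennreal (g / (2 * h)) * ennreal (rho (r + s) y)"
    using r s by (subst nn_integral_add) (auto simp: nn_integral_cmult rho_conv[OF r s] cv_def)
  also have "\<dots> = ennreal (h / (2 * g) * (g * g) + g / (2 * h) * (h * h))"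
    unfolding g(2)[symmetric] h(2)[symmetric] by (rule ennreal_mult_add[symmetric]) (use g(1) h(1) in auto)
  also have "h / (2 * g) * (g * g) + g / (2 * h) * (h * h) = g * h" using g(1) h(1) by (simp add: field_simps)
  finally show ?thesis using g(1) h(1) by (simp add: sr_def g_def h_def ennreal_mult)
qed

text \<open>rho_(r+s) is the rho_r-average of left translates of rho_s. The double integral for B is
  unchanged by a left translation, and by \<open>sr_conv_le\<close> the averaged products of square
  roots are at most the product for the average.\<close>

lemma Bf_mono: assumes r: "0 < r" and s: "0 < s" and t: "0 < t" shows "Bf t s \<le> Bf t (r + s)"
proof -
  have rs: "0 < r + s" and tt: "0 < t + t" using r s t by auto
  let ?k = "kap (t + t)"
  let ?F = "\<lambda>w x y. ennreal (rho r w) * (sr s ((- w) \<odot> x) * sr s ((- w) \<odot> y))"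
  have inv: "(\<integral>\<^sup>+x. \<integral>\<^sup>+y. sr s ((- w) \<odot> x) * sr s ((- w) \<odot> y) * ?k x y \<partial>lborel \<partial>lborel) = Bf t s" for w
  proof -
    have "(\<integral>\<^sup>+x. \<integral>\<^sup>+y. sr s ((- w) \<odot> x) * sr s ((- w) \<odot> y) * ?k x y \<partial>lborel \<partial>lborel)
      = (\<integral>\<^sup>+x. \<integral>\<^sup>+y. sr s ((- w) \<odot> x) * sr s ((- w) \<odot> (w \<odot> y)) * ?k x (w \<odot> y) \<partial>lborel \<partial>lborel)"
      using s tt by (intro nn_integral_cong nn_integral_left[symmetric, of "\<lambda>y. sr s ((- w) \<odot> _) * sr s ((- w) \<odot> y) * ?k _ y"]) measurable
    also have "\<dots> = (\<integral>\<^sup>+x. \<integral>\<^sup>+y. sr s ((- w) \<odot> (w \<odot> x)) * sr s ((- w) \<odot> (w \<odot> y)) * ?k (w \<odot> x) (w \<odot> y) \<partial>lborel \<partial>lborel)"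
      using s tt by (intro nn_integral_left[symmetric, of "\<lambda>x. \<integral>\<^sup>+y. sr s ((- w) \<odot> x) * sr s ((- w) \<odot> (w \<odot> y)) * ?k x (w \<odot> y) \<partial>lborel"]) measurable
    finally show ?thesis by (simp add: kap_left Bf_eq[OF s t])
  qed
  have "Bf t s = (\<integral>\<^sup>+w. ennreal (rho r w) * Bf t s \<partial>lborel)"
    using r by (subst nn_integral_multc) (auto simp: nn_rho)
  also have "\<dots> = (\<integral>\<^sup>+w. \<integral>\<^sup>+x. \<integral>\<^sup>+y. ?F w x y * ?k x y \<partial>lborel \<partial>lborel \<partial>lborel)"
  proof (rule nn_integral_cong)
    fix w
    have "ennreal (rho r w) * Bf t s = ennreal (rho r w) * (\<integral>\<^sup>+x. \<integral>\<^sup>+y. sr s ((- w) \<odot> x) * sr s ((- w) \<odot> y) * ?k x y \<partial>lborel \<partial>lborel)"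
      by (simp only: inv)
    also have "\<dots> = (\<integral>\<^sup>+x. ennreal (rho r w) * (\<integral>\<^sup>+y. sr s ((- w) \<odot> x) * sr s ((- w) \<odot> y) * ?k x y \<partial>lborel) \<partial>lborel)"
      using s tt by (subst nn_integral_cmult) auto
    also have "\<dots> = (\<integral>\<^sup>+x. \<integral>\<^sup>+y. ennreal (rho r w) * (sr s ((- w) \<odot> x) * sr s ((- w) \<odot> y) * ?k x y) \<partial>lborel \<partial>lborel)"
      using s tt by (intro nn_integral_cong nn_integral_cmult[symmetric]) measurable
    finally show "ennreal (rho r w) * Bf t s = (\<integral>\<^sup>+x. \<integral>\<^sup>+y. ?F w x y * ?k x y \<partial>lborel \<partial>lborel)" by (simp add: mult.assoc)
  qed
  also have "\<dots> = (\<integral>\<^sup>+x. \<integral>\<^sup>+w. \<integral>\<^sup>+y. ?F w x y * ?k x y \<partial>lborel \<partial>lborel \<partial>lborel)"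
    using r s tt by (intro lborel_pair.Fubini') (simp add: case_prod_unfold)
  also have "\<dots> = (\<integral>\<^sup>+x. \<integral>\<^sup>+y. \<integral>\<^sup>+w. ?F w x y * ?k x y \<partial>lborel \<partial>lborel \<partial>lborel)"
    using r s tt by (intro nn_integral_cong lborel_pair.Fubini') (simp add: case_prod_unfold)
  also have "\<dots> = (\<integral>\<^sup>+x. \<integral>\<^sup>+y. (\<integral>\<^sup>+w. ?F w x y \<partial>lborel) * ?k x y \<partial>lborel \<partial>lborel)"
    using r s tt by (intro nn_integral_cong nn_integral_multc) measurable
  also have "\<dots> \<le> (\<integral>\<^sup>+x. \<integral>\<^sup>+y. sr (r + s) x * sr (r + s) y * ?k x y \<partial>lborel \<partial>lborel)"
    by (intro nn_integral_mono mult_right_mono sr_conv_le r s) auto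
  also have "\<dots> = Bf t (r + s)" by (rule Bf_eq[OF rs t, symmetric])
  finally show ?thesis .
qed

definition Jf :: "real \<Rightarrow> real \<Rightarrow> ennreal" where
  "Jf a t = (\<integral>\<^sup>+x. \<integral>\<^sup>+y. kap t x y * ennreal ((sqrt (rho a y) - sqrt (rho a x))\<^sup>2) \<partial>lborel \<partial>lborel)"

text \<open>Expanding the square, the two diagonal terms integrate to 1 each and the cross term to
  -2B; in other words J at time 2t is 2(1 - B).\<close>

lemma Jf_Bf: assumes a: "0 < a" and t: "0 < t" shows "Jf a (t + t) + 2 * Bf t a = 2"
proof -
  have tt: "0 < t + t" using t by simp
  let ?k = "kap (t + t)"
  have pt: "?k x y * ennreal ((sqrt (rho a y) - sqrt (rho a x))\<^sup>2) + 2 * (sr a x * sr a y * ?k x y)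
     = ennreal (rho a x) * ?k x y + ennreal (rho a y) * ?k x y" for x y
  proof -
    have p: "0 \<le> rho a x" "0 \<le> rho a y" using rho_pos[OF a] less_imp_le by auto
    have "ennreal ((sqrt (rho a y) - sqrt (rho a x))\<^sup>2) + 2 * (sr a x * sr a y)
       = ennreal ((sqrt (rho a y) - sqrt (rho a x))\<^sup>2 + 2 * (sqrt (rho a x) * sqrt (rho a y)))"
      using p by (simp add: sr_def ennreal_plus ennreal_mult)
    also have "(sqrt (rho a y) - sqrt (rho a x))\<^sup>2 + 2 * (sqrt (rho a x) * sqrt (rho a y)) = rho a x + rho a y"
      using p by (simp add: power2_eq_square algebra_simps)
    also have "ennreal (rho a x + rho a y) = ennreal (rho a x) + ennreal (rho a y)" using p by (simp add: ennreal_plus)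
    finally have "(ennreal ((sqrt (rho a y) - sqrt (rho a x))\<^sup>2) + 2 * (sr a x * sr a y)) * ?k x y = (ennreal (rho a x) + ennreal (rho a y)) * ?k x y"
      by (simp only:)
    then show ?thesis by (simp only: distrib_right) (simp only: mult_ac)
  qed
  have "Jf a (t + t) + 2 * Bf t a = (\<integral>\<^sup>+x. \<integral>\<^sup>+y. ?k x y * ennreal ((sqrt (rho a y) - sqrt (rho a x))\<^sup>2) \<partial>lborel \<partial>lborel)
     + (\<integral>\<^sup>+x. 2 * (\<integral>\<^sup>+y. sr a x * sr a y * ?k x y \<partial>lborel) \<partial>lborel)"
    unfolding Jf_def Bf_eq[OF a t] using a tt by (subst nn_integral_cmult) auto
  also have "\<dots> = (\<integral>\<^sup>+x. (\<integral>\<^sup>+y. ?k x y * ennreal ((sqrt (rho a y) - sqrt (rho a x))\<^sup>2) \<partial>lborel) + 2 * (\<integral>\<^sup>+y. sr a x * sr a y * ?k x y \<partial>lborel) \<partial>lborel)"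
    using a tt by (intro nn_integral_add[symmetric]) measurable
  also have "\<dots> = (\<integral>\<^sup>+x. \<integral>\<^sup>+y. ?k x y * ennreal ((sqrt (rho a y) - sqrt (rho a x))\<^sup>2) + 2 * (sr a x * sr a y * ?k x y) \<partial>lborel \<partial>lborel)"
  proof (rule nn_integral_cong)
    fix x
    show "(\<integral>\<^sup>+y. ?k x y * ennreal ((sqrt (rho a y) - sqrt (rho a x))\<^sup>2) \<partial>lborel) + 2 * (\<integral>\<^sup>+y. sr a x * sr a y * ?k x y \<partial>lborel)
      = (\<integral>\<^sup>+y. ?k x y * ennreal ((sqrt (rho a y) - sqrt (rho a x))\<^sup>2) + 2 * (sr a x * sr a y * ?k x y) \<partial>lborel)"
      using a tt by (subst nn_integral_add) (auto simp: nn_integral_cmult)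
  qed
  also have "\<dots> = (\<integral>\<^sup>+x. \<integral>\<^sup>+y. ennreal (rho a x) * ?k x y + ennreal (rho a y) * ?k x y \<partial>lborel \<partial>lborel)" by (simp only: pt)
  also have "\<dots> = (\<integral>\<^sup>+x. ennreal (rho a x) + ennreal (rho (a + (t + t)) x) \<partial>lborel)"
  proof (rule nn_integral_cong)
    fix x
    have "(\<integral>\<^sup>+y. ennreal (rho a x) * ?k x y + ennreal (rho a y) * ?k x y \<partial>lborel)
      = (\<integral>\<^sup>+y. ennreal (rho a x) * ?k x y \<partial>lborel) + (\<integral>\<^sup>+y. ennreal (rho a y) * ?k y x \<partial>lborel)"
    proof -
      have "(\<lambda>y. ennreal (rho a y) * ?k y x) = (\<lambda>y. ennreal (rho a y) * ?k x y)"
        by (rule ext) (simp only: kap_sym[OF tt, of x])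
      then show ?thesis using a tt by (simp only: nn_integral_add) (subst nn_integral_add, auto)
    qed
    also have "\<dots> = ennreal (rho a x) + ennreal (rho (a + (t + t)) x)"
      using a tt by (simp add: nn_integral_cmult nn_kap rho_kap)
    finally show "(\<integral>\<^sup>+y. ennreal (rho a x) * ?k x y + ennreal (rho a y) * ?k x y \<partial>lborel) = ennreal (rho a x) + ennreal (rho (a + (t + t)) x)" .
  qed
  also have "\<dots> = 2" using a tt by (subst nn_integral_add) (auto simp: nn_rho)
  finally show ?thesis .
qed

text \<open>Between a/2 and a, n applications of \<open>energy_step\<close> telescope in S, and
  monotonicity replaces B at each intermediate time by its value at a. So n (1 - B(a)) is bounded
  independently of n.\<close>

lemma Jf_bound:
  assumes a: "0 < a"
  obtains C where "0 \<le> C" "\<And>n::nat. 0 < n \<Longrightarrow> Jf a (a / real n) \<le> ennreal (C / real n)"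
proof -
  \<comment> \<open>One bound for the kernel at all times from a/2 on; this is why the chain of
    times starts at a/2.\<close>
  define M where "M = rho (a / 2) 0"
  have M: "0 < M" "\<And>s z. a / 2 \<le> s \<Longrightarrow> rho s z \<le> M"
    using rho_pos[of "a/2" 0] rho_decreasing_sup[of "a/2"] a by (auto simp: M_def)
  define S where "S s = enn2real (Sf s)" for s
  have S: "Sf s = ennreal (S s)" "0 \<le> S s" if "0 < s" for s using Sf_finite[OF that] by (auto simp: S_def less_top)
  define c where "c = 2 * sqrt M"
  have c: "0 \<le> c" using M(1) by (simp add: c_def)
  have "Jf a (a / real n) \<le> ennreal (2 * c * S a / real n)" if n: "0 < n" for n :: nat
  proof -
    \<comment> \<open>Half of a/n, because \<open>Bf t\<close> belongs to the kernel at time 2t; n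
      steps of this length lead from a/2 to a.\<close>
    define t where "t = a / (2 * real n)"
    have t: "0 < t" "t + t = a / real n" using a n by (auto simp: t_def field_simps)
    define B where "B s = enn2real (Bf t s)" for s
    have B: "Bf t s = ennreal (B s)" "0 \<le> B s" "B s \<le> 1" if "0 < s" for s
    proof -
      have le: "Bf t s \<le> 1" by (rule Bf_le_1[OF that t(1)])
      then have "Bf t s < top" by (rule le_less_trans) simp
      then show "Bf t s = ennreal (B s)" "0 \<le> B s" by (auto simp: B_def)
      then show "B s \<le> 1" using le by simp
    qed
    define s where "s j = a / 2 + real j * t" for j :: nat
    have s: "0 < s j" "a / 2 \<le> s j" "s (Suc j) = s j + t" for j using a t(1) by (auto simp: s_def algebra_simps intro!: add_nonneg_pos)
    have sn: "s n = a" using n by (simp add: s_def t_def)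
    have step: "1 - B a \<le> c * S (s (Suc j)) - c * S (s j)" if j: "j < n" for j
    proof -
      have "1 + ennreal c * Sf (s j) \<le> Bf t (s j) + ennreal c * Sf (s j + t)"
        unfolding c_def by (rule energy_step[OF s(1) t(1)]) (use s(2)[of j] t(1) M(2) in auto)
      then have "ennreal (1 + c * S (s j)) \<le> ennreal (B (s j) + c * S (s (Suc j)))"
        using c S[OF s(1)[of j]] S[OF s(1)[of "Suc j"]] B[OF s(1)[of j]] by (simp add: s(3)[symmetric] ennreal_plus ennreal_mult)
      then have 1: "1 + c * S (s j) \<le> B (s j) + c * S (s (Suc j))"
        using c S(2)[OF s(1)[of "Suc j"]] B(2)[OF s(1)[of j]] by (subst (asm) ennreal_le_iff) auto
      have "s j < s n" using j t(1) by (simp add: s_def)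
      then have "s j < a" by (simp only: sn)
      then have "Bf t (s j) \<le> Bf t ((a - s j) + s j)" by (intro Bf_mono s(1) t(1)) simp
      then have "B (s j) \<le> B a" using B[OF s(1)[of j]] B[OF a] by simp
      with 1 show ?thesis by linarith
    qed
    have "real n * (1 - B a) = (\<Sum>j<n. 1 - B a)" by simp
    also have "\<dots> \<le> (\<Sum>j<n. c * S (s (Suc j)) - c * S (s j))" by (rule sum_mono) (use step in auto)
    also have "\<dots> = c * S (s n) - c * S (s 0)" by (rule sum_lessThan_telescope)
    also have "\<dots> \<le> c * S a" using c S(2)[OF s(1)[of 0]] by (simp add: sn)
    finally have 2: "1 - B a \<le> c * S a / real n" using n by (simp add: field_simps)
    have "2 - 2 * B a \<le> 2 * c * S a / real n" using mult_left_mono[OF 2, of 2] by simp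
    moreover have "Jf a (a / real n) = ennreal (2 - 2 * B a)"
    proof -
      have e: "Jf a (a / real n) + ennreal (2 * B a) = ennreal 2"
        using Jf_Bf[OF a t(1)] B[OF a] t(2) by (simp add: ennreal_mult)
      have "Jf a (a / real n) = ennreal 2 - ennreal (2 * B a)" by (subst e[symmetric]) simp
      then show ?thesis using ennreal_minus[of "2 * B a" 2] B(2)[OF a] by simp
    qed
    ultimately show ?thesis by (simp add: ennreal_leI)
  qed
  moreover have "0 \<le> 2 * c * S a" using c S(2)[OF a] by simp
  ultimately show thesis using that by blast
qed

lemma PP_taylor_0:
  assumes f: "test_fn f" and h: "0 < h" and B: "\<And>x. cmod (lap (lap f) x) \<le> B"
  shows "cmod (PP h f x - f x - (h / 4) *\<^sub>R lap f x) \<le> B * h\<^sup>2"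
proof (rule tendsto_upperbound)
  have "isCont (\<lambda>u. PP u f x) h"
    using has_vector_derivative_continuous[OF PP_deriv[OF f h, of x]] by simp
  then have 1: "((\<lambda>r. PP (r + h) f x) \<longlongrightarrow> PP h f x) (at_right 0)"
    by (rule isCont_tendsto_compose) (auto intro!: tendsto_eq_intros)
  show "((\<lambda>r. cmod (PP (r + h) f x - PP r f x - (h / 4) *\<^sub>R PP r (lap f) x)) \<longlongrightarrow> cmod (PP h f x - f x - (h / 4) *\<^sub>R lap f x)) (at_right 0)"
    by (intro tendsto_intros 1 PP_lim f test_fn_lap)
  show "\<forall>\<^sub>F r in at_right 0. cmod (PP (r + h) f x - PP r f x - (h / 4) *\<^sub>R PP r (lap f) x) \<le> B * h\<^sup>2"
    unfolding eventually_at_right_field using PP_taylor[OF f _ less_imp_le[OF h] B] by (intro exI[of _ 1]) auto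
qed simp

definition sqrho :: "real \<Rightarrow> complex^'n \<Rightarrow> real" where "sqrho a x = sqrt (rho a x)"

lemma smooth_sqrho: "0 < a \<Longrightarrow> smooth (sqrho a)"
  unfolding sqrho_def[abs_def] by (rule smooth_sqrt[OF rho_pos rho_smooth])

text \<open>Let u = sqrt rho_a. The semigroup at time a/n applied to a localised (u - u(x))^2 has
  value a/(4n) times its sublaplacian at x, up to O(n^-2), and that sublaplacian is twice the
  squared horizontal gradient of u. So n times the inner integral of J has lower limit at least a/2
  times the squared gradient, and Fatou's lemma with \<open>Jf_bound\<close> concludes.\<close>

lemma fisher_sqrt:
  assumes a: "0 < a"
  shows "(\<integral>\<^sup>+x. ennreal (\<Sum>i\<in>zidx. (lv (zt i) (sqrho a) x)\<^sup>2) \<partial>lborel) < \<infinity>"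
proof -
  obtain C where C: "0 \<le> C" "\<And>n::nat. 0 < n \<Longrightarrow> Jf a (a / real n) \<le> ennreal (C / real n)" using Jf_bound[OF a] by blast
  define u where "u = sqrho a"
  have su: "smooth u" unfolding u_def by (rule smooth_sqrho[OF a])
  define I where "I n x = (\<integral>\<^sup>+y. kap (a / real (Suc n)) x y * ennreal ((u y - u x)\<^sup>2) \<partial>lborel)" for n x
  have an: "0 < a / real (Suc n)" for n using a by simp
  have [measurable]: "u \<in> borel_measurable borel" by (rule smooth_borel[OF su])
  have mI[measurable]: "I n \<in> borel_measurable borel" for n unfolding I_def using an[of n] by measurable
  have intI: "(\<integral>\<^sup>+x. ennreal (real (Suc n)) * I n x \<partial>lborel) \<le> ennreal C" for n
  proof -
    have "(\<integral>\<^sup>+x. ennreal (real (Suc n)) * I n x \<partial>lborel) = ennreal (real (Suc n)) * (\<integral>\<^sup>+x. I n x \<partial>lborel)"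
      by (rule nn_integral_cmult) simp
    also have "(\<integral>\<^sup>+x. I n x \<partial>lborel) = Jf a (a / real (Suc n))"
      by (simp only: Jf_def I_def u_def sqrho_def)
    also have "ennreal (real (Suc n)) * Jf a (a / real (Suc n)) \<le> ennreal (real (Suc n)) * ennreal (C / real (Suc n))" by (intro mult_left_mono C(2)) auto
    also have "\<dots> = ennreal C" using C(1) by (subst ennreal_mult[symmetric]) auto
    finally show ?thesis .
  qed
  have low: "ennreal (a / 2 * (\<Sum>i\<in>zidx. (lv (zt i) u x)\<^sup>2)) \<le> liminf (\<lambda>n. ennreal (real (Suc n)) * I n x)" for x
  proof -
    obtain R where R: "1 \<le> R" "hn x \<le> R\<^sup>2"
    proof -
      have "hn x \<le> (1 + hn x)\<^sup>2" using hn_nonneg[of x] by (simp add: power2_eq_square algebra_simps)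
      then show thesis using that[of "1 + hn x"] hn_nonneg[of x] by simp
    qed
    have c1: "cutR R x = 1" by (rule cutR_1[OF R])
    define w where "w y = u y - u x" for y
    have sw: "smooth w" unfolding w_def by (intro smooth_diff su smooth_const)
    have w0: "w x = 0" by (simp add: w_def)
    have lw: "lv v w y = lv v u y" for v y unfolding w_def using lv_diff[OF su smooth_const] by simp
    \<comment> \<open>The cutoff yields a test function and only lowers the integral. Since w
      vanishes at x, just its value 1 at x enters the second derivative there.\<close>
    define g where "g y = cutR R y * w y * w y" for y
    have sg: "smooth g" unfolding g_def by (intro smooth_mult smooth_cutR sw)
    define \<Theta> where "\<Theta> y = complex_of_real (g y)" for y
    have \<Theta>: "test_fn \<Theta>"
    proof -
      have "test_fn (\<lambda>y. complex_of_real (w y * w y) * complex_of_real (cutR R y))"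
        by (intro test_fn_smooth_mult smooth_of_real smooth_mult sw test_fn_cutR) (use R in simp)
      then show ?thesis by (simp add: \<Theta>_def[abs_def] g_def mult_ac)
    qed
    have lapg: "lap \<Theta> x = complex_of_real (2 * (\<Sum>i\<in>zidx. (lv (zt i) u x)\<^sup>2))"
    proof -
      have "lv v (lv v \<Theta>) x = complex_of_real (2 * (lv v u x)\<^sup>2)" for v
      proof -
        have "lv v \<Theta> = (\<lambda>y. complex_of_real (lv v g y))" unfolding \<Theta>_def[abs_def] by (rule ext) (rule lv_of_real[OF sg])
        then have 1: "lv v (lv v \<Theta>) x = complex_of_real (lv v (lv v g) x)" by (simp add: lv_of_real[OF smooth_lv[OF sg]])
        have s1: "smooth (\<lambda>y. cutR R y * w y)" by (intro smooth_mult smooth_cutR sw)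
        have "lv v g = (\<lambda>y. (cutR R y * w y) * lv v w y + lv v (\<lambda>y. cutR R y * w y) y * w y)"
          unfolding g_def[abs_def] by (rule ext) (rule lv_mult[OF s1 sw])
        then have "lv v (lv v g) x = lv v (\<lambda>y. (cutR R y * w y) * lv v w y) x + lv v (\<lambda>y. lv v (\<lambda>y. cutR R y * w y) y * w y) x"
          using lv_add[OF smooth_mult[OF s1 smooth_lv[OF sw]] smooth_mult[OF smooth_lv[OF s1] sw]] by simp
        also have "\<dots> = (lv v (\<lambda>y. cutR R y * w y) x * lv v w x) + lv v (\<lambda>y. cutR R y * w y) x * lv v w x"
          using lv_mult[OF s1 smooth_lv[OF sw], of v v x] lv_mult[OF smooth_lv[OF s1] sw, of v v x] w0 by simp
        also have "lv v (\<lambda>y. cutR R y * w y) x = lv v w x"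
          using lv_mult[OF smooth_cutR sw, of v R x] w0 c1 by simp
        finally have "lv v (lv v g) x = 2 * (lv v u x)\<^sup>2" by (simp add: lw power2_eq_square)
        then show ?thesis using 1 by simp
      qed
      then show ?thesis unfolding lap_eq by (simp add: sum_distrib_left)
    qed
    obtain B where B: "\<And>y. cmod (lap (lap \<Theta>) y) \<le> B" using test_fn_bounded[OF test_fn_lap[OF test_fn_lap[OF \<Theta>]]] by blast
    have PPT: "PP s \<Theta> x = complex_of_real (\<integral>y. g (x \<odot> y) * rho s y \<partial>lborel)" if s: "0 < s" for s
    proof -
      have [measurable]: "g \<in> borel_measurable borel" by (rule smooth_borel[OF sg])
      have "PP s \<Theta> x = complex_of_real (\<integral>y. g (x \<odot> (- y)) * rho s (- y) \<partial>lborel)"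
        unfolding heat_conv_def \<Theta>_def by (simp add: rho_even[OF s] flip: of_real_mult)
      also have "(\<integral>y. g (x \<odot> (- y)) * rho s (- y) \<partial>lborel) = (\<integral>y. g (x \<odot> y) * rho s y \<partial>lborel)"
        by (rule integral_minus_arg) (use s in measurable)
      finally show ?thesis .
    qed
    have PI: "ennreal (\<integral>y. g (x \<odot> y) * rho (a / real (Suc n)) y \<partial>lborel) \<le> I n x" for n
    proof -
      let ?s = "a / real (Suc n)"
      have g0: "0 \<le> g y" "g y \<le> (u y - u x)\<^sup>2" for y
        using cutR_bounds[of R y] mult_left_le_one_le[of "(w y)\<^sup>2" "cutR R y"]
        by (auto simp: g_def w_def power2_eq_square mult.assoc)
      have [measurable]: "g \<in> borel_measurable borel" by (rule smooth_borel[OF sg])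
      have "ennreal (\<integral>y. g (x \<odot> y) * rho ?s y \<partial>lborel) \<le> (\<integral>\<^sup>+y. ennreal (g (x \<odot> y) * rho ?s y) \<partial>lborel)"
        using g0(1) rho_pos[OF an] an[of n] by (intro integral_eq_nn_integral[THEN eq_refl, THEN ennreal_leI, THEN order_trans]) (auto simp: less_imp_le ennreal_enn2real_if)
      also have "\<dots> \<le> (\<integral>\<^sup>+y. kap ?s x (x \<odot> y) * ennreal ((u (x \<odot> y) - u x)\<^sup>2) \<partial>lborel)"
      proof (rule nn_integral_mono)
        fix y
        have "ennreal (g (x \<odot> y) * rho ?s y) \<le> ennreal (rho ?s y * (u (x \<odot> y) - u x)\<^sup>2)"
          using g0(2)[of "x \<odot> y"] rho_pos[OF an[of n], of y] by (intro ennreal_leI) (simp add: mult.commute[of "rho _ _"] mult_right_mono)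
        then show "ennreal (g (x \<odot> y) * rho ?s y) \<le> kap ?s x (x \<odot> y) * ennreal ((u (x \<odot> y) - u x)\<^sup>2)"
          using rho_pos[OF an[of n], of y] by (simp add: kap_def ennreal_mult less_imp_le)
      qed
      also have "\<dots> = I n x"
        unfolding I_def using an[of n] by (intro nn_integral_left[of "\<lambda>y. kap ?s x y * ennreal ((u y - u x)\<^sup>2)"]) measurable
      finally show ?thesis .
    qed
    let ?L = "\<Sum>i\<in>zidx. (lv (zt i) u x)\<^sup>2"
    have lim: "(\<lambda>n. real (Suc n) * (\<integral>y. g (x \<odot> y) * rho (a / real (Suc n)) y \<partial>lborel)) \<longlonglongrightarrow> a / 2 * ?L"
    proof (rule LIM_zero_cancel, rule Lim_null_comparison)
      show "(\<lambda>n. B * a\<^sup>2 * inverse (real (Suc n))) \<longlonglongrightarrow> 0"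
        using tendsto_mult_right_zero[OF LIMSEQ_inverse_real_of_nat] by simp
      show "\<forall>\<^sub>F n in sequentially. norm (real (Suc n) * (\<integral>y. g (x \<odot> y) * rho (a / real (Suc n)) y \<partial>lborel) - a / 2 * ?L) \<le> B * a\<^sup>2 * inverse (real (Suc n))"
      proof (intro always_eventually allI)
        fix n
        define N where "N = real (Suc n)"
        have N: "0 < N" by (simp add: N_def)
        define G where "G = (\<integral>y. g (x \<odot> y) * rho (a / N) y \<partial>lborel)"
        have "cmod (PP (a / N) \<Theta> x - \<Theta> x - (a / N / 4) *\<^sub>R lap \<Theta> x) \<le> B * (a / N)\<^sup>2"
          by (rule PP_taylor_0[OF \<Theta> _ B]) (use a N in simp)
        moreover have "PP (a / N) \<Theta> x - \<Theta> x - (a / N / 4) *\<^sub>R lap \<Theta> x = complex_of_real (G - a / N / 2 * ?L)"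
          using PPT[of "a / N"] a N by (simp add: G_def \<Theta>_def g_def w0 lapg scaleR_conv_of_real)
        ultimately have "\<bar>G - a / N / 2 * ?L\<bar> \<le> B * (a / N)\<^sup>2" by (simp only: norm_of_real)
        then have "N * \<bar>G - a / N / 2 * ?L\<bar> \<le> N * (B * (a / N)\<^sup>2)" using N by (intro mult_left_mono) auto
        moreover have "N * \<bar>G - a / N / 2 * ?L\<bar> = \<bar>N * G - a / 2 * ?L\<bar>"
        proof -
          have "N * G - a / 2 * ?L = N * (G - a / N / 2 * ?L)" using N by (simp add: right_diff_distrib)
          then show ?thesis using N by (simp only: abs_mult abs_of_pos)
        qed
        moreover have "N * (B * (a / N)\<^sup>2) = B * a\<^sup>2 * inverse N" using N by (simp add: power2_eq_square field_simps)
        ultimately have "\<bar>N * G - a / 2 * ?L\<bar> \<le> B * a\<^sup>2 * inverse N" by linarith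
        then show "norm (real (Suc n) * (\<integral>y. g (x \<odot> y) * rho (a / real (Suc n)) y \<partial>lborel) - a / 2 * ?L) \<le> B * a\<^sup>2 * inverse (real (Suc n))"
          by (simp only: N_def G_def real_norm_def)
      qed
    qed
    have "ennreal (a / 2 * ?L) = liminf (\<lambda>n. ennreal (real (Suc n) * (\<integral>y. g (x \<odot> y) * rho (a / real (Suc n)) y \<partial>lborel)))"
      by (rule lim_imp_Liminf[OF sequentially_bot tendsto_ennrealI[OF lim], symmetric])
    also have "\<dots> \<le> liminf (\<lambda>n. ennreal (real (Suc n)) * I n x)"
    proof (rule Liminf_mono, intro always_eventually allI)
      fix n
      have "ennreal (real (Suc n) * (\<integral>y. g (x \<odot> y) * rho (a / real (Suc n)) y \<partial>lborel)) = ennreal (real (Suc n)) * ennreal (\<integral>y. g (x \<odot> y) * rho (a / real (Suc n)) y \<partial>lborel)"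
        by (rule ennreal_mult') simp
      also have "\<dots> \<le> ennreal (real (Suc n)) * I n x" by (intro mult_left_mono PI) simp
      finally show "ennreal (real (Suc n) * (\<integral>y. g (x \<odot> y) * rho (a / real (Suc n)) y \<partial>lborel)) \<le> ennreal (real (Suc n)) * I n x" .
    qed
    finally show ?thesis .
  qed
  have [measurable]: "(\<lambda>x. lv v u x) \<in> borel_measurable borel" for v by (rule smooth_borel[OF smooth_lv[OF su]])
  have "ennreal (a / 2) * (\<integral>\<^sup>+x. ennreal (\<Sum>i\<in>zidx. (lv (zt i) u x)\<^sup>2) \<partial>lborel) = (\<integral>\<^sup>+x. ennreal (a / 2 * (\<Sum>i\<in>zidx. (lv (zt i) u x)\<^sup>2)) \<partial>lborel)"
  proof -
    have "(\<integral>\<^sup>+x. ennreal (a / 2 * (\<Sum>i\<in>zidx. (lv (zt i) u x)\<^sup>2)) \<partial>lborel) = (\<integral>\<^sup>+x. ennreal (a / 2) * ennreal (\<Sum>i\<in>zidx. (lv (zt i) u x)\<^sup>2) \<partial>lborel)"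
      by (intro nn_integral_cong ennreal_mult) (use a in \<open>auto simp: sum_nonneg\<close>)
    then show ?thesis by (simp add: nn_integral_cmult)
  qed
  also have "\<dots> \<le> (\<integral>\<^sup>+x. liminf (\<lambda>n. ennreal (real (Suc n)) * I n x) \<partial>lborel)" by (rule nn_integral_mono[OF low])
  also have "\<dots> \<le> liminf (\<lambda>n. \<integral>\<^sup>+x. ennreal (real (Suc n)) * I n x \<partial>lborel)" by (rule nn_integral_liminf) measurable
  also have "\<dots> \<le> liminf (\<lambda>n. ennreal C)" by (rule Liminf_mono) (use intI in auto)
  also have "\<dots> = ennreal C" by (simp add: Liminf_const)
  finally have "ennreal (a / 2) * (\<integral>\<^sup>+x. ennreal (\<Sum>i\<in>zidx. (lv (zt i) u x)\<^sup>2) \<partial>lborel) < \<infinity>"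
    by (rule le_less_trans) simp
  then show ?thesis using a by (auto simp: ennreal_mult_less_top u_def)
qed

lemma lv_rho: assumes a: "0 < a" shows "lv v (rho a) x = 2 * sqrho a x * lv v (sqrho a) x"
proof -
  have "rho a = (\<lambda>x. sqrho a x * sqrho a x)" using rho_pos[OF a] by (auto simp: sqrho_def less_imp_le)
  then have "lv v (rho a) x = lv v (\<lambda>x. sqrho a x * sqrho a x) x" by simp
  also have "\<dots> = 2 * sqrho a x * lv v (sqrho a) x"
    using lv_mult[OF smooth_sqrho[OF a] smooth_sqrho[OF a]] by (simp add: algebra_simps)
  finally show ?thesis .
qed

text \<open>Writing rho as the square of its root, (D rho)^2 / rho = 4 (D sqrt rho)^2.\<close>

lemma fisher:
  assumes a: "0 < a" and i: "i \<in> zidx"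
  shows "integrable lborel (\<lambda>x. (lv (zt i) (rho a) x / rho a x)\<^sup>2 * rho a x)"
proof (rule integrableI_bounded)
  have [measurable]: "(\<lambda>x. lv v (rho a) x) \<in> borel_measurable borel" for v by (rule smooth_borel[OF smooth_lv[OF rho_smooth[OF a]]])
  show "(\<lambda>x. (lv (zt i) (rho a) x / rho a x)\<^sup>2 * rho a x) \<in> borel_measurable lborel" using a by measurable
  have [measurable]: "(\<lambda>x. lv v (sqrho a) x) \<in> borel_measurable borel" for v by (rule smooth_borel[OF smooth_lv[OF smooth_sqrho[OF a]]])
  have "(\<integral>\<^sup>+x. ennreal (norm ((lv (zt i) (rho a) x / rho a x)\<^sup>2 * rho a x)) \<partial>lborel) \<le> (\<integral>\<^sup>+x. ennreal 4 * ennreal (\<Sum>i\<in>zidx. (lv (zt i) (sqrho a) x)\<^sup>2) \<partial>lborel)"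
  proof (rule nn_integral_mono)
    fix x
    have q: "0 < sqrho a x" "rho a x = sqrho a x * sqrho a x" using rho_pos[OF a, of x] by (auto simp: sqrho_def)
    have "(lv (zt i) (rho a) x / rho a x)\<^sup>2 * rho a x = 4 * (lv (zt i) (sqrho a) x)\<^sup>2"
      unfolding lv_rho[OF a] q(2) using q(1) by (simp add: power2_eq_square field_simps)
    also have "\<dots> \<le> 4 * (\<Sum>i\<in>zidx. (lv (zt i) (sqrho a) x)\<^sup>2)"
      using i by (intro mult_left_mono member_le_sum) auto
    finally have "norm ((lv (zt i) (rho a) x / rho a x)\<^sup>2 * rho a x) \<le> 4 * (\<Sum>i\<in>zidx. (lv (zt i) (sqrho a) x)\<^sup>2)"
      using rho_pos[OF a, of x] by (simp add: abs_mult less_imp_le)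
    then have "ennreal (norm ((lv (zt i) (rho a) x / rho a x)\<^sup>2 * rho a x)) \<le> ennreal (4 * (\<Sum>i\<in>zidx. (lv (zt i) (sqrho a) x)\<^sup>2))" by (rule ennreal_leI)
    then show "ennreal (norm ((lv (zt i) (rho a) x / rho a x)\<^sup>2 * rho a x)) \<le> ennreal 4 * ennreal (\<Sum>i\<in>zidx. (lv (zt i) (sqrho a) x)\<^sup>2)"
      by (simp only: ennreal_mult sum_nonneg zero_le_power2 zero_le_numeral)
  qed
  also have "\<dots> = ennreal 4 * (\<integral>\<^sup>+x. ennreal (\<Sum>i\<in>zidx. (lv (zt i) (sqrho a) x)\<^sup>2) \<partial>lborel)" by (rule nn_integral_cmult) measurable
  also have "\<dots> < \<infinity>" using fisher_sqrt[OF a] by (simp add: ennreal_mult_less_top)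
  finally show "(\<integral>\<^sup>+x. ennreal (norm ((lv (zt i) (rho a) x / rho a x)\<^sup>2 * rho a x)) \<partial>lborel) < \<infinity>" .
qed

end

section \<open>Square integrable functions\<close>

definition sqn :: "'a measure \<Rightarrow> ('a \<Rightarrow> complex) \<Rightarrow> real" where
  "sqn M f = integral\<^sup>L M (\<lambda>x. (cmod (f x))\<^sup>2)"

lemma sqn_nonneg: "0 \<le> sqn M f" by (simp add: sqn_def)

lemma borel_measurable_cnj_fun [measurable]: "f \<in> borel_measurable M \<Longrightarrow> (\<lambda>x. cnj (f x)) \<in> borel_measurable M"
  by (rule measurable_compose[OF _ borel_measurable_continuous_onI]) (auto intro: continuous_intros)

lemma L2_measurable: "f \<in> L2 M \<Longrightarrow> f \<in> borel_measurable M" by (simp add: L2_def)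

lemma L2_integrable: "f \<in> L2 M \<Longrightarrow> integrable M (\<lambda>x. (cmod (f x))\<^sup>2)" by (simp add: L2_def)

lemma cmod_add_squared: "(cmod (u + v))\<^sup>2 \<le> 2 * (cmod u)\<^sup>2 + 2 * (cmod v)\<^sup>2"
proof -
  have "(cmod (u + v))\<^sup>2 \<le> (cmod u + cmod v)\<^sup>2" by (intro power_mono norm_triangle_ineq) simp
  also have "\<dots> \<le> 2 * (cmod u)\<^sup>2 + 2 * (cmod v)\<^sup>2" using sum_squares_bound[of "cmod u" "cmod v"] by (simp add: power2_sum)
  finally show ?thesis .
qed

lemma L2_add: assumes "f \<in> L2 M" "g \<in> L2 M" shows "(\<lambda>x. f x + g x) \<in> L2 M"
  unfolding L2_def
proof (intro CollectI conjI)
  have [measurable]: "f \<in> borel_measurable M" "g \<in> borel_measurable M" using assms by (auto simp: L2_def)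
  show "(\<lambda>x. f x + g x) \<in> borel_measurable M" by measurable
  show "integrable M (\<lambda>x. (cmod (f x + g x))\<^sup>2)"
    by (rule Bochner_Integration.integrable_bound[where f = "\<lambda>x. 2 * (cmod (f x))\<^sup>2 + 2 * (cmod (g x))\<^sup>2"])
       (use assms cmod_add_squared in \<open>auto simp: L2_def\<close>)
qed

lemma L2_cmult: assumes "f \<in> L2 M" shows "(\<lambda>x. c * f x) \<in> L2 M"
  using assms by (auto simp: L2_def norm_mult power_mult_distrib)

lemma L2_diff: assumes "f \<in> L2 M" "g \<in> L2 M" shows "(\<lambda>x. f x - g x) \<in> L2 M"
  using L2_add[OF assms(1) L2_cmult[OF assms(2), of "-1"]] by simp

lemma L2_sum: "(\<And>i. i \<in> I \<Longrightarrow> f i \<in> L2 M) \<Longrightarrow> (\<lambda>x. \<Sum>i\<in>I. f i x) \<in> L2 M"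
  by (induction I rule: infinite_finite_induct) (auto intro: L2_add simp: L2_def[of M, THEN eqset_imp_iff, of "\<lambda>x. 0"])

lemma L2_integrable_mult: assumes "f \<in> L2 M" "g \<in> L2 M"
  shows "integrable M (\<lambda>x. cmod (f x) * cmod (g x))" "integrable M (\<lambda>x. f x * cnj (g x))"
proof -
  have [measurable]: "f \<in> borel_measurable M" "g \<in> borel_measurable M" using assms by (auto simp: L2_def)
  have le: "cmod (f x) * cmod (g x) \<le> (cmod (f x))\<^sup>2 + (cmod (g x))\<^sup>2" for x
    using sum_squares_bound[of "cmod (f x)" "cmod (g x)"] mult_nonneg_nonneg[OF norm_ge_zero[of "f x"] norm_ge_zero[of "g x"]] by linarith
  show "integrable M (\<lambda>x. cmod (f x) * cmod (g x))" "integrable M (\<lambda>x. f x * cnj (g x))"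
    by (rule Bochner_Integration.integrable_bound[where f = "\<lambda>x. (cmod (f x))\<^sup>2 + (cmod (g x))\<^sup>2"],
        use assms le in \<open>auto simp: L2_def norm_mult\<close>)+
qed

lemma sqn_le:
  assumes "u \<in> L2 M" "v \<in> L2 M" "f \<in> borel_measurable M" "\<And>x. f x = u x + v x \<or> f x = u x - v x"
  shows "sqn M f \<le> 2 * sqn M u + 2 * sqn M v"
proof -
  have le: "(cmod (f x))\<^sup>2 \<le> 2 * (cmod (u x))\<^sup>2 + 2 * (cmod (v x))\<^sup>2" for x
    using assms(4)[of x] cmod_add_squared[of "u x" "v x"] cmod_add_squared[of "u x" "- v x"] by auto
  have 1: "integrable M (\<lambda>x. 2 * (cmod (u x))\<^sup>2 + 2 * (cmod (v x))\<^sup>2)" using assms(1,2) by (auto simp: L2_def)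
  have "sqn M f \<le> (\<integral>x. 2 * (cmod (u x))\<^sup>2 + 2 * (cmod (v x))\<^sup>2 \<partial>M)" unfolding sqn_def
    by (rule integral_mono_AE'[OF 1]) (use le in auto)
  also have "\<dots> = 2 * sqn M u + 2 * sqn M v" using assms(1,2) by (simp add: L2_def sqn_def)
  finally show ?thesis .
qed

lemma L2_Cauchy_Schwarz:
  assumes f: "f \<in> L2 M" and g: "g \<in> L2 M"
  shows "cmod (\<integral>x. f x * cnj (g x) \<partial>M) \<le> sqrt (sqn M f) * sqrt (sqn M g)"
proof -
  note [measurable] = L2_measurable[OF f] L2_measurable[OF g]
  let ?I = "\<integral>x. cmod (f x) * cmod (g x) \<partial>M"
  have "cmod (\<integral>x. f x * cnj (g x) \<partial>M) \<le> (\<integral>x. norm (f x * cnj (g x)) \<partial>M)" by (rule integral_norm_bound)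
  also have "\<dots> = ?I" by (simp add: norm_mult)
  finally have 1: "cmod (\<integral>x. f x * cnj (g x) \<partial>M) \<le> ?I" .
  have 0: "0 \<le> ?I" by (rule Bochner_Integration.integral_nonneg) simp
  have I: "(\<integral>\<^sup>+x. ennreal (cmod (f x)) * ennreal (cmod (g x)) \<partial>M) = ennreal ?I"
    by (subst nn_integral_eq_integral[symmetric]) (auto simp: ennreal_mult L2_integrable_mult[OF f g])
  have sq: "(\<integral>\<^sup>+x. (ennreal (cmod (u x)))\<^sup>2 \<partial>M) = ennreal (sqn M u)" if "u \<in> L2 M" for u
    unfolding sqn_def by (subst nn_integral_eq_integral[symmetric]) (auto simp: ennreal_power L2_integrable[OF that])
  have "(ennreal ?I)\<^sup>2 \<le> ennreal (sqn M f) * ennreal (sqn M g)"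
    using Cauchy_Schwarz_nn_integral[of "\<lambda>x. ennreal (cmod (f x))" M "\<lambda>x. ennreal (cmod (g x))"]
    by (simp only: I sq[OF f] sq[OF g]) measurable
  then have "ennreal (?I\<^sup>2) \<le> ennreal (sqn M f * sqn M g)"
    by (simp only: ennreal_power[OF 0] ennreal_mult[OF sqn_nonneg sqn_nonneg])
  then have "?I\<^sup>2 \<le> sqn M f * sqn M g" by (subst (asm) ennreal_le_iff) (auto intro: mult_nonneg_nonneg sqn_nonneg)
  then have "?I \<le> sqrt (sqn M f * sqn M g)" by (rule real_le_rsqrt)
  with 1 show ?thesis by (simp add: real_sqrt_mult)
qed

lemma L2_pairing_tendsto:
  assumes h: "h \<in> L2 M" and f: "f \<in> L2 M" and p: "\<And>n. \<psi> n \<in> L2 M"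
    and lim: "(\<lambda>n. sqn M (\<lambda>x. \<psi> n x - f x)) \<longlonglongrightarrow> 0"
  shows "(\<lambda>n. \<integral>x. h x * cnj (\<psi> n x) \<partial>M) \<longlonglongrightarrow> (\<integral>x. h x * cnj (f x) \<partial>M)"
proof (rule LIM_zero_cancel, rule Lim_null_comparison)
  show "\<forall>\<^sub>F n in sequentially. norm ((\<integral>x. h x * cnj (\<psi> n x) \<partial>M) - (\<integral>x. h x * cnj (f x) \<partial>M)) \<le> sqrt (sqn M h) * sqrt (sqn M (\<lambda>x. \<psi> n x - f x))"
  proof (intro always_eventually allI)
    fix n
    have "(\<integral>x. h x * cnj (\<psi> n x) \<partial>M) - (\<integral>x. h x * cnj (f x) \<partial>M) = (\<integral>x. h x * cnj (\<psi> n x - f x) \<partial>M)"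
      by (subst Bochner_Integration.integral_diff[symmetric]) (auto simp: L2_integrable_mult h p f right_diff_distrib)
    then show "norm ((\<integral>x. h x * cnj (\<psi> n x) \<partial>M) - (\<integral>x. h x * cnj (f x) \<partial>M)) \<le> sqrt (sqn M h) * sqrt (sqn M (\<lambda>x. \<psi> n x - f x))"
      using L2_Cauchy_Schwarz[OF h L2_diff[OF p f]] by simp
  qed
  show "(\<lambda>n. sqrt (sqn M h) * sqrt (sqn M (\<lambda>x. \<psi> n x - f x))) \<longlonglongrightarrow> 0"
    using tendsto_mult_right_zero[OF tendsto_real_sqrt[OF lim, simplified]] .
qed

section \<open>The Dirichlet form\<close>

lemma test_fn_cnj: "test_fn f \<Longrightarrow> test_fn (\<lambda>x. cnj (f x))"
  by (auto simp: test_fn_iff intro: smooth_linear_comp[OF bounded_linear_cnj])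

context heat_group
begin

lemma lv_cnj: "smooth f \<Longrightarrow> lv v (\<lambda>x. cnj (f x)) x = cnj (lv v f x)"
  using lv_eq[OF bounded_linear.has_derivative[OF bounded_linear_cnj smooth_has_derivative], of f v x]
    lv_eq[OF smooth_has_derivative, of f v x] by simp

lemma lv_parts:
  assumes u: "test_fn u" and w: "smooth w"
  shows "(\<integral>x. lv v u x * w x \<partial>lborel) = - (\<integral>x. u x * lv v w x \<partial>lborel)"
proof -
  have su: "smooth u" by (rule test_fn_smooth[OF u])
  have "test_fn (\<lambda>x. w x * u x)" by (rule test_fn_smooth_mult[OF w u])
  moreover have "lv v (\<lambda>x. w x * u x) = (\<lambda>x. w x * lv v u x + lv v w x * u x)" by (rule ext) (rule lv_mult[OF w su])
  ultimately have "(\<integral>x. w x * lv v u x + lv v w x * u x \<partial>lborel) = 0" using integral_lv_0 by metis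
  moreover have "(\<integral>x. w x * lv v u x + lv v w x * u x \<partial>lborel) = (\<integral>x. w x * lv v u x \<partial>lborel) + (\<integral>x. lv v w x * u x \<partial>lborel)"
    by (intro Bochner_Integration.integral_add test_fn_integrable test_fn_smooth_mult w smooth_lv u test_fn_lv)
  ultimately show ?thesis by (simp add: mult.commute add_eq_0_iff2)
qed

context fixes a :: real assumes a: "0 < a"
begin

abbreviation Q0 :: "(complex^'n \<Rightarrow> complex) \<Rightarrow> (complex^'n \<Rightarrow> complex) \<Rightarrow> complex" where
  "Q0 \<equiv> Q0form mul k xs (rho a)"

definition energy :: "(complex^'n \<Rightarrow> complex) \<Rightarrow> real" where
  "energy \<phi> = (\<Sum>i\<in>zidx. sqn (mu a) (lv (zt i) \<phi>))"

lemma integrable_mu: "f \<in> borel_measurable borel \<Longrightarrow> integrable (mu a) f \<longleftrightarrow> integrable lborel (\<lambda>x. rho a x *\<^sub>R f x)"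
  for f :: "complex^'n \<Rightarrow> 'b::{banach, second_countable_topology}"
  using rho_borel[OF a] rho_pos[OF a] by (subst integrable_density) (auto simp: less_imp_le)

lemma finite_measure_mu: "finite_measure (mu a)"
  by (rule finite_measureI) (simp add: emeasure_mu_UNIV[OF a])

lemma test_fn_L2: assumes "test_fn f" shows "f \<in> L2 (mu a)"
proof -
  obtain C where C: "0 \<le> C" "\<And>x. cmod (f x) \<le> C" using test_fn_bounded[OF assms] by blast
  have [measurable]: "f \<in> borel_measurable borel" by (rule smooth_borel[OF test_fn_smooth[OF assms]])
  have "integrable (mu a) (\<lambda>x. (cmod (f x))\<^sup>2)"
    by (rule finite_measure.integrable_const_bound[OF finite_measure_mu, where B = "C\<^sup>2"]) (use C in \<open>auto intro: power_mono\<close>)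
  then show ?thesis by (simp add: L2_def)
qed

lemma lv_L2: "test_fn f \<Longrightarrow> lv v f \<in> L2 (mu a)" by (intro test_fn_L2 test_fn_lv)

lemma Q0_eq:
  assumes "test_fn \<phi>" "test_fn \<psi>"
  shows "Q0 \<phi> \<psi> = (\<Sum>i\<in>zidx. \<integral>x. lv (zt i) \<phi> x * cnj (lv (zt i) \<psi> x) \<partial>mu a)"
proof -
  have b [measurable]: "lv v \<phi> \<in> borel_measurable borel" "lv v \<psi> \<in> borel_measurable borel" for v
    using assms by (auto intro: smooth_borel smooth_lv test_fn_smooth)
  have "Q0 \<phi> \<psi> = (\<integral>x. (\<Sum>i\<in>zidx. lv (zt i) \<phi> x * cnj (lv (zt i) \<psi> x)) * complex_of_real (rho a x) \<partial>lborel)"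
    unfolding Q0form_def by (simp only: sum_zidx[of "\<lambda>v. lv v \<phi> x * cnj (lv v \<psi> x)" for x])
  also have "\<dots> = (\<integral>x. (\<Sum>i\<in>zidx. lv (zt i) \<phi> x * cnj (lv (zt i) \<psi> x)) \<partial>mu a)"
    by (rule integral_mu[OF a, symmetric]) measurable
  also have "\<dots> = (\<Sum>i\<in>zidx. \<integral>x. lv (zt i) \<phi> x * cnj (lv (zt i) \<psi> x) \<partial>mu a)"
    by (intro Bochner_Integration.integral_sum L2_integrable_mult lv_L2 assms)
  finally show ?thesis .
qed

lemma Q0_self: assumes "test_fn \<phi>" shows "Q0 \<phi> \<phi> = complex_of_real (energy \<phi>)"
  unfolding Q0_eq[OF assms assms] energy_def sqn_def by (simp add: complex_norm_square[symmetric] flip: of_real_power)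

lemma energy_nonneg: "0 \<le> energy \<phi>" by (simp add: energy_def sum_nonneg sqn_nonneg)

lemma sqn_le_energy: "i \<in> zidx \<Longrightarrow> sqn (mu a) (lv (zt i) \<phi>) \<le> energy \<phi>"
  unfolding energy_def by (rule member_le_sum) (auto simp: sqn_nonneg)

lemma Q0_bound: assumes "test_fn \<phi>" "test_fn \<psi>"
  shows "cmod (Q0 \<phi> \<psi>) \<le> real (card zidx) * (sqrt (energy \<phi>) * sqrt (energy \<psi>))"
proof -
  have "cmod (Q0 \<phi> \<psi>) \<le> (\<Sum>i\<in>zidx. sqrt (energy \<phi>) * sqrt (energy \<psi>))"
    unfolding Q0_eq[OF assms]
  proof (intro order_trans[OF norm_sum] sum_mono)
    fix i assume i: "i \<in> zidx"
    have "cmod (\<integral>x. lv (zt i) \<phi> x * cnj (lv (zt i) \<psi> x) \<partial>mu a) \<le> sqrt (sqn (mu a) (lv (zt i) \<phi>)) * sqrt (sqn (mu a) (lv (zt i) \<psi>))"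
      by (intro L2_Cauchy_Schwarz lv_L2 assms)
    also have "\<dots> \<le> sqrt (energy \<phi>) * sqrt (energy \<psi>)"
      by (intro mult_mono real_sqrt_le_mono sqn_le_energy i) (auto simp: sqn_nonneg energy_nonneg)
    finally show "cmod (\<integral>x. lv (zt i) \<phi> x * cnj (lv (zt i) \<psi> x) \<partial>mu a) \<le> sqrt (energy \<phi>) * sqrt (energy \<psi>)" .
  qed
  then show ?thesis by simp
qed

lemma Q0_diff_left: assumes "test_fn \<phi>" "test_fn \<psi>" "test_fn \<zeta>"
  shows "Q0 (\<lambda>x. \<phi> x - \<psi> x) \<zeta> = Q0 \<phi> \<zeta> - Q0 \<psi> \<zeta>"
proof -
  have "Q0 (\<lambda>x. \<phi> x - \<psi> x) \<zeta> = (\<Sum>i\<in>zidx. (\<integral>x. lv (zt i) \<phi> x * cnj (lv (zt i) \<zeta> x) \<partial>mu a) - (\<integral>x. lv (zt i) \<psi> x * cnj (lv (zt i) \<zeta> x) \<partial>mu a))"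
    unfolding Q0_eq[OF test_fn_diff[OF assms(1,2)] assms(3)]
    by (intro sum.cong refl, subst Bochner_Integration.integral_diff[symmetric])
       (auto intro!: L2_integrable_mult lv_L2 assms simp: lv_diff test_fn_smooth assms left_diff_distrib)
  then show ?thesis using assms by (simp add: Q0_eq sum_subtractf)
qed

lemma energy_le:
  assumes "test_fn u" "test_fn v" "test_fn f" "(\<forall>x. f x = u x + v x) \<or> (\<forall>x. f x = u x - v x)"
  shows "energy f \<le> 2 * energy u + 2 * energy v"
proof -
  have "f = (\<lambda>x. u x + v x) \<or> f = (\<lambda>x. u x - v x)" using assms(4) by auto
  then have "lv w f x = lv w u x + lv w v x \<or> lv w f x = lv w u x - lv w v x" for w x
    using assms by (auto simp: lv_add lv_diff test_fn_smooth)
  then have "sqn (mu a) (lv (zt i) f) \<le> 2 * sqn (mu a) (lv (zt i) u) + 2 * sqn (mu a) (lv (zt i) v)" for i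
    by (intro sqn_le lv_L2 L2_measurable assms)
  then show ?thesis unfolding energy_def sum_distrib_left sum.distrib[symmetric] by (intro sum_mono)
qed

text \<open>Integration by parts moves all derivatives to one side: zeta is -1/rho times the sum of
  D(rho D phi), a test function because rho is smooth and positive. Pairing with a fixed test
  function is therefore continuous in L2, which is the source of closability.\<close>

lemma Q0_adjoint: assumes p: "test_fn \<phi>"
  obtains \<zeta> where "test_fn \<zeta>" "\<And>\<psi>. test_fn \<psi> \<Longrightarrow> Q0 \<phi> \<psi> = (\<integral>x. \<zeta> x * cnj (\<psi> x) \<partial>mu a)"
proof -
  let ?r = "\<lambda>x. complex_of_real (rho a x)"
  have sr: "smooth ?r" by (intro smooth_of_real rho_smooth a)
  define u where "u i x = ?r x * lv (zt i) \<phi> x" for i x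
  have u: "test_fn (u i)" for i unfolding u_def by (intro test_fn_smooth_mult sr test_fn_lv p)
  define \<zeta> where "\<zeta> x = complex_of_real (- inverse (rho a x)) * (\<Sum>i\<in>zidx. lv (zt i) (u i) x)" for x
  have "smooth (\<lambda>x. complex_of_real (- inverse (rho a x)))"
    by (intro smooth_of_real smooth_minus smooth_inverse rho_smooth a) (use rho_pos[OF a] in \<open>auto simp: less_imp_neq[symmetric]\<close>)
  then have c: "test_fn \<zeta>" unfolding \<zeta>_def by (intro test_fn_smooth_mult test_fn_sum test_fn_lv u)
  show thesis
  proof (rule that[OF c])
    fix \<psi> :: "complex^'n \<Rightarrow> complex" assume q: "test_fn \<psi>"
    have [measurable]: "lv v \<phi> \<in> borel_measurable borel" "lv v \<psi> \<in> borel_measurable borel" "\<zeta> \<in> borel_measurable borel" "\<psi> \<in> borel_measurable borel" for v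
      using p q c by (auto intro: smooth_borel smooth_lv test_fn_smooth)
    have sc: "smooth (\<lambda>x. cnj (\<psi> x))" by (intro test_fn_smooth test_fn_cnj q)
    have "(\<integral>x. lv (zt i) \<phi> x * cnj (lv (zt i) \<psi> x) \<partial>mu a) = - (\<integral>x. lv (zt i) (u i) x * cnj (\<psi> x) \<partial>lborel)" for i
    proof -
      have "(\<integral>x. lv (zt i) \<phi> x * cnj (lv (zt i) \<psi> x) \<partial>mu a) = (\<integral>x. u i x * lv (zt i) (\<lambda>x. cnj (\<psi> x)) x \<partial>lborel)"
        by (subst integral_mu[OF a]) (auto simp: u_def lv_cnj[OF test_fn_smooth[OF q]] mult_ac)
      then show ?thesis using lv_parts[OF u[of i] sc, of "zt i"] by simp
    qed
    then have "Q0 \<phi> \<psi> = (\<Sum>i\<in>zidx. - (\<integral>x. lv (zt i) (u i) x * cnj (\<psi> x) \<partial>lborel))" by (simp add: Q0_eq[OF p q])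
    also have "\<dots> = - (\<integral>x. (\<Sum>i\<in>zidx. lv (zt i) (u i) x * cnj (\<psi> x)) \<partial>lborel)"
      unfolding sum_negf by (subst Bochner_Integration.integral_sum)
        (auto intro!: test_fn_integrable test_fn_smooth_mult smooth_lv test_fn_smooth[OF u] test_fn_cnj q)
    also have "\<dots> = (\<integral>x. (\<zeta> x * cnj (\<psi> x)) * ?r x \<partial>lborel)"
      unfolding Bochner_Integration.integral_minus[symmetric]
    proof (rule Bochner_Integration.integral_cong[OF refl])
      fix x
      show "- (\<Sum>i\<in>zidx. lv (zt i) (u i) x * cnj (\<psi> x)) = (\<zeta> x * cnj (\<psi> x)) * ?r x"
        using rho_pos[OF a, of x] by (simp add: \<zeta>_def sum_distrib_right[symmetric])
    qed
    also have "\<dots> = (\<integral>x. \<zeta> x * cnj (\<psi> x) \<partial>mu a)" by (rule integral_mu[OF a, symmetric]) measurable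
    finally show "Q0 \<phi> \<psi> = (\<integral>x. \<zeta> x * cnj (\<psi> x) \<partial>mu a)" .
  qed
qed

text \<open>The energy of eta_n splits as Q0(eta_n - eta_l, eta_n) + Q0(eta_l, eta_n) with l fixed.
  The first term is small by the Cauchy property and the boundedness of the energies, the second
  tends to 0 by \<open>Q0_adjoint\<close>.\<close>

lemma closable:
  assumes t: "\<And>n. test_fn (\<eta> n)" and lim: "(\<lambda>n. sqn (mu a) (\<eta> n)) \<longlonglongrightarrow> 0"
    and cau: "\<And>e. 0 < e \<Longrightarrow> \<exists>N. \<forall>n\<ge>N. \<forall>l\<ge>N. energy (\<lambda>x. \<eta> n x - \<eta> l x) < e"
  shows "(\<lambda>n. energy (\<eta> n)) \<longlonglongrightarrow> 0"
proof (rule LIMSEQ_I)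
  fix e :: real assume e: "0 < e"
  let ?c = "real (card zidx)"
  obtain N1 where N1: "\<forall>n\<ge>N1. \<forall>l\<ge>N1. energy (\<lambda>x. \<eta> n x - \<eta> l x) < 1" using cau[of 1] by auto
  define B where "B = 2 + 2 * energy (\<eta> N1)"
  have B0: "0 \<le> B" by (simp add: B_def energy_nonneg)
  have B: "energy (\<eta> n) \<le> B" if "N1 \<le> n" for n
  proof -
    have "energy (\<eta> n) \<le> 2 * energy (\<lambda>x. \<eta> n x - \<eta> N1 x) + 2 * energy (\<eta> N1)"
      by (rule energy_le) (auto intro: t test_fn_diff)
    moreover have "energy (\<lambda>x. \<eta> n x - \<eta> N1 x) < 1" using N1 that by auto
    ultimately show ?thesis by (simp add: B_def)
  qed
  \<comment> \<open>Chosen to keep the Cauchy-Schwarz bound of the first term below e/2; the added 1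
    keeps the denominator positive.\<close>
  define d where "d = e / (2 * (?c * sqrt B + 1))"
  have cB: "0 < ?c * sqrt B + 1" using B0 by (simp add: add_nonneg_pos)
  have d: "0 < d" using e cB by (simp add: d_def)
  have cd: "?c * (d * sqrt B) < e / 2"
  proof -
    have "?c * (d * sqrt B) < d * (?c * sqrt B + 1)" using d by (simp add: algebra_simps)
    also have "\<dots> = e / 2" using cB by (simp add: d_def field_simps)
    finally show ?thesis .
  qed
  obtain N2 where N2: "\<forall>n\<ge>N2. \<forall>l\<ge>N2. energy (\<lambda>x. \<eta> n x - \<eta> l x) < d\<^sup>2" using cau[of "d\<^sup>2"] d by auto
  define l where "l = max N1 N2"
  obtain \<zeta> where c: "test_fn \<zeta>" "\<And>\<psi>. test_fn \<psi> \<Longrightarrow> Q0 (\<eta> l) \<psi> = (\<integral>x. \<zeta> x * cnj (\<psi> x) \<partial>mu a)"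
    using Q0_adjoint[OF t] by blast
  have "(\<lambda>n. \<integral>x. \<zeta> x * cnj (\<eta> n x) \<partial>mu a) \<longlonglongrightarrow> (\<integral>x. \<zeta> x * cnj 0 \<partial>mu a)"
    by (rule L2_pairing_tendsto) (auto intro: test_fn_L2 c t lim test_fn_zero simp: lim)
  then have "(\<lambda>n. Q0 (\<eta> l) (\<eta> n)) \<longlonglongrightarrow> 0" by (simp add: c(2)[OF t])
  from LIMSEQ_D[OF this, of "e / 2"] e obtain N3 where N3: "\<forall>n\<ge>N3. cmod (Q0 (\<eta> l) (\<eta> n)) < e / 2" by auto
  show "\<exists>no. \<forall>n\<ge>no. norm (energy (\<eta> n) - 0) < e"
  proof (intro exI allI impI)
    fix n assume n: "max l N3 \<le> n"
    have "complex_of_real (energy (\<eta> n)) = Q0 (\<lambda>x. \<eta> n x - \<eta> l x) (\<eta> n) + Q0 (\<eta> l) (\<eta> n)"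
      by (simp add: Q0_diff_left t Q0_self)
    then have "cmod (complex_of_real (energy (\<eta> n))) \<le> cmod (Q0 (\<lambda>x. \<eta> n x - \<eta> l x) (\<eta> n)) + cmod (Q0 (\<eta> l) (\<eta> n))"
      by (simp only: norm_triangle_ineq)
    then have "energy (\<eta> n) \<le> cmod (Q0 (\<lambda>x. \<eta> n x - \<eta> l x) (\<eta> n)) + cmod (Q0 (\<eta> l) (\<eta> n))"
      by (simp only: norm_of_real abs_of_nonneg energy_nonneg)
    also have "cmod (Q0 (\<eta> l) (\<eta> n)) < e / 2" using N3 n by auto
    also have "cmod (Q0 (\<lambda>x. \<eta> n x - \<eta> l x) (\<eta> n)) \<le> ?c * (sqrt (energy (\<lambda>x. \<eta> n x - \<eta> l x)) * sqrt (energy (\<eta> n)))"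
      by (rule Q0_bound) (intro t test_fn_diff)+
    also have "\<dots> \<le> ?c * (d * sqrt B)"
    proof -
      have "energy (\<lambda>x. \<eta> n x - \<eta> l x) \<le> d\<^sup>2" using N2 n by (auto simp: l_def intro: less_imp_le)
      then have "sqrt (energy (\<lambda>x. \<eta> n x - \<eta> l x)) \<le> sqrt (d\<^sup>2)" by (rule real_sqrt_le_mono)
      then have "sqrt (energy (\<lambda>x. \<eta> n x - \<eta> l x)) \<le> d" using d by simp
      moreover have "sqrt (energy (\<eta> n)) \<le> sqrt B" using B[of n] n by (auto simp: l_def)
      ultimately show ?thesis using d by (intro mult_left_mono mult_mono) (auto simp: energy_nonneg)
    qed
    finally have "energy (\<eta> n) < e" using cd by linarith
    then show "norm (energy (\<eta> n) - 0) < e" by (simp add: energy_nonneg)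
  qed
qed

lemma form_approx_iff: "form_approx (mu a) Q0 f \<phi> \<longleftrightarrow> (\<forall>n. test_fn (\<phi> n)) \<and>
    (\<lambda>n. sqn (mu a) (\<lambda>x. \<phi> n x - f x)) \<longlonglongrightarrow> 0 \<and>
    (\<forall>e>0. \<exists>N. \<forall>n\<ge>N. \<forall>l\<ge>N. energy (\<lambda>x. \<phi> n x - \<phi> l x) < e)"
proof (cases "\<forall>n. test_fn (\<phi> n)")
  case True
  then have "cmod (Q0 (\<lambda>x. \<phi> n x - \<phi> l x) (\<lambda>x. \<phi> n x - \<phi> l x)) = energy (\<lambda>x. \<phi> n x - \<phi> l x)" for n l
    by (subst Q0_self) (auto intro: test_fn_diff simp: energy_nonneg)
  then show ?thesis unfolding form_approx_def sqn_def by simp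
qed (auto simp: form_approx_def)

text \<open>\<open>form_val\<close> is a definite description over all approximating sequences, so
  one sequence with convergent gradients does not suffice by itself. Any other sequence differs from
  it by one that is null in L2 and Cauchy in energy, and closability makes its energy vanish in the
  limit, so the gradients converge to the same u. For f2 only bounded energies and L2 convergence
  are used.\<close>

lemma form_genI:
  assumes f: "f \<in> L2 (mu a)" and app: "form_approx (mu a) Q0 f \<phi>"
    and u: "\<And>i. i \<in> zidx \<Longrightarrow> u i \<in> L2 (mu a)"
    and du: "\<And>i. i \<in> zidx \<Longrightarrow> (\<lambda>n. sqn (mu a) (\<lambda>x. lv (zt i) (\<phi> n) x - u i x)) \<longlonglongrightarrow> 0"
    and h: "h \<in> L2 (mu a)"
    and uh: "\<And>\<psi>. test_fn \<psi> \<Longrightarrow> (\<Sum>i\<in>zidx. \<integral>x. u i x * cnj (lv (zt i) \<psi> x) \<partial>mu a) = (\<integral>x. h x * cnj (\<psi> x) \<partial>mu a)"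
  shows "form_gen (mu a) Q0 f h"
  unfolding form_gen_def
proof (intro conjI ballI)
  show "f \<in> form_dom (mu a) Q0" using f app by (auto simp: form_dom_def)
  show "h \<in> L2 (mu a)" by (rule h)
  have phi: "\<And>n. test_fn (\<phi> n)" "(\<lambda>n. sqn (mu a) (\<lambda>x. \<phi> n x - f x)) \<longlonglongrightarrow> 0"
    "\<And>e. 0 < e \<Longrightarrow> \<exists>N. \<forall>n\<ge>N. \<forall>l\<ge>N. energy (\<lambda>x. \<phi> n x - \<phi> l x) < e" using app by (auto simp: form_approx_iff)
  fix f2 assume "f2 \<in> form_dom (mu a) Q0"
  then obtain \<psi>0 where f2: "f2 \<in> L2 (mu a)" and psi0: "form_approx (mu a) Q0 f2 \<psi>0" by (auto simp: form_dom_def)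
  have lim: "(\<lambda>n. Q0 (\<theta> n) (\<psi> n)) \<longlonglongrightarrow> (\<integral>x. h x * cnj (f2 x) \<partial>mu a)"
    if th: "form_approx (mu a) Q0 f \<theta>" and ps: "form_approx (mu a) Q0 f2 \<psi>" for \<theta> \<psi>
  proof -
    have th: "\<And>n. test_fn (\<theta> n)" "(\<lambda>n. sqn (mu a) (\<lambda>x. \<theta> n x - f x)) \<longlonglongrightarrow> 0"
      "\<And>e. 0 < e \<Longrightarrow> \<exists>N. \<forall>n\<ge>N. \<forall>l\<ge>N. energy (\<lambda>x. \<theta> n x - \<theta> l x) < e" using th by (auto simp: form_approx_iff)
    have ps: "\<And>n. test_fn (\<psi> n)" "(\<lambda>n. sqn (mu a) (\<lambda>x. \<psi> n x - f2 x)) \<longlonglongrightarrow> 0"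
      "\<And>e. 0 < e \<Longrightarrow> \<exists>N. \<forall>n\<ge>N. \<forall>l\<ge>N. energy (\<lambda>x. \<psi> n x - \<psi> l x) < e" using ps by (auto simp: form_approx_iff)
    define \<eta> where "\<eta> n x = \<theta> n x - \<phi> n x" for n x
    have te: "test_fn (\<eta> n)" for n unfolding \<eta>_def by (intro test_fn_diff th phi)
    have e0: "(\<lambda>n. energy (\<eta> n)) \<longlonglongrightarrow> 0"
    proof (rule closable[OF te])
      have le: "sqn (mu a) (\<eta> n) \<le> 2 * sqn (mu a) (\<lambda>x. \<theta> n x - f x) + 2 * sqn (mu a) (\<lambda>x. \<phi> n x - f x)" for n
        by (rule sqn_le[OF L2_diff[OF test_fn_L2[OF th(1)] f] L2_diff[OF test_fn_L2[OF phi(1)] f] L2_measurable[OF test_fn_L2[OF te]]]) (simp add: \<eta>_def)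
      have "(\<lambda>n. 2 * sqn (mu a) (\<lambda>x. \<theta> n x - f x) + 2 * sqn (mu a) (\<lambda>x. \<phi> n x - f x)) \<longlonglongrightarrow> 2 * 0 + 2 * 0"
        by (intro tendsto_intros th phi)
      then show "(\<lambda>n. sqn (mu a) (\<eta> n)) \<longlonglongrightarrow> 0"
        by (intro Lim_null_comparison[where g = "\<lambda>n. 2 * sqn (mu a) (\<lambda>x. \<theta> n x - f x) + 2 * sqn (mu a) (\<lambda>x. \<phi> n x - f x)" and f = "\<lambda>n. sqn (mu a) (\<eta> n)"] always_eventually allI)
           (simp_all add: sqn_nonneg le)
      fix e :: real assume "0 < e"
      then obtain N1 N2 where N: "\<forall>n\<ge>N1. \<forall>l\<ge>N1. energy (\<lambda>x. \<theta> n x - \<theta> l x) < e / 4"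
          "\<forall>n\<ge>N2. \<forall>l\<ge>N2. energy (\<lambda>x. \<phi> n x - \<phi> l x) < e / 4" using th(3)[of "e / 4"] phi(3)[of "e / 4"] by auto
      show "\<exists>N. \<forall>n\<ge>N. \<forall>l\<ge>N. energy (\<lambda>x. \<eta> n x - \<eta> l x) < e"
      proof (intro exI[of _ "max N1 N2"] allI impI)
        fix n l assume nl: "max N1 N2 \<le> n" "max N1 N2 \<le> l"
        have "energy (\<lambda>x. \<eta> n x - \<eta> l x) \<le> 2 * energy (\<lambda>x. \<theta> n x - \<theta> l x) + 2 * energy (\<lambda>x. \<phi> n x - \<phi> l x)"
          by (rule energy_le[OF test_fn_diff[OF th(1) th(1)] test_fn_diff[OF phi(1) phi(1)] test_fn_diff[OF te te]]) (simp add: \<eta>_def)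
        moreover have "energy (\<lambda>x. \<theta> n x - \<theta> l x) < e / 4" "energy (\<lambda>x. \<phi> n x - \<phi> l x) < e / 4" using N nl by auto
        ultimately show "energy (\<lambda>x. \<eta> n x - \<eta> l x) < e" by linarith
      qed
    qed
    have du': "(\<lambda>n. sqn (mu a) (\<lambda>x. lv (zt i) (\<theta> n) x - u i x)) \<longlonglongrightarrow> 0" if i: "i \<in> zidx" for i
    proof (rule Lim_null_comparison)
      have le: "sqn (mu a) (\<lambda>x. lv (zt i) (\<theta> n) x - u i x) \<le> 2 * sqn (mu a) (lv (zt i) (\<eta> n)) + 2 * sqn (mu a) (\<lambda>x. lv (zt i) (\<phi> n) x - u i x)" for n
        by (rule sqn_le[OF lv_L2[OF te] L2_diff[OF lv_L2[OF phi(1)] u[OF i]] L2_measurable[OF L2_diff[OF lv_L2[OF th(1)] u[OF i]]]])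
           (simp add: \<eta>_def[abs_def] lv_diff test_fn_smooth[OF th(1)] test_fn_smooth[OF phi(1)])
      show "\<forall>\<^sub>F n in sequentially. norm (sqn (mu a) (\<lambda>x. lv (zt i) (\<theta> n) x - u i x)) \<le> 2 * energy (\<eta> n) + 2 * sqn (mu a) (\<lambda>x. lv (zt i) (\<phi> n) x - u i x)"
        by (intro always_eventually allI) (use le sqn_le_energy[OF i] in \<open>smt (verit) sqn_nonneg real_norm_def\<close>)
      have "(\<lambda>n. 2 * energy (\<eta> n) + 2 * sqn (mu a) (\<lambda>x. lv (zt i) (\<phi> n) x - u i x)) \<longlonglongrightarrow> 2 * 0 + 2 * 0"
        by (intro tendsto_intros e0 du i)
      then show "(\<lambda>n. 2 * energy (\<eta> n) + 2 * sqn (mu a) (\<lambda>x. lv (zt i) (\<phi> n) x - u i x)) \<longlonglongrightarrow> 0" by simp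
    qed
    obtain N1 where N1: "\<forall>n\<ge>N1. \<forall>l\<ge>N1. energy (\<lambda>x. \<psi> n x - \<psi> l x) < 1" using ps(3)[of 1] by auto
    define B where "B = 2 + 2 * energy (\<psi> N1)"
    have B: "energy (\<psi> n) \<le> B" if "N1 \<le> n" for n
    proof -
      have "energy (\<psi> n) \<le> 2 * energy (\<lambda>x. \<psi> n x - \<psi> N1 x) + 2 * energy (\<psi> N1)"
        by (rule energy_le) (auto intro: ps test_fn_diff)
      moreover have "energy (\<lambda>x. \<psi> n x - \<psi> N1 x) < 1" using N1 that by auto
      ultimately show ?thesis by (simp add: B_def)
    qed
    let ?R = "\<lambda>n. \<Sum>i\<in>zidx. \<integral>x. (lv (zt i) (\<theta> n) x - u i x) * cnj (lv (zt i) (\<psi> n) x) \<partial>mu a"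
    have split: "Q0 (\<theta> n) (\<psi> n) = ?R n + (\<integral>x. h x * cnj (\<psi> n x) \<partial>mu a)" for n
      unfolding Q0_eq[OF th(1) ps(1)] uh[OF ps(1), symmetric] sum.distrib[symmetric]
      by (intro sum.cong refl, subst Bochner_Integration.integral_add[symmetric])
         (auto intro!: L2_integrable_mult L2_diff lv_L2 th ps u simp: left_diff_distrib)
    have "?R \<longlonglongrightarrow> (\<Sum>i\<in>zidx. 0)"
    proof (rule tendsto_sum, rule Lim_null_comparison)
      fix i assume i: "i \<in> zidx"
      show "\<forall>\<^sub>F n in sequentially. norm (\<integral>x. (lv (zt i) (\<theta> n) x - u i x) * cnj (lv (zt i) (\<psi> n) x) \<partial>mu a) \<le> sqrt (sqn (mu a) (\<lambda>x. lv (zt i) (\<theta> n) x - u i x)) * sqrt B"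
        unfolding eventually_sequentially
      proof (intro exI[of _ N1] allI impI)
        fix n assume n: "N1 \<le> n"
        have "norm (\<integral>x. (lv (zt i) (\<theta> n) x - u i x) * cnj (lv (zt i) (\<psi> n) x) \<partial>mu a) \<le> sqrt (sqn (mu a) (\<lambda>x. lv (zt i) (\<theta> n) x - u i x)) * sqrt (sqn (mu a) (lv (zt i) (\<psi> n)))"
          by (intro L2_Cauchy_Schwarz L2_diff lv_L2 th ps u i)
        also have "\<dots> \<le> sqrt (sqn (mu a) (\<lambda>x. lv (zt i) (\<theta> n) x - u i x)) * sqrt B"
          using B[OF n] sqn_le_energy[OF i, of "\<psi> n"] by (intro mult_left_mono) (auto simp: sqn_nonneg)
        finally show "norm (\<integral>x. (lv (zt i) (\<theta> n) x - u i x) * cnj (lv (zt i) (\<psi> n) x) \<partial>mu a) \<le> sqrt (sqn (mu a) (\<lambda>x. lv (zt i) (\<theta> n) x - u i x)) * sqrt B" .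
      qed
      show "(\<lambda>n. sqrt (sqn (mu a) (\<lambda>x. lv (zt i) (\<theta> n) x - u i x)) * sqrt B) \<longlonglongrightarrow> 0"
        using tendsto_mult_left_zero[OF tendsto_real_sqrt[OF du'[OF i], simplified]] .
    qed
    moreover have "(\<lambda>n. \<integral>x. h x * cnj (\<psi> n x) \<partial>mu a) \<longlonglongrightarrow> (\<integral>x. h x * cnj (f2 x) \<partial>mu a)"
      by (rule L2_pairing_tendsto[OF h f2 test_fn_L2[OF ps(1)] ps(2)])
    ultimately show ?thesis unfolding split using tendsto_add by fastforce
  qed
  show "(\<integral>x. h x * cnj (f2 x) \<partial>mu a) = form_val (mu a) Q0 f f2" unfolding form_val_def
  proof (rule the_equality[symmetric])
    fix q assume "\<forall>phi psi. form_approx (mu a) Q0 f phi \<longrightarrow> form_approx (mu a) Q0 f2 psi \<longrightarrow> (\<lambda>n. Q0 (phi n) (psi n)) \<longlonglongrightarrow> q"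
    then have "(\<lambda>n. Q0 (\<phi> n) (\<psi>0 n)) \<longlonglongrightarrow> q" using app psi0 by blast
    then show "q = (\<integral>x. h x * cnj (f2 x) \<partial>mu a)" using lim[OF app psi0] LIMSEQ_unique by blast
  qed (use lim in blast)
qed

lemma test_fn_form_dom: assumes "test_fn \<phi>" shows "\<phi> \<in> form_dom (mu a) Q0"
proof -
  have "form_approx (mu a) Q0 \<phi> (\<lambda>n. \<phi>)"
    using assms by (auto simp: form_approx_iff sqn_def energy_def lvf_def)
  then show ?thesis using test_fn_L2[OF assms] by (auto simp: form_dom_def)
qed

end

end

section \<open>Commutators of left-invariant fields\<close>

lemma smooth_ray_derivative:
  fixes g :: "'a::euclidean_space \<Rightarrow> real"
  assumes "smooth g"
  shows "((\<lambda>t. g (y + t *\<^sub>R w)) has_real_derivative dderiv w g (y + t *\<^sub>R w)) (at t)"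
proof -
  obtain g' where g': "\<And>x. (g has_derivative g' x) (at x)" by (rule smooth_derivative[OF assms]) (rule that)
  have "((\<lambda>t. y + t *\<^sub>R w) has_derivative (\<lambda>h. h *\<^sub>R w)) (at t)" by (auto intro!: derivative_eq_intros)
  from has_derivative_compose[OF this g'] have "((\<lambda>t. g (y + t *\<^sub>R w)) has_derivative (\<lambda>h. g' (y + t *\<^sub>R w) (h *\<^sub>R w))) (at t)" .
  moreover have "(\<lambda>h. g' (y + t *\<^sub>R w) (h *\<^sub>R w)) = (*) (dderiv w g (y + t *\<^sub>R w))"
    using linear_scale[OF has_derivative_linear[OF g']] by (auto simp: dderiv_eq(1)[OF g'])
  ultimately show ?thesis by (simp add: has_field_derivative_def)
qed

text \<open>Two mean value theorems, first along u and then along v, write the second difference as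
  h^2 times the mixed derivative at a nearby point. The difference itself is symmetric in u and v,
  which gives \<open>dderiv_commute\<close>.\<close>

lemma second_difference_tendsto:
  fixes f :: "'a::euclidean_space \<Rightarrow> real"
  assumes f: "smooth f"
  defines "h \<equiv> \<lambda>n. inverse (real (Suc n))"
  shows "(\<lambda>n. (f (x + h n *\<^sub>R u + h n *\<^sub>R v) - f (x + h n *\<^sub>R u) - f (x + h n *\<^sub>R v) + f x) / (h n)\<^sup>2)
    \<longlonglongrightarrow> dderiv v (dderiv u f) x"
proof -
  have h: "0 < h n" for n by (simp add: h_def)
  let ?D = "dderiv v (dderiv u f)"
  have "\<exists>s t. 0 < s \<and> s < h n \<and> 0 < t \<and> t < h n \<and>
      f (x + h n *\<^sub>R u + h n *\<^sub>R v) - f (x + h n *\<^sub>R u) - f (x + h n *\<^sub>R v) + f x = (h n)\<^sup>2 * ?D (x + s *\<^sub>R u + t *\<^sub>R v)" for n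
  proof -
    have "((\<lambda>s. f ((x + h n *\<^sub>R v) + s *\<^sub>R u) - f (x + s *\<^sub>R u)) has_real_derivative
        dderiv u f ((x + h n *\<^sub>R v) + s *\<^sub>R u) - dderiv u f (x + s *\<^sub>R u)) (at s)" for s
      by (intro DERIV_diff smooth_ray_derivative f)
    from MVT2[OF h this] obtain s where s: "0 < s" "s < h n"
      "(f ((x + h n *\<^sub>R v) + h n *\<^sub>R u) - f (x + h n *\<^sub>R u)) - (f (x + h n *\<^sub>R v) - f x)
        = h n * (dderiv u f ((x + h n *\<^sub>R v) + s *\<^sub>R u) - dderiv u f (x + s *\<^sub>R u))" by auto
    have "((\<lambda>t. dderiv u f ((x + s *\<^sub>R u) + t *\<^sub>R v)) has_real_derivative ?D ((x + s *\<^sub>R u) + t *\<^sub>R v)) (at t)" for t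
      by (intro smooth_ray_derivative smooth_dderiv f)
    from MVT2[OF h this] obtain t where t: "0 < t" "t < h n"
      "dderiv u f ((x + s *\<^sub>R u) + h n *\<^sub>R v) - dderiv u f (x + s *\<^sub>R u) = h n * ?D ((x + s *\<^sub>R u) + t *\<^sub>R v)" by auto
    have "dderiv u f ((x + h n *\<^sub>R v) + s *\<^sub>R u) - dderiv u f (x + s *\<^sub>R u) = h n * ?D (x + s *\<^sub>R u + t *\<^sub>R v)"
      using t(3) by (simp add: add_ac)
    with s(3) have "f (x + h n *\<^sub>R u + h n *\<^sub>R v) - f (x + h n *\<^sub>R u) - f (x + h n *\<^sub>R v) + f x = h n * (h n * ?D (x + s *\<^sub>R u + t *\<^sub>R v))"
      by (simp add: add_ac)
    then show ?thesis using s t by (intro exI[of _ s] exI[of _ t]) (simp add: power2_eq_square)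
  qed
  then obtain s t where st: "\<And>n. 0 < s n" "\<And>n. s n < h n" "\<And>n. 0 < t n" "\<And>n. t n < h n"
      "\<And>n. f (x + h n *\<^sub>R u + h n *\<^sub>R v) - f (x + h n *\<^sub>R u) - f (x + h n *\<^sub>R v) + f x = (h n)\<^sup>2 * ?D (x + s n *\<^sub>R u + t n *\<^sub>R v)"
    by metis
  have h0: "h \<longlonglongrightarrow> 0" unfolding h_def by (rule LIMSEQ_inverse_real_of_nat)
  have "s \<longlonglongrightarrow> 0" "t \<longlonglongrightarrow> 0"
    by (rule tendsto_sandwich[OF _ _ tendsto_const h0], use st in \<open>auto intro!: always_eventually less_imp_le\<close>)+
  then have "(\<lambda>n. x + s n *\<^sub>R u + t n *\<^sub>R v) \<longlonglongrightarrow> x + 0 *\<^sub>R u + 0 *\<^sub>R v" by (intro tendsto_intros)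
  moreover have "isCont ?D x"
    using smooth_continuous[OF smooth_dderiv[OF smooth_dderiv[OF f]]] by (simp add: continuous_on_eq_continuous_at)
  ultimately have "(\<lambda>n. ?D (x + s n *\<^sub>R u + t n *\<^sub>R v)) \<longlonglongrightarrow> ?D x" using isCont_tendsto_compose by fastforce
  moreover have "(h n)\<^sup>2 \<noteq> 0" for n using h[of n] by simp
  ultimately show ?thesis by (simp add: st(5))
qed

lemma dderiv_commute:
  fixes f :: "'a::euclidean_space \<Rightarrow> real"
  assumes f: "smooth f" shows "dderiv u (dderiv v f) x = dderiv v (dderiv u f) x"
proof (rule LIMSEQ_unique)
  let ?h = "\<lambda>n. inverse (real (Suc n))"
  show "(\<lambda>n. (f (x + ?h n *\<^sub>R u + ?h n *\<^sub>R v) - f (x + ?h n *\<^sub>R u) - f (x + ?h n *\<^sub>R v) + f x) / (?h n)\<^sup>2) \<longlonglongrightarrow> dderiv v (dderiv u f) x"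
    by (rule second_difference_tendsto[OF f])
  have "f (x + ?h n *\<^sub>R u + ?h n *\<^sub>R v) - f (x + ?h n *\<^sub>R u) - f (x + ?h n *\<^sub>R v) + f x
    = f (x + ?h n *\<^sub>R v + ?h n *\<^sub>R u) - f (x + ?h n *\<^sub>R v) - f (x + ?h n *\<^sub>R u) + f x" for n by (simp add: algebra_simps)
  then show "(\<lambda>n. (f (x + ?h n *\<^sub>R u + ?h n *\<^sub>R v) - f (x + ?h n *\<^sub>R u) - f (x + ?h n *\<^sub>R v) + f x) / (?h n)\<^sup>2) \<longlonglongrightarrow> dderiv u (dderiv v f) x"
    using second_difference_tendsto[OF f, of x v u] by (simp only:)
qed

text \<open>Complex differentiability at one point for vector-valued maps; \<open>holo\<close>
  concerns scalar functions on the whole space.\<close>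

definition cderiv :: "(complex^'n \<Rightarrow> complex^'n) \<Rightarrow> complex^'n \<Rightarrow> bool" where
  "cderiv f x \<longleftrightarrow> (\<exists>L. (f has_derivative L) (at x) \<and> (\<forall>c v. L (c *s v) = c *s L v))"

context stratified_lie
begin

lemma cderiv_nbr: "(\<And>f. f \<in> set fs \<Longrightarrow> cderiv f x) \<Longrightarrow> cderiv (\<lambda>z. nbr br (map (\<lambda>h. h z) fs)) x"
proof (induction fs rule: induct_list012)
  case 1
  show ?case by (auto simp: cderiv_def intro!: exI[of _ "\<lambda>_. 0"])
next
  case (3 f g fs)
  then have "cderiv f x" "cderiv (\<lambda>z. nbr br (map (\<lambda>h. h z) (g # fs))) x" by auto
  then obtain L M where L: "(f has_derivative L) (at x)" "\<And>c v. L (c *s v) = c *s L v"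
      and M: "((\<lambda>z. nbr br (map (\<lambda>h. h z) (g # fs))) has_derivative M) (at x)" "\<And>c v. M (c *s v) = c *s M v"
    unfolding cderiv_def by blast
  show ?case unfolding cderiv_def
    by (rule exI, rule conjI, simp, rule bounded_bilinear.FDERIV[OF bounded_bilinear_br L(1) M(1)[simplified]])
       (simp add: L(2) M(2) br_cscale_left br_cscale_right vector_add_ldistrib)
qed auto

lemma cderiv_sum: "(\<And>i. i \<in> I \<Longrightarrow> cderiv (f i) x) \<Longrightarrow> cderiv (\<lambda>z. \<Sum>i\<in>I. f i z) x"
proof -
  assume "\<And>i. i \<in> I \<Longrightarrow> cderiv (f i) x"
  then obtain L where L: "\<And>i. i \<in> I \<Longrightarrow> (f i has_derivative L i) (at x)" "\<And>i c v. i \<in> I \<Longrightarrow> L i (c *s v) = c *s L i v"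
    unfolding cderiv_def by metis
  have "((\<lambda>z. \<Sum>i\<in>I. f i z) has_derivative (\<lambda>v. \<Sum>i\<in>I. L i v)) (at x)" by (rule has_derivative_sum[OF L(1)])
  moreover have "(\<Sum>i\<in>I. L i (c *s v)) = c *s (\<Sum>i\<in>I. L i v)" for c v by (simp add: L(2) vec.scale_sum_right)
  ultimately show ?thesis unfolding cderiv_def by blast
qed

lemma cderiv_scaleR: assumes "cderiv f x" shows "cderiv (\<lambda>z. r *\<^sub>R f z) x"
proof -
  obtain L where L: "(f has_derivative L) (at x)" "\<And>c v. L (c *s v) = c *s L v" using assms unfolding cderiv_def by blast
  show ?thesis unfolding cderiv_def
    by (intro exI[of _ "\<lambda>v. r *\<^sub>R L v"] conjI has_derivative_scaleR_right L(1))
       (simp add: L(2) scaleR_eq_vector_smult vector_smult_assoc mult.commute)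
qed

text \<open>The group law is a polynomial in complex bilinear brackets, so left translations are
  holomorphic and their differentials complex linear. Hence left-invariant derivatives of
  holomorphic functions depend complex linearly on the direction.\<close>

lemma vel_cscale: "vel x (c *s v) = c *s vel x v"
proof -
  have "cderiv (\<lambda>y. x \<odot> y) 0" unfolding bch_def
  proof (intro cderiv_sum cderiv_scaleR)
    fix rs :: "(nat \<times> nat) list"
    have "cderiv (\<lambda>y. x) 0" by (auto simp: cderiv_def intro!: exI[of _ "\<lambda>_. 0"])
    moreover have "cderiv (\<lambda>y. y) 0" by (auto simp: cderiv_def intro!: exI[of _ "\<lambda>v. v"])
    ultimately have "cderiv (\<lambda>z. nbr br (map (\<lambda>h. h z) (dynkin_word (\<lambda>y. x) (\<lambda>y. y) rs))) 0"
      using set_dynkin_word[of "\<lambda>y. x" "\<lambda>y. y" rs] by (intro cderiv_nbr) auto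
    then show "cderiv (\<lambda>y. nbr br (dynkin_word x y rs)) 0"
      using dynkin_word_fun[of "\<lambda>y. x" _ "\<lambda>y. y" rs] by simp
  qed
  then obtain L where "((\<lambda>y. x \<odot> y) has_derivative L) (at 0)" "\<And>c v. L (c *s v) = c *s L v" unfolding cderiv_def by blast
  then show ?thesis using has_derivative_unique[OF vel_has_derivative] by metis
qed

lemma lv_holo: assumes "holo g" shows "lv (cJ v) g x = \<i> * lv v g x"
proof -
  obtain L where L: "(g has_derivative L) (at x)" "\<And>c v. L (c *s v) = c * L v" using assms unfolding holo_def by blast
  then show ?thesis by (simp add: lv_eq[OF L(1)] cJ_def vel_cscale)
qed

lemma Adj_minus_Adj: "Adj (- y) (Adj y v) = v"
  using mul_conj[of "- y" "Adj y v"] by (simp add: mul_conj[of y v, symmetric] mul_assoc)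

text \<open>Moving the evaluation point from x to x (su) replaces v by Ad(su) v and f by its right
  translate. Differentiating in s at 0, the translate contributes D_v D_u f by symmetry of mixed
  partials, and Ad(su) v contributes the bracket [u, v].\<close>

lemma lv_commutator:
  fixes f :: "complex^'n \<Rightarrow> real"
  assumes f: "smooth f"
  shows "lv u (lv v f) x - lv v (lv u f) x = lv (br u v) f x"
proof -
  define G where "G w p = f (x \<odot> (fst p *\<^sub>R w) \<odot> (snd p *\<^sub>R u))" for w and p :: "real \<times> real"
  have G: "smooth (G w)" for w unfolding G_def
    by (intro smooth_comp[OF f] smooth_mul smooth_const smooth_bilinear[OF bounded_bilinear_scaleR] smooth_bounded_linear bounded_linear_fst bounded_linear_snd)
  define L where "L w s = lv w (\<lambda>z. f (z \<odot> (s *\<^sub>R u))) x" for w s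
  define L' where "L' w = dderiv (0, 1) (dderiv (1, 0) (G w)) (0, 0)" for w
  have "L w = (\<lambda>s. dderiv (1, 0) (G w) ((0, 0) + s *\<^sub>R (0, 1)))" for w
    by (rule ext) (simp add: L_def G_def dderiv_def lvf_def)
  moreover have "((\<lambda>s. dderiv (1, 0) (G w) ((0, 0) + s *\<^sub>R (0, 1))) has_real_derivative dderiv (0, 1) (dderiv (1, 0) (G w)) ((0, 0) + 0 *\<^sub>R (0, 1))) (at 0)" for w
    by (rule smooth_ray_derivative[OF smooth_dderiv[OF G]])
  ultimately have Ld: "(L w has_real_derivative L' w) (at 0)" for w
    unfolding L'_def by simp
  have L'v: "L' v = lv v (lv u f) x"
  proof -
    have "L' v = dderiv (1, 0) (dderiv (0, 1) (G v)) (0, 0)" unfolding L'_def by (rule dderiv_commute[OF G])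
    moreover have "dderiv (0, 1) (G v) (t, 0) = lv u f (x \<odot> (t *\<^sub>R v))" for t by (simp add: G_def dderiv_def lvf_def)
    ultimately show ?thesis by (simp add: dderiv_def[of "(1, 0)"] lvf_def[of mul v])
  qed
  have smt: "smooth (\<lambda>z. f (z \<odot> y))" for y by (intro smooth_comp[OF f] smooth_mul smooth_const smooth_ident)
  have "lv v f (x \<odot> (s *\<^sub>R u)) = (\<Sum>n<K. (s ^ n / fact n) * L ((br u ^^ n) v) s)" for s
  proof -
    have "lv v f (x \<odot> (s *\<^sub>R u)) = L (Adj (s *\<^sub>R u) v) s" unfolding L_def lv_right_translate Adj_minus_Adj ..
    also have "\<dots> = (\<Sum>n<K. (s ^ n / fact n) *\<^sub>R L ((br u ^^ n) v) s)" unfolding L_def Adj_eq by (rule lv_sum_vec[OF smt])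
    finally show ?thesis by simp
  qed
  moreover have "((\<lambda>s. \<Sum>n<K. (s ^ n / fact n) * L ((br u ^^ n) v) s) has_real_derivative
      (\<Sum>n<K. (0 ^ n / fact n) * L' ((br u ^^ n) v) + (real n * 0 ^ (n - 1) / fact n) * L ((br u ^^ n) v) 0)) (at 0)"
    by (intro DERIV_sum DERIV_mult') (auto intro!: derivative_eq_intros Ld)
  moreover have "(\<Sum>n<K. (0 ^ n / fact n) * L' ((br u ^^ n) v) + (real n * 0 ^ (n - 1) / fact n) * L ((br u ^^ n) v) 0) = L' v + L (br u v) 0"
  proof -
    \<comment> \<open>At s = 0 only the terms n = 0 and n = 1 survive; the latter is present because
      m >= 1.\<close>
    obtain m' where "m = Suc m'" using m_pos by (cases m) auto
    then show ?thesis by (simp add: sum.lessThan_Suc_shift del: sum.lessThan_Suc)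
  qed
  ultimately have "((\<lambda>s. lv v f (x \<odot> (s *\<^sub>R u))) has_real_derivative L' v + L (br u v) 0) (at 0)" by simp
  then have "lv u (lv v f) x = L' v + L (br u v) 0"
    unfolding lvf_def[of mul u] by (intro vector_derivative_at) (simp add: has_real_derivative_iff_has_vector_derivative)
  then show ?thesis by (simp add: L'v L_def)
qed

text \<open>For w in the top layer the error in \<open>mul_diff_filt\<close> lies in
  \<open>filt (Suc m)\<close>, which is zero; inversion carries the result from left to right
  factors.\<close>

lemma mul_central: assumes w: "w \<in> layer m" shows "x \<odot> w = x + w"
proof -
  have l: "u \<odot> y = u + y" if "u \<in> layer m" for u y
    using mul_diff_filt[of u m 0 y] layer_subset_filt[of m] that m_pos by (auto simp: filt_top algebra_simps)
  have "- w \<in> layer m" using subspace_neg[OF subspace_layer w] .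
  from l[OF this, of "- x"] show ?thesis using minus_mul[of "- w" "- x"] by simp
qed

end

section \<open>Complex linear functions in the domain of the generator\<close>

lemma linear_cJ: "linear cJ"
  by (rule linearI) (simp_all add: cJ_def vector_add_ldistrib scaleR_eq_vector_smult vector_smult_assoc mult.commute)

lemma cJ_cJ: "cJ (cJ x) = - x"
  by (simp add: cJ_def vec_eq_iff flip: mult.assoc)

lemma cscale_eq: "c *s x = Re c *\<^sub>R x + Im c *\<^sub>R cJ x"
  by (simp add: cJ_def vec_eq_iff complex_eq_iff)

lemma sqn_tendsto_0:
  assumes g: "\<And>n. g n \<in> borel_measurable M" and w: "w \<in> L2 M"
    and le: "\<And>n x. cmod (g n x) \<le> cmod (w x)" and lim: "\<And>x. (\<lambda>n. g n x) \<longlonglongrightarrow> 0"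
  shows "(\<lambda>n. sqn M (g n)) \<longlonglongrightarrow> 0"
proof -
  note [measurable] = g
  have "(\<lambda>n. \<integral>x. (cmod (g n x))\<^sup>2 \<partial>M) \<longlonglongrightarrow> (\<integral>x. 0 \<partial>M)"
  proof (rule integral_dominated_convergence[where w = "\<lambda>x. (cmod (w x))\<^sup>2"])
    show "AE x in M. (\<lambda>n. (cmod (g n x))\<^sup>2) \<longlonglongrightarrow> 0"
      using tendsto_power[OF tendsto_norm[OF lim], of _ 2] by simp
  qed (use L2_integrable[OF w] le in \<open>auto intro: power_mono\<close>)
  then show ?thesis by (simp add: sqn_def)
qed

text \<open>If F(x) is not 0, the real part of conj(F(x)) F is positive near x. Testing with a bump
  there yields a nonnegative continuous integrand with integral 0 that is positive at x.\<close>

lemma continuous_test_fn_eq_0: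
  fixes F :: "complex^'n \<Rightarrow> complex"
  assumes F: "continuous_on UNIV F" and z: "\<And>\<phi>. test_fn \<phi> \<Longrightarrow> (\<integral>x. F x * \<phi> x \<partial>lborel) = 0"
  shows "F x = 0"
proof (rule ccontr)
  assume nz: "F x \<noteq> 0"
  let ?G = "\<lambda>y. Re (cnj (F x) * F y)"
  have G: "continuous_on UNIV ?G" by (intro continuous_intros F)
  have "0 < ?G x" using nz complex_neq_0[of "F x"] by (simp add: power2_eq_square)
  then have "x \<in> {y. 0 < ?G y}" by (rule CollectI)
  then obtain e where e: "0 < e" and be: "ball x e \<subseteq> {y. 0 < ?G y}"
    by (rule openE[OF open_Collect_less[OF continuous_on_const G]])
  have e: "0 < e" "\<And>y. dist y x < e \<Longrightarrow> 0 < ?G y" using e subsetD[OF be] unfolding mem_Collect_eq mem_ball dist_commute[of x] by blast+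
  define b where "b y = sstep (1 - (y - x) \<bullet> (y - x) / e\<^sup>2)" for y
  have b0: "b y = 0" if "e \<le> dist y x" for y
  proof -
    have "e\<^sup>2 \<le> (dist y x)\<^sup>2" using that e(1) by (intro power_mono) auto
    then show ?thesis unfolding b_def using e(1) by (intro sstep_0) (simp add: dist_norm power2_norm_eq_inner field_simps)
  qed
  have sb: "smooth b" unfolding b_def
    by (intro smooth_comp[OF smooth_sstep] smooth_diff smooth_const smooth_inner smooth_ident smooth_mult[where g = "\<lambda>_. inverse (e\<^sup>2)", folded divide_inverse])
  have tb: "test_fn (\<lambda>y. cnj (F x) * complex_of_real (b y))"
    by (rule test_fnI[where B = "ball x e"]) (auto simp: b0 dist_commute intro!: smooth_mult smooth_const smooth_of_real sb)
  have cb: "continuous_on UNIV b" by (rule smooth_continuous[OF sb])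
  let ?H = "\<lambda>y. ?G y * b y"
  have cH: "continuous_on UNIV ?H" by (intro continuous_intros G cb)
  have "integrable lborel (\<lambda>y. F y * (cnj (F x) * complex_of_real (b y)))"
  proof -
    let ?f = "\<lambda>y. F y * (cnj (F x) * complex_of_real (b y))"
    have c: "continuous_on UNIV ?f" by (intro continuous_intros F cb)
    have "compact (?f ` cball x e)" by (intro compact_continuous_image continuous_on_subset[OF c]) auto
    from compact_imp_bounded[OF this, unfolded bounded_iff] obtain C where C': "\<forall>u\<in>?f ` cball x e. norm u \<le> C" by (rule exE)
    have C: "norm (?f y) \<le> C" if "y \<in> cball x e" for y using bspec[OF C' imageI[OF that]] .
    have "norm (?f y) \<le> max C 0" for y using C[of y] b0[of y] by (cases "y \<in> cball x e") (auto simp: dist_commute)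
    then show ?thesis by (intro bounded_support_integrable[where B = "ball x e"] continuous_borel c) (auto simp: b0 dist_commute)
  qed
  then have iH: "integrable lborel ?H" and "(\<integral>y. ?H y \<partial>lborel) = Re (\<integral>y. F y * (cnj (F x) * complex_of_real (b y)) \<partial>lborel)"
    using integrable_Re[of lborel "\<lambda>y. F y * (cnj (F x) * complex_of_real (b y))"] integral_Re[of lborel "\<lambda>y. F y * (cnj (F x) * complex_of_real (b y))"]
    by (simp_all add: algebra_simps)
  with z[OF tb] have I0: "(\<integral>y. ?H y \<partial>lborel) = 0" by simp
  have nn: "0 \<le> ?H y" for y
  proof (cases "dist y x < e")
    case True
    then show ?thesis by (intro mult_nonneg_nonneg less_imp_le[OF e(2)]) (simp_all add: b_def sstep_bounds)
  qed (use b0[of y] in simp)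
  have "AE y in lborel. ?H y = 0" using integral_nonneg_eq_0_iff_AE[OF iH] nn I0 by simp
  then have "?H x = 0" by (rule continuous_AE_eq[OF cH continuous_on_const])
  moreover have "b x = 1" by (simp add: b_def sstep_1)
  ultimately show False using \<open>0 < ?G x\<close> by simp
qed

context heat_group
begin

text \<open>The complex linear functional whose real part is the Euclidean inner product of the
  \<open>V 1\<close>-component with z; complex linearity then forces the imaginary part.\<close>

definition fz :: "complex^'n \<Rightarrow> complex^'n \<Rightarrow> complex" where
  "fz z x = Complex (proj 1 x \<bullet> z) (- (cJ (proj 1 x) \<bullet> z))"

lemma linear_fz: "linear (fz z)"
  by (rule linearI)
     (simp_all add: fz_def complex_eq_iff linear_add[OF linear_proj] linear_scale[OF linear_proj] linear_add[OF linear_cJ] linear_scale[OF linear_cJ] inner_add_left)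

lemma fz_cscale: "fz z (c *s x) = c * fz z x"
proof -
  have "cJ (Re c *\<^sub>R proj 1 x + Im c *\<^sub>R cJ (proj 1 x)) = Re c *\<^sub>R cJ (proj 1 x) - Im c *\<^sub>R proj 1 x"
    by (simp add: linear_add[OF linear_cJ] linear_scale[OF linear_cJ] cJ_cJ)
  then show ?thesis by (simp add: fz_def proj_cscale cscale_eq[of c "proj _ x"] complex_eq_iff inner_add_left inner_diff_left)
qed

lemma holo_fz: "holo (fz z)"
  unfolding holo_def using fz_cscale linear_imp_has_derivative[OF linear_fz] by blast

lemma smooth_fz: "smooth (fz z)" by (rule smooth_linear[OF linear_fz])

lemma lv_fz: "lv v (fz z) x = fz z v"
proof -
  have "fz z (x \<odot> (t *\<^sub>R v)) = fz z x + t *\<^sub>R fz z v" for t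
  proof -
    have "fz z (x \<odot> (t *\<^sub>R v)) = fz z (x + t *\<^sub>R v)" unfolding fz_def proj_one_mul by (simp only: linear_add[OF linear_proj])
    then show ?thesis by (simp add: linear_add[OF linear_fz] linear_scale[OF linear_fz])
  qed
  moreover have "((\<lambda>t. fz z x + t *\<^sub>R fz z v) has_vector_derivative fz z v) (at 0)" by (auto intro!: derivative_eq_intros)
  ultimately show ?thesis by (simp add: lvf_def vector_derivative_at)
qed

lemma fz_bound: obtains C where "0 \<le> C" "\<And>x. cmod (fz z x) \<le> C * (1 + norm x)"
proof -
  obtain C where C: "0 < C" "\<And>x. cmod (fz z x) \<le> C * norm x" using linear_bounded_pos[OF linear_fz] by blast
  have "C * norm x \<le> C * (1 + norm x)" for x using C(1) by simp
  then show thesis using that[of C] C order_trans by (meson less_imp_le)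
qed

lemma lv_cut_bound: obtains B where "0 \<le> B" "\<And>x. \<bar>lv v cut x\<bar> \<le> B"
proof -
  have "test_fn (lv v (\<lambda>x. complex_of_real (cutR 1 x)))" by (intro test_fn_lv test_fn_cutR) simp
  then obtain B where B: "0 \<le> B" "\<And>x. cmod (lv v (\<lambda>x. complex_of_real (cutR 1 x)) x) \<le> B" using test_fn_bounded by blast
  have "cutR 1 = cut" by (simp add: cutR_def dil_1 fun_eq_iff)
  then show thesis using that[of B] B by (simp add: lv_of_real[OF smooth_cut])
qed

lemma cutR_tendsto: "(\<lambda>n. cutR (real (Suc n)) x) \<longlonglongrightarrow> 1"
proof (rule tendsto_eventually, unfold eventually_sequentially, intro exI allI impI)
  fix n assume "nat \<lceil>hn x\<rceil> \<le> n"
  then have "hn x \<le> real (Suc n)" by linarith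
  also have "\<dots> \<le> (real (Suc n))\<^sup>2" by (simp add: power2_eq_square)
  finally show "cutR (real (Suc n)) x = 1" by (intro cutR_1) auto
qed

text \<open>The frame operator of the horizontal vectors. They are orthonormal for g and not for the
  ambient Euclidean inner product, so this operator, and not the identity, converts the functional
  \<open>fz z\<close> into the direction of the field in \<open>hz_zbar\<close>.\<close>

definition vz :: "complex^'n \<Rightarrow> complex^'n" where "vz z = (\<Sum>i\<in>zidx. (zt i \<bullet> z) *\<^sub>R zt i)"

lemma span_zt: "span (zt ` zidx) = layer 1"
proof -
  have "zt ` zidx = xs ` {1..k} \<union> (cJ \<circ> xs) ` {1..k}" by (force simp: zidx_def zt_def)
  then show ?thesis using span_xs by (simp only: layer_1)
qed

text \<open>A vector d orthogonal to the range satisfies \<open>d \<bullet> vz d = 0\<close>, a sum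
  of squares, so it is orthogonal to every \<open>zt i\<close>; if it also lies in the layer that
  these span, it is 0. Every horizontal direction is thus reached by some
  \<open>fz z\<close>.\<close>

lemma range_vz: assumes w: "w \<in> layer 1" obtains z where "w = vz z"
proof -
  have lin: "linear vz"
    by (rule linearI) (simp_all add: vz_def inner_add_right scaleR_add_left sum.distrib scaleR_sum_right)
  have sub: "subspace (range vz)" by (rule linear_subspace_image[OF lin subspace_UNIV])
  obtain y d where yd: "y \<in> span (range vz)" "\<And>u. u \<in> span (range vz) \<Longrightarrow> orthogonal d u" "w = y + d"
    by (rule orthogonal_subspace_decomp_exists[of "range vz" w]) (rule that)
  have y: "y \<in> range vz" using yd(1) span_eq_iff[THEN iffD2, OF sub] by simp
  have "d \<bullet> vz d = 0" using yd(2)[OF span_base] by (simp add: orthogonal_def)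
  then have "(\<Sum>i\<in>zidx. (zt i \<bullet> d)\<^sup>2) = 0" by (simp add: vz_def inner_sum_right power2_eq_square inner_commute)
  then have z: "zt i \<bullet> d = 0" if "i \<in> zidx" for i using that by (simp add: sum_nonneg_eq_0_iff)
  have "vz u \<in> layer 1" for u unfolding vz_def by (intro subspace_sum subspace_scale subspace_layer zt_layer)
  then have "y \<in> layer 1" using y by auto
  then have "d \<in> span (zt ` zidx)" unfolding span_zt using w yd(3) subspace_diff[OF subspace_layer w, of y] by simp
  then have "orthogonal d d" using z by (intro orthogonal_to_span[of d "zt ` zidx"]) (auto simp: orthogonal_def inner_commute)
  then show thesis using that y yd(3) by (auto simp: orthogonal_def)
qed

context fixes a :: real assumes a: "0 < a"
begin

lemma L2_growth:
  assumes [measurable]: "f \<in> borel_measurable borel" and C: "\<And>x. cmod (f x) \<le> C * (1 + norm x)"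
  shows "f \<in> L2 (mu a)"
proof -
  have [measurable]: "rho a \<in> borel_measurable borel" by (rule rho_borel[OF a])
  have "integrable lborel (\<lambda>x. rho a x *\<^sub>R (cmod (f x))\<^sup>2)"
  proof (rule Bochner_Integration.integrable_bound)
    show "integrable lborel (\<lambda>x. C\<^sup>2 * ((1 + norm x) ^ 2 * rho a x))" by (intro integrable_mult_right moment_integrable a)
    show "AE x in lborel. norm (rho a x *\<^sub>R (cmod (f x))\<^sup>2) \<le> norm (C\<^sup>2 * ((1 + norm x) ^ 2 * rho a x))"
    proof (rule AE_I2)
      fix x
      have "(cmod (f x))\<^sup>2 \<le> (C * (1 + norm x))\<^sup>2" using C by (intro power_mono) auto
      then show "norm (rho a x *\<^sub>R (cmod (f x))\<^sup>2) \<le> norm (C\<^sup>2 * ((1 + norm x) ^ 2 * rho a x))"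
        using mult_right_mono[of "(cmod (f x))\<^sup>2" "(C * (1 + norm x))\<^sup>2" "rho a x"] rho_pos[OF a, of x]
        by (simp add: power_mult_distrib abs_mult mult_ac)
    qed
  qed measurable
  then show ?thesis by (simp add: L2_def integrable_mu[OF a])
qed

lemma fisher_L2: assumes i: "i \<in> zidx" shows "(\<lambda>x. complex_of_real (lv (zt i) (rho a) x / rho a x)) \<in> L2 (mu a)"
proof -
  have [measurable]: "rho a \<in> borel_measurable borel" "lv (zt i) (rho a) \<in> borel_measurable borel"
    by (auto intro: rho_borel[OF a] smooth_borel smooth_lv rho_smooth[OF a])
  have "integrable (mu a) (\<lambda>x. (lv (zt i) (rho a) x / rho a x)\<^sup>2)"
    using fisher[OF a i] by (subst integrable_mu[OF a]) (auto simp: mult.commute)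
  then have "integrable (mu a) (\<lambda>x. (cmod (complex_of_real (lv (zt i) (rho a) x / rho a x)))\<^sup>2)" by (simp only: norm_of_real power2_abs)
  then show ?thesis unfolding L2_def by (intro CollectI conjI) measurable
qed

text \<open>The expected value of A at \<open>fz z\<close>: minus the pairing of its constant
  horizontal derivatives with the logarithmic derivatives of the kernel.\<close>

definition hz :: "complex^'n \<Rightarrow> complex^'n \<Rightarrow> complex" where
  "hz z x = (\<Sum>i\<in>zidx. - fz z (zt i) * complex_of_real (lv (zt i) (rho a) x / rho a x))"

lemma hz_L2: "hz z \<in> L2 (mu a)"
  unfolding hz_def[abs_def] by (intro L2_sum L2_cmult fisher_L2)

lemma smooth_hz: "smooth (hz z)"
  unfolding hz_def[abs_def] divide_inverse
  by (intro smooth_sum smooth_mult smooth_const smooth_of_real smooth_lv rho_smooth a smooth_inverse)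
     (use rho_pos[OF a] in \<open>auto simp: less_imp_neq[symmetric]\<close>)

lemma hz_pairing:
  assumes q: "test_fn \<psi>"
  shows "(\<Sum>i\<in>zidx. \<integral>x. fz z (zt i) * cnj (lv (zt i) \<psi> x) \<partial>mu a) = (\<integral>x. hz z x * cnj (\<psi> x) \<partial>mu a)"
proof -
  let ?l = "\<lambda>i x. complex_of_real (lv (zt i) (rho a) x / rho a x)"
  have [measurable]: "lv v \<psi> \<in> borel_measurable borel" "\<psi> \<in> borel_measurable borel" "rho a \<in> borel_measurable borel" "lv v (rho a) \<in> borel_measurable borel" for v
    using q by (auto intro: smooth_borel smooth_lv test_fn_smooth rho_smooth[OF a])
  have "(\<integral>x. fz z (zt i) * cnj (lv (zt i) \<psi> x) \<partial>mu a) = (\<integral>x. (- fz z (zt i) * ?l i x) * cnj (\<psi> x) \<partial>mu a)" for i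
  proof -
    have "(\<integral>x. fz z (zt i) * cnj (lv (zt i) \<psi> x) \<partial>mu a) = fz z (zt i) * (\<integral>x. lv (zt i) (\<lambda>x. cnj (\<psi> x)) x * complex_of_real (rho a x) \<partial>lborel)"
      by (subst integral_mu[OF a]) (auto simp: lv_cnj[OF test_fn_smooth[OF q]] mult.assoc)
    also have "(\<integral>x. lv (zt i) (\<lambda>x. cnj (\<psi> x)) x * complex_of_real (rho a x) \<partial>lborel) = - (\<integral>x. cnj (\<psi> x) * complex_of_real (lv (zt i) (rho a) x) \<partial>lborel)"
      using lv_parts[OF test_fn_cnj[OF q] smooth_of_real[OF rho_smooth[OF a]], of "zt i"] by (simp add: lv_of_real[OF rho_smooth[OF a]])
    also have "fz z (zt i) * \<dots> = (\<integral>x. ((- fz z (zt i) * ?l i x) * cnj (\<psi> x)) * complex_of_real (rho a x) \<partial>lborel)"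
    proof -
      have e: "((- fz z (zt i) * ?l i x) * cnj (\<psi> x)) * complex_of_real (rho a x) = - fz z (zt i) * (cnj (\<psi> x) * complex_of_real (lv (zt i) (rho a) x))" for x
        using rho_pos[OF a, of x] by simp
      show ?thesis unfolding e by simp
    qed
    also have "\<dots> = (\<integral>x. (- fz z (zt i) * ?l i x) * cnj (\<psi> x) \<partial>mu a)" by (rule integral_mu[OF a, symmetric]) measurable
    finally show ?thesis .
  qed
  then have "(\<Sum>i\<in>zidx. \<integral>x. fz z (zt i) * cnj (lv (zt i) \<psi> x) \<partial>mu a) = (\<Sum>i\<in>zidx. \<integral>x. (- fz z (zt i) * ?l i x) * cnj (\<psi> x) \<partial>mu a)" by simp
  also have "\<dots> = (\<integral>x. (\<Sum>i\<in>zidx. (- fz z (zt i) * ?l i x) * cnj (\<psi> x)) \<partial>mu a)"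
    by (intro Bochner_Integration.integral_sum[symmetric] L2_integrable_mult L2_cmult fisher_L2 test_fn_L2[OF a q])
  finally show ?thesis by (simp only: hz_def sum_distrib_right)
qed

lemma form_approxI:
  assumes t: "\<And>n. test_fn (\<phi> n)" and lim: "(\<lambda>n. sqn (mu a) (\<lambda>x. \<phi> n x - f x)) \<longlonglongrightarrow> 0"
    and u: "\<And>i. i \<in> zidx \<Longrightarrow> u i \<in> L2 (mu a)"
    and du: "\<And>i. i \<in> zidx \<Longrightarrow> (\<lambda>n. sqn (mu a) (\<lambda>x. lv (zt i) (\<phi> n) x - u i x)) \<longlonglongrightarrow> 0"
  shows "form_approx (mu a) (Q0 a) f \<phi>"
  unfolding form_approx_iff[OF a]
proof (intro conjI allI impI t lim)
  fix e :: real assume e: "0 < e"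
  define E where "E n = (\<Sum>i\<in>zidx. sqn (mu a) (\<lambda>x. lv (zt i) (\<phi> n) x - u i x))" for n
  have "E \<longlonglongrightarrow> (\<Sum>i\<in>zidx. 0)" unfolding E_def by (intro tendsto_sum du)
  from order_tendstoD(2)[OF this, of "e / 4"] e obtain N where N: "\<forall>n\<ge>N. E n < e / 4"
    by (auto simp: eventually_sequentially)
  have le: "energy a (\<lambda>x. \<phi> n x - \<phi> l x) \<le> 2 * E n + 2 * E l" for n l
    unfolding energy_def[OF a] E_def sum_distrib_left sum.distrib[symmetric]
    by (intro sum_mono sqn_le L2_diff L2_measurable lv_L2[OF a] t u test_fn_diff)
       (simp_all add: lv_diff test_fn_smooth[OF t])
  show "\<exists>N. \<forall>n\<ge>N. \<forall>l\<ge>N. energy a (\<lambda>x. \<phi> n x - \<phi> l x) < e"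
  proof (intro exI[of _ N] allI impI)
    fix n l assume "N \<le> n" "N \<le> l"
    then have "E n < e / 4" "E l < e / 4" using N by auto
    then show "energy a (\<lambda>x. \<phi> n x - \<phi> l x) < e" using le[of n l] by linarith
  qed
qed

text \<open>The functional is unbounded, so it is approximated by its products with dilated cutoffs.
  Derivatives falling on the cutoff are O(1/R), the functional grows linearly and the kernel has
  second moments, so dominated convergence gives both the L2 limit and the limits of the
  derivatives.\<close>

lemma fz_form_gen: "form_gen (mu a) (Q0 a) (fz z) (hz z)"
proof -
  obtain C where C: "0 \<le> C" "\<And>x. cmod (fz z x) \<le> C * (1 + norm x)" using fz_bound by blast
  have f [measurable]: "fz z \<in> borel_measurable borel" by (rule smooth_borel[OF smooth_fz])
  have fL: "fz z \<in> L2 (mu a)" by (rule L2_growth[OF f C(2)])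
  define R where "R n = real (Suc n)" for n
  have R: "1 \<le> R n" for n by (simp add: R_def)
  define \<phi> where "\<phi> n x = fz z x * complex_of_real (cutR (R n) x)" for n x
  have t: "test_fn (\<phi> n)" for n unfolding \<phi>_def
    using R[of n] by (intro test_fn_smooth_mult smooth_fz test_fn_cutR) simp
  have [measurable]: "cutR r \<in> borel_measurable borel" "lv v (cutR r) \<in> borel_measurable borel" for r v
    by (auto intro: smooth_borel smooth_lv smooth_cutR)
  have ab: "\<bar>cutR r x - 1\<bar> \<le> 1" for r x using cutR_bounds[of r x] by auto
  have cu: "(\<lambda>n. cutR (R n) x - 1) \<longlonglongrightarrow> 0" for x using cutR_tendsto[of x] by (simp add: R_def LIM_zero)
  have lim: "(\<lambda>n. sqn (mu a) (\<lambda>x. \<phi> n x - fz z x)) \<longlonglongrightarrow> 0"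
  proof -
    have e: "\<phi> n x - fz z x = fz z x * complex_of_real (cutR (R n) x - 1)" for n x by (simp add: \<phi>_def algebra_simps)
    show ?thesis unfolding e
    proof (rule sqn_tendsto_0[OF _ fL])
      show "(\<lambda>n. fz z x * complex_of_real (cutR (R n) x - 1)) \<longlonglongrightarrow> 0" for x
        using tendsto_mult_right_zero[OF tendsto_of_real[OF cu, where 'a = complex, simplified]] by simp
      show "cmod (fz z x * complex_of_real (cutR (R n) x - 1)) \<le> cmod (fz z x)" for n x
        unfolding norm_mult norm_of_real using mult_left_mono[OF ab norm_ge_zero[of "fz z x"]] by simp
    qed simp
  qed
  have du: "(\<lambda>n. sqn (mu a) (\<lambda>x. lv (zt i) (\<phi> n) x - fz z (zt i))) \<longlonglongrightarrow> 0" if i: "i \<in> zidx" for i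
  proof -
    obtain B where B: "0 \<le> B" "\<And>x. \<bar>lv (zt i) cut x\<bar> \<le> B" using lv_cut_bound by blast
    have lb: "\<bar>lv (zt i) (cutR (R n)) x\<bar> \<le> B * inverse (R n)" for n x
      using R[of n] mult_right_mono[OF B(2)[of "dil (1 / R n) x"], of "inverse (R n)"]
      by (simp add: lv_cutR[OF zt_layer[OF i]] abs_mult divide_inverse mult.commute)
    have lb': "B * inverse (R n) \<le> B" for n using mult_left_mono[OF _ B(1), of "inverse (R n)" 1] R[of n] by (simp add: inverse_le_1_iff)
    have e: "lv (zt i) (\<phi> n) x - fz z (zt i) = fz z x * complex_of_real (lv (zt i) (cutR (R n)) x) + fz z (zt i) * complex_of_real (cutR (R n) x - 1)" for n x
      unfolding \<phi>_def using lv_mult[OF smooth_fz smooth_of_real[OF smooth_cutR], of "zt i" z "R n" x]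
      by (simp add: lv_fz lv_of_real[OF smooth_cutR] algebra_simps)
    \<comment> \<open>Dominates for all n at once: the first term takes care of the derivative of
      the cutoff, the second of the cutoff error in the constant derivative.\<close>
    define w where "w x = complex_of_real (B * cmod (fz z x) + cmod (fz z (zt i)))" for x
    have "w \<in> L2 (mu a)"
    proof (rule L2_growth)
      show "cmod (w x) \<le> (B * C + cmod (fz z (zt i))) * (1 + norm x)" for x
      proof -
        have "cmod (w x) = B * cmod (fz z x) + cmod (fz z (zt i)) * 1" unfolding w_def norm_of_real using B(1) by simp
        also have "\<dots> \<le> B * (C * (1 + norm x)) + cmod (fz z (zt i)) * (1 + norm x)"
          by (intro add_mono mult_left_mono B C) auto
        finally show ?thesis by (simp add: algebra_simps)
      qed
    qed (simp add: w_def[abs_def])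
    then show ?thesis unfolding e
    proof (rule sqn_tendsto_0[rotated])
      show "cmod (fz z x * complex_of_real (lv (zt i) (cutR (R n)) x) + fz z (zt i) * complex_of_real (cutR (R n) x - 1)) \<le> cmod (w x)" for n x
      proof -
        have "cmod (fz z x * complex_of_real (lv (zt i) (cutR (R n)) x) + fz z (zt i) * complex_of_real (cutR (R n) x - 1))
          \<le> cmod (fz z x) * \<bar>lv (zt i) (cutR (R n)) x\<bar> + cmod (fz z (zt i)) * \<bar>cutR (R n) x - 1\<bar>"
          by (rule order_trans[OF norm_triangle_ineq]) (simp only: norm_mult norm_of_real)
        also have "\<dots> \<le> cmod (fz z x) * B + cmod (fz z (zt i)) * 1"
          by (intro add_mono mult_left_mono ab order_trans[OF lb lb']) auto
        also have "\<dots> = cmod (w x)" unfolding w_def norm_of_real using B(1) by simp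
        finally show ?thesis .
      qed
      show "(\<lambda>n. fz z x * complex_of_real (lv (zt i) (cutR (R n)) x) + fz z (zt i) * complex_of_real (cutR (R n) x - 1)) \<longlonglongrightarrow> 0" for x
      proof -
        have "(\<lambda>n. B * inverse (R n)) \<longlonglongrightarrow> 0" unfolding R_def using tendsto_mult_right_zero[OF LIMSEQ_inverse_real_of_nat] .
        then have l0: "(\<lambda>n. lv (zt i) (cutR (R n)) x) \<longlonglongrightarrow> 0" by (rule Lim_null_comparison[rotated]) (auto intro!: always_eventually simp: lb)
        have "(\<lambda>n. fz z x * complex_of_real (lv (zt i) (cutR (R n)) x) + fz z (zt i) * complex_of_real (cutR (R n) x - 1)) \<longlonglongrightarrow> fz z x * complex_of_real 0 + fz z (zt i) * complex_of_real 0"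
          by (intro tendsto_intros l0 cu)
        then show ?thesis by simp
      qed
    qed measurable
  qed
  have cL: "(\<lambda>x. c) \<in> L2 (mu a)" for c using finite_measure_mu[OF a] by (simp add: L2_def finite_measure.integrable_const)
  show ?thesis
    by (rule form_genI[OF a fL form_approxI[OF t lim cL du] cL du hz_L2 hz_pairing])
qed

text \<open>\<open>form_gen\<close> is a relation that is single-valued only up to null sets. Both
  values pair equally with all test functions; continuity and positivity of rho turn this into
  pointwise equality.\<close>

lemma form_gen_continuous_unique:
  assumes g: "form_gen (mu a) (Q0 a) f g" "continuous_on UNIV g" and h: "form_gen (mu a) (Q0 a) f h" "continuous_on UNIV h"
  shows "g x = h x"
proof -
  have cr: "continuous_on UNIV (rho a)" by (intro smooth_continuous rho_smooth a)
  have "(g x - h x) * complex_of_real (rho a x) = 0"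
  proof (rule continuous_test_fn_eq_0[of "\<lambda>x. (g x - h x) * complex_of_real (rho a x)"])
    show "continuous_on UNIV (\<lambda>x. (g x - h x) * complex_of_real (rho a x))" by (intro continuous_intros g h cr)
    fix \<phi> :: "complex^'n \<Rightarrow> complex" assume p: "test_fn \<phi>"
    note q = test_fn_cnj[OF p]
    have [measurable]: "g \<in> borel_measurable borel" "h \<in> borel_measurable borel" "\<phi> \<in> borel_measurable borel"
      by (auto intro: continuous_borel g h smooth_borel test_fn_smooth p)
    have L: "g \<in> L2 (mu a)" "h \<in> L2 (mu a)" using g h by (auto simp: form_gen_def)
    have e: "(\<integral>x. u x * cnj (f2 x) \<partial>mu a) = form_val (mu a) (Q0 a) f f2"
      if "form_gen (mu a) (Q0 a) f u" "f2 \<in> form_dom (mu a) (Q0 a)" for u f2 using that by (simp add: form_gen_def)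
    have "(\<integral>x. g x * cnj (cnj (\<phi> x)) \<partial>mu a) = (\<integral>x. h x * cnj (cnj (\<phi> x)) \<partial>mu a)"
      by (rule trans[OF e[OF g(1)] e[OF h(1), symmetric]]) (rule test_fn_form_dom[OF a q])+
    then have "(\<integral>x. g x * cnj (cnj (\<phi> x)) - h x * cnj (cnj (\<phi> x)) \<partial>mu a) = 0"
      by (subst Bochner_Integration.integral_diff) (auto intro!: L2_integrable_mult L test_fn_L2[OF a] q simp del: complex_cnj_cnj)
    then have "(\<integral>x. (g x - h x) * \<phi> x \<partial>mu a) = 0" by (simp add: left_diff_distrib)
    then show "(\<integral>x. (g x - h x) * complex_of_real (rho a x) * \<phi> x \<partial>lborel) = 0"
      by (subst (asm) integral_mu[OF a]) (auto simp: mult_ac)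
  qed
  then show ?thesis using rho_pos[OF a, of x] by simp
qed

end

end

section \<open>Antiholomorphic derivatives of the heat kernel\<close>

context heat_group
begin

context fixes a :: real assumes a: "0 < a"
begin

definition zbar :: "complex^'n \<Rightarrow> complex^'n \<Rightarrow> complex" where
  "zbar v x = complex_of_real (lv v (rho a) x) + \<i> * complex_of_real (lv (cJ v) (rho a) x)"

lemma lv_rho_linear: "linear (\<lambda>v. lv v (rho a) x)"
  using lv_linear[OF smooth_has_derivative[OF rho_smooth[OF a]]] .

lemma linear_zbar: "linear (\<lambda>v. zbar v x)"
  by (rule linearI)
     (simp_all add: zbar_def linear_add[OF lv_rho_linear] linear_scale[OF lv_rho_linear] linear_add[OF linear_cJ] linear_scale[OF linear_cJ] complex_eq_iff)

lemma hz_zbar: "zbar (vz z) x = - hz a z x * complex_of_real (rho a x)"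
proof -
  have re: "lv (vz z) (rho a) x = (\<Sum>i\<in>zidx. (zt i \<bullet> z) * lv (zt i) (rho a) x)"
    unfolding vz_def using lv_sum_vec[OF rho_smooth[OF a]] by simp
  have "lv (cJ (vz z)) (rho a) x = (\<Sum>i\<in>zidx. (zt i \<bullet> z) * lv (cJ (zt i)) (rho a) x)"
    unfolding vz_def linear_sum[OF linear_cJ] linear_scale[OF linear_cJ] using lv_sum_vec[OF rho_smooth[OF a], where v = "\<lambda>i. cJ (zt i)"] by simp
  \<comment> \<open>J permutes the horizontal family up to sign, x_j to J x_j to -x_j, so reindexing
    moves J from the derivative to the inner product.\<close>
  also have "\<dots> = (\<Sum>i\<in>zidx. - (cJ (zt i) \<bullet> z) * lv (zt i) (rho a) x)"
    unfolding sum_zidx[of "\<lambda>v. (v \<bullet> z) * lv (cJ v) (rho a) x"] sum_zidx[of "\<lambda>v. - (cJ v \<bullet> z) * lv v (rho a) x"]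
    by (simp add: cJ_cJ linear_neg[OF lv_rho_linear] algebra_simps)
  finally have im: "lv (cJ (vz z)) (rho a) x = (\<Sum>i\<in>zidx. - (cJ (zt i) \<bullet> z) * lv (zt i) (rho a) x)" .
  have fz: "fz z (zt i) = Complex (zt i \<bullet> z) (- (cJ (zt i) \<bullet> z))" if "i \<in> zidx" for i
    using proj_layer[OF zt_layer[OF that], of 1] by (simp add: fz_def)
  have "zbar (vz z) x = (\<Sum>i\<in>zidx. fz z (zt i) * complex_of_real (lv (zt i) (rho a) x))"
    unfolding zbar_def re im of_real_sum sum_distrib_left sum.distrib[symmetric]
    by (intro sum.cong refl) (simp add: fz complex_eq_iff)
  also have "\<dots> = - hz a z x * complex_of_real (rho a x)"
    unfolding hz_def[OF a] sum_negf[symmetric] sum_distrib_right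
    by (intro sum.cong refl) (use rho_pos[OF a, of x] in simp)
  finally show ?thesis .
qed

text \<open>Says that Z_w log rho is holomorphic. Smoothness of g is carried along so that the
  product rule applies to g rho.\<close>

definition hlog :: "complex^'n \<Rightarrow> bool" where
  "hlog w \<longleftrightarrow> (\<exists>g. holo g \<and> smooth g \<and> (\<forall>x. zbar w x = - g x * complex_of_real (rho a x)))"

text \<open>Write Z_u rho = -g rho and Z_v rho = -h rho. Both fields annihilate holomorphic
  functions, so applying them in either order gives g h rho and the commutator kills rho. Complex
  bilinearity of the bracket combines the four real commutators into 2 Z at [u, v].\<close>

lemma zbar_br_0: assumes "hlog u" "hlog v" shows "zbar (br u v) x = 0"
proof -
  obtain g where g: "holo g" "smooth g" "zbar u = (\<lambda>x. - g x * complex_of_real (rho a x))" using assms(1) unfolding hlog_def by blast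
  obtain h where h: "holo h" "smooth h" "zbar v = (\<lambda>x. - h x * complex_of_real (rho a x))" using assms(2) unfolding hlog_def by blast
  note sr = rho_smooth[OF a]
  let ?r = "\<lambda>x. complex_of_real (rho a x)" and ?p = "\<lambda>w. lv w (rho a)"
  have zz: "lv s (zbar t) x = complex_of_real (lv s (?p t) x) + \<i> * complex_of_real (lv s (?p (cJ t)) x)" for s t
    unfolding zbar_def[abs_def]
    by (simp add: lv_add lv_cmult lv_of_real smooth_lv sr smooth_of_real smooth_mult smooth_const)
  \<comment> \<open>Z_s applied to -f rho; the term with Z_s f drops out because f is
    holomorphic.\<close>
  have A: "lv s (zbar t) x + \<i> * lv (cJ s) (zbar t) x = - f x * zbar s x"
    if f: "holo f" "smooth f" "zbar t = (\<lambda>x. - f x * ?r x)" for f s t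
  proof -
    have "lv q (zbar t) x = - (f x * complex_of_real (?p q x) + lv q f x * ?r x)" for q
      unfolding f(3) using lv_cmult[of "\<lambda>x. f x * ?r x" q "-1" x] lv_mult[OF f(2) smooth_of_real[OF sr], of q x]
      by (simp add: lv_of_real[OF sr] smooth_mult f(2) smooth_of_real sr)
    note e = this
    show ?thesis unfolding e lv_holo[OF f(1)] zbar_def by (simp add: complex_eq_iff algebra_simps)
  qed
  have brJ: "br (cJ u) v = cJ (br u v)" "br u (cJ v) = cJ (br u v)" "br (cJ u) (cJ v) = - br u v"
    by (simp_all add: cJ_def br_cscale_left br_cscale_right)
  have c: "lv s (?p t) x = lv t (?p s) x + ?p (br s t) x" for s t using lv_commutator[OF sr, of s t x] by simp
  have "(lv u (zbar v) x + \<i> * lv (cJ u) (zbar v) x) - (lv v (zbar u) x + \<i> * lv (cJ v) (zbar u) x) = 2 * zbar (br u v) x"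
    unfolding zz c[of u v] c[of "cJ u" v] c[of u "cJ v"] c[of "cJ u" "cJ v"] brJ zbar_def
    by (simp add: complex_eq_iff linear_neg[OF lv_rho_linear])
  moreover have "lv u (zbar v) x + \<i> * lv (cJ u) (zbar v) x = h x * g x * ?r x" using A[OF h] by (simp add: g(3))
  moreover have "lv v (zbar u) x + \<i> * lv (cJ v) (zbar u) x = h x * g x * ?r x" using A[OF g] by (simp add: h(3))
  ultimately show ?thesis by simp
qed

text \<open>Where Z_w rho = 0, \<open>hlog\<close> holds with g = 0, so the result for one layer
  supplies the hypothesis of \<open>zbar_br_0\<close> for the next.\<close>

lemma zbar_layer:
  assumes one: "\<And>w. w \<in> layer 1 \<Longrightarrow> hlog w"
  shows "1 \<le> j \<Longrightarrow> (\<forall>w\<in>layer j. hlog w) \<and> (2 \<le> j \<longrightarrow> (\<forall>w\<in>layer j. \<forall>x. zbar w x = 0))"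
proof (induction j rule: dec_induct)
  case (step j)
  have "zbar w x = 0" if "w \<in> layer (Suc j)" for w x
  proof -
    have "w \<in> span {br a b | a b. a \<in> layer 1 \<and> b \<in> layer j}" by (rule layer_Suc) (use step that in auto)
    moreover have "span {br a b | a b. a \<in> layer 1 \<and> b \<in> layer j} \<subseteq> {w. zbar w x = 0}"
    proof (rule span_minimal)
      show "subspace {w. zbar w x = 0}" using linear_subspace_kernel[OF linear_zbar] by simp
      show "{br a b | a b. a \<in> layer 1 \<and> b \<in> layer j} \<subseteq> {w. zbar w x = 0}" using step.IH one zbar_br_0 by auto
    qed
    ultimately show ?thesis by auto
  qed
  moreover have "hlog w" if "\<And>x. zbar w x = 0" for w
    unfolding hlog_def using that
    by (intro exI[of _ "\<lambda>_. 0"]) (auto simp: holo_def smooth_const intro!: exI[of _ "\<lambda>_. 0"])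
  ultimately show ?case by blast
qed (use one in simp)

text \<open>By invariance the first moment is the same after translation by tw, while t |w| <= |y +
  tw| + |y|. Integrating bounds t |w| by twice the first moment for all t >= 0.\<close>

lemma rho_not_invariant: assumes w: "w \<noteq> 0" and inv: "\<And>x t. rho a (x + t *\<^sub>R w) = rho a x" shows False
proof -
  let ?I = "\<integral>y. norm y * rho a y \<partial>lborel"
  have [measurable]: "rho a \<in> borel_measurable borel" by (rule rho_borel[OF a])
  have i: "integrable lborel (\<lambda>y. norm y * rho a y)"
    by (rule Bochner_Integration.integrable_bound[OF moment_integrable[OF a, of 1]])
       (auto simp: abs_mult intro!: mult_right_mono)
  have "t * norm w \<le> 2 * ?I" if t: "0 \<le> t" for t
  proof -
    have e: "norm (y + t *\<^sub>R w) * rho a y = norm (y + t *\<^sub>R w) * rho a (y + t *\<^sub>R w)" for y by (simp add: inv)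
    have I: "(\<integral>y. norm (y + t *\<^sub>R w) * rho a y \<partial>lborel) = ?I"
      unfolding e by (rule integral_translate[of "\<lambda>y. norm y * rho a y"]) measurable
    have i': "integrable lborel (\<lambda>y. norm (y + t *\<^sub>R w) * rho a y)"
    proof (rule Bochner_Integration.integrable_bound)
      show "integrable lborel (\<lambda>y. norm y * rho a y + norm (t *\<^sub>R w) * rho a y)"
        by (intro Bochner_Integration.integrable_add i integrable_mult_right rho_integrable a)
      show "AE y in lborel. norm (norm (y + t *\<^sub>R w) * rho a y) \<le> norm (norm y * rho a y + norm (t *\<^sub>R w) * rho a y)"
      proof (rule AE_I2)
        fix y
        have "norm (y + t *\<^sub>R w) * rho a y \<le> (norm y + norm (t *\<^sub>R w)) * rho a y"
          using rho_pos[OF a, of y] by (intro mult_right_mono norm_triangle_ineq) simp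
        then show "norm (norm (y + t *\<^sub>R w) * rho a y) \<le> norm (norm y * rho a y + norm (t *\<^sub>R w) * rho a y)"
          using rho_pos[OF a, of y] by (simp add: algebra_simps abs_mult)
      qed
    qed measurable
    have "t * norm w = (\<integral>y. (t * norm w) * rho a y \<partial>lborel)" by (simp add: rho_integral[OF a])
    also have "\<dots> \<le> (\<integral>y. norm (y + t *\<^sub>R w) * rho a y + norm y * rho a y \<partial>lborel)"
    proof (rule integral_mono)
      fix y
      have "t * norm w = norm ((y + t *\<^sub>R w) - y)" using t by simp
      also have "\<dots> \<le> norm (y + t *\<^sub>R w) + norm y" by (rule norm_triangle_ineq4)
      finally show "(t * norm w) * rho a y \<le> norm (y + t *\<^sub>R w) * rho a y + norm y * rho a y"
        using rho_pos[OF a, of y] by (simp add: mult_right_mono flip: distrib_right)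
    qed (intro integrable_mult_right rho_integrable a Bochner_Integration.integrable_add i i')+
    also have "\<dots> = 2 * ?I" using i i' I by simp
    finally show ?thesis .
  qed
  from this[of "(2 * \<bar>?I\<bar> + 1) / norm w"] w show False by auto
qed

lemma zbar_top_nonzero:
  assumes w: "w \<in> layer m" "w \<noteq> 0" and z: "\<And>x. zbar w x = 0" shows False
proof (rule rho_not_invariant[OF w(2)])
  fix x t
  have "lv w (rho a) y = 0" for y using z[of y] by (simp add: zbar_def complex_eq_iff)
  then have "((\<lambda>t. rho a (x \<odot> (t *\<^sub>R w))) has_real_derivative 0) (at t)" for t
    using lv_has_vector_derivative[OF rho_smooth[OF a], of x w t] by (simp add: has_real_derivative_iff_has_vector_derivative)
  then have "rho a (x \<odot> (t *\<^sub>R w)) = rho a (x \<odot> (0 *\<^sub>R w))"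
    using DERIV_const_ratio_const[of 0 t "\<lambda>t. rho a (x \<odot> (t *\<^sub>R w))" 0] by (cases "t = 0") auto
  then show "rho a (x + t *\<^sub>R w) = rho a x"
    by (simp add: mul_central subspace_scale[OF subspace_layer w(1)])
qed

lemma generator_not_holomorphic:
  assumes nonab: "br x y \<noteq> 0"
    and hol: "\<And>f g. holo f \<Longrightarrow> form_gen (mu a) (Q0 a) f g \<Longrightarrow> \<exists>g. holo g \<and> form_gen (mu a) (Q0 a) f g"
  shows False
proof -
  \<comment> \<open>With a single layer every bracket would lie in layer 2, which is then zero.
    Noncommutativity thus puts the top layer among those where Z annihilates the kernel.\<close>
  have m2: "2 \<le> m"
  proof (rule ccontr)
    assume "\<not> 2 \<le> m"
    then have m: "m = 1" using m_pos by simp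
    have "u = proj 1 u" for u using sum_proj[of u] by (simp add: m)
    then have "u \<in> layer 1" for u by (metis proj_in_layer)
    then have "br x y \<in> layer 2" using br_layer[of x 1 y 1] by (simp add: numeral_2_eq_2)
    then show False using nonab unfolding layer_def by (simp add: m)
  qed
  have "hlog w" if w: "w \<in> layer 1" for w
  proof -
    obtain z where z: "w = vz z" by (rule range_vz[OF w])
    obtain g where g: "holo g" "form_gen (mu a) (Q0 a) (fz z) g" using hol[OF holo_fz fz_form_gen[OF a]] by blast
    have cg: "continuous_on UNIV g"
      using g(1) unfolding holo_def continuous_on_eq_continuous_at[OF open_UNIV] by (blast intro: has_derivative_continuous)
    \<comment> \<open>The assumption provides only some holomorphic representative; continuity
      identifies it with the explicit one, so that its relation to the kernel becomes known.\<close>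
    have "g = hz a z"
      using form_gen_continuous_unique[OF a g(2) cg fz_form_gen[OF a] smooth_continuous[OF smooth_hz[OF a]]] by blast
    then show ?thesis unfolding hlog_def z hz_zbar using g(1) smooth_hz[OF a] by blast
  qed
  from zbar_layer[OF this m_pos] m2 have z: "\<And>w x. w \<in> layer m \<Longrightarrow> zbar w x = 0" by blast
  have "layer m \<noteq> {0}" using strat m_pos by (simp add: layer_def stratified_def)
  moreover have "0 \<in> layer m" by (rule subspace_0[OF subspace_layer])
  ultimately obtain w where "w \<in> layer m" "w \<noteq> 0" by blast
  then show False using zbar_top_nonzero z by blast
qed

end

end

theorem theorem5p10:
  fixes br :: "complex^'n \<Rightarrow> complex^'n \<Rightarrow> complex^'n"
    and m :: nat and V :: "nat \<Rightarrow> (complex^'n) set"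
    and h :: "(complex^'n \<Rightarrow> real) \<Rightarrow> (complex^'n \<Rightarrow> real) \<Rightarrow> real"
    and gg :: "complex^'n \<Rightarrow> complex^'n \<Rightarrow> real"
    and k :: nat and xs :: "nat \<Rightarrow> complex^'n"
    and rho :: "real \<Rightarrow> complex^'n \<Rightarrow> real"
    and a :: real
  assumes "is_lie_bracket br"
    and "stratified br m V"
    and "subriem h (V 1) gg"
    and "horiz_onb gg (V 1) k xs"
    and "heat_kernel (bch br m) (sublap (bch br m) k xs) rho"
    and "0 < a"
    and "\<exists>x y. br x y \<noteq> 0"
  shows "\<not> (\<forall>f. holo f \<and>
              (\<exists>g. form_gen (density lborel (\<lambda>x. ennreal (rho a x)))
                             (Q0form (bch br m) k xs (rho a)) f g)
           \<longrightarrow> (\<exists>g. holo g \<and>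
              form_gen (density lborel (\<lambda>x. ennreal (rho a x)))
                       (Q0form (bch br m) k xs (rho a)) f g))"
proof -
  interpret heat_group br m V k xs rho
    by unfold_locales (use assms in \<open>auto simp: horiz_onb_def\<close>)
  show ?thesis using generator_not_holomorphic[OF assms(6)] assms(7) by blast
qed

end
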